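(* Let $K$ be a discrete valuation field of characteristic $p>0$ and let $\varphi\in W_n(K)$. Then $$\min\{m\ge1\mid\varphi\in{}^\flat\mathrm{fil}^F_mW_n(K)\}=1+\max\{s_{K'}(\varphi)\mid K'\in\mathcal{E}_2\},$$ where $\mathcal{E}_2$ is the class of discrete valuation fields $K'\supset K$ with $O_{K'}\cap K=O_K$, $m_{K'}\cap K=m_K$, perfect residue field, and ramification index $e(K'/K)=1$.
   Context: For a discrete valuation field $L$ of characteristic $p$ with normalized valuation $v_L$: $\mathrm{fil}_mW_n(L)=\{(f_{n-1},\dots,f_0)\mid p^jv_L(f_j)\ge-m\ \forall j\}$; ${}^\flat\mathrm{fil}_mW_n(L)$ consists of those elements of $\mathrm{fil}_mW_n(L)$ such that, if $i=\mathrm{ord}_p(m)<n$, then $p^iv_L(f_i)>-m$; $F$ is the componentwise $p$-th power; $\mathrm{fil}^F_m=\sum_{j\ge0}F^j(\mathrm{fil}_m)$, ${}^\flat\mathrm{fil}^F_m=\sum_{j\ge0}F^j({}^\flat\mathrm{fil}_m)$; $s_L(\varphi)=\min\{m\in\mathbb{N}\mid\varphi\in\mathrm{fil}^F_mW_n(L)\}$. *)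

theory Defs
  imports "HOL-Algebra.Algebra" "HOL-Computational_Algebra.Primes"
begin

text \<open>A discrete valuation field: a field K (HOL-Algebra record) with a normalized
 discrete valuation v, given on nonzero elements (v 0 is irrelevant; v(0) = infinity
 is handled by explicit case distinctions below).\<close>
definition dvf :: "('a, 'c) ring_scheme \<Rightarrow> ('a \<Rightarrow> int) \<Rightarrow> bool" where
  "dvf K v \<longleftrightarrow> field K \<and>
     (\<forall>x\<in>carrier K - {\<zero>\<^bsub>K\<^esub>}. \<forall>y\<in>carrier K - {\<zero>\<^bsub>K\<^esub>}.
        v (x \<otimes>\<^bsub>K\<^esub> y) = v x + v y \<and>
        (x \<oplus>\<^bsub>K\<^esub> y \<noteq> \<zero>\<^bsub>K\<^esub> \<longrightarrow> v (x \<oplus>\<^bsub>K\<^esub> y) \<ge> min (v x) (v y))) \<and>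
     (\<exists>\<pi>\<in>carrier K - {\<zero>\<^bsub>K\<^esub>}. v \<pi> = 1)"

definition char_p :: "('a, 'c) ring_scheme \<Rightarrow> nat \<Rightarrow> bool" where
  "char_p K p \<longleftrightarrow> Factorial_Ring.prime p \<and> add_pow K p \<one>\<^bsub>K\<^esub> = \<zero>\<^bsub>K\<^esub>"

datatype pexpr = Var nat | PZero | POne | PAdd pexpr pexpr | PMul pexpr pexpr | PNeg pexpr

fun eval_int :: "(nat \<Rightarrow> int) \<Rightarrow> pexpr \<Rightarrow> int" where
  "eval_int \<rho> (Var i) = \<rho> i"
| "eval_int \<rho> PZero = 0"
| "eval_int \<rho> POne = 1"
| "eval_int \<rho> (PAdd a b) = eval_int \<rho> a + eval_int \<rho> b"
| "eval_int \<rho> (PMul a b) = eval_int \<rho> a * eval_int \<rho> b"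
| "eval_int \<rho> (PNeg a) = - eval_int \<rho> a"

fun peval :: "('a, 'c) ring_scheme \<Rightarrow> (nat \<Rightarrow> 'a) \<Rightarrow> pexpr \<Rightarrow> 'a" where
  "peval R \<rho> (Var i) = \<rho> i"
| "peval R \<rho> PZero = \<zero>\<^bsub>R\<^esub>"
| "peval R \<rho> POne = \<one>\<^bsub>R\<^esub>"
| "peval R \<rho> (PAdd a b) = peval R \<rho> a \<oplus>\<^bsub>R\<^esub> peval R \<rho> b"
| "peval R \<rho> (PMul a b) = peval R \<rho> a \<otimes>\<^bsub>R\<^esub> peval R \<rho> b"
| "peval R \<rho> (PNeg a) = \<ominus>\<^bsub>R\<^esub> peval R \<rho> a"

definition ghost :: "nat \<Rightarrow> nat \<Rightarrow> (nat \<Rightarrow> int) \<Rightarrow> int" where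
  "ghost p k a = (\<Sum>i\<le>k. int p ^ i * a i ^ (p ^ (k - i)))"

definition interl :: "(nat \<Rightarrow> 'a) \<Rightarrow> (nat \<Rightarrow> 'a) \<Rightarrow> nat \<Rightarrow> 'a" where
  "interl a b j = (if even j then a (j div 2) else b (j div 2))"

text \<open>The Witt addition polynomials S_k, characterized by w_k(S) = w_k(X) + w_k(Y) over the
 integers (this determines them as polynomials).\<close>
definition witt_S :: "nat \<Rightarrow> nat \<Rightarrow> pexpr" where
  "witt_S p = (SOME S. \<forall>k a b. ghost p k (\<lambda>i. eval_int (interl a b) (S i)) = ghost p k a + ghost p k b)"

definition witt_carrier :: "('a, 'c) ring_scheme \<Rightarrow> nat \<Rightarrow> (nat \<Rightarrow> 'a) set" where
  "witt_carrier R n = {x. (\<forall>k<n. x k \<in> carrier R) \<and> (\<forall>k\<ge>n. x k = \<zero>\<^bsub>R\<^esub>)}"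

definition witt_zero :: "('a, 'c) ring_scheme \<Rightarrow> nat \<Rightarrow> 'a" where
  "witt_zero R = (\<lambda>k. \<zero>\<^bsub>R\<^esub>)"

definition witt_add :: "('a, 'c) ring_scheme \<Rightarrow> nat \<Rightarrow> nat \<Rightarrow> (nat \<Rightarrow> 'a) \<Rightarrow> (nat \<Rightarrow> 'a) \<Rightarrow> nat \<Rightarrow> 'a" where
  "witt_add R p n x y = (\<lambda>k. if k < n then peval R (interl x y) (witt_S p k) else \<zero>\<^bsub>R\<^esub>)"

definition witt_F :: "('a, 'c) ring_scheme \<Rightarrow> nat \<Rightarrow> (nat \<Rightarrow> 'a) \<Rightarrow> nat \<Rightarrow> 'a" where
  "witt_F R p x = (\<lambda>k. x k [^]\<^bsub>R\<^esub> p)"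

inductive_set witt_span :: "('a, 'c) ring_scheme \<Rightarrow> nat \<Rightarrow> nat \<Rightarrow> (nat \<Rightarrow> 'a) set \<Rightarrow> (nat \<Rightarrow> 'a) set"
  for R p n S where
  zero: "witt_zero R \<in> witt_span R p n S"
| add: "a \<in> S \<Longrightarrow> b \<in> witt_span R p n S \<Longrightarrow> witt_add R p n a b \<in> witt_span R p n S"

text \<open>Paper's component f_j (with (f_{n-1},...,f_0)) is the Witt component x_{n-1-j}.\<close>
definition fil :: "('a, 'c) ring_scheme \<Rightarrow> ('a \<Rightarrow> int) \<Rightarrow> nat \<Rightarrow> nat \<Rightarrow> nat \<Rightarrow> (nat \<Rightarrow> 'a) set" where
  "fil L v p n m = {x \<in> witt_carrier L n.
     \<forall>j<n. x (n - 1 - j) = \<zero>\<^bsub>L\<^esub> \<or> int (p ^ j) * v (x (n - 1 - j)) \<ge> - int m}"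

definition flat_fil :: "('a, 'c) ring_scheme \<Rightarrow> ('a \<Rightarrow> int) \<Rightarrow> nat \<Rightarrow> nat \<Rightarrow> nat \<Rightarrow> (nat \<Rightarrow> 'a) set" where
  "flat_fil L v p n m = {x \<in> fil L v p n m.
     m > 0 \<longrightarrow> (let i = multiplicity p m in
        i < n \<longrightarrow> (x (n - 1 - i) = \<zero>\<^bsub>L\<^esub> \<or> int (p ^ i) * v (x (n - 1 - i)) > - int m))}"

definition filF :: "('a, 'c) ring_scheme \<Rightarrow> ('a \<Rightarrow> int) \<Rightarrow> nat \<Rightarrow> nat \<Rightarrow> nat \<Rightarrow> (nat \<Rightarrow> 'a) set" where
  "filF L v p n m = witt_span L p n (\<Union>j. (witt_F L p ^^ j) ` fil L v p n m)"

definition flat_filF :: "('a, 'c) ring_scheme \<Rightarrow> ('a \<Rightarrow> int) \<Rightarrow> nat \<Rightarrow> nat \<Rightarrow> nat \<Rightarrow> (nat \<Rightarrow> 'a) set" where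
  "flat_filF L v p n m = witt_span L p n (\<Union>j. (witt_F L p ^^ j) ` flat_fil L v p n m)"

definition sw :: "('a, 'c) ring_scheme \<Rightarrow> ('a \<Rightarrow> int) \<Rightarrow> nat \<Rightarrow> nat \<Rightarrow> (nat \<Rightarrow> 'a) \<Rightarrow> nat" where
  "sw L v p n \<phi> = (LEAST m. \<phi> \<in> filF L v p n m)"

definition E2 :: "('a, 'c) ring_scheme \<Rightarrow> ('a \<Rightarrow> int) \<Rightarrow> nat \<Rightarrow> ('b, 'd) ring_scheme \<Rightarrow> ('b \<Rightarrow> int) \<Rightarrow> ('a \<Rightarrow> 'b) \<Rightarrow> bool" where
  "E2 K v p K' v' \<iota> \<longleftrightarrow> dvf K' v' \<and> \<iota> \<in> ring_hom K K' \<and>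
     (\<forall>x\<in>carrier K - {\<zero>\<^bsub>K\<^esub>}. (v' (\<iota> x) \<ge> 0 \<longleftrightarrow> v x \<ge> 0)) \<and>
     (\<forall>x\<in>carrier K - {\<zero>\<^bsub>K\<^esub>}. (v' (\<iota> x) > 0 \<longleftrightarrow> v x > 0)) \<and>
     (\<forall>a\<in>carrier K'. (a = \<zero>\<^bsub>K'\<^esub> \<or> v' a \<ge> 0) \<longrightarrow>
        (\<exists>b\<in>carrier K'. (b = \<zero>\<^bsub>K'\<^esub> \<or> v' b \<ge> 0) \<and>
           (a \<ominus>\<^bsub>K'\<^esub> b [^]\<^bsub>K'\<^esub> p = \<zero>\<^bsub>K'\<^esub> \<or> v' (a \<ominus>\<^bsub>K'\<^esub> b [^]\<^bsub>K'\<^esub> p) > 0))) \<and>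
     (\<forall>\<pi>\<in>carrier K - {\<zero>\<^bsub>K\<^esub>}. v \<pi> = 1 \<longrightarrow> v' (\<iota> \<pi>) = 1)"

end

theory Submission
  imports Defs
begin

text \<open>
  The upper bound rests on \<open>\<^sup>\<flat>fil\<^sub>m(K) \<subseteq> fil\<^sub>m\<^sub>-\<^sub>1(K') + F fil\<^sub>m\<^sub>-\<^sub>1(K')\<close>: over a perfect residue field a component whose
  pole order is exactly \<open>m / p ^ j\<close> with \<open>p\<close> dividing that order is a \<open>p\<close>-th power up to a smaller pole.

  For the lower bound, consider \<open>x \<in> \<^sup>\<flat>fil\<^sub>m(K)\<close> that cannot be improved modulo \<open>F\<close>, with leading residues
  \<open>a\<^sub>j\<close>. Subtracting \<open>F t\<close>, where \<open>t\<close> is built from approximate \<open>p\<close>-th roots \<open>b\<^sub>j \<in> K'\<close> of the \<open>a\<^sub>j\<close>, leaves the last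
  component \<open>\<Sum>\<^sub>j b\<^sub>j ^ (p (p ^ j - 1)) (a\<^sub>j - b\<^sub>j ^ p)\<close> to first order, and \<open>x\<close> stays outside \<open>fil\<^sub>m\<^sub>-\<^sub>2 + F W\<^sub>n\<close> as
  soon as this sum has valuation one. Modulo the square of the maximal ideal, replacing \<open>K'\<close> by another extension
  changes the sum by the differential form \<open>\<Sum>\<^sub>j a\<^sub>j ^ (p ^ j - 1) d a\<^sub>j\<close>, which the iterated Cartier operator
  shows to be nonzero if some \<open>a\<^sub>j\<close> is no \<open>p\<close>-th power in the residue field. So one of two extensions works:
  inside the perfect closure of \<open>K\<close>, adjoin the \<open>p\<close>-th root of \<open>a\<close> or of \<open>a + \<pi>\<close>, where \<open>a\<close> is a residual
  \<open>p\<close>-basis of a maximal unramified subextension, and enlarge to a maximal subfield with integral valuation,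
  whose residue field is perfect.
\<close>

section \<open>Existence of the Witt addition polynomials\<close>

text \<open>With \<open>M\<close> the least admissible level, the lower bound asks for one extension
  in which \<open>\<phi>\<close> stays outside \<open>filF\<close> at level \<open>M - 2\<close>.
  Leading terms alone cannot show this: those that \<open>flat_fil\<close> allows become p-th powers
  up to smaller poles over a perfect residue field and are absorbed by \<open>F\<close>. The
  obstruction sits one order deeper, so Witt addition must be controlled to second order. This is
  feasible because the addition polynomials are isobaric, the filtration is a bound proportional to
  the weight, and in the last component the linear part has a closed form, \<open>witt_Q\<close>.
  The perfect closure serves two purposes. The valuation extends to it by dividing values by powers
  of \<open>p\<close>, and each of its elements is determined by a pair in
  \<open>nat \<times> 'a\<close>, so the extensions can be copied into the prescribed type. The
  delicate point there is that adjoining a p-th root of a residual non-p-th-power keeps the values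
  integral. Residue fields are never formed: every residual statement is an inequality between
  values.\<close>

definition polfun :: "((nat \<Rightarrow> int) \<Rightarrow> int) \<Rightarrow> bool" where
  "polfun f \<longleftrightarrow> (\<exists>e. \<forall>\<rho>. f \<rho> = eval_int \<rho> e)"

lemma polfun_eval: "polfun (\<lambda>\<rho>. eval_int \<rho> e)"
  by (auto simp: polfun_def)

lemma polfun_var: "polfun (\<lambda>\<rho>. \<rho> i)"
  unfolding polfun_def by (rule exI[of _ "Var i"]) simp

lemma polfun_add: "polfun f \<Longrightarrow> polfun g \<Longrightarrow> polfun (\<lambda>\<rho>. f \<rho> + g \<rho>)"
  unfolding polfun_def by (metis eval_int.simps(4))

lemma polfun_mult: "polfun f \<Longrightarrow> polfun g \<Longrightarrow> polfun (\<lambda>\<rho>. f \<rho> * g \<rho>)"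
  unfolding polfun_def by (metis eval_int.simps(5))

lemma polfun_neg: "polfun f \<Longrightarrow> polfun (\<lambda>\<rho>. - f \<rho>)"
  unfolding polfun_def by (metis eval_int.simps(6))

lemma polfun_diff: "polfun f \<Longrightarrow> polfun g \<Longrightarrow> polfun (\<lambda>\<rho>. f \<rho> - g \<rho>)"
  using polfun_add[OF _ polfun_neg, of f g] by simp

lemma polfun_0: "polfun (\<lambda>\<rho>. 0)"
  unfolding polfun_def by (rule exI[of _ PZero]) simp

lemma polfun_1: "polfun (\<lambda>\<rho>. 1)"
  unfolding polfun_def by (rule exI[of _ POne]) simp

lemma polfun_of_nat: "polfun (\<lambda>\<rho>. int n)"
proof (induction n)
  case (Suc n)
  from polfun_add[OF this polfun_1] show ?case by (simp add: add.commute)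
qed (simp add: polfun_0)

lemma polfun_const: "polfun (\<lambda>\<rho>. c)"
proof (cases "c \<ge> 0")
  case True
  with polfun_of_nat[of "nat c"] show ?thesis by simp
next
  case False
  with polfun_neg[OF polfun_of_nat[of "nat (- c)"]] show ?thesis by simp
qed

lemma polfun_power: "polfun f \<Longrightarrow> polfun (\<lambda>\<rho>. f \<rho> ^ n)"
  by (induction n) (auto intro: polfun_1 polfun_mult)

lemma polfun_sum: "finite I \<Longrightarrow> (\<And>i. i \<in> I \<Longrightarrow> polfun (f i)) \<Longrightarrow> polfun (\<lambda>\<rho>. \<Sum>i\<in>I. f i \<rho>)"
  by (induction I rule: finite_induct) (auto intro: polfun_0 polfun_add)

lemmas polfun_intros = polfun_var polfun_add polfun_mult polfun_neg polfun_diff polfun_const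
  polfun_power polfun_sum polfun_eval

lemma polfun_subst:
  assumes "polfun f" and "\<And>i. polfun (\<lambda>\<rho>. g \<rho> i)"
  shows "polfun (\<lambda>\<rho>. f (g \<rho>))"
proof -
  obtain e where e: "\<And>\<rho>. f \<rho> = eval_int \<rho> e" using assms(1) unfolding polfun_def by auto
  have "polfun (\<lambda>\<rho>. eval_int (g \<rho>) e)"
    by (induction e) (auto intro: polfun_intros assms(2) simp: polfun_0 polfun_1)
  then show ?thesis by (simp add: e)
qed

text \<open>The quotient must itself be polynomial. Divisibility of all values is weaker:
  \<open>p\<close> divides every value of \<open>x ^ p - x\<close>, yet dividing by \<open>p\<close>
  leaves the integral polynomials, and the Witt polynomials arise by exactly such divisions.\<close>

definition pol_cong :: "int \<Rightarrow> ((nat \<Rightarrow> int) \<Rightarrow> int) \<Rightarrow> ((nat \<Rightarrow> int) \<Rightarrow> int) \<Rightarrow> bool" where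
  "pol_cong m f g \<longleftrightarrow> (\<exists>h. polfun h \<and> (\<forall>\<rho>. f \<rho> = g \<rho> + m * h \<rho>))"

lemma pol_cong_refl: "pol_cong m f f"
  unfolding pol_cong_def by (rule exI[of _ "\<lambda>_. 0"]) (simp add: polfun_0)

lemma pol_cong_trans: "pol_cong m f g \<Longrightarrow> pol_cong m g h \<Longrightarrow> pol_cong m f h"
  unfolding pol_cong_def
proof (elim exE conjE)
  fix a b assume "polfun a" "polfun b" "\<forall>\<rho>. f \<rho> = g \<rho> + m * a \<rho>" "\<forall>\<rho>. g \<rho> = h \<rho> + m * b \<rho>"
  then show "\<exists>k. polfun k \<and> (\<forall>\<rho>. f \<rho> = h \<rho> + m * k \<rho>)"
    by (intro exI[of _ "\<lambda>\<rho>. a \<rho> + b \<rho>"]) (auto intro: polfun_add simp: algebra_simps)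
qed

lemma pol_cong_sym: "pol_cong m f g \<Longrightarrow> pol_cong m g f"
  unfolding pol_cong_def
proof (elim exE conjE)
  fix a assume "polfun a" "\<forall>\<rho>. f \<rho> = g \<rho> + m * a \<rho>"
  then show "\<exists>k. polfun k \<and> (\<forall>\<rho>. g \<rho> = f \<rho> + m * k \<rho>)"
    by (intro exI[of _ "\<lambda>\<rho>. - a \<rho>"]) (auto intro: polfun_neg simp: algebra_simps)
qed

lemma pol_cong_add: "pol_cong m f g \<Longrightarrow> pol_cong m f' g' \<Longrightarrow> pol_cong m (\<lambda>\<rho>. f \<rho> + f' \<rho>) (\<lambda>\<rho>. g \<rho> + g' \<rho>)"
  unfolding pol_cong_def
proof (elim exE conjE)
  fix a b assume "polfun a" "polfun b" "\<forall>\<rho>. f \<rho> = g \<rho> + m * a \<rho>" "\<forall>\<rho>. f' \<rho> = g' \<rho> + m * b \<rho>"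
  then show "\<exists>k. polfun k \<and> (\<forall>\<rho>. f \<rho> + f' \<rho> = g \<rho> + g' \<rho> + m * k \<rho>)"
    by (intro exI[of _ "\<lambda>\<rho>. a \<rho> + b \<rho>"]) (auto intro: polfun_add simp: algebra_simps)
qed

lemma pol_cong_mult: "polfun f \<Longrightarrow> polfun g' \<Longrightarrow> pol_cong m f g \<Longrightarrow> pol_cong m f' g' \<Longrightarrow>
   pol_cong m (\<lambda>\<rho>. f \<rho> * f' \<rho>) (\<lambda>\<rho>. g \<rho> * g' \<rho>)"
  unfolding pol_cong_def
proof (elim exE conjE)
  fix a b assume *: "polfun f" "polfun g'" "polfun a" "polfun b" "\<forall>\<rho>. f \<rho> = g \<rho> + m * a \<rho>" "\<forall>\<rho>. f' \<rho> = g' \<rho> + m * b \<rho>"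
  have "f \<rho> * f' \<rho> = g \<rho> * g' \<rho> + m * (f \<rho> * b \<rho> + a \<rho> * g' \<rho>)" for \<rho>
  proof -
    have "f \<rho> * f' \<rho> = f \<rho> * g' \<rho> + m * (f \<rho> * b \<rho>)" using *(6) by (simp add: algebra_simps)
    also have "f \<rho> * g' \<rho> = g \<rho> * g' \<rho> + m * (a \<rho> * g' \<rho>)" using *(5) by (simp add: algebra_simps)
    finally show ?thesis by (simp add: algebra_simps)
  qed
  moreover have "polfun (\<lambda>\<rho>. f \<rho> * b \<rho> + a \<rho> * g' \<rho>)" using *(1-4) by (intro polfun_intros)
  ultimately show "\<exists>k. polfun k \<and> (\<forall>\<rho>. f \<rho> * f' \<rho> = g \<rho> * g' \<rho> + m * k \<rho>)" by blast
qed

lemma pol_cong_neg: "pol_cong m f g \<Longrightarrow> pol_cong m (\<lambda>\<rho>. - f \<rho>) (\<lambda>\<rho>. - g \<rho>)"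
  unfolding pol_cong_def
proof (elim exE conjE)
  fix a assume "polfun a" "\<forall>\<rho>. f \<rho> = g \<rho> + m * a \<rho>"
  then show "\<exists>k. polfun k \<and> (\<forall>\<rho>. - f \<rho> = - g \<rho> + m * k \<rho>)"
    by (intro exI[of _ "\<lambda>\<rho>. - a \<rho>"]) (auto intro: polfun_neg simp: algebra_simps)
qed

lemma pol_cong_sum: "finite I \<Longrightarrow> (\<And>i. i \<in> I \<Longrightarrow> pol_cong m (f i) (g i)) \<Longrightarrow>
   pol_cong m (\<lambda>\<rho>. \<Sum>i\<in>I. f i \<rho>) (\<lambda>\<rho>. \<Sum>i\<in>I. g i \<rho>)"
  by (induction I rule: finite_induct) (auto intro: pol_cong_refl pol_cong_add)

lemma pol_cong_scale: "pol_cong m f g \<Longrightarrow> pol_cong (c * m) (\<lambda>\<rho>. c * f \<rho>) (\<lambda>\<rho>. c * g \<rho>)"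
  unfolding pol_cong_def by (auto simp: algebra_simps)

section \<open>Frobenius congruences modulo powers of \<open>p\<close>\<close>

lemma binomial_prime_split:
  fixes x y :: int
  assumes "Factorial_Ring.prime p"
  shows "(x + y) ^ p = x ^ p + y ^ p + int p * (\<Sum>i\<in>{1..<p}. int ((p choose i) div p) * x ^ i * y ^ (p - i))"
proof -
  have p: "p > 0" using assms prime_gt_0_nat by blast
  have split: "{..p} = insert 0 (insert p {1..<p})" using p by auto
  have "(x + y) ^ p = (\<Sum>i\<le>p. int (p choose i) * x ^ i * y ^ (p - i))"
    by (simp add: binomial_ring)
  also have "\<dots> = y ^ p + (x ^ p + (\<Sum>i\<in>{1..<p}. int (p choose i) * x ^ i * y ^ (p - i)))"
    unfolding split using p by (subst sum.insert; simp)+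
  also have "(\<Sum>i\<in>{1..<p}. int (p choose i) * x ^ i * y ^ (p - i))
     = (\<Sum>i\<in>{1..<p}. int p * (int ((p choose i) div p) * x ^ i * y ^ (p - i)))"
  proof (rule sum.cong)
    fix i assume "i \<in> {1..<p}"
    then have "p dvd (p choose i)" using assms by (intro dvd_choose_prime) auto
    then have "int (p choose i) = int p * int ((p choose i) div p)"
      by (metis dvd_mult_div_cancel of_nat_mult)
    then show "int (p choose i) * x ^ i * y ^ (p - i) = int p * (int ((p choose i) div p) * x ^ i * y ^ (p - i))"
      by simp
  qed simp
  finally show ?thesis by (simp add: sum_distrib_left)
qed

lemma pol_cong_add_power:
  assumes "Factorial_Ring.prime p" "polfun f" "polfun g"
  shows "pol_cong (int p) (\<lambda>\<rho>. (f \<rho> + g \<rho>) ^ p) (\<lambda>\<rho>. f \<rho> ^ p + g \<rho> ^ p)"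
  unfolding pol_cong_def
  by (rule exI[of _ "\<lambda>\<rho>. \<Sum>i\<in>{1..<p}. int ((p choose i) div p) * f \<rho> ^ i * g \<rho> ^ (p - i)"])
     (auto intro!: polfun_intros assms simp: binomial_prime_split[OF assms(1)])

text \<open>Modulo \<open>p\<close> both sides are compatible with all ring operations, so it is
  enough to go through the constructors.\<close>

lemma pol_cong_frobenius_eval:
  assumes p: "Factorial_Ring.prime p"
  shows "pol_cong (int p) (\<lambda>\<rho>. eval_int \<rho> e ^ p) (\<lambda>\<rho>. eval_int (\<lambda>i. \<rho> i ^ p) e)"
proof (induction e)
  case (PAdd a b)
  have "pol_cong (int p) (\<lambda>\<rho>. (eval_int \<rho> a + eval_int \<rho> b) ^ p) (\<lambda>\<rho>. eval_int \<rho> a ^ p + eval_int \<rho> b ^ p)"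
    by (intro pol_cong_add_power p polfun_eval)
  from pol_cong_trans[OF this pol_cong_add[OF PAdd]] show ?case by simp
next
  case (PMul a b)
  have "polfun (\<lambda>\<rho>. eval_int (\<lambda>i. \<rho> i ^ p) b)"
    by (rule polfun_subst[OF polfun_eval, of "\<lambda>\<rho> i. \<rho> i ^ p"]) (intro polfun_intros)
  then show ?case using pol_cong_mult[OF _ _ PMul] by (simp add: power_mult_distrib polfun_intros)
next
  case (PNeg a)
  \<comment> \<open>An odd exponent commutes with the sign. For \<open>p = 2\<close> the sign is
    lost, but \<open>x ^ 2\<close> and \<open>- (x ^ 2)\<close> differ by
    \<open>2 * x ^ 2\<close>.\<close>
  have 1: "pol_cong (int p) (\<lambda>\<rho>. (- eval_int \<rho> a) ^ p) (\<lambda>\<rho>. - (eval_int \<rho> a ^ p))"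
  proof (cases "p = 2")
    case True
    have "(- x) ^ p = - (x ^ p) + int p * (x ^ p)" for x :: int unfolding True by simp
    then show ?thesis unfolding pol_cong_def
      by (intro exI[of _ "\<lambda>\<rho>. eval_int \<rho> a ^ p"]) (auto intro: polfun_intros)
  next
    case False
    then have "odd p" using p prime_ge_2_nat[OF p] by (intro prime_odd_nat) auto
    then show ?thesis by (simp add: pol_cong_refl)
  qed
  from pol_cong_trans[OF 1 pol_cong_neg[OF PNeg]] show ?case by simp
qed (use prime_gt_0_nat[OF p] in \<open>auto simp: pol_cong_refl zero_power\<close>)

lemma pol_cong_frobenius:
  assumes p: "Factorial_Ring.prime p" and "polfun f"
  shows "pol_cong (int p) (\<lambda>\<rho>. f \<rho> ^ p) (\<lambda>\<rho>. f (\<lambda>i. \<rho> i ^ p))"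
proof -
  obtain e where e: "\<And>\<rho>. f \<rho> = eval_int \<rho> e" using assms(2) unfolding polfun_def by auto
  show ?thesis unfolding e by (rule pol_cong_frobenius_eval[OF p])
qed

text \<open>Expand \<open>(g + p ^ r * h) ^ p\<close>: the middle terms gain one factor
  \<open>p\<close> from their binomial coefficients, and the last term carries
  \<open>p ^ (r * p)\<close>, which suffices because \<open>r \<ge> 1\<close> and
  \<open>p \<ge> 2\<close> give \<open>r + 1 \<le> r * p\<close>.\<close>

lemma pol_cong_power_lift:
  assumes p: "Factorial_Ring.prime p" and r: "r \<ge> 1" and fg: "polfun g" "pol_cong (int p ^ r) f g"
  shows "pol_cong (int p ^ Suc r) (\<lambda>\<rho>. f \<rho> ^ p) (\<lambda>\<rho>. g \<rho> ^ p)"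
proof -
  obtain h where h: "polfun h" "\<And>\<rho>. f \<rho> = g \<rho> + int p ^ r * h \<rho>"
    using fg(2) unfolding pol_cong_def by auto
  define k where "k \<rho> = int p ^ (r * p - Suc r) * h \<rho> ^ p +
      (\<Sum>i\<in>{1..<p}. int ((p choose i) div p) * g \<rho> ^ i * (int p ^ (r * (p - i - 1)) * h \<rho> ^ (p - i)))" for \<rho>
  have p2: "p \<ge> 2" using p prime_ge_2_nat by blast
  have le: "Suc r \<le> r * p"
  proof -
    have "Suc r \<le> r * 2" using r by simp
    also have "\<dots> \<le> r * p" using p2 by (rule mult_le_mono2)
    finally show ?thesis .
  qed
  have "f \<rho> ^ p = g \<rho> ^ p + int p ^ Suc r * k \<rho>" for \<rho>
  proof -
    have "f \<rho> ^ p = g \<rho> ^ p + (int p ^ r * h \<rho>) ^ p + int p * (\<Sum>i\<in>{1..<p}. int ((p choose i) div p) * g \<rho> ^ i * (int p ^ r * h \<rho>) ^ (p - i))"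
      unfolding h(2) by (rule binomial_prime_split[OF p])
    also have "(int p ^ r * h \<rho>) ^ p = int p ^ Suc r * (int p ^ (r * p - Suc r) * h \<rho> ^ p)"
    proof -
      have "int p ^ (r * p) = int p ^ Suc r * int p ^ (r * p - Suc r)"
        using le by (metis le_add_diff_inverse power_add)
      then show ?thesis by (simp add: power_mult_distrib flip: power_mult)
    qed
    also have "(\<Sum>i\<in>{1..<p}. int ((p choose i) div p) * g \<rho> ^ i * (int p ^ r * h \<rho>) ^ (p - i))
       = (\<Sum>i\<in>{1..<p}. int p ^ r * (int ((p choose i) div p) * g \<rho> ^ i * (int p ^ (r * (p - i - 1)) * h \<rho> ^ (p - i))))"
    proof (rule sum.cong)
      fix i assume "i \<in> {1..<p}"
      then have "p - i = Suc (p - i - 1)" by auto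
      then have "r * (p - i) = r + r * (p - i - 1)" by (metis mult_Suc_right)
      then have "(int p ^ r) ^ (p - i) = int p ^ r * int p ^ (r * (p - i - 1))"
        by (simp flip: power_mult power_add)
      then show "int ((p choose i) div p) * g \<rho> ^ i * (int p ^ r * h \<rho>) ^ (p - i) =
        int p ^ r * (int ((p choose i) div p) * g \<rho> ^ i * (int p ^ (r * (p - i - 1)) * h \<rho> ^ (p - i)))"
        by (simp add: power_mult_distrib)
    qed simp
    finally show ?thesis by (simp add: k_def algebra_simps sum_distrib_left)
  qed
  moreover have "polfun k" unfolding k_def by (intro polfun_intros h fg) auto
  ultimately show ?thesis unfolding pol_cong_def by blast
qed

lemma pol_cong_frobenius_iter:
  assumes p: "Factorial_Ring.prime p" and f: "polfun f"
  shows "pol_cong (int p ^ Suc r) (\<lambda>\<rho>. f \<rho> ^ (p ^ Suc r)) (\<lambda>\<rho>. f (\<lambda>i. \<rho> i ^ p) ^ (p ^ r))"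
proof (induction r)
  case 0
  show ?case using pol_cong_frobenius[OF p f] by simp
next
  case (Suc r)
  have "polfun (\<lambda>\<rho>. f (\<lambda>i. \<rho> i ^ p))"
    by (rule polfun_subst[OF f]) (intro polfun_intros)
  from pol_cong_power_lift[OF p _ polfun_power[OF this] Suc] show ?case
    by (simp add: mult.commute[of _ p] flip: power_mult)
qed

section \<open>Dwork's criterion and the Witt addition polynomials\<close>

lemma ghost_Suc: "ghost p (Suc k) a = ghost p k (\<lambda>i. a i ^ p) + int p ^ Suc k * a (Suc k)"
proof -
  have "a i ^ p ^ (Suc k - i) = (a i ^ p) ^ p ^ (k - i)" if "i \<le> k" for i
    using that by (simp add: Suc_diff_le flip: power_mult)
  then show ?thesis unfolding ghost_def by simp
qed

lemma polfun_ghost: "(\<And>i. i \<le> k \<Longrightarrow> polfun (\<lambda>\<rho>. a \<rho> i)) \<Longrightarrow> polfun (\<lambda>\<rho>. ghost p k (a \<rho>))"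
  unfolding ghost_def by (intro polfun_intros) auto

text \<open>Once the components below \<open>k\<close> are known, the ghost identity prescribes
  \<open>p ^ k\<close> times the next one. The congruence for \<open>G\<close> and the Frobenius
  congruence for the earlier components say that this prescribed value is divisible by
  \<open>p ^ k\<close> among the integral polynomials.\<close>

lemma dwork_lemma:
  assumes p: "Factorial_Ring.prime p" and G: "\<And>k. polfun (G k)"
    and cong: "\<And>k. pol_cong (int p ^ Suc k) (G (Suc k)) (\<lambda>\<rho>. G k (\<lambda>i. \<rho> i ^ p))"
  shows "\<exists>S :: nat \<Rightarrow> pexpr. \<forall>k \<rho>. ghost p k (\<lambda>i. eval_int \<rho> (S i)) = G k \<rho>"
proof -
  have p0: "p > 0" using p prime_gt_0_nat by blast
  have step: "\<exists>e. \<forall>\<rho>. ghost p k (\<lambda>i. eval_int \<rho> ((S(k := e)) i)) = G k \<rho>"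
    if S: "\<And>j \<rho>. j < k \<Longrightarrow> ghost p j (\<lambda>i. eval_int \<rho> (S i)) = G j \<rho>" for S k
  proof (cases k)
    case 0
    obtain e where "\<And>\<rho>. G 0 \<rho> = eval_int \<rho> e" using G unfolding polfun_def by blast
    then show ?thesis by (intro exI[of _ e]) (simp add: 0 ghost_def)
  next
    case (Suc l)
    \<comment> \<open>Termwise: the powers of the \<open>i\<close>-th component agree modulo
      \<open>p ^ (l - i + 1)\<close>, and the factor \<open>p ^ i\<close> of the ghost component
      supplies the rest of \<open>p ^ k\<close>.\<close>
    have 1: "pol_cong (int p ^ k) (\<lambda>\<rho>. ghost p l (\<lambda>i. eval_int \<rho> (S i) ^ p)) (\<lambda>\<rho>. ghost p l (\<lambda>i. eval_int (\<lambda>i. \<rho> i ^ p) (S i)))"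
      unfolding ghost_def
    proof (intro pol_cong_sum)
      fix i assume "i \<in> {..l}"
      then have i: "i \<le> l" by simp
      have "pol_cong (int p ^ i * int p ^ Suc (l - i)) (\<lambda>\<rho>. int p ^ i * eval_int \<rho> (S i) ^ (p ^ Suc (l - i)))
          (\<lambda>\<rho>. int p ^ i * eval_int (\<lambda>i. \<rho> i ^ p) (S i) ^ (p ^ (l - i)))"
        by (intro pol_cong_scale pol_cong_frobenius_iter[OF p polfun_eval])
      moreover have "int p ^ i * int p ^ Suc (l - i) = int p ^ k"
        using i by (simp add: Suc flip: power_add power_Suc)
      ultimately show "pol_cong (int p ^ k) (\<lambda>\<rho>. int p ^ i * (eval_int \<rho> (S i) ^ p) ^ p ^ (l - i))
            (\<lambda>\<rho>. int p ^ i * eval_int (\<lambda>i. \<rho> i ^ p) (S i) ^ p ^ (l - i))"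
        by (simp flip: power_mult)
    qed simp
    have "(\<lambda>\<rho>. ghost p l (\<lambda>i. eval_int (\<lambda>i. \<rho> i ^ p) (S i))) = (\<lambda>\<rho>. G l (\<lambda>i. \<rho> i ^ p))"
      using S[of l] Suc by auto
    with 1 have "pol_cong (int p ^ k) (\<lambda>\<rho>. ghost p l (\<lambda>i. eval_int \<rho> (S i) ^ p)) (\<lambda>\<rho>. G l (\<lambda>i. \<rho> i ^ p))"
      by simp
    from pol_cong_trans[OF cong[of l, folded Suc] pol_cong_sym[OF this]]
    obtain h where h: "polfun h" "\<And>\<rho>. G k \<rho> = ghost p l (\<lambda>i. eval_int \<rho> (S i) ^ p) + int p ^ k * h \<rho>"
      unfolding pol_cong_def by auto
    obtain e where e: "\<And>\<rho>. h \<rho> = eval_int \<rho> e" using h(1) unfolding polfun_def by blast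
    have "ghost p l (\<lambda>i. eval_int \<rho> ((S(k := e)) i) ^ p) = ghost p l (\<lambda>i. eval_int \<rho> (S i) ^ p)" for \<rho>
      unfolding ghost_def by (intro sum.cong) (auto simp: Suc)
    then show ?thesis
      by (intro exI[of _ e]) (simp add: h(2)[unfolded Suc] e Suc ghost_Suc)
  qed
  \<comment> \<open>\<open>T m\<close> is the sequence after \<open>m\<close> choices, with
    \<open>PZero\<close> as placeholder for the entries not yet chosen. Entry \<open>i\<close> is
    final from stage \<open>i + 1\<close> on, so the diagonal \<open>S\<close> collects all
    choices.\<close>
  define T where "T = rec_nat (\<lambda>_::nat. PZero) (\<lambda>k S. S(k := (SOME e. \<forall>\<rho>. ghost p k (\<lambda>i. eval_int \<rho> ((S(k := e)) i)) = G k \<rho>)))"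
  have T_stable: "T m i = T (Suc i) i" if "Suc i \<le> m" for m i
    using that by (induction m rule: dec_induct) (auto simp: T_def)
  define S where "S i = T (Suc i) i" for i
  have ghost_cong: "ghost p j (\<lambda>i. eval_int \<rho> (T m i)) = ghost p j (\<lambda>i. eval_int \<rho> (S i))" if "j < m" for j m \<rho>
    unfolding ghost_def using that by (intro sum.cong) (auto simp: S_def T_stable[of _ m])
  have "\<forall>\<rho>. ghost p k (\<lambda>i. eval_int \<rho> (S i)) = G k \<rho>" for k
  proof (induction k rule: less_induct)
    case (less k)
    have "\<exists>e. \<forall>\<rho>. ghost p k (\<lambda>i. eval_int \<rho> (((T k)(k := e)) i)) = G k \<rho>"
      by (rule step) (use less ghost_cong in auto)
    from someI_ex[OF this]
    have "\<forall>\<rho>. ghost p k (\<lambda>i. eval_int \<rho> (T (Suc k) i)) = G k \<rho>" by (simp add: T_def)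
    then show ?case by (simp add: ghost_cong)
  qed
  then show ?thesis by blast
qed

text \<open>This justifies the choice made in \<open>witt_S\<close>. Dwork's congruence is
  immediate: by \<open>ghost_Suc\<close>, passing from \<open>k\<close> to \<open>k + 1\<close>
  replaces variables by their p-th powers and adds \<open>p ^ (k + 1)\<close> times the two new
  variables.\<close>

lemma ghost_witt_S:
  assumes p: "Factorial_Ring.prime p"
  shows "ghost p k (\<lambda>i. eval_int (interl a b) (witt_S p i)) = ghost p k a + ghost p k b"
proof -
  define G where "G k \<rho> = ghost p k (\<lambda>i. \<rho> (2 * i)) + ghost p k (\<lambda>i. \<rho> (2 * i + 1))" for k and \<rho> :: "nat \<Rightarrow> int"
  have "\<exists>S :: nat \<Rightarrow> pexpr. \<forall>k \<rho>. ghost p k (\<lambda>i. eval_int \<rho> (S i)) = G k \<rho>"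
  proof (rule dwork_lemma[OF p])
    show "polfun (G k)" for k unfolding G_def by (intro polfun_intros polfun_ghost)
    show "pol_cong (int p ^ Suc k) (G (Suc k)) (\<lambda>\<rho>. G k (\<lambda>i. \<rho> i ^ p))" for k
      unfolding pol_cong_def
      by (rule exI[of _ "\<lambda>\<rho>. \<rho> (2 * Suc k) + \<rho> (2 * Suc k + 1)"])
        (auto intro!: polfun_intros simp: G_def ghost_Suc algebra_simps)
  qed
  then obtain S where S: "\<And>k \<rho>. ghost p k (\<lambda>i. eval_int \<rho> (S i)) = G k \<rho>" by blast
  have "\<exists>S. \<forall>k a b. ghost p k (\<lambda>i. eval_int (interl a b) (S i)) = ghost p k a + ghost p k b"
    by (rule exI[of _ S]) (simp add: S G_def interl_def)
  from someI_ex[OF this] show ?thesis unfolding witt_S_def by blast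
qed

section \<open>Transfer of polynomial identities to commutative rings\<close>

text \<open>Monomials are lists, so that multiplication is concatenation and nothing has to be
  sorted or merged. Commutativity enters only when \<open>tcoef\<close> collects coefficients along
  \<open>mset\<close>.\<close>

fun terms :: "pexpr \<Rightarrow> (int \<times> nat list) list" where
  "terms (Var i) = [(1, [i])]"
| "terms PZero = []"
| "terms POne = [(1, [])]"
| "terms (PAdd a b) = terms a @ terms b"
| "terms (PMul a b) = concat (map (\<lambda>(c, xs). map (\<lambda>(d, ys). (c * d, xs @ ys)) (terms b)) (terms a))"
| "terms (PNeg a) = map (\<lambda>(c, xs). (- c, xs)) (terms a)"

definition int_tsum :: "(nat \<Rightarrow> int) \<Rightarrow> (int \<times> nat list) list \<Rightarrow> int" where
  "int_tsum \<rho> L = (\<Sum>(c, xs)\<leftarrow>L. c * prod_list (map \<rho> xs))"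

definition tcoef :: "(int \<times> nat list) list \<Rightarrow> nat multiset \<Rightarrow> int" where
  "tcoef L m = (\<Sum>(c, xs)\<leftarrow>L. if mset xs = m then c else 0)"

lemma int_tsum_simps [simp]:
  "int_tsum \<rho> [] = 0" "int_tsum \<rho> ((c, xs) # L) = c * prod_list (map \<rho> xs) + int_tsum \<rho> L"
  "int_tsum \<rho> (L @ L') = int_tsum \<rho> L + int_tsum \<rho> L'"
  by (simp_all add: int_tsum_def)

lemma tcoef_simps [simp]:
  "tcoef [] m = 0" "tcoef ((c, xs) # L) m = (if mset xs = m then c else 0) + tcoef L m"
  "tcoef (L @ L') m = tcoef L m + tcoef L' m"
  by (simp_all add: tcoef_def)

lemma int_tsum_mult_term:
  "int_tsum \<rho> (map (\<lambda>(d, ys). (c * d, xs @ ys)) L) = c * prod_list (map \<rho> xs) * int_tsum \<rho> L"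
  by (induction L) (auto simp: algebra_simps)

lemma int_tsum_mult:
  "int_tsum \<rho> (concat (map (\<lambda>(c, xs). map (\<lambda>(d, ys). (c * d, xs @ ys)) L') L)) = int_tsum \<rho> L * int_tsum \<rho> L'"
  by (induction L) (auto simp: int_tsum_mult_term algebra_simps)

lemma int_tsum_neg: "int_tsum \<rho> (map (\<lambda>(c, xs). (- c, xs)) L) = - int_tsum \<rho> L"
  by (induction L) auto

lemma eval_int_eq_tsum: "eval_int \<rho> e = int_tsum \<rho> (terms e)"
  by (induction e) (auto simp: int_tsum_mult int_tsum_neg)

lemma int_tsum_eq_coef:
  assumes "finite M" "(\<lambda>t. mset (snd t)) ` set L \<subseteq> M"
  shows "int_tsum \<rho> L = (\<Sum>m\<in>M. tcoef L m * prod_mset (image_mset \<rho> m))"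
  using assms(2)
proof (induction L)
  case (Cons t L)
  obtain c xs where t: "t = (c, xs)" by (cases t)
  have "mset xs \<in> M" using Cons.prems t by auto
  then have "(\<Sum>m\<in>M. (if mset xs = m then c else 0) * prod_mset (image_mset \<rho> m)) = c * prod_mset (image_mset \<rho> (mset xs))"
    using assms(1) by (simp add: if_distrib[of "\<lambda>z. z * _"] cong: if_cong)
  moreover have "prod_mset (image_mset \<rho> (mset xs)) = prod_list (map \<rho> xs)"
    by (simp add: prod_mset_prod_list flip: mset_map)
  ultimately show ?case using Cons by (simp add: t algebra_simps sum.distrib)
qed simp

text \<open>A Vandermonde argument. Subtracting \<open>l \<mu>\<close> times the identity for
  \<open>s\<close> from the one for \<open>s + 1\<close> removes the node \<open>\<mu>\<close> and
  multiplies the other coefficients by the nonzero numbers \<open>l m - l \<mu>\<close>.\<close>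

lemma power_sums_zero_imp_coef_zero:
  fixes c :: "'i \<Rightarrow> int" and l :: "'i \<Rightarrow> int"
  assumes "finite M" "inj_on l M" "\<And>s. (\<Sum>m\<in>M. c m * l m ^ s) = 0" "m \<in> M"
  shows "c m = 0"
  using assms
proof (induction M arbitrary: c m rule: finite_induct)
  case (insert \<mu> M)
  have "(\<Sum>m\<in>M. (c m * (l m - l \<mu>)) * l m ^ s) = 0" for s
  proof -
    have "(\<Sum>m\<in>insert \<mu> M. c m * l m ^ Suc s) - l \<mu> * (\<Sum>m\<in>insert \<mu> M. c m * l m ^ s) = 0"
      using insert.prems(2)[of "Suc s"] insert.prems(2)[of s] by simp
    moreover have "(\<Sum>m\<in>insert \<mu> M. c m * l m ^ Suc s) - l \<mu> * (\<Sum>m\<in>insert \<mu> M. c m * l m ^ s)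
      = (\<Sum>m\<in>insert \<mu> M. (c m * (l m - l \<mu>)) * l m ^ s)"
      by (simp add: sum_distrib_left algebra_simps flip: sum_subtractf)
    ultimately show ?thesis using insert.hyps by simp
  qed
  then have "c m * (l m - l \<mu>) = 0" if "m \<in> M" for m
    using insert.IH[of "\<lambda>m. c m * (l m - l \<mu>)"] insert.prems(1) that by auto
  then have M: "c m = 0" if "m \<in> M" for m
    using insert.prems(1) insert.hyps that by (auto simp: inj_on_def)
  then have "c \<mu> = 0" using insert.prems(2)[of 0] insert.hyps by simp
  with M insert.prems(3) show ?case by auto
qed simp

lemma ex_inj_primes: "\<exists>q :: nat \<Rightarrow> nat. inj q \<and> (\<forall>i. Factorial_Ring.prime (q i))"
proof -
  have "infinite {p :: nat. Factorial_Ring.prime p}" by (rule primes_infinite)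
  from infinite_countable_subset[OF this] obtain f :: "nat \<Rightarrow> nat" where "inj f" "range f \<subseteq> {p. Factorial_Ring.prime p}" by blast
  then show ?thesis by (intro exI[of _ f]) auto
qed

text \<open>Evaluating at the \<open>s\<close>-th powers of distinct primes separates the monomials by unique factorization.\<close>

lemma tcoef_zero_if_vanishing:
  assumes "\<And>\<rho>. int_tsum \<rho> L = 0"
  shows "tcoef L m = 0"
proof (cases "m \<in> (\<lambda>t. mset (snd t)) ` set L")
  case False
  then show ?thesis by (induction L) auto
next
  case True
  define M where "M = (\<lambda>t. mset (snd t)) ` set L"
  obtain q :: "nat \<Rightarrow> nat" where q: "inj q" "\<And>i. Factorial_Ring.prime (q i)" using ex_inj_primes by blast
  define l where "l m = int (prod_mset (image_mset q m))" for m
  have "inj l"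
  proof
    fix m m' assume "l m = l m'"
    then have "prod_mset (image_mset q m) = prod_mset (image_mset q m')" by (simp add: l_def)
    then have "prime_factorization (prod_mset (image_mset q m)) = prime_factorization (prod_mset (image_mset q m'))" by simp
    moreover have "prime_factorization (prod_mset (image_mset q m)) = image_mset q m" for m
      by (rule prime_factorization_prod_mset_primes) (auto simp: q)
    ultimately show "m = m'" using multiset.inj_map[OF q(1)] by (simp add: inj_def)
  qed
  have "(\<Sum>m\<in>M. tcoef L m * l m ^ s) = 0" for s
  proof -
    have "prod_mset (image_mset (\<lambda>i. int (q i) ^ s) m) = l m ^ s" for m
      unfolding l_def by (induction m) (auto simp: power_mult_distrib)
    then show ?thesis
      using int_tsum_eq_coef[of M L "\<lambda>i. int (q i) ^ s"] assms by (simp add: M_def)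
  qed
  from power_sums_zero_imp_coef_zero[OF _ _ this] True \<open>inj l\<close> show ?thesis
    unfolding M_def by (auto intro: inj_on_subset)
qed

section \<open>Substitution and transfer to rings\<close>

fun psubst :: "(nat \<Rightarrow> pexpr) \<Rightarrow> pexpr \<Rightarrow> pexpr" where
  "psubst \<sigma> (Var i) = \<sigma> i"
| "psubst \<sigma> PZero = PZero"
| "psubst \<sigma> POne = POne"
| "psubst \<sigma> (PAdd a b) = PAdd (psubst \<sigma> a) (psubst \<sigma> b)"
| "psubst \<sigma> (PMul a b) = PMul (psubst \<sigma> a) (psubst \<sigma> b)"
| "psubst \<sigma> (PNeg a) = PNeg (psubst \<sigma> a)"

fun ppow :: "pexpr \<Rightarrow> nat \<Rightarrow> pexpr" where
  "ppow e 0 = POne"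
| "ppow e (Suc n) = PMul (ppow e n) e"

fun psum :: "(nat \<Rightarrow> pexpr) \<Rightarrow> nat \<Rightarrow> pexpr" where
  "psum f 0 = PZero"
| "psum f (Suc n) = PAdd (psum f n) (f n)"

fun pnat :: "nat \<Rightarrow> pexpr" where
  "pnat 0 = PZero"
| "pnat (Suc n) = PAdd (pnat n) POne"

lemma eval_int_psubst [simp]: "eval_int \<rho> (psubst \<sigma> e) = eval_int (\<lambda>i. eval_int \<rho> (\<sigma> i)) e"
  by (induction e) auto

lemma eval_int_ppow [simp]: "eval_int \<rho> (ppow e n) = eval_int \<rho> e ^ n"
  by (induction n) auto

lemma eval_int_psum [simp]: "eval_int \<rho> (psum f n) = (\<Sum>i<n. eval_int \<rho> (f i))"
  by (induction n) auto

lemma eval_int_pnat [simp]: "eval_int \<rho> (pnat n) = int n"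
  by (induction n) auto

lemma peval_psubst [simp]: "peval R \<rho> (psubst \<sigma> e) = peval R (\<lambda>i. peval R \<rho> (\<sigma> i)) e"
  by (induction e) auto

fun mval :: "('a, 'c) ring_scheme \<Rightarrow> (nat \<Rightarrow> 'a) \<Rightarrow> nat list \<Rightarrow> 'a" where
  "mval R \<rho> [] = \<one>\<^bsub>R\<^esub>"
| "mval R \<rho> (x # xs) = \<rho> x \<otimes>\<^bsub>R\<^esub> mval R \<rho> xs"

fun tsum :: "('a, 'c) ring_scheme \<Rightarrow> (nat \<Rightarrow> 'a) \<Rightarrow> (int \<times> nat list) list \<Rightarrow> 'a" where
  "tsum R \<rho> [] = \<zero>\<^bsub>R\<^esub>"
| "tsum R \<rho> ((c, xs) # L) = add_pow R c (mval R \<rho> xs) \<oplus>\<^bsub>R\<^esub> tsum R \<rho> L"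

context cring begin

lemma peval_closed [simp, intro]: "(\<And>i. \<rho> i \<in> carrier R) \<Longrightarrow> peval R \<rho> e \<in> carrier R"
  by (induction e) auto

lemma mval_closed [simp, intro]: "(\<And>i. \<rho> i \<in> carrier R) \<Longrightarrow> mval R \<rho> xs \<in> carrier R"
  by (induction xs) auto

lemma tsum_closed [simp, intro]: "(\<And>i. \<rho> i \<in> carrier R) \<Longrightarrow> tsum R \<rho> L \<in> carrier R"
  by (induction L) (auto simp: split_paired_all)

lemma mval_append: "(\<And>i. \<rho> i \<in> carrier R) \<Longrightarrow> mval R \<rho> (xs @ ys) = mval R \<rho> xs \<otimes> mval R \<rho> ys"
  by (induction xs) (auto simp: m_assoc)

lemma mval_remove1: "(\<And>i. \<rho> i \<in> carrier R) \<Longrightarrow> x \<in> set xs \<Longrightarrow> mval R \<rho> xs = \<rho> x \<otimes> mval R \<rho> (remove1 x xs)"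
  by (induction xs) (auto simp: m_lcomm)

lemma mval_mset_cong: "(\<And>i. \<rho> i \<in> carrier R) \<Longrightarrow> mset xs = mset ys \<Longrightarrow> mval R \<rho> xs = mval R \<rho> ys"
proof (induction xs arbitrary: ys)
  case (Cons x xs)
  then have "x \<in> set ys" by (metis list.set_intros(1) set_mset_mset)
  moreover from Cons.prems this have "mset xs = mset (remove1 x ys)" by (metis mset_remove1 add_mset_remove_trivial mset.simps(2))
  ultimately show ?case using Cons.IH[OF Cons.prems(1), of "remove1 x ys"] mval_remove1[OF Cons.prems(1), of x ys] by simp
qed simp

lemma tsum_append: "(\<And>i. \<rho> i \<in> carrier R) \<Longrightarrow> tsum R \<rho> (L @ L') = tsum R \<rho> L \<oplus> tsum R \<rho> L'"
  by (induction L) (auto simp: a_assoc split_paired_all)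

lemma tsum_filter: "(\<And>i. \<rho> i \<in> carrier R) \<Longrightarrow>
   tsum R \<rho> L = tsum R \<rho> (filter P L) \<oplus> tsum R \<rho> (filter (\<lambda>t. \<not> P t) L)"
  by (induction L) (auto simp: a_ac split_paired_all)

lemma tsum_mult_term: "(\<And>i. \<rho> i \<in> carrier R) \<Longrightarrow>
   tsum R \<rho> (map (\<lambda>(d, ys). (c * d, xs @ ys)) L) = add_pow R c (mval R \<rho> xs) \<otimes> tsum R \<rho> L"
proof (induction L)
  case (Cons t L)
  obtain d ys where t: "t = (d, ys)" by (cases t)
  have "add_pow R (c * d) (mval R \<rho> xs \<otimes> mval R \<rho> ys) = add_pow R c (mval R \<rho> xs) \<otimes> add_pow R d (mval R \<rho> ys)"
    using Cons.prems by (simp add: add_pow_ldistr_int add_pow_rdistr_int add.int_pow_pow mult.commute)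
  then show ?case using Cons by (simp add: t mval_append r_distr)
qed simp

lemma tsum_mult: "(\<And>i. \<rho> i \<in> carrier R) \<Longrightarrow>
  tsum R \<rho> (concat (map (\<lambda>(c, xs). map (\<lambda>(d, ys). (c * d, xs @ ys)) L') L)) = tsum R \<rho> L \<otimes> tsum R \<rho> L'"
  by (induction L) (auto simp: tsum_mult_term tsum_append l_distr split_paired_all)

lemma tsum_neg: "(\<And>i. \<rho> i \<in> carrier R) \<Longrightarrow> tsum R \<rho> (map (\<lambda>(c, xs). (- c, xs)) L) = \<ominus> tsum R \<rho> L"
  by (induction L) (auto simp: minus_add add.int_pow_neg split_paired_all)

lemma peval_eq_tsum: "(\<And>i. \<rho> i \<in> carrier R) \<Longrightarrow> peval R \<rho> e = tsum R \<rho> (terms e)"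
  by (induction e) (simp_all add: tsum_append tsum_mult tsum_neg)

lemma tsum_same_monomial:
  assumes "\<And>i. \<rho> i \<in> carrier R" "\<And>t. t \<in> set L \<Longrightarrow> mset (snd t) = mset xs"
  shows "tsum R \<rho> L = add_pow R (tcoef L (mset xs)) (mval R \<rho> xs)"
  using assms(2)
proof (induction L)
  case (Cons t L)
  obtain c ys where t: "t = (c, ys)" by (cases t)
  then have ys: "mset ys = mset xs" using Cons.prems[of t] by simp
  have "mval R \<rho> ys = mval R \<rho> xs" by (rule mval_mset_cong[OF assms(1) ys])
  then show ?case using Cons by (simp add: t ys add.int_pow_mult assms(1))
qed (simp add: add_pow_def int_pow_0[where G = "add_monoid R"])

text \<open>Each round removes all terms with the monomial of the first one. They add up to the
  collected coefficient, which is zero, times that monomial, and the list becomes shorter.\<close>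

lemma tsum_zero:
  assumes "\<And>i. \<rho> i \<in> carrier R" "\<And>m. tcoef L m = 0"
  shows "tsum R \<rho> L = \<zero>"
  using assms(2)
proof (induction L rule: length_induct)
  case (1 L)
  show ?case
  proof (cases L)
    case (Cons t L')
    obtain c xs where t: "t = (c, xs)" by (cases t)
    let ?P = "\<lambda>t. mset (snd t) = mset xs"
    have coef: "tcoef (filter P L) m = (if (\<forall>xs. mset xs = m \<longrightarrow> P' m) then tcoef L m else 0)"
      if "\<And>c xs. P (c, xs) = P' (mset xs)" for P P' m
    proof -
      have ex: "\<exists>xs. mset xs = m" by (rule ex_mset)
      show ?thesis
        by (induction L) (use that ex in auto)
    qed
    have "tsum R \<rho> (filter ?P L) = add_pow R (tcoef (filter ?P L) (mset xs)) (mval R \<rho> xs)"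
      by (rule tsum_same_monomial[OF assms(1)]) auto
    also have "tcoef (filter ?P L) (mset xs) = 0"
      using coef[of ?P "\<lambda>m. m = mset xs" "mset xs"] 1(2) by simp
    finally have A: "tsum R \<rho> (filter ?P L) = \<zero>" by (simp add: add_pow_def int_pow_0[where G = "add_monoid R"])
    have "length (filter (\<lambda>t. \<not> ?P t) L) < length L"
      unfolding Cons t by (simp add: le_imp_less_Suc)
    moreover have "tcoef (filter (\<lambda>t. \<not> ?P t) L) m = 0" for m
      using coef[of "\<lambda>t. \<not> ?P t" "\<lambda>m. m \<noteq> mset xs" m] 1(2) by simp
    ultimately have "tsum R \<rho> (filter (\<lambda>t. \<not> ?P t) L) = \<zero>" using 1(1) by blast
    with A show ?thesis using tsum_filter[of \<rho> L ?P] assms(1) by simp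
  qed simp
qed

text \<open>The bridge from the integers to \<open>R\<close>. Besides the Witt identities it also
  proves plain ring identities later on: the elements are named by an environment and the identity
  is checked over the integers.\<close>

lemma peval_cong_int:
  assumes "\<And>i. \<rho> i \<in> carrier R" "\<And>\<rho>. eval_int \<rho> e = eval_int \<rho> e'"
  shows "peval R \<rho> e = peval R \<rho> e'"
proof -
  have "tsum R \<rho> (terms (PAdd e (PNeg e'))) = \<zero>"
  proof (rule tsum_zero[OF assms(1)], rule tcoef_zero_if_vanishing)
    show "int_tsum \<rho> (terms (PAdd e (PNeg e'))) = 0" for \<rho>
      unfolding eval_int_eq_tsum[symmetric] by (simp add: assms(2))
  qed
  then have "peval R \<rho> e \<ominus> peval R \<rho> e' = \<zero>"
    using assms(1) by (subst (asm) peval_eq_tsum[symmetric]) (auto simp: minus_eq)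
  then show ?thesis using assms(1) by (simp add: r_right_minus_eq)
qed

lemma peval_ppow [simp]: "(\<And>i. \<rho> i \<in> carrier R) \<Longrightarrow> peval R \<rho> (ppow e n) = peval R \<rho> e [^] n"
  by (induction n) auto

lemma peval_psum [simp]: "(\<And>i. \<rho> i \<in> carrier R) \<Longrightarrow> peval R \<rho> (psum f n) = (\<Oplus>i\<in>{..<n}. peval R \<rho> (f i))"
  by (induction n) (auto simp: lessThan_Suc a_comm)

lemma peval_pnat [simp]: "peval R \<rho> (pnat n) = add_pow R n \<one>"
  by (induction n) (auto simp: add.nat_pow_Suc)

text \<open>The multiple of \<open>p\<close> becomes zero in characteristic \<open>p\<close>, so
  congruences of polynomials modulo \<open>p\<close> turn into identities.\<close>

lemma peval_cong_int_mod:
  assumes "\<And>i. \<rho> i \<in> carrier R" "add_pow R p \<one> = \<zero>"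
    "\<And>\<rho>. eval_int \<rho> e = eval_int \<rho> e' + int p * eval_int \<rho> e''"
  shows "peval R \<rho> e = peval R \<rho> e'"
proof -
  have "peval R \<rho> e = peval R \<rho> (PAdd e' (PMul (pnat p) e''))"
    by (rule peval_cong_int[OF assms(1)]) (simp add: assms(3))
  then show ?thesis using assms by simp
qed

end

lemma peval_hom:
  assumes "cring R" "cring S" "h \<in> ring_hom R S" "\<And>i. \<rho> i \<in> carrier R"
  shows "h (peval R \<rho> e) = peval S (\<lambda>i. h (\<rho> i)) e"
proof -
  interpret R: cring R by fact
  interpret S: cring S by fact
  interpret h: ring_hom_cring R S h
    by (intro ring_hom_cringI ring_hom_cring.intro ring_hom_cring_axioms.intro assms)
  show ?thesis by (induction e) (auto simp: assms(4))
qed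

section \<open>Gradings on the Witt addition polynomials\<close>

lemma tcoef_filter:
  assumes "\<And>c xs. P (c, xs) = P' (mset xs)"
  shows "tcoef (filter P L) m = (if P' m then tcoef L m else 0)"
  by (induction L) (use assms in auto)

lemma tcoef_map_scale:
  "tcoef (map (\<lambda>(c, xs). (c * f (mset xs), xs)) L) m = tcoef L m * f m"
  by (induction L) (auto simp: algebra_simps)

definition mweight :: "nat \<Rightarrow> nat multiset \<Rightarrow> nat" where
  "mweight p m = (\<Sum>i\<in>#m. p ^ (i div 2))"

definition mydeg :: "nat multiset \<Rightarrow> nat" where
  "mydeg m = size (filter_mset odd m)"

text \<open>Even-numbered variables are the \<open>X\<close>'s and odd-numbered ones the \<open>Y\<close>'s (cf. \<open>interl\<close>);
  \<open>X\<^sub>k\<close> and \<open>Y\<^sub>k\<close> have weight \<open>p ^ k\<close>.\<close>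

definition graded :: "nat \<Rightarrow> pexpr \<Rightarrow> nat \<Rightarrow> nat \<Rightarrow> bool" where
  "graded p e W d \<longleftrightarrow> (\<forall>m. tcoef (terms e) m \<noteq> 0 \<longrightarrow> mweight p m = W \<and> d \<le> mydeg m)"

text \<open>The scaling multiplies a monomial of weight \<open>w\<close> by \<open>2 ^ w\<close>.
  Homogeneity is then a polynomial identity whose coefficients are \<open>2 ^ w - 2 ^ W\<close>
  times the old ones, and distinct powers of two differ.\<close>

lemma isobaric_imp_mweight:
  assumes hom: "\<And>\<rho>. eval_int (\<lambda>i. 2 ^ (p ^ (i div 2)) * \<rho> i) e = 2 ^ W * eval_int \<rho> e"
    and "tcoef (terms e) m \<noteq> 0"
  shows "mweight p m = W"
proof -
  define L where "L = map (\<lambda>(c, xs). (c * ((\<lambda>m. 2 ^ mweight p m - 2 ^ W) (mset xs)), xs)) (terms e)"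
  have "int_tsum \<rho> (map (\<lambda>(c, xs). (c * ((\<lambda>m. 2 ^ mweight p m - 2 ^ W) (mset xs)), xs)) T)
      = int_tsum (\<lambda>i. 2 ^ (p ^ (i div 2)) * \<rho> i) T - 2 ^ W * int_tsum \<rho> T" for \<rho> T
  proof (induction T)
    case (Cons t T)
    obtain c xs where t: "t = (c, xs)" by (cases t)
    have "prod_list (map (\<lambda>i. 2 ^ (p ^ (i div 2)) * \<rho> i) xs) = 2 ^ mweight p (mset xs) * prod_list (map \<rho> xs)"
      by (induction xs) (auto simp: mweight_def power_add)
    then show ?case using Cons by (simp add: t algebra_simps)
  qed simp
  then have "int_tsum \<rho> L = 0" for \<rho>
    using hom[of \<rho>] unfolding L_def eval_int_eq_tsum by simp
  from tcoef_zero_if_vanishing[OF this, of m]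
  have "tcoef (terms e) m * (2 ^ mweight p m - 2 ^ W) = 0"
    unfolding L_def using tcoef_map_scale[of "\<lambda>m. 2 ^ mweight p m - 2 ^ W" "terms e" m] by simp
  with assms(2) have "(2::int) ^ mweight p m = 2 ^ W" by simp
  then show ?thesis by simp
qed

text \<open>Putting zero for the odd variables retains exactly the terms free of them. As these
  vanish as a function, their collected coefficients vanish.\<close>

lemma mydeg_pos_if:
  assumes "\<And>\<rho>. eval_int (\<lambda>i. if odd i then 0 else \<rho> i) e = 0" and "tcoef (terms e) m \<noteq> 0"
  shows "1 \<le> mydeg m"
proof -
  let ?P = "\<lambda>(c::int, xs). mydeg (mset xs) = 0"
  have "int_tsum \<rho> (filter ?P T) = int_tsum (\<lambda>i. if odd i then 0 else \<rho> i) T" for \<rho> T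
  proof (induction T)
    case (Cons t T)
    obtain c xs where t: "t = (c, xs)" by (cases t)
    have "prod_list (map (\<lambda>i. if odd i then 0 else \<rho> i) xs) = (if mydeg (mset xs) = 0 then prod_list (map \<rho> xs) else 0)"
      by (induction xs) (auto simp: mydeg_def)
    then show ?case using Cons by (simp add: t)
  qed simp
  then have "int_tsum \<rho> (filter ?P (terms e)) = 0" for \<rho>
    by (simp add: assms(1) flip: eval_int_eq_tsum)
  from tcoef_zero_if_vanishing[OF this, of m]
  show ?thesis using tcoef_filter[of ?P "\<lambda>m. mydeg m = 0" "terms e" m] assms(2)
    by (cases "mydeg m = 0") auto
qed

text \<open>Replacing \<open>Y\<close> by \<open>h * Y\<close> gives \<open>A + h * B\<close> modulo
  \<open>h\<^sup>2\<close>, with \<open>A\<close> and \<open>B\<close> the parts of degree zero and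
  one. For \<open>h\<close> above \<open>\<bar>A\<bar> + \<bar>B\<bar>\<close> this number is
  smaller than \<open>h\<^sup>2\<close>, so divisibility makes it zero, and two such
  \<open>h\<close> give \<open>A = B = 0\<close>. Values of \<open>h\<close> prime to
  \<open>p\<close> must do, because the application obtains divisibility only after cancelling a
  power of \<open>p\<close>.\<close>

lemma mydeg_ge2_if:
  assumes "\<And>\<rho> h. coprime h (int p) \<Longrightarrow> h\<^sup>2 dvd eval_int (\<lambda>i. if odd i then h * \<rho> i else \<rho> i) e"
    and p: "p > 0" and "tcoef (terms e) m \<noteq> 0"
  shows "2 \<le> mydeg m"
proof -
  let ?P = "\<lambda>d (c::int, xs). mydeg (mset xs) = d"
  have expand: "\<exists>r. int_tsum (\<lambda>i. if odd i then h * \<rho> i else \<rho> i) T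
     = int_tsum \<rho> (filter (?P 0) T) + h * int_tsum \<rho> (filter (?P 1) T) + h\<^sup>2 * r" for \<rho> T and h :: int
  proof (induction T)
    case (Cons t T)
    then obtain r where r: "int_tsum (\<lambda>i. if odd i then h * \<rho> i else \<rho> i) T
      = int_tsum \<rho> (filter (?P 0) T) + h * int_tsum \<rho> (filter (?P 1) T) + h\<^sup>2 * r" by blast
    obtain c xs where t: "t = (c, xs)" by (cases t)
    have *: "prod_list (map (\<lambda>i. if odd i then h * \<rho> i else \<rho> i) xs) = h ^ mydeg (mset xs) * prod_list (map \<rho> xs)"
      by (induction xs) (auto simp: mydeg_def)
    show ?case
    proof (cases "mydeg (mset xs) \<ge> 2")
      case True
      then have "h ^ mydeg (mset xs) = h\<^sup>2 * h ^ (mydeg (mset xs) - 2)"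
        by (metis le_add_diff_inverse power_add)
      then show ?thesis using True
        by (intro exI[of _ "r + c * (h ^ (mydeg (mset xs) - 2) * prod_list (map \<rho> xs))"]) (simp add: t * r algebra_simps)
    next
      case False
      then have "mydeg (mset xs) = 0 \<or> mydeg (mset xs) = 1" by auto
      then show ?thesis by (intro exI[of _ r]) (auto simp: t * r algebra_simps)
    qed
  qed simp
  have AB: "int_tsum \<rho> (filter (?P 0) (terms e)) = 0 \<and> int_tsum \<rho> (filter (?P 1) (terms e)) = 0" for \<rho>
  proof -
    define A B where "A = int_tsum \<rho> (filter (?P 0) (terms e))" and "B = int_tsum \<rho> (filter (?P 1) (terms e))"
    have zero: "A + h * B = 0" if h: "coprime h (int p)" "h > \<bar>A\<bar> + \<bar>B\<bar>" "h \<ge> 1" for h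
    proof (rule ccontr)
      assume n: "A + h * B \<noteq> 0"
      obtain r where "eval_int (\<lambda>i. if odd i then h * \<rho> i else \<rho> i) e = A + h * B + h\<^sup>2 * r"
        using expand[of h \<rho> "terms e"] unfolding A_def B_def eval_int_eq_tsum by blast
      with assms(1)[OF h(1), of \<rho>] have "h\<^sup>2 dvd A + h * B" by (simp add: dvd_add_left_iff)
      with n have "\<bar>h\<^sup>2\<bar> \<le> \<bar>A + h * B\<bar>" using dvd_imp_le_int by blast
      also have "\<dots> \<le> \<bar>A\<bar> + h * \<bar>B\<bar>" using h(3) by (metis abs_mult abs_of_pos abs_triangle_ineq int_one_le_iff_zero_less)
      also have "\<dots> \<le> h * (\<bar>A\<bar> + \<bar>B\<bar>)" using h(3) by (simp add: algebra_simps mult_le_cancel_right1)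
      also have "\<dots> < h * h" using h by simp
      finally show False by (simp add: power2_eq_square)
    qed
    \<comment> \<open>The numbers \<open>p * t + 1\<close> are prime to \<open>p\<close> and
      arbitrarily large; the values at \<open>t = s\<close> and \<open>t = s + 1\<close> isolate
      \<open>p * B\<close>.\<close>
    define s where "s = \<bar>A\<bar> + \<bar>B\<bar>"
    have cop: "coprime (int p * t + 1) (int p)" for t
      by (intro coprimeI) (metis add.commute add_diff_cancel_right' dvd_diff dvd_mult2)
    have big: "int p * t + 1 > s" "int p * t + 1 \<ge> 1" if "t \<ge> s" for t
    proof -
      have "s \<ge> 0" by (simp add: s_def)
      with that p have "t \<le> int p * t" by (simp add: mult_le_cancel_right1)
      with that \<open>s \<ge> 0\<close> show "int p * t + 1 > s" "int p * t + 1 \<ge> 1" by auto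
    qed
    have 1: "A + (int p * s + 1) * B = 0" using zero[OF cop] big[of s] by (simp add: s_def)
    have 2: "A + (int p * (s + 1) + 1) * B = 0" using zero[OF cop] big[of "s + 1"] by (simp add: s_def)
    have "int p * B = (A + (int p * (s + 1) + 1) * B) - (A + (int p * s + 1) * B)" by (simp add: algebra_simps)
    with 1 2 have "int p * B = 0" by simp
    with p 1 have "B = 0" "A = 0" by auto
    then show ?thesis by (simp add: A_def B_def)
  qed
  have "mydeg m \<noteq> 0"
    using tcoef_filter[of "?P 0" "\<lambda>m. mydeg m = 0" "terms e" m] assms(3)
      tcoef_zero_if_vanishing[of "filter (?P 0) (terms e)" m] AB by auto
  moreover have "mydeg m \<noteq> 1"
    using tcoef_filter[of "?P 1" "\<lambda>m. mydeg m = 1" "terms e" m] assms(3)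
      tcoef_zero_if_vanishing[of "filter (?P 1) (terms e)" m] AB by auto
  ultimately show ?thesis by linarith
qed

section \<open>Scaling, truncation and the carry of Witt addition\<close>

lemma ghost_inject:
  assumes p: "p > 0" and "\<And>k. ghost p k a = ghost p k b"
  shows "a k = b k"
proof (induction k rule: less_induct)
  case (less k)
  have split: "ghost p k c = (\<Sum>i<k. int p ^ i * c i ^ p ^ (k - i)) + int p ^ k * c k" for c
    unfolding ghost_def by (simp add: lessThan_Suc_atMost[symmetric])
  have "(\<Sum>i<k. int p ^ i * a i ^ p ^ (k - i)) = (\<Sum>i<k. int p ^ i * b i ^ p ^ (k - i))"
    using less by (intro sum.cong) auto
  with assms(2)[of k] have "int p ^ k * a k = int p ^ k * b k" by (simp add: split)
  then show ?case using p by simp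
qed

text \<open>Over the integers a Witt vector is determined by its ghost components, where addition is
  ordinary addition. Identities for the addition polynomials are therefore checked on
  ghosts.\<close>

lemma eval_witt_S_eqI:
  assumes p: "Factorial_Ring.prime p" and "\<And>k. ghost p k c = ghost p k a + ghost p k b"
  shows "eval_int (interl a b) (witt_S p k) = c k"
  by (rule ghost_inject[OF prime_gt_0_nat[OF p], where a = "\<lambda>k. eval_int (interl a b) (witt_S p k)"])
    (simp add: assms ghost_witt_S)

lemma ghost_zero: "p > 0 \<Longrightarrow> ghost p k (\<lambda>_. 0) = 0"
  unfolding ghost_def by (simp add: zero_power)

lemma ghost_scale: "ghost p k (\<lambda>i. 2 ^ (p ^ i) * a i) = 2 ^ (p ^ k) * ghost p k a"
proof -
  have "int p ^ i * (2 ^ (p ^ i) * a i) ^ p ^ (k - i) = 2 ^ (p ^ k) * (int p ^ i * a i ^ p ^ (k - i))" if "i \<le> k" for i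
  proof -
    have "p ^ i * p ^ (k - i) = p ^ k" using that by (simp flip: power_add)
    then show ?thesis by (simp add: power_mult_distrib flip: power_mult)
  qed
  then show ?thesis unfolding ghost_def sum_distrib_left by (intro sum.cong) auto
qed

lemma interl_scale: "(\<lambda>i. c (i div 2) * \<rho> i) = interl (\<lambda>i. c i * \<rho> (2 * i)) (\<lambda>i. c i * \<rho> (2 * i + 1))"
  by (auto simp: interl_def fun_eq_iff)

lemma interl_split: "\<rho> = interl (\<lambda>i. \<rho> (2 * i)) (\<lambda>i. \<rho> (2 * i + 1))"
  by (auto simp: interl_def fun_eq_iff)

lemma eval_witt_S_scale:
  assumes p: "Factorial_Ring.prime p"
  shows "eval_int (\<lambda>i. 2 ^ (p ^ (i div 2)) * \<rho> i) (witt_S p k) = 2 ^ (p ^ k) * eval_int \<rho> (witt_S p k)"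
proof -
  let ?a = "\<lambda>i. \<rho> (2 * i)" and ?b = "\<lambda>i. \<rho> (2 * i + 1)"
  have "eval_int (interl (\<lambda>i. 2 ^ (p ^ i) * ?a i) (\<lambda>i. 2 ^ (p ^ i) * ?b i)) (witt_S p k)
     = 2 ^ (p ^ k) * eval_int (interl ?a ?b) (witt_S p k)"
    by (rule eval_witt_S_eqI[OF p])
      (simp only: ghost_scale ghost_witt_S[OF p] distrib_left)
  then show ?thesis
    using interl_scale[of "\<lambda>i. 2 ^ (p ^ i)" \<rho>] interl_split[of \<rho>] by metis
qed

lemma eval_witt_S_zero_right:
  assumes p: "Factorial_Ring.prime p"
  shows "eval_int (interl a (\<lambda>_. 0)) (witt_S p k) = a k"
  by (rule eval_witt_S_eqI[OF p]) (simp add: ghost_zero prime_gt_0_nat[OF p])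

lemma eval_witt_S_recursion:
  assumes p: "Factorial_Ring.prime p"
  shows "int p ^ k * (eval_int (interl a b) (witt_S p k) - a k - b k)
    = (\<Sum>i<k. int p ^ i * (a i ^ p ^ (k - i) + b i ^ p ^ (k - i) - eval_int (interl a b) (witt_S p i) ^ p ^ (k - i)))"
proof -
  have split: "ghost p k c = (\<Sum>i<k. int p ^ i * c i ^ p ^ (k - i)) + int p ^ k * c k" for c
    unfolding ghost_def by (simp add: lessThan_Suc_atMost[symmetric])
  show ?thesis using ghost_witt_S[OF p, of k a b] unfolding split
    by (simp add: algebra_simps sum.distrib sum_subtractf)
qed

lemma eval_witt_S_cong_le:
  assumes p: "Factorial_Ring.prime p" and "\<And>i. i \<le> k \<Longrightarrow> a i = a' i \<and> b i = b' i"
  shows "eval_int (interl a b) (witt_S p k) = eval_int (interl a' b') (witt_S p k)"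
  using assms(2)
proof (induction k rule: less_induct)
  case (less k)
  have "int p ^ k * (eval_int (interl a b) (witt_S p k) - a k - b k) = int p ^ k * (eval_int (interl a' b') (witt_S p k) - a' k - b' k)"
    unfolding eval_witt_S_recursion[OF p] using less by (intro sum.cong) auto
  then show ?case using less.prems[of k] prime_gt_0_nat[OF p] by simp
qed

text \<open>The carry of Witt addition. By \<open>eval_witt_S_recursion\<close> it depends only on
  the components of index below \<open>k\<close>.\<close>

definition witt_P :: "nat \<Rightarrow> nat \<Rightarrow> pexpr" where
  "witt_P p k = PAdd (witt_S p k) (PNeg (PAdd (Var (2 * k)) (Var (2 * k + 1))))"

definition trunc_at :: "'a \<Rightarrow> nat \<Rightarrow> (nat \<Rightarrow> 'a) \<Rightarrow> nat \<Rightarrow> 'a" where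
  "trunc_at z k x i = (if i < k then x i else z)"

lemma eval_witt_P_trunc:
  assumes p: "Factorial_Ring.prime p"
  shows "eval_int (interl a b) (witt_P p k) = eval_int (interl (trunc_at 0 k a) (trunc_at 0 k b)) (witt_P p k)"
proof -
  have "int p ^ k * (eval_int (interl a b) (witt_S p k) - a k - b k)
     = int p ^ k * (eval_int (interl (trunc_at 0 k a) (trunc_at 0 k b)) (witt_S p k) - trunc_at 0 k a k - trunc_at 0 k b k)"
    unfolding eval_witt_S_recursion[OF p]
  proof (intro sum.cong refl)
    fix i assume "i \<in> {..<k}"
    then have "eval_int (interl a b) (witt_S p i) = eval_int (interl (trunc_at 0 k a) (trunc_at 0 k b)) (witt_S p i)"
      by (intro eval_witt_S_cong_le[OF p]) (auto simp: trunc_at_def)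
    with \<open>i \<in> {..<k}\<close> show "int p ^ i * (a i ^ p ^ (k - i) + b i ^ p ^ (k - i) - eval_int (interl a b) (witt_S p i) ^ p ^ (k - i)) =
         int p ^ i * (trunc_at 0 k a i ^ p ^ (k - i) + trunc_at 0 k b i ^ p ^ (k - i) -
          eval_int (interl (trunc_at 0 k a) (trunc_at 0 k b)) (witt_S p i) ^ p ^ (k - i))"
      by (simp add: trunc_at_def)
  qed
  then show ?thesis using prime_gt_0_nat[OF p] by (simp add: witt_P_def interl_def)
qed

text \<open>The weight comes from the scaling behaviour of the ghost components. For
  \<open>Y = 0\<close> the sum is \<open>X\<close>, so the carry vanishes and each of its monomials
  contains some \<open>Y\<close>.\<close>

lemma graded_witt_P:
  assumes p: "Factorial_Ring.prime p"
  shows "graded p (witt_P p k) (p ^ k) 1"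
  unfolding graded_def
proof (intro allI impI conjI)
  fix m assume m: "tcoef (terms (witt_P p k)) m \<noteq> 0"
  show "mweight p m = p ^ k"
    by (rule isobaric_imp_mweight[OF _ m])
      (simp add: witt_P_def eval_witt_S_scale[OF p] right_diff_distrib distrib_left)
  show "1 \<le> mydeg m"
  proof (rule mydeg_pos_if[OF _ m])
    fix \<rho> :: "nat \<Rightarrow> int"
    have "(\<lambda>i. if odd i then 0 else \<rho> i) = interl (\<lambda>i. \<rho> (2 * i)) (\<lambda>_. 0)"
      by (auto simp: interl_def fun_eq_iff)
    then show "eval_int (\<lambda>i. if odd i then 0 else \<rho> i) (witt_P p k) = 0"
      by (simp add: witt_P_def eval_witt_S_zero_right[OF p] interl_def)
  qed
qed

lemma eval_int_cong_dvd:
  "(\<And>i. h dvd \<rho> i - \<rho>' i) \<Longrightarrow> h dvd eval_int \<rho> e - eval_int \<rho>' e"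
proof (induction e)
  case (PMul a b)
  have "eval_int \<rho> a * eval_int \<rho> b - eval_int \<rho>' a * eval_int \<rho>' b
    = (eval_int \<rho> a - eval_int \<rho>' a) * eval_int \<rho> b + eval_int \<rho>' a * (eval_int \<rho> b - eval_int \<rho>' b)"
    by (simp add: algebra_simps)
  then show ?case using PMul by simp
next
  case (PAdd a b)
  have "eval_int \<rho> a + eval_int \<rho> b - (eval_int \<rho>' a + eval_int \<rho>' b)
    = (eval_int \<rho> a - eval_int \<rho>' a) + (eval_int \<rho> b - eval_int \<rho>' b)" by simp
  then show ?case using PAdd by (metis dvd_add eval_int.simps(4))
next
  case (PNeg a)
  have "eval_int \<rho> (PNeg a) - eval_int \<rho>' (PNeg a) = - (eval_int \<rho> a - eval_int \<rho>' a)" by simp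
  then show ?case using PNeg by (metis dvd_minus_iff)
qed auto

lemma power_add_mod_square:
  fixes a d h :: int
  assumes "h dvd d"
  shows "h\<^sup>2 dvd (a + d) ^ q - a ^ q - int q * a ^ (q - 1) * d"
proof (induction q)
  case (Suc q)
  have sq: "h\<^sup>2 dvd d * d" using assms by (simp add: power2_eq_square mult_dvd_mono)
  have a: "int q * a ^ q = int q * (a ^ (q - 1) * a)"
    by (cases q) auto
  have "(a + d) ^ Suc q - a ^ Suc q - int (Suc q) * a ^ (Suc q - 1) * d
     = (a + d) * ((a + d) ^ q - a ^ q - int q * a ^ (q - 1) * d) + (int q * a ^ (q - 1)) * (d * d)
       + (int q * (a ^ (q - 1) * a) - int q * a ^ q) * d"
    by (simp add: algebra_simps)
  also have "\<dots> = (a + d) * ((a + d) ^ q - a ^ q - int q * a ^ (q - 1) * d) + (int q * a ^ (q - 1)) * (d * d)"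
    by (simp add: a)
  finally show ?case using Suc sq by simp
qed simp

definition witt_Q :: "nat \<Rightarrow> nat \<Rightarrow> pexpr" where
  "witt_Q p N = PAdd (psum (\<lambda>l. PMul (ppow (Var (2 * l)) (p ^ (N - l) - 1)) (PAdd (witt_S p l) (PNeg (Var (2 * l))))) (Suc N))
     (PNeg (Var (2 * N + 1)))"

text \<open>The linear part in \<open>Y\<close> of \<open>\<Sum>\<^sub>l X\<^sub>l ^ (p ^ (N - l) - 1) (S\<^sub>l - X\<^sub>l)\<close> is \<open>Y\<^sub>N\<close>: differentiate
  the ghost identity and divide by \<open>p ^ N\<close>.\<close>

lemma graded_witt_Q:
  assumes p: "Factorial_Ring.prime p"
  shows "graded p (witt_Q p N) (p ^ N) 2"
  unfolding graded_def
proof (intro allI impI conjI)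
  fix m assume m: "tcoef (terms (witt_Q p N)) m \<noteq> 0"
  have p0: "p > 0" and p2: "p \<ge> 2" using p prime_gt_0_nat prime_ge_2_nat by auto
  show "mweight p m = p ^ N"
  proof (rule isobaric_imp_mweight[OF _ m])
    fix \<rho>
    have "(2 ^ p ^ l * \<rho> (2 * l)) ^ (p ^ (N - l) - 1) * (2 ^ p ^ l * eval_int \<rho> (witt_S p l) - 2 ^ p ^ l * \<rho> (2 * l))
      = 2 ^ p ^ N * (\<rho> (2 * l) ^ (p ^ (N - l) - 1) * (eval_int \<rho> (witt_S p l) - \<rho> (2 * l)))" if "l \<le> N" for l
    proof -
      have "p ^ l * (p ^ (N - l) - 1) + p ^ l = p ^ N"
      proof -
        have "p ^ (N - l) \<ge> 1" using p0 by simp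
        then have "p ^ l * (p ^ (N - l) - 1) + p ^ l = p ^ l * p ^ (N - l)" by (simp add: diff_mult_distrib2)
        also have "\<dots> = p ^ N" using that by (simp flip: power_add)
        finally show ?thesis .
      qed
      then have "((2::int) ^ p ^ l) ^ (p ^ (N - l) - 1) * 2 ^ p ^ l = 2 ^ p ^ N"
        by (simp flip: power_mult power_add)
      then show ?thesis by (simp add: power_mult_distrib algebra_simps)
    qed
    then have "(\<Sum>l<Suc N. (2 ^ p ^ l * \<rho> (2 * l)) ^ (p ^ (N - l) - 1) * (2 ^ p ^ l * eval_int \<rho> (witt_S p l) - 2 ^ p ^ l * \<rho> (2 * l)))
      = (\<Sum>l<Suc N. 2 ^ p ^ N * (\<rho> (2 * l) ^ (p ^ (N - l) - 1) * (eval_int \<rho> (witt_S p l) - \<rho> (2 * l))))"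
      by (intro sum.cong) auto
    then show "eval_int (\<lambda>i. 2 ^ p ^ (i div 2) * \<rho> i) (witt_Q p N) = 2 ^ p ^ N * eval_int \<rho> (witt_Q p N)"
      by (simp add: witt_Q_def eval_witt_S_scale[OF p] sum_distrib_left right_diff_distrib distrib_left del: sum.lessThan_Suc psum.simps)
  qed
  show "2 \<le> mydeg m"
  proof (rule mydeg_ge2_if[OF _ p0 m])
    fix \<rho> :: "nat \<Rightarrow> int" and h :: int assume h: "coprime h (int p)"
    define a y where "a i = \<rho> (2 * i)" and "y i = \<rho> (2 * i + 1)" for i
    define b where "b i = h * y i" for i
    define s where "s l = eval_int (interl a b) (witt_S p l)" for l
    have env: "(\<lambda>i. if odd i then h * \<rho> i else \<rho> i) = interl a b"
      by (auto simp: interl_def fun_eq_iff a_def b_def y_def)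
    have s_a: "h dvd s l - a l" for l
    proof -
      have "h dvd eval_int (interl a b) (witt_S p l) - eval_int (interl a (\<lambda>_. 0)) (witt_S p l)"
        by (rule eval_int_cong_dvd) (auto simp: interl_def b_def)
      then show ?thesis by (simp add: s_def eval_witt_S_zero_right[OF p])
    qed
    have "h\<^sup>2 dvd int p ^ l * (s l ^ p ^ (N - l) - a l ^ p ^ (N - l) - b l ^ p ^ (N - l))
        - int p ^ N * (a l ^ (p ^ (N - l) - 1) * (s l - a l) - (if l = N then b N else 0))" if l: "l \<le> N" for l
    proof -
      have "h\<^sup>2 dvd (a l + (s l - a l)) ^ p ^ (N - l) - a l ^ p ^ (N - l) - int (p ^ (N - l)) * a l ^ (p ^ (N - l) - 1) * (s l - a l)"
        by (rule power_add_mod_square[OF s_a])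
      \<comment> \<open>For \<open>l < N\<close> the exponent is at least two and \<open>b l\<close>
        contains the factor \<open>h\<close>; only \<open>l = N\<close> contributes a linear
        term.\<close>
      moreover have "h\<^sup>2 dvd b l ^ p ^ (N - l) - (if l = N then b N else 0)"
      proof (cases "l = N")
        case False
        with l have "N - l \<ge> 1" by simp
        then have "p ^ 1 \<le> p ^ (N - l)" using p0 by (intro power_increasing) auto
        with p2 have "2 \<le> p ^ (N - l)" by simp
        then have "h\<^sup>2 dvd b l ^ p ^ (N - l)" unfolding b_def power_mult_distrib
          by (intro dvd_mult2 le_imp_power_dvd)
        with False show ?thesis by simp
      qed simp
      ultimately have "h\<^sup>2 dvd int p ^ l * (((a l + (s l - a l)) ^ p ^ (N - l) - a l ^ p ^ (N - l) - int (p ^ (N - l)) * a l ^ (p ^ (N - l) - 1) * (s l - a l))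
         - (b l ^ p ^ (N - l) - (if l = N then b N else 0)))" by (rule dvd_mult[OF dvd_diff])
      moreover have "int p ^ l * int (p ^ (N - l)) = int p ^ N" using l by (simp flip: power_add)
      then have "int p ^ l * (((a l + (s l - a l)) ^ p ^ (N - l) - a l ^ p ^ (N - l) - int (p ^ (N - l)) * a l ^ (p ^ (N - l) - 1) * (s l - a l))
         - (b l ^ p ^ (N - l) - (if l = N then b N else 0)))
        = int p ^ l * (s l ^ p ^ (N - l) - a l ^ p ^ (N - l) - b l ^ p ^ (N - l))
        - int p ^ N * (a l ^ (p ^ (N - l) - 1) * (s l - a l) - (if l = N then b N else 0))"
        by (simp add: right_diff_distrib mult.assoc[symmetric] del: of_nat_power)
      ultimately show ?thesis by (simp del: of_nat_power)
    qed
    then have "h\<^sup>2 dvd (\<Sum>l\<le>N. int p ^ l * (s l ^ p ^ (N - l) - a l ^ p ^ (N - l) - b l ^ p ^ (N - l))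
        - int p ^ N * (a l ^ (p ^ (N - l) - 1) * (s l - a l) - (if l = N then b N else 0)))"
      by (intro dvd_sum) auto
    also have "\<dots> = (ghost p N s - ghost p N a - ghost p N b) - int p ^ N * ((\<Sum>l\<le>N. a l ^ (p ^ (N - l) - 1) * (s l - a l)) - b N)"
      by (simp add: ghost_def sum_subtractf right_diff_distrib sum_distrib_left if_distrib[of "\<lambda>z. _ * z"] cong: if_cong)
    also have "ghost p N s = ghost p N a + ghost p N b"
      unfolding s_def by (rule ghost_witt_S[OF p])
    finally have "h\<^sup>2 dvd int p ^ N * ((\<Sum>l\<le>N. a l ^ (p ^ (N - l) - 1) * (s l - a l)) - b N)" by simp
    \<comment> \<open>Differentiating the ghost identity leaves the common factor
      \<open>p ^ N\<close>, which may be cancelled since \<open>h\<close> is prime to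
      \<open>p\<close>.\<close>
    moreover have "coprime (h\<^sup>2) (int p ^ N)" using h by simp
    ultimately have "h\<^sup>2 dvd (\<Sum>l\<le>N. a l ^ (p ^ (N - l) - 1) * (s l - a l)) - b N"
      using coprime_dvd_mult_right_iff by blast
    also have "\<dots> = eval_int (interl a b) (witt_Q p N)"
      by (simp add: witt_Q_def s_def interl_def lessThan_Suc_atMost del: sum.lessThan_Suc psum.simps)
    finally show "h\<^sup>2 dvd eval_int (\<lambda>i. if odd i then h * \<rho> i else \<rho> i) (witt_Q p N)" by (simp add: env)
  qed
qed

section \<open>Witt vectors over valued fields\<close>

text \<open>Values are real so that one set of estimates serves both the integral valuation of a
  discrete valuation field and the fractional values of the perfect closure. Zero gets no value;
  \<open>vge\<close> and \<open>vgt\<close> treat it as having value infinity.\<close>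

locale valued_field = field R for R (structure) +
  fixes w :: "'a \<Rightarrow> real"
  assumes w_mult: "\<lbrakk>x \<in> carrier R; y \<in> carrier R; x \<noteq> \<zero>; y \<noteq> \<zero>\<rbrakk> \<Longrightarrow> w (x \<otimes> y) = w x + w y"
    and w_add: "\<lbrakk>x \<in> carrier R; y \<in> carrier R; x \<noteq> \<zero>; y \<noteq> \<zero>; x \<oplus> y \<noteq> \<zero>\<rbrakk> \<Longrightarrow> min (w x) (w y) \<le> w (x \<oplus> y)"
begin

definition vge :: "'a \<Rightarrow> real \<Rightarrow> bool" where "vge x r \<longleftrightarrow> x = \<zero> \<or> r \<le> w x"
definition vgt :: "'a \<Rightarrow> real \<Rightarrow> bool" where "vgt x r \<longleftrightarrow> x = \<zero> \<or> r < w x"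

lemma w_one: "w \<one> = 0"
  using w_mult[of \<one> \<one>] by simp

lemma w_minus_one: "w (\<ominus> \<one>) = 0"
proof -
  have nz: "\<ominus> \<one> \<noteq> \<zero>" using local.minus_minus zero_not_one by fastforce
  have "(\<ominus> \<one>) \<otimes> (\<ominus> \<one>) = \<one>" by (simp add: l_minus)
  then show ?thesis using w_mult[of "\<ominus> \<one>" "\<ominus> \<one>"] nz w_one by simp
qed

lemma w_neg [simp]: assumes "x \<in> carrier R" shows "w (\<ominus> x) = w x"
proof (cases "x = \<zero>")
  case False
  have nz: "\<ominus> \<one> \<noteq> \<zero>" using local.minus_minus zero_not_one by fastforce
  have "\<ominus> x = (\<ominus> \<one>) \<otimes> x" using assms by (simp add: l_minus)
  then show ?thesis using w_mult[of "\<ominus> \<one>" x] nz False assms w_minus_one by simp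
qed simp

lemma pow_nonzero: "x \<in> carrier R \<Longrightarrow> x \<noteq> \<zero> \<Longrightarrow> x [^] (n::nat) \<noteq> \<zero>"
  by (induction n) (auto simp: integral_iff)

lemma w_pow: "x \<in> carrier R \<Longrightarrow> x \<noteq> \<zero> \<Longrightarrow> w (x [^] (n::nat)) = real n * w x"
  by (induction n) (auto simp: w_one w_mult pow_nonzero algebra_simps)

lemma inv_nonzero: "x \<in> carrier R \<Longrightarrow> x \<noteq> \<zero> \<Longrightarrow> inv x \<in> carrier R \<and> inv x \<noteq> \<zero> \<and> x \<otimes> inv x = \<one>"
  using field_Units Units_inv_closed Units_r_inv r_null by (metis Diff_iff insertE singletonD insertI1 zero_not_one)

lemma w_inv: assumes "x \<in> carrier R" "x \<noteq> \<zero>" shows "w (inv x) = - w x"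
  using w_mult[of x "inv x"] inv_nonzero[OF assms] assms w_one by simp

lemma vge_zero [simp]: "vge \<zero> r" by (simp add: vge_def)
lemma vgt_zero [simp]: "vgt \<zero> r" by (simp add: vgt_def)

lemma vge_mono: "vge x r \<Longrightarrow> s \<le> r \<Longrightarrow> vge x s" by (auto simp: vge_def)
lemma vge_imp_vgt: "vge x r \<Longrightarrow> s < r \<Longrightarrow> vgt x s" by (auto simp: vge_def vgt_def)
lemma vgt_imp_vge: "vgt x r \<Longrightarrow> vge x r" by (auto simp: vge_def vgt_def)

lemma vge_add: assumes "x \<in> carrier R" "y \<in> carrier R" "vge x r" "vge y r" shows "vge (x \<oplus> y) r"
proof (cases "x = \<zero> \<or> y = \<zero> \<or> x \<oplus> y = \<zero>")
  case True with assms show ?thesis by auto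
next
  case False
  with w_add[of x y] assms show ?thesis unfolding vge_def by auto
qed

lemma vgt_add: assumes "x \<in> carrier R" "y \<in> carrier R" "vgt x r" "vgt y r" shows "vgt (x \<oplus> y) r"
proof (cases "x = \<zero> \<or> y = \<zero> \<or> x \<oplus> y = \<zero>")
  case True with assms show ?thesis by auto
next
  case False
  with w_add[of x y] assms show ?thesis unfolding vgt_def by auto
qed

lemma vge_neg: "x \<in> carrier R \<Longrightarrow> vge (\<ominus> x) r \<longleftrightarrow> vge x r"
  unfolding vge_def by (metis local.minus_minus minus_zero w_neg)
lemma vgt_neg: "x \<in> carrier R \<Longrightarrow> vgt (\<ominus> x) r \<longleftrightarrow> vgt x r"
  unfolding vgt_def by (metis local.minus_minus minus_zero w_neg)

lemma vge_diff: "x \<in> carrier R \<Longrightarrow> y \<in> carrier R \<Longrightarrow> vge x r \<Longrightarrow> vge y r \<Longrightarrow> vge (x \<ominus> y) r"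
  unfolding minus_eq by (intro vge_add) (auto simp: vge_neg)
lemma vgt_diff: "x \<in> carrier R \<Longrightarrow> y \<in> carrier R \<Longrightarrow> vgt x r \<Longrightarrow> vgt y r \<Longrightarrow> vgt (x \<ominus> y) r"
  unfolding minus_eq by (intro vgt_add) (auto simp: vgt_neg)

lemma vge_mult: "x \<in> carrier R \<Longrightarrow> y \<in> carrier R \<Longrightarrow> vge x r \<Longrightarrow> vge y s \<Longrightarrow> vge (x \<otimes> y) (r + s)"
  unfolding vge_def using w_mult[of x y] by (cases "x = \<zero> \<or> y = \<zero>") auto
lemma vgt_mult: "x \<in> carrier R \<Longrightarrow> y \<in> carrier R \<Longrightarrow> vgt x r \<Longrightarrow> vge y s \<Longrightarrow> vgt (x \<otimes> y) (r + s)"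
  unfolding vge_def vgt_def using w_mult[of x y] by (cases "x = \<zero> \<or> y = \<zero>") auto

lemma vge_one: "vge \<one> 0" by (simp add: vge_def w_one)

lemma vge_pow: "x \<in> carrier R \<Longrightarrow> vge x r \<Longrightarrow> vge (x [^] (n::nat)) (real n * r)"
proof (induction n)
  case (Suc n)
  then have "vge (x [^] n \<otimes> x) (real n * r + r)" by (intro vge_mult) auto
  then show ?case by (simp add: algebra_simps)
qed (simp add: vge_one)

lemma vge_pow_nonneg: "x \<in> carrier R \<Longrightarrow> vge x 0 \<Longrightarrow> vge (x [^] (n::nat)) 0"
  using vge_pow[of x 0 n] by simp

lemma vge_finsum: "finite A \<Longrightarrow> (\<And>i. i \<in> A \<Longrightarrow> f i \<in> carrier R) \<Longrightarrow> (\<And>i. i \<in> A \<Longrightarrow> vge (f i) r) \<Longrightarrow> vge (finsum R f A) r"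
  by (induction A rule: finite_induct) (auto simp: Pi_def intro!: vge_add finsum_closed)
lemma vgt_finsum: "finite A \<Longrightarrow> (\<And>i. i \<in> A \<Longrightarrow> f i \<in> carrier R) \<Longrightarrow> (\<And>i. i \<in> A \<Longrightarrow> vgt (f i) r) \<Longrightarrow> vgt (finsum R f A) r"
  by (induction A rule: finite_induct) (auto simp: Pi_def intro!: vgt_add finsum_closed)

lemma vge_add_pow_nat: "x \<in> carrier R \<Longrightarrow> vge x r \<Longrightarrow> vge (add_pow R (n::nat) x) r"
  by (induction n) (auto simp: add.nat_pow_Suc intro!: vge_add)

lemma vge_add_pow_int: assumes "x \<in> carrier R" "vge x r" shows "vge (add_pow R (c::int) x) r"
proof (cases "c \<ge> 0")
  case True
  then have "add_pow R c x = add_pow R (nat c) x"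
    by (metis add_pow_int_ge)
  then show ?thesis using vge_add_pow_nat[OF assms] by simp
next
  case False
  then have "add_pow R c x = \<ominus> add_pow R (nat (- c)) x"
    by (intro add_pow_int_lt) auto
  then show ?thesis using vge_add_pow_nat[OF assms] assms by (simp add: vge_neg)
qed

lemma w_close:
  assumes "x \<in> carrier R" "y \<in> carrier R" "y \<noteq> \<zero>" "vgt (x \<ominus> y) (w y)"
  shows "x \<noteq> \<zero> \<and> w x = w y"
proof -
  have x: "x = (x \<ominus> y) \<oplus> y" using assms by (simp add: minus_eq a_assoc l_neg)
  have nz: "x \<noteq> \<zero>"
  proof
    assume "x = \<zero>"
    then have "vgt (\<ominus> y) (w y)" using assms by (simp add: minus_eq)
    then show False using assms by (auto simp: vgt_neg vgt_def)
  qed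
  have "vge ((x \<ominus> y) \<oplus> y) (w y)"
    by (intro vge_add vgt_imp_vge[OF assms(4)] assms minus_closed) (simp add: vge_def)
  then have "w y \<le> w x" using x nz by (simp add: vge_def)
  moreover have "w x \<le> w y"
  proof (rule ccontr)
    assume "\<not> w x \<le> w y"
    then have "vgt x (w y)" by (simp add: vgt_def)
    then have "vgt (x \<ominus> (x \<ominus> y)) (w y)" by (intro vgt_diff assms minus_closed)
    moreover have "x \<ominus> (x \<ominus> y) = y" using assms by (simp add: minus_eq minus_add a_assoc[symmetric] r_neg)
    ultimately show False using assms by (simp add: vgt_def)
  qed
  ultimately show ?thesis using nz by simp
qed

lemma mval_vge:
  assumes "\<And>i. \<rho> i \<in> carrier R" "\<And>i. i \<in> set xs \<Longrightarrow> vge (\<rho> i) (b i)"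
  shows "vge (mval R \<rho> xs) (\<Sum>i\<leftarrow>xs. b i)"
  using assms(2) by (induction xs) (auto intro!: vge_one vge_mult assms(1))

text \<open>If every variable has value at least \<open>- c\<close> times its weight, a monomial of
  weight \<open>W\<close> has value at least \<open>- c * W\<close>, each \<open>Y\<close> in it
  adds \<open>g\<close>, and integer coefficients do not lower values. Bounds are asked only for
  variables of weight at most \<open>W\<close>, as no other fits into such a monomial.\<close>

lemma peval_graded_vge:
  assumes gr: "graded p e W d" and p: "p > 0" and \<rho>: "\<And>i. \<rho> i \<in> carrier R" and g: "g \<ge> 0"
    and bd: "\<And>i. p ^ (i div 2) \<le> W \<Longrightarrow> vge (\<rho> i) (- c * real (p ^ (i div 2)) + (if odd i then g else 0))"
  shows "vge (peval R \<rho> e) (- c * real W + real d * g)"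
proof -
  let ?P = "\<lambda>(a::int, xs). mweight p (mset xs) = W \<and> d \<le> mydeg (mset xs)"
  let ?P' = "\<lambda>m. mweight p m = W \<and> d \<le> mydeg m"
  \<comment> \<open>\<open>graded\<close> speaks of collected coefficients. The term list may still
    contain monomials of other type, which cancel among themselves and are discarded here as one
    vanishing sum.\<close>
  have "tcoef (filter (\<lambda>t. \<not> ?P t) (terms e)) m = 0" for m
    using tcoef_filter[of "\<lambda>t. \<not> ?P t" "\<lambda>m. \<not> ?P' m" "terms e" m] gr
    unfolding graded_def by auto
  then have "tsum R \<rho> (filter (\<lambda>t. \<not> ?P t) (terms e)) = \<zero>"
    by (intro tsum_zero \<rho>)
  then have eq: "peval R \<rho> e = tsum R \<rho> (filter ?P (terms e))"
    using tsum_filter[of \<rho> "terms e" ?P] \<rho> by (simp add: peval_eq_tsum)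
  have trm: "vge (mval R \<rho> xs) (- c * real W + real d * g)" if xs: "?P' (mset xs)" for xs
  proof -
    have le: "p ^ (i div 2) \<le> W" if "i \<in> set xs" for i
    proof -
      have "i \<in># mset xs" using that by simp
      then obtain m' where "mset xs = add_mset i m'" by (meson multi_member_split)
      then show ?thesis using xs by (simp add: mweight_def)
    qed
    have "vge (mval R \<rho> xs) (\<Sum>i\<leftarrow>xs. - c * real (p ^ (i div 2)) + (if odd i then g else 0))"
      by (rule mval_vge[OF \<rho>]) (use bd le in auto)
    moreover have "(\<Sum>i\<leftarrow>xs. - c * real (p ^ (i div 2)) + (if odd i then g else 0)) = - c * real (mweight p (mset xs)) + g * real (mydeg (mset xs))"
      by (induction xs) (auto simp: mweight_def mydeg_def algebra_simps)
    moreover have "real d * g \<le> g * real (mydeg (mset xs))"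
      using xs g by (metis mult.commute mult_left_mono of_nat_le_iff)
    ultimately show ?thesis using xs by (auto elim: vge_mono)
  qed
  have "vge (tsum R \<rho> T) (- c * real W + real d * g)" if "\<And>t. t \<in> set T \<Longrightarrow> ?P t" for T
    using that
  proof (induction T)
    case (Cons t T)
    obtain a xs where t: "t = (a, xs)" by (cases t)
    have "?P' (mset xs)" using Cons.prems[of t] t by auto
    then show ?case unfolding t tsum.simps
      by (intro vge_add vge_add_pow_int trm Cons.IH) (use Cons.prems \<rho> in auto)
  qed simp
  from this[of "filter ?P (terms e)"] show ?thesis unfolding eq by simp
qed

end

section \<open>Witt addition over commutative rings\<close>

definition wS :: "('a, 'c) ring_scheme \<Rightarrow> nat \<Rightarrow> (nat \<Rightarrow> 'a) \<Rightarrow> (nat \<Rightarrow> 'a) \<Rightarrow> nat \<Rightarrow> 'a" where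
  "wS R p x y k = peval R (interl x y) (witt_S p k)"

lemma interl_closed [simp, intro]: "(\<And>i. x i \<in> A) \<Longrightarrow> (\<And>i. y i \<in> A) \<Longrightarrow> interl x y i \<in> A"
  by (simp add: interl_def)

lemma interl_fun: "(\<lambda>i. f (interl x y i)) = interl (\<lambda>i. f (x i)) (\<lambda>i. f (y i))"
  by (auto simp: interl_def fun_eq_iff)

context cring begin

context
  fixes p :: nat
  assumes p: "Factorial_Ring.prime p"
begin

lemma wS_closed [simp, intro]: "(\<And>i. x i \<in> carrier R) \<Longrightarrow> (\<And>i. y i \<in> carrier R) \<Longrightarrow> wS R p x y k \<in> carrier R"
  unfolding wS_def by (intro peval_closed interl_closed)

text \<open>Both bracketings have the sum of the three ghost vectors as ghost, so they agree as
  polynomials.\<close>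

lemma wS_assoc:
  assumes "\<And>i. x i \<in> carrier R" "\<And>i. y i \<in> carrier R" "\<And>i. z i \<in> carrier R"
  shows "wS R p (wS R p x y) z k = wS R p x (wS R p y z) k"
proof -
  \<comment> \<open>The three vectors are interleaved modulo three, so that associativity becomes an
    identity in a single family of variables.\<close>
  define \<rho> where "\<rho> j = (if j mod 3 = 0 then x (j div 3) else if j mod 3 = 1 then y (j div 3) else z (j div 3))" for j
  define A B C where "A j = Var (3 * j)" and "B j = Var (3 * j + 1)" and "C j = Var (3 * j + 2)" for j
  define S2 where "S2 f g k = psubst (interl f g) (witt_S p k)" for f g k
  have ev: "eval_int \<sigma> (S2 f g k) = eval_int (interl (\<lambda>i. eval_int \<sigma> (f i)) (\<lambda>i. eval_int \<sigma> (g i))) (witt_S p k)" for \<sigma> f g k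
    by (simp add: S2_def interl_fun)
  have pe: "peval R \<sigma> (S2 f g k) = wS R p (\<lambda>i. peval R \<sigma> (f i)) (\<lambda>i. peval R \<sigma> (g i)) k" for \<sigma> f g k
    by (simp add: S2_def interl_fun wS_def)
  have "peval R \<rho> (S2 (S2 A B) C k) = peval R \<rho> (S2 A (S2 B C) k)"
  proof (rule peval_cong_int)
    show "\<rho> i \<in> carrier R" for i using assms by (simp add: \<rho>_def)
    show "eval_int \<sigma> (S2 (S2 A B) C k) = eval_int \<sigma> (S2 A (S2 B C) k)" for \<sigma>
      unfolding ev[of _ "S2 A B"]
      by (rule eval_witt_S_eqI[OF p]) (simp add: ev ghost_witt_S[OF p])
  qed
  moreover have "\<rho> (3 * j) = x j" "\<rho> (3 * j + 1) = y j" "\<rho> (3 * j + 2) = z j" for j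
  proof -
    have "(3 * j + 1) mod 3 = 1" "(3 * j + 2) mod 3 = 2" "(3 * j + 1) div 3 = j" "(3 * j + 2) div 3 = j" by presburger+
    then show "\<rho> (3 * j) = x j" "\<rho> (3 * j + 1) = y j" "\<rho> (3 * j + 2) = z j" by (simp_all add: \<rho>_def)
  qed
  ultimately show ?thesis unfolding pe by (simp add: pe A_def B_def C_def)
qed

lemma wS_comm:
  assumes "\<And>i. x i \<in> carrier R" "\<And>i. y i \<in> carrier R"
  shows "wS R p x y k = wS R p y x k"
proof -
  let ?s = "interl (\<lambda>j. Var (2 * j + 1)) (\<lambda>j. Var (2 * j))"
  have "peval R (interl x y) (witt_S p k) = peval R (interl x y) (psubst ?s (witt_S p k))"
  proof (rule peval_cong_int)
    show "interl x y i \<in> carrier R" for i using assms by simp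
    show "eval_int \<sigma> (witt_S p k) = eval_int \<sigma> (psubst ?s (witt_S p k))" for \<sigma>
    proof -
      have "eval_int (interl (\<lambda>j. \<sigma> (2 * j)) (\<lambda>j. \<sigma> (2 * j + 1))) (witt_S p k) = eval_int (interl (\<lambda>j. \<sigma> (2 * j + 1)) (\<lambda>j. \<sigma> (2 * j))) (witt_S p k)"
        by (rule eval_witt_S_eqI[OF p]) (simp add: ghost_witt_S[OF p])
      then show ?thesis using interl_split[of \<sigma>] by (simp add: interl_fun)
    qed
  qed
  also have "\<dots> = wS R p y x k" by (simp add: interl_fun wS_def) (simp add: interl_def[abs_def])
  finally show ?thesis by (simp add: wS_def)
qed

text \<open>With disjoint supports each summand of a ghost component sees only one nonzero entry, so
  componentwise addition already adds the ghosts. This splits a Witt vector by components without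
  any carry.\<close>

lemma wS_eq_add:
  assumes "\<And>i. x i \<in> carrier R" "\<And>i. y i \<in> carrier R"
    and "\<And>i. x i = \<zero> \<or> y i = \<zero>"
  shows "wS R p x y k = x k \<oplus> y k"
proof -
  \<comment> \<open>\<open>H\<close> turns the hypothesis on values into a substitution: in each
    index one of the two variables is replaced by \<open>PZero\<close>, and the claim becomes a
    polynomial identity.\<close>
  define H where "H = {i. y i = \<zero>}"
  let ?s = "interl (\<lambda>j. if j \<in> H then Var (2 * j) else PZero) (\<lambda>j. if j \<in> H then PZero else Var (2 * j + 1))"
  have "peval R (interl x y) (psubst ?s (witt_S p k)) = peval R (interl x y) (if k \<in> H then Var (2 * k) else Var (2 * k + 1))"
  proof (rule peval_cong_int)
    show "interl x y i \<in> carrier R" for i using assms by simp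
    show "eval_int \<sigma> (psubst ?s (witt_S p k)) = eval_int \<sigma> (if k \<in> H then Var (2 * k) else Var (2 * k + 1))" for \<sigma>
      unfolding eval_int_psubst interl_fun
    proof (rule eval_witt_S_eqI[OF p])
      have "p > 0" using p prime_gt_0_nat by blast
      show "ghost p k (\<lambda>k. eval_int \<sigma> (if k \<in> H then Var (2 * k) else Var (2 * k + 1))) =
         ghost p k (\<lambda>i. eval_int \<sigma> (if i \<in> H then Var (2 * i) else PZero)) +
         ghost p k (\<lambda>i. eval_int \<sigma> (if i \<in> H then PZero else Var (2 * i + 1)))" for k
        unfolding ghost_def sum.distrib[symmetric] using \<open>p > 0\<close> by (intro sum.cong) (auto simp: zero_power)
    qed
  qed
  moreover have "peval R (interl x y) (psubst ?s (witt_S p k)) = wS R p x y k"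
    unfolding peval_psubst interl_fun wS_def
  proof (rule arg_cong[of _ _ "\<lambda>\<rho>. peval R \<rho> (witt_S p k)"])
    show "interl (\<lambda>i. peval R (interl x y) (if i \<in> H then Var (2 * i) else PZero))
            (\<lambda>i. peval R (interl x y) (if i \<in> H then PZero else Var (2 * i + 1))) = interl x y"
      using assms(3) by (simp add: interl_def fun_eq_iff H_def) metis
  qed
  moreover have "peval R (interl x y) (if k \<in> H then Var (2 * k) else Var (2 * k + 1)) = x k \<oplus> y k"
    using assms(3)[of k] assms(1,2) by (auto simp: interl_def H_def)
  ultimately show ?thesis by simp
qed

lemma wS_zero_right: "(\<And>i. x i \<in> carrier R) \<Longrightarrow> wS R p x (\<lambda>_. \<zero>) k = x k"
  by (subst wS_eq_add) auto

lemma wS_eq_P: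
  assumes "\<And>i. x i \<in> carrier R" "\<And>i. y i \<in> carrier R"
  shows "wS R p x y k = x k \<oplus> y k \<oplus> peval R (interl x y) (witt_P p k)"
proof -
  have "wS R p x y k \<in> carrier R" using assms by simp
  then have "wS R p x y k = x k \<oplus> y k \<oplus> (wS R p x y k \<oplus> \<ominus> (x k \<oplus> y k))"
    using assms by (simp add: a_comm[of "wS R p x y k"] a_assoc[symmetric, of "x k \<oplus> y k"] r_neg)
  then show ?thesis by (simp add: witt_P_def wS_def interl_def)
qed

lemma peval_witt_P_trunc:
  assumes "\<And>i. x i \<in> carrier R" "\<And>i. y i \<in> carrier R"
  shows "peval R (interl x y) (witt_P p k) = peval R (interl (trunc_at \<zero> k x) (trunc_at \<zero> k y)) (witt_P p k)"
proof -
  let ?s = "interl (trunc_at PZero k (\<lambda>j. Var (2 * j))) (trunc_at PZero k (\<lambda>j. Var (2 * j + 1)))"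
  have "peval R (interl x y) (witt_P p k) = peval R (interl x y) (psubst ?s (witt_P p k))"
  proof (rule peval_cong_int)
    show "interl x y i \<in> carrier R" for i using assms by simp
    show "eval_int \<sigma> (witt_P p k) = eval_int \<sigma> (psubst ?s (witt_P p k))" for \<sigma>
    proof -
      have *: "(\<lambda>i. eval_int \<sigma> (trunc_at PZero k f i)) = trunc_at 0 k (\<lambda>j. eval_int \<sigma> (f j))" for f
        by (auto simp: trunc_at_def fun_eq_iff)
      show ?thesis unfolding eval_int_psubst interl_fun *
        using eval_witt_P_trunc[OF p, of "\<lambda>j. \<sigma> (2 * j)" "\<lambda>j. \<sigma> (2 * j + 1)" k] interl_split[of \<sigma>] by simp
    qed
  qed
  also have "\<dots> = peval R (interl (trunc_at \<zero> k x) (trunc_at \<zero> k y)) (witt_P p k)"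
  proof -
    have *: "(\<lambda>i. peval R \<sigma> (trunc_at PZero k f i)) = trunc_at \<zero> k (\<lambda>j. peval R \<sigma> (f j))" for f \<sigma>
      by (auto simp: trunc_at_def fun_eq_iff)
    show ?thesis unfolding peval_psubst interl_fun * by (simp add: interl_def)
  qed
  finally show ?thesis .
qed

lemma wS_cong_le:
  assumes "\<And>i. x i \<in> carrier R" "\<And>i. y i \<in> carrier R" "\<And>i. x' i \<in> carrier R" "\<And>i. y' i \<in> carrier R"
    and "\<And>i. i \<le> k \<Longrightarrow> x i = x' i" "\<And>i. i \<le> k \<Longrightarrow> y i = y' i"
  shows "wS R p x y k = wS R p x' y' k"
proof -
  have "trunc_at \<zero> k x = trunc_at \<zero> k x'" "trunc_at \<zero> k y = trunc_at \<zero> k y'"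
    using assms(5,6) by (auto simp: trunc_at_def fun_eq_iff)
  then show ?thesis
    using assms by (simp add: wS_eq_P peval_witt_P_trunc[of x y] peval_witt_P_trunc[of x' y'])
qed

lemma peval_frobenius:
  assumes ch: "add_pow R p \<one> = \<zero>" and \<rho>: "\<And>i. \<rho> i \<in> carrier R"
  shows "peval R (\<lambda>i. \<rho> i [^] p) e = peval R \<rho> e [^] p"
proof -
  obtain h where h: "polfun h" "\<And>\<rho>. eval_int \<rho> e ^ p = eval_int (\<lambda>i. \<rho> i ^ p) e + int p * h \<rho>"
    using pol_cong_frobenius_eval[OF p, of e] unfolding pol_cong_def by auto
  obtain f where f: "\<And>\<rho>. h \<rho> = eval_int \<rho> f" using h(1) unfolding polfun_def by auto
  have "peval R \<rho> (ppow e p) = peval R \<rho> (psubst (\<lambda>i. ppow (Var i) p) e)"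
    by (rule peval_cong_int_mod[OF \<rho> ch, where e'' = f]) (simp add: h f)
  then show ?thesis using \<rho> by simp
qed

lemma frobenius_add:
  assumes ch: "add_pow R p \<one> = \<zero>" and "x \<in> carrier R" "y \<in> carrier R"
  shows "(x \<oplus> y) [^] p = x [^] p \<oplus> y [^] p"
  using peval_frobenius[OF ch, of "\<lambda>i. if i = 0 then x else y" "PAdd (Var 0) (Var 1)"] assms(2,3) by simp

lemma wS_frobenius:
  assumes ch: "add_pow R p \<one> = \<zero>" and "\<And>i. x i \<in> carrier R" "\<And>i. y i \<in> carrier R"
  shows "wS R p (\<lambda>i. x i [^] p) (\<lambda>i. y i [^] p) k = wS R p x y k [^] p"
  unfolding wS_def interl_fun[symmetric, of "\<lambda>a. a [^] p" x y]
  by (rule peval_frobenius[OF ch]) (use assms in simp)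

lemma peval_witt_Q:
  assumes "\<And>i. x i \<in> carrier R" "\<And>i. y i \<in> carrier R"
  shows "peval R (interl x y) (witt_Q p N) =
    (\<Oplus>l\<in>{..<Suc N}. x l [^] (p ^ (N - l) - 1) \<otimes> (wS R p x y l \<ominus> x l)) \<ominus> y N"
  using assms unfolding witt_Q_def
  by (simp del: psum.simps add: minus_eq wS_def interl_def)

end

end

section \<open>The filtrations\<close>

locale char_dvf = field R for R (structure) +
  fixes v :: "'a \<Rightarrow> int" and p n :: nat
  assumes dvf: "dvf R v" and char_p: "char_p R p"

sublocale char_dvf \<subseteq> valued_field R "\<lambda>x. real_of_int (v x)"
proof unfold_locales
  fix x y assume *: "x \<in> carrier R" "y \<in> carrier R" "x \<noteq> \<zero>" "y \<noteq> \<zero>"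
  with dvf have "v (x \<otimes> y) = v x + v y" unfolding dvf_def by auto
  then show "real_of_int (v (x \<otimes> y)) = real_of_int (v x) + real_of_int (v y)" by simp
next
  fix x y assume *: "x \<in> carrier R" "y \<in> carrier R" "x \<noteq> \<zero>" "y \<noteq> \<zero>" "x \<oplus> y \<noteq> \<zero>"
  with dvf have "min (v x) (v y) \<le> v (x \<oplus> y)" unfolding dvf_def by auto
  then show "min (real_of_int (v x)) (real_of_int (v y)) \<le> real_of_int (v (x \<oplus> y))" by linarith
qed

context char_dvf begin

lemma prime_p: "Factorial_Ring.prime p" and add_pow_p: "add_pow R p \<one> = \<zero>"
  using char_p by (auto simp: char_p_def)

lemma p_pos: "p > 0" and p_ge2: "p \<ge> 2"
  using prime_gt_0_nat[OF prime_p] prime_ge_2_nat[OF prime_p] by auto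

abbreviation W where "W \<equiv> witt_carrier R n"
abbreviation wadd (infixl \<open>\<boxplus>\<close> 65) where "x \<boxplus> y \<equiv> witt_add R p n x y"
abbreviation F where "F \<equiv> witt_F R p"

lemma W_closed: "x \<in> W \<Longrightarrow> x i \<in> carrier R"
  unfolding witt_carrier_def by (cases "i < n") auto

lemma W_zero: "x \<in> W \<Longrightarrow> n \<le> i \<Longrightarrow> x i = \<zero>"
  unfolding witt_carrier_def by auto

lemma W_eqI: "x \<in> W \<Longrightarrow> y \<in> W \<Longrightarrow> (\<And>k. k < n \<Longrightarrow> x k = y k) \<Longrightarrow> x = y"
  by (rule ext) (metis W_zero not_less)

lemma wadd_nth: "k < n \<Longrightarrow> (x \<boxplus> y) k = wS R p x y k"
  by (simp add: witt_add_def wS_def)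

lemma wadd_closed [simp]: "x \<in> W \<Longrightarrow> y \<in> W \<Longrightarrow> x \<boxplus> y \<in> W"
  using wS_closed[OF prime_p, of x y] W_closed[of x] W_closed[of y]
  unfolding witt_carrier_def[of R n] by (simp add: witt_add_def wS_def)

lemma wzero_closed [simp]: "witt_zero R \<in> W"
  by (simp add: witt_zero_def witt_carrier_def)

lemma wadd_comm: "x \<in> W \<Longrightarrow> y \<in> W \<Longrightarrow> x \<boxplus> y = y \<boxplus> x"
  by (rule W_eqI) (auto simp: wadd_nth W_closed intro!: wS_comm[OF prime_p])

lemma wadd_assoc:
  assumes "x \<in> W" "y \<in> W" "z \<in> W" shows "(x \<boxplus> y) \<boxplus> z = x \<boxplus> (y \<boxplus> z)"
proof (rule W_eqI)
  fix k assume k: "k < n"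
  note c = W_closed[OF assms(1)] W_closed[OF assms(2)] W_closed[OF assms(3)]
  have "((x \<boxplus> y) \<boxplus> z) k = wS R p (wS R p x y) z k"
    unfolding wadd_nth[OF k]
    by (rule wS_cong_le[OF prime_p]) (use k assms c W_closed[of "x \<boxplus> y"] in \<open>auto simp: wadd_nth wS_closed[OF prime_p]\<close>)
  also have "\<dots> = wS R p x (wS R p y z) k" by (rule wS_assoc[OF prime_p]) (use c in auto)
  also have "\<dots> = (x \<boxplus> (y \<boxplus> z)) k"
    unfolding wadd_nth[OF k]
    by (rule wS_cong_le[OF prime_p]) (use k assms c W_closed[of "y \<boxplus> z"] in \<open>auto simp: wadd_nth wS_closed[OF prime_p]\<close>)
  finally show "((x \<boxplus> y) \<boxplus> z) k = (x \<boxplus> (y \<boxplus> z)) k" .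
qed (use assms in auto)

lemma wadd_lcomm: "x \<in> W \<Longrightarrow> y \<in> W \<Longrightarrow> z \<in> W \<Longrightarrow> x \<boxplus> (y \<boxplus> z) = y \<boxplus> (x \<boxplus> z)"
  using wadd_assoc[of x y z] wadd_assoc[of y x z] wadd_comm[of x y] by simp

lemma wadd_zero [simp]: "x \<in> W \<Longrightarrow> x \<boxplus> witt_zero R = x"
  by (rule W_eqI) (auto simp: wadd_nth witt_zero_def W_closed intro!: wS_zero_right[OF prime_p] wadd_closed[unfolded witt_zero_def] wzero_closed[unfolded witt_zero_def])

lemma wadd_zero_left [simp]: "x \<in> W \<Longrightarrow> witt_zero R \<boxplus> x = x"
  using wadd_comm[of x "witt_zero R"] by simp

text \<open>Subtraction without negation polynomials: the carry into component \<open>m\<close>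
  involves only earlier components, so \<open>t \<boxplus> z = x\<close> can be solved for
  \<open>z m\<close> one index at a time.\<close>

lemma wdiff_exists:
  assumes "x \<in> W" "t \<in> W" shows "\<exists>z\<in>W. t \<boxplus> z = x"
proof -
  note c = W_closed[OF assms(1)] W_closed[OF assms(2)]
  have "\<exists>z. (\<forall>i. z i \<in> carrier R) \<and> (\<forall>i\<ge>m. z i = \<zero>) \<and> (\<forall>k<m. wS R p t z k = x k)" for m
  proof (induction m)
    case 0
    show ?case by (rule exI[of _ "\<lambda>_. \<zero>"]) auto
  next
    case (Suc m)
    then obtain z where z: "\<And>i. z i \<in> carrier R" "\<And>i. i \<ge> m \<Longrightarrow> z i = \<zero>" "\<And>k. k < m \<Longrightarrow> wS R p t z k = x k" by blast
    let ?P = "peval R (interl t z) (witt_P p m)"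
    let ?z = "z(m := x m \<ominus> (t m \<oplus> ?P))"
    have P: "?P \<in> carrier R" using z(1) c by (intro peval_closed interl_closed) auto
    have z': "?z i \<in> carrier R" for i using z(1) c P by simp
    have "wS R p t ?z k = x k" if "k < Suc m" for k
    proof (cases "k = m")
      case False
      then have "wS R p t ?z k = wS R p t z k" using that z(1) z' c
        by (intro wS_cong_le[OF prime_p]) auto
      with False that z(3) show ?thesis by simp
    next
      case True
      have tr: "trunc_at \<zero> m ?z = trunc_at \<zero> m z" by (auto simp: trunc_at_def fun_eq_iff)
      have "peval R (interl t ?z) (witt_P p m) = ?P"
        using peval_witt_P_trunc[OF prime_p, of t ?z m] peval_witt_P_trunc[OF prime_p, of t z m] z' z(1) c tr by simp
      then have "wS R p t ?z m = t m \<oplus> (x m \<ominus> (t m \<oplus> ?P)) \<oplus> ?P"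
        using wS_eq_P[OF prime_p, of t ?z m] z' c by simp
      also have "\<dots> = x m" using c P
        by (simp add: minus_eq minus_add a_ac r_neg r_neg1 r_neg2) (simp add: a_lcomm[of "t m" "x m"] r_neg)
      finally show ?thesis using True by simp
    qed
    with z(2) z' show ?case by (intro exI[of _ ?z] conjI allI impI) (auto simp del: fun_upd_apply simp: fun_upd_other)
  qed
  from this[of n] obtain z where z: "\<And>i. z i \<in> carrier R" "\<And>i. i \<ge> n \<Longrightarrow> z i = \<zero>" "\<And>k. k < n \<Longrightarrow> wS R p t z k = x k" by blast
  then have "z \<in> W" by (simp add: witt_carrier_def)
  with z(3) assms show ?thesis by (intro bexI[of _ z] W_eqI) (auto simp: wadd_nth)
qed

definition wdiff where "wdiff x t = (SOME z. z \<in> W \<and> t \<boxplus> z = x)"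

lemma wdiff: assumes "x \<in> W" "t \<in> W" shows "wdiff x t \<in> W" "t \<boxplus> wdiff x t = x"
  using someI_ex[of "\<lambda>z. z \<in> W \<and> t \<boxplus> z = x"] wdiff_exists[OF assms] unfolding wdiff_def by auto

lemma wadd_cancel: assumes "a \<in> W" "b \<in> W" "c \<in> W" "a \<boxplus> b = a \<boxplus> c" shows "b = c"
proof -
  let ?n = "wdiff (witt_zero R) a"
  have n: "?n \<in> W" "a \<boxplus> ?n = witt_zero R" using wdiff[OF wzero_closed assms(1)] by auto
  have *: "?n \<boxplus> (a \<boxplus> d) = d" if "d \<in> W" for d
    using wadd_assoc[OF n(1) assms(1) that] wadd_comm[OF n(1) assms(1)] n(2) that by simp
  have "?n \<boxplus> (a \<boxplus> c) = b" using *[OF assms(2)] unfolding assms(4) .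
  then show ?thesis unfolding *[OF assms(3)] by (rule sym)
qed

lemma F_closed [simp]: "x \<in> W \<Longrightarrow> F x \<in> W"
  using p_pos by (auto simp: witt_carrier_def witt_F_def nat_pow_zero)

lemma F_wadd: assumes "x \<in> W" "y \<in> W" shows "F (x \<boxplus> y) = F x \<boxplus> F y"
proof (rule W_eqI)
  fix k assume k: "k < n"
  have "F (x \<boxplus> y) k = wS R p x y k [^] p" by (simp add: witt_F_def wadd_nth[OF k])
  also have "\<dots> = wS R p (\<lambda>i. x i [^] p) (\<lambda>i. y i [^] p) k"
    using wS_frobenius[OF prime_p add_pow_p, of x y k] W_closed[OF assms(1)] W_closed[OF assms(2)] by simp
  finally show "F (x \<boxplus> y) k = (F x \<boxplus> F y) k" by (simp add: wadd_nth[OF k] witt_F_def)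
qed (use assms in auto)

lemma F_zero [simp]: "F (witt_zero R) = witt_zero R"
  using p_pos by (auto simp: witt_F_def witt_zero_def fun_eq_iff nat_pow_zero)

lemma wadd_disjoint:
  assumes "x \<in> W" "y \<in> W" "\<And>k. x k = \<zero> \<or> y k = \<zero>" "k < n"
  shows "(x \<boxplus> y) k = x k \<oplus> y k"
  unfolding wadd_nth[OF assms(4)] by (rule wS_eq_add[OF prime_p]) (use assms W_closed[OF assms(1)] W_closed[OF assms(2)] in auto)

lemma wadd_P:
  assumes "x \<in> W" "y \<in> W" "k < n"
  shows "(x \<boxplus> y) k = x k \<oplus> (y k \<oplus> peval R (interl (trunc_at \<zero> k x) (trunc_at \<zero> k y)) (witt_P p k))"
    and "peval R (interl (trunc_at \<zero> k x) (trunc_at \<zero> k y)) (witt_P p k) \<in> carrier R"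
proof -
  show *: "peval R (interl (trunc_at \<zero> k x) (trunc_at \<zero> k y)) (witt_P p k) \<in> carrier R"
    using W_closed[OF assms(1)] W_closed[OF assms(2)] by (intro peval_closed interl_closed) (auto simp: trunc_at_def)
  show "(x \<boxplus> y) k = x k \<oplus> (y k \<oplus> peval R (interl (trunc_at \<zero> k x) (trunc_at \<zero> k y)) (witt_P p k))"
    using wS_eq_P[OF prime_p, of x y k] peval_witt_P_trunc[OF prime_p, of x y k] W_closed[OF assms(1)] W_closed[OF assms(2)] *
    by (simp add: wadd_nth[OF assms(3)] a_assoc)
qed

section \<open>First and second order estimates for Witt sums\<close>

lemma P_vge:
  assumes xy: "x \<in> W" "y \<in> W" and g: "g \<ge> 0"
    and x: "\<And>l. l < k \<Longrightarrow> vge (x l) (- c * real (p ^ l))"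
    and y: "\<And>l. l < k \<Longrightarrow> vge (y l) (- c * real (p ^ l) + g)"
  shows "vge (peval R (interl (trunc_at \<zero> k x) (trunc_at \<zero> k y)) (witt_P p k)) (- c * real (p ^ k) + g)"
proof -
  have "vge (peval R (interl (trunc_at \<zero> k x) (trunc_at \<zero> k y)) (witt_P p k)) (- c * real (p ^ k) + real 1 * g)"
  proof (rule peval_graded_vge[OF graded_witt_P[OF prime_p] p_pos _ g])
    show "interl (trunc_at \<zero> k x) (trunc_at \<zero> k y) i \<in> carrier R" for i
      using W_closed[OF xy(1)] W_closed[OF xy(2)] by (auto simp: trunc_at_def interl_def)
    show "vge (interl (trunc_at \<zero> k x) (trunc_at \<zero> k y) i) (- c * real (p ^ (i div 2)) + (if odd i then g else 0))" for i
      using x[of "i div 2"] y[of "i div 2"] by (auto simp: trunc_at_def interl_def)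
  qed
  then show ?thesis by simp
qed

lemma add_minus_cancel: "a \<in> carrier R \<Longrightarrow> b \<in> carrier R \<Longrightarrow> (a \<oplus> b) \<ominus> a = b"
  by (simp add: minus_eq a_comm[of a b] a_assoc r_neg)

text \<open>Every monomial of the carry contains some \<open>Y\<close>. If \<open>y\<close> lies
  beyond the common bound by \<open>g\<close> in all components, the carry does too, and so does the
  change of \<open>x\<close>.\<close>

lemma wadd_gain:
  assumes xy: "x \<in> W" "y \<in> W" "k < n" and g: "g \<ge> 0"
    and x: "\<And>l. l \<le> k \<Longrightarrow> vge (x l) (- c * real (p ^ l))"
    and y: "\<And>l. l \<le> k \<Longrightarrow> vge (y l) (- c * real (p ^ l) + g)"
  shows "vge ((x \<boxplus> y) k \<ominus> x k) (- c * real (p ^ k) + g)"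
proof -
  note P = wadd_P[OF xy]
  have "vge (y k \<oplus> peval R (interl (trunc_at \<zero> k x) (trunc_at \<zero> k y)) (witt_P p k)) (- c * real (p ^ k) + g)"
    by (intro vge_add P_vge[OF xy(1,2)] P(2)) (use x y g W_closed[OF xy(1)] W_closed[OF xy(2)] in auto)
  then show ?thesis unfolding P(1) using add_minus_cancel P(2) W_closed[OF xy(1)] W_closed[OF xy(2)] by simp
qed

text \<open>The component \<open>y k\<close> is the change minus the carry, and the carry uses only
  components of \<open>y\<close> that are already estimated.\<close>

lemma wadd_gain_conv:
  assumes xy: "x \<in> W" "y \<in> W" and g: "g \<ge> 0"
    and x: "\<And>l. l < n \<Longrightarrow> vge (x l) (- c * real (p ^ l))"
    and d: "\<And>l. l < n \<Longrightarrow> vge ((x \<boxplus> y) l \<ominus> x l) (- c * real (p ^ l) + g)"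
    and k: "k < n"
  shows "vge (y k) (- c * real (p ^ k) + g)"
  using k
proof (induction k rule: less_induct)
  case (less k)
  let ?P = "peval R (interl (trunc_at \<zero> k x) (trunc_at \<zero> k y)) (witt_P p k)"
  note P = wadd_P[OF xy less.prems]
  have "(x \<boxplus> y) k \<ominus> x k = ?P \<oplus> y k" unfolding P(1) using add_minus_cancel P(2) W_closed[OF xy(1)] W_closed[OF xy(2)] by (simp add: a_comm)
  then have "((x \<boxplus> y) k \<ominus> x k) \<ominus> ?P = y k" using P(2) W_closed[OF xy(1)] W_closed[OF xy(2)] by (simp add: add_minus_cancel)
  moreover have "vge (((x \<boxplus> y) k \<ominus> x k) \<ominus> ?P) (- c * real (p ^ k) + g)"
    by (intro vge_diff[OF _ _ d[OF less.prems] P_vge[OF xy(1,2) g]] P(2) minus_closed)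
      (use x less W_closed[OF xy(1)] W_closed[OF wadd_closed[OF xy(1,2)]] in auto)
  ultimately show ?case by simp
qed

text \<open>\<open>witt_Q\<close> is at least quadratic in \<open>Y\<close>, hence the doubled gain.
  It expresses the last component of a difference, up to second order, through the changes of all
  components.\<close>

lemma witt_Q_vge:
  assumes xy: "x \<in> W" "y \<in> W" and g: "g \<ge> 0" and n: "n = Suc N"
    and x: "\<And>l. l < n \<Longrightarrow> vge (x l) (- c * real (p ^ l))"
    and y: "\<And>l. l < n \<Longrightarrow> vge (y l) (- c * real (p ^ l) + g)"
  shows "vge ((\<Oplus>l\<in>{..<n}. x l [^] (p ^ (N - l) - 1) \<otimes> ((x \<boxplus> y) l \<ominus> x l)) \<ominus> y N) (- c * real (p ^ N) + 2 * g)"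
proof -
  have "vge (peval R (interl x y) (witt_Q p N)) (- c * real (p ^ N) + real 2 * g)"
  proof (rule peval_graded_vge[OF graded_witt_Q[OF prime_p] p_pos _ g])
    show "interl x y i \<in> carrier R" for i using W_closed[OF xy(1)] W_closed[OF xy(2)] by auto
    show "vge (interl x y i) (- c * real (p ^ (i div 2)) + (if odd i then g else 0))" for i
      using x[of "i div 2"] y[of "i div 2"] W_zero[OF xy(1), of "i div 2"] W_zero[OF xy(2), of "i div 2"]
      by (cases "i div 2 < n") (auto simp: interl_def)
  qed
  moreover have "peval R (interl x y) (witt_Q p N) = (\<Oplus>l\<in>{..<n}. x l [^] (p ^ (N - l) - 1) \<otimes> ((x \<boxplus> y) l \<ominus> x l)) \<ominus> y N"
    unfolding peval_witt_Q[OF prime_p W_closed[OF xy(1)] W_closed[OF xy(2)]] n[symmetric]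
    by (intro arg_cong2[where f = "\<lambda>a b. a \<ominus> b"] finsum_cong') (use W_closed[OF xy(1)] W_closed[OF xy(2)] W_closed[OF wadd_closed[OF xy(1,2)]] wS_closed[OF prime_p W_closed[OF xy(1)] W_closed[OF xy(2)]] in \<open>auto simp: wadd_nth\<close>)
  ultimately show ?thesis by simp
qed

section \<open>The filtration by pole order\<close>

abbreviation q where "q k \<equiv> p ^ (n - 1 - k)"

text \<open>Dividing \<open>- m \<le> q k * v (x k)\<close> by \<open>q k\<close> gives
  \<open>v (x k) \<ge> - bnd m * p ^ k\<close>. In this form the bound is proportional to the weight
  \<open>p ^ k\<close>, as the graded estimates require.\<close>

definition bnd :: "nat \<Rightarrow> real" where "bnd m = real m / real (p ^ (n - 1))"

lemma bnd_le_iff: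
  assumes "k < n"
  shows "- bnd m * real (p ^ k) \<le> real_of_int a \<longleftrightarrow> - int m \<le> int (q k) * a"
    and "- bnd m * real (p ^ k) < real_of_int a \<longleftrightarrow> - int m < int (q k) * a"
proof -
  have "q k * p ^ k = p ^ (n - 1)" using assms by (simp flip: power_add)
  then have N: "real (p ^ (n - 1)) = real (q k) * real (p ^ k)" by (metis of_nat_mult)
  have "real (q k) > 0" "real (p ^ k) > 0" using p_pos by auto
  then have "bnd m * real (p ^ k) = real m / real (q k)" unfolding bnd_def N by (simp del: of_nat_power)
  then have *: "- bnd m * real (p ^ k) = - (real m / real (q k))" by simp
  have "- bnd m * real (p ^ k) \<le> real_of_int a \<longleftrightarrow> - real m \<le> real (q k) * real_of_int a"
    unfolding * using \<open>real (q k) > 0\<close> by (simp add: field_simps del: of_nat_power)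
  also have "\<dots> \<longleftrightarrow> real_of_int (- int m) \<le> real_of_int (int (q k) * a)" by simp
  finally show "- bnd m * real (p ^ k) \<le> real_of_int a \<longleftrightarrow> - int m \<le> int (q k) * a" by linarith
  have "- bnd m * real (p ^ k) < real_of_int a \<longleftrightarrow> - real m < real (q k) * real_of_int a"
    unfolding * using \<open>real (q k) > 0\<close> by (simp add: field_simps del: of_nat_power)
  also have "\<dots> \<longleftrightarrow> real_of_int (- int m) < real_of_int (int (q k) * a)" by simp
  finally show "- bnd m * real (p ^ k) < real_of_int a \<longleftrightarrow> - int m < int (q k) * a" by linarith
qed

lemma fil_iff_int: "x \<in> fil R v p n m \<longleftrightarrow> x \<in> W \<and> (\<forall>k<n. x k = \<zero> \<or> - int m \<le> int (q k) * v (x k))"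
proof -
  have "(\<forall>j<n. x (n - 1 - j) = \<zero> \<or> int (p ^ j) * v (x (n - 1 - j)) \<ge> - int m) \<longleftrightarrow> (\<forall>k<n. x k = \<zero> \<or> - int m \<le> int (q k) * v (x k))"
    (is "?A \<longleftrightarrow> ?B")
  proof
    assume A: ?A
    show ?B
    proof (intro allI impI)
      fix k assume "k < n"
      then have "n - 1 - k < n" "n - 1 - (n - 1 - k) = k" by auto
      with A show "x k = \<zero> \<or> - int m \<le> int (q k) * v (x k)" by metis
    qed
  next
    assume B: ?B
    show ?A
    proof (intro allI impI)
      fix j assume "j < n"
      then have "n - 1 - j < n" "n - 1 - (n - 1 - j) = j" by auto
      with B show "x (n - 1 - j) = \<zero> \<or> - int m \<le> int (p ^ j) * v (x (n - 1 - j))" by metis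
    qed
  qed
  then show ?thesis unfolding fil_def by blast
qed

lemma fil_iff: "x \<in> fil R v p n m \<longleftrightarrow> x \<in> W \<and> (\<forall>k<n. vge (x k) (- bnd m * real (p ^ k)))"
  unfolding fil_iff_int vge_def using bnd_le_iff(1) by blast

lemma filD: "x \<in> fil R v p n m \<Longrightarrow> x \<in> W" by (simp add: fil_iff_int)

lemma fil_vge: "x \<in> fil R v p n m \<Longrightarrow> vge (x k) (- bnd m * real (p ^ k))"
  unfolding fil_iff using W_zero[of x k] by (cases "k < n") auto

lemma fil_mono: "m \<le> m' \<Longrightarrow> fil R v p n m \<subseteq> fil R v p n m'"
proof
  fix x assume "m \<le> m'" "x \<in> fil R v p n m"
  then show "x \<in> fil R v p n m'" unfolding fil_iff_int by fastforce
qed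

lemma fil_zero [simp]: "witt_zero R \<in> fil R v p n m"
  by (auto simp: fil_iff_int) (simp add: witt_zero_def)

lemma fil_add: assumes "x \<in> fil R v p n m" "y \<in> fil R v p n m" shows "x \<boxplus> y \<in> fil R v p n m"
proof -
  note W = filD[OF assms(1)] filD[OF assms(2)]
  have "vge ((x \<boxplus> y) k) (- bnd m * real (p ^ k))" if k: "k < n" for k
  proof -
    have "vge ((x \<boxplus> y) k \<ominus> x k) (- bnd m * real (p ^ k) + 0)"
      by (rule wadd_gain[OF W k]) (use fil_vge[OF assms(1)] fil_vge[OF assms(2)] in auto)
    then have "vge (((x \<boxplus> y) k \<ominus> x k) \<oplus> x k) (- bnd m * real (p ^ k))"
      using W_closed[OF W(1)] W_closed[OF W(2)] W_closed[OF wadd_closed[OF W]] fil_vge[OF assms(1)] by (intro vge_add) auto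
    moreover have "((x \<boxplus> y) k \<ominus> x k) \<oplus> x k = (x \<boxplus> y) k"
      using W_closed[OF wadd_closed[OF W]] W_closed[OF W(1)] by (simp add: minus_eq a_assoc l_neg)
    ultimately show ?thesis by simp
  qed
  then show ?thesis using W by (simp add: fil_iff)
qed

lemma fil_diff: assumes "x \<in> fil R v p n m" "t \<in> fil R v p n m" "z \<in> W" "t \<boxplus> z = x" shows "z \<in> fil R v p n m"
proof -
  note W = filD[OF assms(1)] filD[OF assms(2)]
  have "vge (z k) (- bnd m * real (p ^ k) + 0)" if k: "k < n" for k
  proof (rule wadd_gain_conv[OF W(2) assms(3) _ _ _ k])
    show "vge ((t \<boxplus> z) l \<ominus> t l) (- bnd m * real (p ^ l) + 0)" for l
      unfolding assms(4) using W_closed[OF W(1)] W_closed[OF W(2)] fil_vge[OF assms(1), of l] fil_vge[OF assms(2), of l] by (intro vge_diff) auto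
  qed (use fil_vge[OF assms(2)] in auto)
  then show ?thesis using assms(3) by (simp add: fil_iff)
qed

text \<open>Values are integers and the bound is a multiple of \<open>1 / p ^ (n - 1)\<close>, so a
  strict inequality wins at least that much. Strictness thereby becomes a gain to which
  \<open>wadd_gain\<close> applies.\<close>

lemma vgt_gain:
  assumes "k < n" "vgt y (- bnd m * real (p ^ k))"
  shows "vge y (- bnd m * real (p ^ k) + 1 / real (p ^ (n - 1)))"
proof (cases "y = \<zero>")
  case False
  let ?N = "real (p ^ (n - 1))"
  have N: "?N > 0" using p_pos by simp
  have "- bnd m * real (p ^ k) < real_of_int (v y)" using assms False by (simp add: vgt_def)
  then have "- real m * real (p ^ k) < ?N * real_of_int (v y)" using N
    unfolding bnd_def by (simp add: field_simps del: of_nat_power)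
  then have "- real m * real (p ^ k) + 1 \<le> ?N * real_of_int (v y)"
  proof -
    assume "- real m * real (p ^ k) < ?N * real_of_int (v y)"
    then have "real_of_int (- int m * int (p ^ k)) < real_of_int (int (p ^ (n - 1)) * v y)" by simp
    then have "- int m * int (p ^ k) < int (p ^ (n - 1)) * v y" by linarith
    then have "- int m * int (p ^ k) + 1 \<le> int (p ^ (n - 1)) * v y" by simp
    then have "real_of_int (- int m * int (p ^ k) + 1) \<le> real_of_int (int (p ^ (n - 1)) * v y)" by linarith
    then show ?thesis by simp
  qed
  then have "(- real m * real (p ^ k) + 1) / ?N \<le> ?N * real_of_int (v y) / ?N" using N
    by (intro divide_right_mono) auto
  then have "- bnd m * real (p ^ k) + 1 / ?N \<le> real_of_int (v y)" using N
    unfolding bnd_def using p_pos by (simp add: add_divide_distrib diff_divide_distrib del: of_nat_power)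
  then show ?thesis by (simp add: vge_def)
qed simp

lemma fil_pred_iff:
  assumes "m \<ge> 1"
  shows "x \<in> fil R v p n (m - 1) \<longleftrightarrow> x \<in> W \<and> (\<forall>k<n. vgt (x k) (- bnd m * real (p ^ k)))"
proof -
  have "- int (m - 1) \<le> a \<longleftrightarrow> - int m < a" for a using assms by linarith
  then show ?thesis unfolding fil_iff_int vgt_def using bnd_le_iff(2) by auto
qed

lemma wadd_strict:
  assumes "x \<in> fil R v p n m" "z \<in> fil R v p n (m - 1)" "m \<ge> 1" "k < n"
  shows "vgt ((x \<boxplus> z) k \<ominus> x k) (- bnd m * real (p ^ k))"
proof -
  have z: "vge (z l) (- bnd m * real (p ^ l) + 1 / real (p ^ (n - 1)))" if "l < n" for l
    using vgt_gain[OF that] assms(2) that unfolding fil_pred_iff[OF assms(3)] by blast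
  have "vge ((x \<boxplus> z) k \<ominus> x k) (- bnd m * real (p ^ k) + 1 / real (p ^ (n - 1)))"
    by (rule wadd_gain[OF filD filD assms(4)]) (use assms z fil_vge in auto)
  then show ?thesis by (rule vge_imp_vgt) (use p_pos in simp)
qed

lemma wadd_strict_conv:
  assumes "x \<in> fil R v p n m" "z \<in> W" "m \<ge> 1"
    and "\<And>k. k < n \<Longrightarrow> vgt ((x \<boxplus> z) k \<ominus> x k) (- bnd m * real (p ^ k))"
  shows "z \<in> fil R v p n (m - 1)"
  unfolding fil_pred_iff[OF assms(3)]
proof (intro conjI allI impI)
  fix k assume k: "k < n"
  have "vge (z k) (- bnd m * real (p ^ k) + 1 / real (p ^ (n - 1)))"
    by (rule wadd_gain_conv[OF filD[OF assms(1)] assms(2) _ _ _ k]) (use vgt_gain assms(4) fil_vge[OF assms(1)] in auto)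
  then show "vgt (z k) (- bnd m * real (p ^ k))" by (rule vge_imp_vgt) (use p_pos in simp)
qed (fact assms(2))

lemma v_pow: "x \<in> carrier R \<Longrightarrow> x \<noteq> \<zero> \<Longrightarrow> v (x [^] (m::nat)) = int m * v x"
  using w_pow[of x m] by (metis of_int_eq_iff of_int_mult of_int_of_nat_eq)

lemma fil_F:
  assumes "x \<in> W" "F x \<in> fil R v p n m" shows "x \<in> fil R v p n (m div p)"
  unfolding fil_iff_int
proof (intro conjI allI impI)
  fix k assume k: "k < n"
  show "x k = \<zero> \<or> - int (m div p) \<le> int (q k) * v (x k)"
  proof (cases "x k = \<zero>")
    case False
    then have "- int m \<le> int (q k) * (int p * v (x k))"
      using assms(2) k W_closed[OF assms(1)] pow_nonzero[of "x k" p] unfolding fil_iff_int by (auto simp: witt_F_def v_pow)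
    then have "int p * (- (int (q k) * v (x k))) \<le> int m" by (simp add: algebra_simps)
    then have "int p * (- (int (q k) * v (x k))) div int p \<le> int m div int p" using p_pos
      by (intro zdiv_mono1) auto
    then have "- (int (q k) * v (x k)) \<le> int m div int p"
      using p_pos nonzero_mult_div_cancel_left[of "int p" "- (int (q k) * v (x k))"] by simp
    then show ?thesis by (simp add: zdiv_int)
  qed simp
qed (fact assms(1))

text \<open>The weighted pole orders of \<open>F x\<close> are multiples of \<open>p\<close>, so a
  level prime to \<open>p\<close> is never attained.\<close>

lemma fil_F_pred:
  assumes "x \<in> W" "F x \<in> fil R v p n m" "m \<ge> 1" "\<not> p dvd m"
  shows "F x \<in> fil R v p n (m - 1)"
  unfolding fil_iff_int
proof (intro conjI allI impI)
  fix k assume k: "k < n"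
  show "F x k = \<zero> \<or> - int (m - 1) \<le> int (q k) * v (F x k)"
  proof (cases "x k = \<zero>")
    case False
    then have eq: "v (F x k) = int p * v (x k)" using W_closed[OF assms(1)] by (simp add: witt_F_def v_pow)
    have le: "- int m \<le> int (q k) * v (F x k)"
      using assms(2) k False W_closed[OF assms(1)] pow_nonzero[of "x k" p] unfolding fil_iff_int by (auto simp: witt_F_def)
    have "int (q k) * v (F x k) \<noteq> - int m"
    proof
      assume "int (q k) * v (F x k) = - int m"
      then have "int p * (- (int (q k) * v (x k))) = int m" unfolding eq by (simp add: algebra_simps)
      then have "int p dvd int m" by (metis dvd_triv_left)
      with assms(4) show False by simp
    qed
    with le assms(3) show ?thesis by linarith
  qed (use p_pos in \<open>simp add: witt_F_def nat_pow_zero\<close>)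
qed (use assms in simp)

text \<open>A component that attains level \<open>m\<close> forces \<open>p ^ j\<close> to divide
  \<open>m\<close> with \<open>j = n - 1 - k\<close>. Flatness rules out the largest such
  \<open>j\<close>, which leaves the components whose pole order \<open>m / p ^ j\<close> is
  divisible by \<open>p\<close>: those that may be p-th powers to leading order.\<close>

lemma flat_iff:
  assumes m: "m \<ge> 1"
  shows "x \<in> flat_fil R v p n m \<longleftrightarrow> x \<in> fil R v p n m \<and>
    (\<forall>k<n. x k \<noteq> \<zero> \<longrightarrow> int (q k) * v (x k) = - int m \<longrightarrow> p * q k dvd m)" (is "_ \<longleftrightarrow> _ \<and> ?B")
proof -
  define i where "i = multiplicity p m"
  have dvd_iff: "p ^ j dvd m \<longleftrightarrow> j \<le> i" for j
    unfolding i_def using m p_ge2 by (intro power_dvd_iff_le_multiplicity) auto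
  have "x \<in> flat_fil R v p n m \<longleftrightarrow> x \<in> fil R v p n m \<and> (i < n \<longrightarrow> (x (n - 1 - i) = \<zero> \<or> int (p ^ i) * v (x (n - 1 - i)) > - int m))"
    using m unfolding flat_fil_def Let_def i_def by auto
  moreover have "(i < n \<longrightarrow> (x (n - 1 - i) = \<zero> \<or> int (p ^ i) * v (x (n - 1 - i)) > - int m)) \<longleftrightarrow> ?B" (is "?A \<longleftrightarrow> _") if x: "x \<in> fil R v p n m"
  proof
    assume A: ?A
    show ?B
    proof (intro allI impI)
      fix k assume k: "k < n" "x k \<noteq> \<zero>" "int (q k) * v (x k) = - int m"
      let ?j = "n - 1 - k"
      have "int (p ^ ?j) * (- v (x k)) = int m" using k(3) by simp
      then have "int (p ^ ?j) dvd int m" by (metis dvd_triv_left)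
      then have "?j \<le> i" using dvd_iff int_dvd_int_iff by blast
      moreover have "?j \<noteq> i"
      proof
        assume j: "?j = i"
        with k(1) have "i < n" "n - 1 - i = k" by auto
        with A k j show False by auto
      qed
      ultimately have "p ^ Suc ?j dvd m" using dvd_iff[of "Suc ?j"] by simp
      then show "p * q k dvd m" by simp
    qed
  next
    assume B: ?B
    show ?A
    proof
      assume i: "i < n"
      let ?k = "n - 1 - i"
      have k: "?k < n" "n - 1 - ?k = i" using i by auto
      have "\<not> p * p ^ i dvd m" using dvd_iff[of "Suc i"] by simp
      with B k have "x ?k = \<zero> \<or> int (p ^ i) * v (x ?k) \<noteq> - int m" by metis
      moreover have "x ?k = \<zero> \<or> - int m \<le> int (p ^ i) * v (x ?k)" using x k unfolding fil_iff_int by metis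
      ultimately show "x ?k = \<zero> \<or> int (p ^ i) * v (x ?k) > - int m" by linarith
    qed
  qed
  ultimately show ?thesis by blast
qed

lemma flat_subset_fil: "flat_fil R v p n m \<subseteq> fil R v p n m"
  by (auto simp: flat_fil_def)

lemma fil_pred_subset_flat: assumes "m \<ge> 1" shows "fil R v p n (m - 1) \<subseteq> flat_fil R v p n m"
proof
  fix x assume x: "x \<in> fil R v p n (m - 1)"
  then have "x \<in> fil R v p n m" using fil_mono[of "m - 1" m] by auto
  moreover have "int (q k) * v (x k) \<noteq> - int m" if "k < n" "x k \<noteq> \<zero>" for k
    using x that assms unfolding fil_iff_int by force
  ultimately show "x \<in> flat_fil R v p n m" unfolding flat_iff[OF assms] by blast
qed

lemma flat_eq_fil_pred: assumes "m \<ge> 1" "\<not> p dvd m" shows "flat_fil R v p n m = fil R v p n (m - 1)"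
proof
  show "flat_fil R v p n m \<subseteq> fil R v p n (m - 1)"
  proof
    fix x assume "x \<in> flat_fil R v p n m"
    then have x: "x \<in> fil R v p n m" "\<And>k. k < n \<Longrightarrow> x k \<noteq> \<zero> \<Longrightarrow> int (q k) * v (x k) \<noteq> - int m"
      unfolding flat_iff[OF assms(1)] using assms(2) by (auto dest: dvd_mult_left)
    show "x \<in> fil R v p n (m - 1)" unfolding fil_iff_int
    proof (intro conjI allI impI)
      fix k assume "k < n"
      with x show "x k = \<zero> \<or> - int (m - 1) \<le> int (q k) * v (x k)" unfolding fil_iff_int using assms(1) by fastforce
    qed (use x filD in auto)
  qed
qed (rule fil_pred_subset_flat[OF assms(1)])

text \<open>For \<open>l \<le> k\<close> the number \<open>q l\<close> is a multiple of
  \<open>q k\<close>. If \<open>p * q k\<close> does not divide \<open>m\<close>, neither does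
  \<open>p * q l\<close>; all components up to \<open>k\<close> then satisfy the bound of level
  \<open>m - 1\<close>, which addition preserves.\<close>

lemma flat_add:
  assumes m: "m \<ge> 1" and x: "x \<in> flat_fil R v p n m" and y: "y \<in> flat_fil R v p n m"
  shows "x \<boxplus> y \<in> flat_fil R v p n m"
  unfolding flat_iff[OF m]
proof (intro conjI allI impI)
  have xf: "x \<in> fil R v p n m" and yf: "y \<in> fil R v p n m" using x y flat_subset_fil by auto
  then show "x \<boxplus> y \<in> fil R v p n m" by (rule fil_add)
  fix k assume k: "k < n" "(x \<boxplus> y) k \<noteq> \<zero>" "int (q k) * v ((x \<boxplus> y) k) = - int m"
  show "p * q k dvd m"
  proof (rule ccontr)
    assume nd: "\<not> p * q k dvd m"
    have st: "vge (z l) (- bnd (m - 1) * real (p ^ l))" if z: "z \<in> flat_fil R v p n m" and l: "l \<le> k" for z l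
    proof (cases "z l = \<zero>")
      case False
      have ln: "l < n" using l k by simp
      have "p * q k dvd p * q l" using l by (intro mult_dvd_mono le_imp_power_dvd) auto
      then have "\<not> p * q l dvd m" using nd dvd_trans by blast
      with z False ln have "int (q l) * v (z l) \<noteq> - int m" "- int m \<le> int (q l) * v (z l)"
        unfolding flat_iff[OF m] fil_iff_int by auto
      then have "- int (m - 1) \<le> int (q l) * v (z l)" using m by linarith
      then show ?thesis unfolding vge_def using bnd_le_iff(1)[OF ln, of "m - 1" "v (z l)"] by simp
    qed simp
    note W = filD[OF xf] filD[OF yf]
    have "vge ((x \<boxplus> y) k \<ominus> x k) (- bnd (m - 1) * real (p ^ k) + 0)"
      using st x y by (intro wadd_gain[OF W k(1)]) auto
    then have "vge (((x \<boxplus> y) k \<ominus> x k) \<oplus> x k) (- bnd (m - 1) * real (p ^ k))"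
      using W_closed[OF W(1)] W_closed[OF W(2)] W_closed[OF wadd_closed[OF W]] st[OF x] by (intro vge_add) auto
    moreover have "((x \<boxplus> y) k \<ominus> x k) \<oplus> x k = (x \<boxplus> y) k"
      using W_closed[OF wadd_closed[OF W]] W_closed[OF W(1)] by (simp add: minus_eq a_assoc l_neg)
    ultimately have "- int (m - 1) \<le> int (q k) * v ((x \<boxplus> y) k)"
      using k(2) bnd_le_iff(1)[OF k(1), of "m - 1" "v ((x \<boxplus> y) k)"] unfolding vge_def by simp
    with k(3) m show False by simp
  qed
qed

end

context char_dvf begin

section \<open>Spans of Frobenius orbits\<close>

abbreviation SF where "SF S \<equiv> witt_span R p n (\<Union>j. (F ^^ j) ` S)"

lemma F_iter_closed [simp]: "x \<in> W \<Longrightarrow> (F ^^ j) x \<in> W"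
  by (induction j) auto

lemma F_iter_wadd: "x \<in> W \<Longrightarrow> y \<in> W \<Longrightarrow> (F ^^ j) (x \<boxplus> y) = (F ^^ j) x \<boxplus> (F ^^ j) y"
  by (induction j) (auto simp: F_wadd)

lemma SF_W: assumes "S \<subseteq> W" "a \<in> SF S" shows "a \<in> W"
  using assms(2) by induction (use assms(1) in auto)

lemma SF_add_elem: "x \<in> S \<Longrightarrow> \<psi> \<in> SF S \<Longrightarrow> (F ^^ j) x \<boxplus> \<psi> \<in> SF S"
  by (intro witt_span.add) auto

lemma SF_elem: "S \<subseteq> W \<Longrightarrow> x \<in> S \<Longrightarrow> (F ^^ j) x \<in> SF S"
  using SF_add_elem[of x S "witt_zero R" j, OF _ witt_span.zero] wadd_zero[of "(F ^^ j) x"] by (auto simp: subset_eq)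

lemma SF_add: assumes S: "S \<subseteq> W" and "a \<in> SF S" "b \<in> SF S" shows "a \<boxplus> b \<in> SF S"
  using assms(2)
proof induction
  case zero
  then show ?case using assms(3) SF_W[OF S assms(3)] by simp
next
  case (add x c)
  then obtain s j where s: "s \<in> S" "x = (F ^^ j) s" by auto
  have W: "x \<in> W" "c \<in> W" "b \<in> W" using s S SF_W[OF S add(2)] SF_W[OF S assms(3)] by auto
  show ?case unfolding wadd_assoc[OF W] unfolding s(2) by (rule SF_add_elem[OF s(1) add.IH])
qed

lemma SF_F: assumes S: "S \<subseteq> W" and "a \<in> SF S" shows "F a \<in> SF S"
  using assms(2)
proof induction
  case zero
  show ?case by (simp add: witt_span.zero)
next
  case (add x c)
  then obtain s j where s: "s \<in> S" "x = (F ^^ j) s" by auto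
  have W: "x \<in> W" "c \<in> W" using s S SF_W[OF S add(2)] by auto
  have "F (x \<boxplus> c) = (F ^^ Suc j) s \<boxplus> F c" using F_wadd[OF W] s(2) by simp
  then show ?case using SF_add_elem[OF s(1) add.IH, of "Suc j"] by simp
qed

text \<open>Summands without Frobenius are gathered in \<open>y\<close>, which uses closure of
  \<open>S\<close> under addition; all others share a factor \<open>F\<close>. The form
  \<open>y \<boxplus> F \<psi>\<close> makes recursion on span elements possible.\<close>

lemma SF_decomp:
  assumes S: "S \<subseteq> W" and z: "witt_zero R \<in> S" and cl: "\<And>x y. x \<in> S \<Longrightarrow> y \<in> S \<Longrightarrow> x \<boxplus> y \<in> S"
    and "a \<in> SF S"
  shows "\<exists>y\<in>S. \<exists>\<psi>\<in>SF S. a = y \<boxplus> F \<psi>"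
  using assms(4)
proof induction
  case zero
  show ?case by (rule bexI[OF _ z], rule bexI[OF _ witt_span.zero]) simp
next
  case (add x c)
  then obtain s j where s: "s \<in> S" "x = (F ^^ j) s" by auto
  obtain y \<psi> where y: "y \<in> S" "\<psi> \<in> SF S" "c = y \<boxplus> F \<psi>" using add.IH by auto
  have \<psi>: "\<psi> \<in> W" using SF_W[OF S y(2)] .
  have W: "x \<in> W" "y \<in> W" "F \<psi> \<in> W" using s S y(1) \<psi> by auto
  show ?case
  proof (cases j)
    case 0
    have "x \<boxplus> c = (x \<boxplus> y) \<boxplus> F \<psi>" unfolding y(3) wadd_assoc[OF W] ..
    moreover have "x \<boxplus> y \<in> S" using cl s 0 y by simp
    ultimately show ?thesis using y(2) by blast
  next
    case (Suc i)
    have sW: "(F ^^ i) s \<in> W" using s S by auto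
    have "x \<boxplus> c = y \<boxplus> (x \<boxplus> F \<psi>)" unfolding y(3) by (rule wadd_lcomm[OF W])
    also have "x \<boxplus> F \<psi> = F ((F ^^ i) s \<boxplus> \<psi>)" using F_wadd[OF sW \<psi>] s(2) Suc by simp
    finally show ?thesis using y(1) SF_add_elem[OF s(1) y(2), of i] by blast
  qed
qed

lemma SF_mono: assumes "S \<subseteq> T" "a \<in> SF S" shows "a \<in> SF T"
  using assms(2)
proof induction
  case zero
  show ?case by (rule witt_span.zero)
next
  case (add x c)
  then show ?case using assms(1) by (intro witt_span.add) auto
qed

lemma filF_eq: "filF R v p n m = SF (fil R v p n m)" by (simp add: filF_def)
lemma flat_filF_eq: "flat_filF R v p n m = SF (flat_fil R v p n m)" by (simp add: flat_filF_def)

lemma fil_W: "fil R v p n m \<subseteq> W" using filD by auto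
lemma flat_W: "flat_fil R v p n m \<subseteq> W" using filD flat_subset_fil by blast

lemma filF_decomp:
  assumes "a \<in> filF R v p n m"
  shows "\<exists>y\<in>fil R v p n m. \<exists>\<psi>\<in>filF R v p n m. a = y \<boxplus> F \<psi>"
  using SF_decomp[OF fil_W fil_zero fil_add assms[unfolded filF_eq]] unfolding filF_eq .

lemma filF_mono: "m \<le> m' \<Longrightarrow> a \<in> filF R v p n m \<Longrightarrow> a \<in> filF R v p n m'"
  unfolding filF_eq by (rule SF_mono[OF fil_mono])

lemma fil_exists: assumes "x \<in> W" shows "\<exists>m. x \<in> fil R v p n m"
proof -
  define m where "m = (\<Sum>k<n. nat (int (q k) * \<bar>v (x k)\<bar>))"
  have "- int m \<le> int (q k) * v (x k)" if "k < n" for k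
  proof -
    have "nat (int (q k) * \<bar>v (x k)\<bar>) \<le> m" unfolding m_def by (rule member_le_sum) (use that in auto)
    then have "int (q k) * \<bar>v (x k)\<bar> \<le> int m" by linarith
    moreover have "- (int (q k) * \<bar>v (x k)\<bar>) \<le> int (q k) * v (x k)"
      by (metis abs_ge_minus_self abs_mult abs_of_nat minus_le_iff)
    ultimately show ?thesis by linarith
  qed
  then show ?thesis unfolding fil_iff_int using assms by blast
qed

lemma flat_filF_exists: assumes "x \<in> W" shows "\<exists>m\<ge>1. x \<in> flat_filF R v p n m"
proof -
  obtain m where "x \<in> fil R v p n m" using fil_exists[OF assms] by blast
  then have "x \<in> flat_fil R v p n (Suc m)" using fil_pred_subset_flat[of "Suc m"] by auto
  then show ?thesis using SF_elem[OF flat_W, of x "Suc m" 0] unfolding flat_filF_eq by (intro exI[of _ "Suc m"]) auto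
qed

lemma div_p_le: "m \<ge> 1 \<Longrightarrow> m div p \<le> m - 1"
  using p_ge2 div_less_dividend[of p m] by linarith

lemma div_p_le2: assumes "m \<ge> 2" shows "(m - 1) div p \<le> m - 2"
proof (cases "m = 2")
  case True then show ?thesis using p_ge2 by simp
next
  case False
  with assms have "(m - 1) div p \<le> m - 1 - 1" by (intro div_p_le) auto
  then show ?thesis by simp
qed

lemma pi_pow: assumes "\<pi> \<in> carrier R" "\<pi> \<noteq> \<zero>" "v \<pi> = 1"
  shows "\<pi> [^] (s::nat) \<in> carrier R" "\<pi> [^] s \<noteq> \<zero>" "v (\<pi> [^] s) = int s"
    "inv (\<pi> [^] s) \<in> carrier R" "inv (\<pi> [^] s) \<noteq> \<zero>" "v (inv (\<pi> [^] s)) = - int s"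
    "\<pi> [^] s \<otimes> inv (\<pi> [^] s) = \<one>"
proof -
  show 1: "\<pi> [^] s \<in> carrier R" "\<pi> [^] s \<noteq> \<zero>" using assms pow_nonzero by auto
  show 2: "v (\<pi> [^] s) = int s" using v_pow assms by simp
  show "inv (\<pi> [^] s) \<in> carrier R" "inv (\<pi> [^] s) \<noteq> \<zero>" "\<pi> [^] s \<otimes> inv (\<pi> [^] s) = \<one>"
    using inv_nonzero[OF 1] by auto
  show "v (inv (\<pi> [^] s)) = - int s" using w_inv[OF 1] 2 by simp
qed

text \<open>The correction term \<open>t\<close>: its \<open>p\<close>-th powers approximate the components of pole order exactly
  \<open>M / q k\<close>, where \<open>p * q k\<close> divides \<open>M\<close>.\<close>

lemma top_approx:
  assumes u: "u \<in> W" and u0: "\<forall>k<n. u k \<noteq> \<zero> \<longrightarrow> p * q k dvd M"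
    and pi: "\<pi> \<in> carrier R" "\<pi> \<noteq> \<zero>" "v \<pi> = 1"
    and b_all: "\<forall>k<n. p * q k dvd M \<longrightarrow> b k \<in> carrier R \<and> vge (b k) 0 \<and> vge (u k \<otimes> \<pi> [^] (M div q k) \<ominus> b k [^] p) 1"
  defines "t \<equiv> \<lambda>k. if k < n \<and> p * q k dvd M then b k \<otimes> inv (\<pi> [^] (M div (p * q k))) else \<zero>"
  shows "t \<in> W" "\<And>k. k < n \<Longrightarrow> vge (F t k) (- bnd M * real (p ^ k))"
    "\<And>k. k < n \<Longrightarrow> vge (u k \<ominus> F t k) (- bnd M * real (p ^ k) + 1)"
    "\<And>k. k < n \<Longrightarrow> p * q k dvd M \<Longrightarrow> F t k = b k [^] p \<otimes> inv (\<pi> [^] (M div q k))"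
    "\<And>k. k < n \<Longrightarrow> p * q k dvd M \<Longrightarrow> u k \<ominus> F t k = (u k \<otimes> \<pi> [^] (M div q k) \<ominus> b k [^] p) \<otimes> inv (\<pi> [^] (M div q k))"
    "\<And>k. k < n \<Longrightarrow> \<not> p * q k dvd M \<Longrightarrow> u k = \<zero> \<and> F t k = \<zero>"
proof -
  note pp = pi_pow[OF pi]
  note b = b_all[rule_format]
  show t: "t \<in> W" using b pp(4) by (auto simp: witt_carrier_def t_def)
  \<comment> \<open>Since \<open>q k\<close> divides \<open>M\<close> here, the bound is the integer
    \<open>- (M div q k)\<close>, the exponent of \<open>\<pi>\<close> in
    \<open>F t k\<close>.\<close>
  have bd: "- bnd M * real (p ^ k) = - real (M div q k)" if k: "k < n" "p * q k dvd M" for k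
  proof -
    have "q k dvd M" using k(2) by (rule dvd_mult_right)
    then have M: "M = q k * (M div q k)" by simp
    have "q k * p ^ k = p ^ (n - 1)" using k(1) by (simp flip: power_add)
    then have N: "real (p ^ (n - 1)) = real (q k) * real (p ^ k)" by (metis of_nat_mult)
    have "real (q k) > 0" "real (p ^ k) > 0" using p_pos by auto
    moreover have "real M = real (q k) * real (M div q k)" by (metis M of_nat_mult)
    ultimately show ?thesis unfolding bnd_def N using p_pos by (simp del: of_nat_power of_nat_div)
  qed
  show F1: "F t k = b k [^] p \<otimes> inv (\<pi> [^] (M div q k))" if k: "k < n" "p * q k dvd M" for k
  proof -
    let ?s = "M div (p * q k)"
    have "M div q k = ?s * p"
    proof -
      obtain c where "M = p * q k * c" using k(2) by (elim dvdE)
      moreover have "p > 0" "q k > 0" using p_pos by auto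
      ultimately show ?thesis by (simp add: mult.commute)
    qed
    then have "\<pi> [^] (M div q k) = (\<pi> [^] ?s) [^] p" using pi by (simp add: nat_pow_pow)
    moreover have "inv ((\<pi> [^] ?s) [^] p) = (inv (\<pi> [^] ?s)) [^] p"
    proof (rule comm_inv_char)
      have "((\<pi> [^] ?s) \<otimes> inv (\<pi> [^] ?s)) [^] p = \<one>" using pp(7)[of ?s] by simp
      then show "(\<pi> [^] ?s) [^] p \<otimes> (inv (\<pi> [^] ?s)) [^] p = \<one>"
        using nat_pow_distrib[OF pp(1)[of ?s] pp(4)[of ?s]] by simp
    qed (use pp in auto)
    ultimately show ?thesis using k b[OF k] nat_pow_distrib[OF _ pp(4)[of ?s]] by (simp add: witt_F_def t_def)
  qed
  show F2: "u k \<ominus> F t k = (u k \<otimes> \<pi> [^] (M div q k) \<ominus> b k [^] p) \<otimes> inv (\<pi> [^] (M div q k))" if k: "k < n" "p * q k dvd M" for k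
  proof -
    have "(u k \<otimes> \<pi> [^] (M div q k) \<ominus> b k [^] p) \<otimes> inv (\<pi> [^] (M div q k))
       = u k \<otimes> (\<pi> [^] (M div q k) \<otimes> inv (\<pi> [^] (M div q k))) \<ominus> b k [^] p \<otimes> inv (\<pi> [^] (M div q k))"
      using b[OF k] pp W_closed[OF u] by (simp add: minus_eq l_distr l_minus m_assoc)
    then show ?thesis unfolding F1[OF k] pp(7) using W_closed[OF u] by simp
  qed
  show F3: "u k = \<zero> \<and> F t k = \<zero>" if "k < n" "\<not> p * q k dvd M" for k
    using u0 that p_pos by (auto simp: witt_F_def t_def nat_pow_zero)
  have ipi: "vge (inv (\<pi> [^] (s::nat))) (- real s)" for s unfolding vge_def pp(6) by simp
  show "vge (F t k) (- bnd M * real (p ^ k))" if k: "k < n" for k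
  proof (cases "p * q k dvd M")
    case True
    have "vge (b k [^] p \<otimes> inv (\<pi> [^] (M div q k))) (0 + - real (M div q k))"
      using b[OF k True] pp by (intro vge_mult ipi vge_pow_nonneg) auto
    then show ?thesis unfolding F1[OF k True] bd[OF k True] by simp
  qed (use F3[OF k] in simp)
  show "vge (u k \<ominus> F t k) (- bnd M * real (p ^ k) + 1)" if k: "k < n" for k
  proof (cases "p * q k dvd M")
    case True
    have "vge ((u k \<otimes> \<pi> [^] (M div q k) \<ominus> b k [^] p) \<otimes> inv (\<pi> [^] (M div q k))) (1 + - real (M div q k))"
      using b[OF k True] pp W_closed[OF u] by (intro vge_mult ipi) auto
    then show ?thesis unfolding F2[OF k True] bd[OF k True] by simp
  qed (use F3[OF k] in \<open>simp add: minus_eq\<close>)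
qed

text \<open>Comparing the two decompositions of \<open>u\<close> gives
  \<open>z = y \<boxplus> F d\<close> with \<open>d\<close> the difference of \<open>w'\<close> and
  \<open>t\<close>. Then \<open>F d\<close> has level \<open>M - 1\<close>, which is prime to
  \<open>p\<close>, and a Frobenius image cannot attain such a level.\<close>

lemma fil_descend:
  assumes M: "M \<ge> 2" "p dvd M" and W: "u \<in> W" "t \<in> W" "w' \<in> W"
    and z: "z \<in> fil R v p n (M - 1)" "F t \<boxplus> z = u" and y: "y \<in> fil R v p n (M - 2)" "u = y \<boxplus> F w'"
  shows "z \<in> fil R v p n (M - 2)"
proof -
  have nd: "\<not> p dvd M - 1"
  proof
    assume "p dvd M - 1"
    then have "p dvd M - (M - 1)" using M(2) by (rule dvd_diff_nat[rotated])
    moreover have "M - (M - 1) = 1" using M(1) by simp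
    ultimately show False using p_ge2 by simp
  qed
  have yW: "y \<in> W" and zW: "z \<in> W" using y(1) z(1) filD by auto
  obtain d where d: "d \<in> W" "t \<boxplus> d = w'" using wdiff[OF W(3) W(2)] by blast
  have "F t \<boxplus> z = F t \<boxplus> (y \<boxplus> F d)"
    unfolding z(2) y(2) d(2)[symmetric] F_wadd[OF W(2) d(1)]
    by (rule wadd_lcomm[OF yW F_closed[OF W(2)] F_closed[OF d(1)]])
  then have zd: "z = y \<boxplus> F d"
    by (rule wadd_cancel[OF F_closed[OF W(2)] zW wadd_closed[OF yW F_closed[OF d(1)]]])
  have "y \<in> fil R v p n (M - 1)" by (rule subsetD[OF fil_mono y(1)]) simp
  then have "F d \<in> fil R v p n (M - 1)" by (rule fil_diff[OF z(1) _ F_closed[OF d(1)] zd[symmetric]])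
  then have "F d \<in> fil R v p n (M - 1 - 1)" by (rule fil_F_pred[OF d(1) _ _ nd]) (use M(1) in simp)
  then have "F d \<in> fil R v p n (M - 2)" by (simp add: numeral_2_eq_2)
  then show ?thesis unfolding zd by (rule fil_add[OF y(1)])
qed

end

section \<open>Extensions in \<open>E2\<close> and the upper bound\<close>

locale e2_ext = K: char_dvf K v p n for K :: "'a ring" and v p n +
  fixes L :: "'b ring" and v' and \<iota> :: "'a \<Rightarrow> 'b"
  assumes E2: "E2 K v p L v' \<iota>"

sublocale e2_ext \<subseteq> L: char_dvf L v' p n
proof -
  have dv: "dvf L v'" using E2 by (simp add: E2_def)
  interpret Lf: field L using dv by (simp add: dvf_def)
  have h: "\<iota> \<in> ring_hom K L" using E2 by (simp add: E2_def)
  interpret h: ring_hom_cring K L \<iota>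
    by (intro ring_hom_cringI ring_hom_cring.intro ring_hom_cring_axioms.intro h K.is_cring Lf.is_cring)
  have "\<iota> (add_pow K m \<one>\<^bsub>K\<^esub>) = add_pow L m \<one>\<^bsub>L\<^esub>" for m :: nat
    by (induction m) (auto simp: K.add.nat_pow_Suc Lf.add.nat_pow_Suc)
  then have "add_pow L p \<one>\<^bsub>L\<^esub> = \<zero>\<^bsub>L\<^esub>" using K.add_pow_p by (metis h.hom_zero)
  then have "char_p L p" using K.prime_p by (simp add: char_p_def)
  with dv show "char_dvf L v' p" by unfold_locales auto
qed

context e2_ext begin

lemma hom: "\<iota> \<in> ring_hom K L" using E2 by (simp add: E2_def)

sublocale h: ring_hom_cring K L \<iota>
  by (intro ring_hom_cringI ring_hom_cring.intro ring_hom_cring_axioms.intro hom K.is_cring L.is_cring)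

lemma iota_zero_iff: "x \<in> carrier K \<Longrightarrow> \<iota> x = \<zero>\<^bsub>L\<^esub> \<longleftrightarrow> x = \<zero>\<^bsub>K\<^esub>"
proof
  assume x: "x \<in> carrier K" and z: "\<iota> x = \<zero>\<^bsub>L\<^esub>"
  show "x = \<zero>\<^bsub>K\<^esub>"
  proof (rule ccontr)
    assume "x \<noteq> \<zero>\<^bsub>K\<^esub>"
    from K.inv_nonzero[OF x this] have i: "inv\<^bsub>K\<^esub> x \<in> carrier K" "x \<otimes>\<^bsub>K\<^esub> inv\<^bsub>K\<^esub> x = \<one>\<^bsub>K\<^esub>" by auto
    have "\<iota> (x \<otimes>\<^bsub>K\<^esub> inv\<^bsub>K\<^esub> x) = \<zero>\<^bsub>L\<^esub>" unfolding h.hom_mult[OF x i(1)] z using i(1) by simp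
    then have "\<one>\<^bsub>L\<^esub> = \<zero>\<^bsub>L\<^esub>" unfolding i(2) by (simp only: h.hom_one)
    then show False using L.one_not_zero by contradiction
  qed
qed simp

text \<open>\<open>E2\<close> only compares signs of values and fixes the value of uniformizers. A
  power of a uniformizer moves \<open>x\<close> to value zero, where the two sign conditions force
  the value zero in the extension.\<close>

lemma v_iota: assumes x: "x \<in> carrier K" "x \<noteq> \<zero>\<^bsub>K\<^esub>" shows "v' (\<iota> x) = v x"
proof -
  obtain \<pi> where pi: "\<pi> \<in> carrier K" "\<pi> \<noteq> \<zero>\<^bsub>K\<^esub>" "v \<pi> = 1" using K.dvf by (auto simp: dvf_def)
  have pi': "\<iota> \<pi> \<in> carrier L" "\<iota> \<pi> \<noteq> \<zero>\<^bsub>L\<^esub>" "v' (\<iota> \<pi>) = 1"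
    using E2 pi iota_zero_iff by (auto simp: E2_def)
  note k = K.pi_pow[OF pi] and l = L.pi_pow[OF pi']
  have zero: "v' (\<iota> y) = 0" if "y \<in> carrier K" "y \<noteq> \<zero>\<^bsub>K\<^esub>" "v y = 0" for y
  proof -
    have "v' (\<iota> y) \<ge> 0" "\<not> v' (\<iota> y) > 0" using E2 that by (auto simp: E2_def)
    then show ?thesis by simp
  qed
  have xn: "\<iota> x \<noteq> \<zero>\<^bsub>L\<^esub>" "\<iota> x \<in> carrier L" using iota_zero_iff x by auto
  have pw: "\<iota> (\<pi> [^]\<^bsub>K\<^esub> (s::nat)) = \<iota> \<pi> [^]\<^bsub>L\<^esub> s" for s
    using pi by (induction s) auto
  show ?thesis
  proof (cases "v x \<ge> 0")
    case True
    define s where "s = nat (v x)"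
    let ?y = "x \<otimes>\<^bsub>K\<^esub> inv\<^bsub>K\<^esub> (\<pi> [^]\<^bsub>K\<^esub> s)"
    have y: "?y \<in> carrier K" "?y \<noteq> \<zero>\<^bsub>K\<^esub>" "v ?y = 0"
      using x k[of s] K.w_mult[of x "inv\<^bsub>K\<^esub> (\<pi> [^]\<^bsub>K\<^esub> s)"] True by (auto simp: K.integral_iff s_def)
    have "x = ?y \<otimes>\<^bsub>K\<^esub> \<pi> [^]\<^bsub>K\<^esub> s" using x k[of s] by (simp add: K.m_assoc K.m_comm[of "inv\<^bsub>K\<^esub> _"])
    then have "\<iota> x = \<iota> ?y \<otimes>\<^bsub>L\<^esub> \<iota> \<pi> [^]\<^bsub>L\<^esub> s" using y(1) k(1)[of s] pw by (metis h.hom_mult)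
    then have "v' (\<iota> x) = v' (\<iota> ?y) + int s"
      using L.w_mult[of "\<iota> ?y" "\<iota> \<pi> [^]\<^bsub>L\<^esub> s"] y iota_zero_iff[OF y(1)] l[of s] by simp
    then show ?thesis using zero[OF y] True by (simp add: s_def)
  next
    case False
    define s where "s = nat (- v x)"
    let ?y = "x \<otimes>\<^bsub>K\<^esub> (\<pi> [^]\<^bsub>K\<^esub> s)"
    have y: "?y \<in> carrier K" "?y \<noteq> \<zero>\<^bsub>K\<^esub>" "v ?y = 0"
      using x k[of s] K.w_mult[of x "\<pi> [^]\<^bsub>K\<^esub> s"] False by (auto simp: K.integral_iff s_def)
    have "\<iota> ?y = \<iota> x \<otimes>\<^bsub>L\<^esub> \<iota> \<pi> [^]\<^bsub>L\<^esub> s" using x k(1)[of s] pw by simp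
    then have "v' (\<iota> ?y) = v' (\<iota> x) + int s"
      using L.w_mult[of "\<iota> x" "\<iota> \<pi> [^]\<^bsub>L\<^esub> s"] xn l[of s] by simp
    then show ?thesis using zero[OF y] False by (simp add: s_def)
  qed
qed

lemma iota_W: "x \<in> K.W \<Longrightarrow> \<iota> \<circ> x \<in> L.W"
  by (auto simp: witt_carrier_def)

lemma iota_wadd: assumes "x \<in> K.W" "y \<in> K.W" shows "\<iota> \<circ> witt_add K p n x y = witt_add L p n (\<iota> \<circ> x) (\<iota> \<circ> y)"
proof
  fix k
  have "\<iota> (peval K (interl x y) (witt_S p k)) = peval L (\<lambda>i. \<iota> (interl x y i)) (witt_S p k)"
    by (rule peval_hom[OF K.is_cring L.is_cring hom]) (use K.W_closed[OF assms(1)] K.W_closed[OF assms(2)] in auto)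
  then show "(\<iota> \<circ> witt_add K p n x y) k = witt_add L p n (\<iota> \<circ> x) (\<iota> \<circ> y) k"
    by (simp add: witt_add_def interl_fun comp_def)
qed

lemma iota_pow: "x \<in> carrier K \<Longrightarrow> \<iota> (x [^]\<^bsub>K\<^esub> (m::nat)) = \<iota> x [^]\<^bsub>L\<^esub> m"
  by (induction m) auto

lemma iota_F: "x \<in> K.W \<Longrightarrow> \<iota> \<circ> K.F x = L.F (\<iota> \<circ> x)"
  using K.W_closed[of x] by (auto simp: witt_F_def iota_pow)

lemma iota_F_iter: "x \<in> K.W \<Longrightarrow> \<iota> \<circ> (K.F ^^ j) x = (L.F ^^ j) (\<iota> \<circ> x)"
  by (induction j) (auto simp: iota_F)

lemma iota_zero: "\<iota> \<circ> witt_zero K = witt_zero L"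
  by (auto simp: witt_zero_def)

lemma iota_fil: assumes "x \<in> K.W" shows "\<iota> \<circ> x \<in> fil L v' p n m \<longleftrightarrow> x \<in> fil K v p n m"
  unfolding L.fil_iff_int K.fil_iff_int
  using assms iota_W[OF assms] iota_zero_iff[OF K.W_closed[OF assms]] v_iota[OF K.W_closed[OF assms]] by auto

lemma pi_L: "\<pi> \<in> carrier K \<Longrightarrow> \<pi> \<noteq> \<zero>\<^bsub>K\<^esub> \<Longrightarrow> v \<pi> = 1 \<Longrightarrow> \<iota> \<pi> \<in> carrier L \<and> \<iota> \<pi> \<noteq> \<zero>\<^bsub>L\<^esub> \<and> v' (\<iota> \<pi>) = 1"
  using iota_zero_iff v_iota by simp

lemma residue_perfect:
  assumes "a \<in> carrier L" "L.vge a 0"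
  shows "\<exists>b\<in>carrier L. L.vge b 0 \<and> L.vge (a \<ominus>\<^bsub>L\<^esub> b [^]\<^bsub>L\<^esub> p) 1"
proof -
  have "a = \<zero>\<^bsub>L\<^esub> \<or> v' a \<ge> 0" using assms(2) by (simp add: L.vge_def)
  moreover have "\<forall>a\<in>carrier L. (a = \<zero>\<^bsub>L\<^esub> \<or> v' a \<ge> 0) \<longrightarrow>
        (\<exists>b\<in>carrier L. (b = \<zero>\<^bsub>L\<^esub> \<or> v' b \<ge> 0) \<and>
           (a \<ominus>\<^bsub>L\<^esub> b [^]\<^bsub>L\<^esub> p = \<zero>\<^bsub>L\<^esub> \<or> v' (a \<ominus>\<^bsub>L\<^esub> b [^]\<^bsub>L\<^esub> p) > 0))"
    using E2 unfolding E2_def by (elim conjE)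
  ultimately obtain b where "b \<in> carrier L" "b = \<zero>\<^bsub>L\<^esub> \<or> v' b \<ge> 0"
    "a \<ominus>\<^bsub>L\<^esub> b [^]\<^bsub>L\<^esub> p = \<zero>\<^bsub>L\<^esub> \<or> v' (a \<ominus>\<^bsub>L\<^esub> b [^]\<^bsub>L\<^esub> p) > 0"
    using assms(1) by blast
  then show ?thesis by (intro bexI[of _ b]) (auto simp: L.vge_def)
qed

lemma flat_fil_subset:
  assumes M: "M \<ge> 1" and x: "x \<in> flat_fil K v p n M"
  shows "\<exists>t\<in>fil L v' p n (M - 1). \<exists>y\<in>fil L v' p n (M - 1). \<iota> \<circ> x = witt_add L p n (L.F t) y"
proof -
  have xf: "x \<in> fil K v p n M" using x K.flat_subset_fil by auto
  have xW: "x \<in> K.W" using xf K.filD by auto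
  \<comment> \<open>\<open>u\<close> keeps the components in which \<open>flat_fil\<close> permits
    level \<open>M\<close> to be attained; there the pole order is divisible by \<open>p\<close> and
    \<open>F t\<close> can match the leading term.\<close>
  define u where "u k = (if k < n \<and> p * K.q k dvd M then \<iota> (x k) else \<zero>\<^bsub>L\<^esub>)" for k
  have ixW: "\<iota> \<circ> x \<in> L.W" using iota_W[OF xW] .
  have u: "u \<in> L.W" using L.W_closed[OF ixW] by (auto simp: witt_carrier_def u_def)
  have ixf: "\<iota> \<circ> x \<in> fil L v' p n M" using iota_fil[OF xW] xf by simp
  obtain \<pi> where pi: "\<pi> \<in> carrier L" "\<pi> \<noteq> \<zero>\<^bsub>L\<^esub>" "v' \<pi> = 1" using L.dvf by (auto simp: dvf_def)
  have uc: "u k \<in> carrier L" for k using L.W_closed[OF u] .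
  have ub: "L.vge (u k \<otimes>\<^bsub>L\<^esub> \<pi> [^]\<^bsub>L\<^esub> (M div K.q k)) 0" if k: "k < n" "p * K.q k dvd M" for k
  proof (cases "u k = \<zero>\<^bsub>L\<^esub>")
    case True then show ?thesis using L.pi_pow[OF pi] by simp
  next
    case False
    have "- int M \<le> int (K.q k) * v' (u k)" using ixf k False unfolding L.fil_iff_int by (auto simp: u_def)
    moreover have "int M = int (K.q k) * int (M div K.q k)"
      using dvd_mult_right[OF k(2)] by (metis dvd_mult_div_cancel of_nat_mult)
    ultimately have "int (K.q k) * (v' (u k) + int (M div K.q k)) \<ge> 0" by (simp add: algebra_simps)
    moreover have "int (K.q k) > 0" using K.p_pos by simp
    ultimately have "v' (u k) + int (M div K.q k) \<ge> 0" using zero_le_mult_iff by (metis not_less)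
    then show ?thesis using L.w_mult[OF uc L.pi_pow(1)[OF pi] False L.pi_pow(2)[OF pi], of "M div K.q k"] L.pi_pow(3)[OF pi]
      by (simp add: L.vge_def)
  qed
  have "\<forall>k. \<exists>b. k < n \<longrightarrow> p * K.q k dvd M \<longrightarrow> b \<in> carrier L \<and> L.vge b 0 \<and> L.vge (u k \<otimes>\<^bsub>L\<^esub> \<pi> [^]\<^bsub>L\<^esub> (M div K.q k) \<ominus>\<^bsub>L\<^esub> b [^]\<^bsub>L\<^esub> p) 1"
    using residue_perfect[OF _ ub] uc L.pi_pow(1)[OF pi] by (meson L.m_closed)
  then obtain b where b: "\<forall>k<n. p * K.q k dvd M \<longrightarrow> b k \<in> carrier L \<and> L.vge (b k) 0 \<and> L.vge (u k \<otimes>\<^bsub>L\<^esub> \<pi> [^]\<^bsub>L\<^esub> (M div K.q k) \<ominus>\<^bsub>L\<^esub> b k [^]\<^bsub>L\<^esub> p) 1"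
    by metis
  define t where "t = (\<lambda>k. if k < n \<and> p * K.q k dvd M then b k \<otimes>\<^bsub>L\<^esub> inv\<^bsub>L\<^esub> (\<pi> [^]\<^bsub>L\<^esub> (M div (p * K.q k))) else \<zero>\<^bsub>L\<^esub>)"
  have u0: "\<forall>k<n. u k \<noteq> \<zero>\<^bsub>L\<^esub> \<longrightarrow> p * K.q k dvd M" by (auto simp: u_def split: if_splits)
  note ta = L.top_approx[OF u u0 pi b, folded t_def]
  have tf: "L.F t \<in> fil L v' p n M" unfolding L.fil_iff using ta(1,2) by simp
  \<comment> \<open>Taking p-th roots divides the level by \<open>p\<close>, and
    \<open>M div p\<close> is at most \<open>M - 1\<close>.\<close>
  then have t1: "t \<in> fil L v' p n (M - 1)"
    using L.fil_F[OF ta(1)] L.fil_mono[OF K.div_p_le[OF M]] by auto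
  obtain y where y: "y \<in> L.W" "witt_add L p n (L.F t) y = \<iota> \<circ> x"
    using L.wdiff[OF ixW L.F_closed[OF ta(1)]] by blast
  have "y \<in> fil L v' p n (M - 1)"
  proof (rule L.wadd_strict_conv[OF tf y(1) M])
    fix k assume k: "k < n"
    show "L.vgt (witt_add L p n (L.F t) y k \<ominus>\<^bsub>L\<^esub> L.F t k) (- L.bnd M * real (p ^ k))"
    proof (cases "p * K.q k dvd M")
      case True
      then have "u k = \<iota> (x k)" using k by (simp add: u_def)
      then have "L.vge (\<iota> (x k) \<ominus>\<^bsub>L\<^esub> L.F t k) (- L.bnd M * real (p ^ k) + 1)" using ta(3)[OF k] by simp
      then show ?thesis unfolding y(2) using L.vge_imp_vgt by fastforce
    next
      case False
      have "L.F t k = \<zero>\<^bsub>L\<^esub>" using ta(6)[OF k False] by simp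
      \<comment> \<open>In the remaining components flatness excludes equality, so the bound of
        level \<open>M\<close> already holds strictly.\<close>
      moreover have "L.vgt (\<iota> (x k)) (- L.bnd M * real (p ^ k))"
      proof (cases "x k = \<zero>\<^bsub>K\<^esub>")
        case nz: False
        have "int (K.q k) * v (x k) \<noteq> - int M" using x k nz False unfolding K.flat_iff[OF M] by blast
        moreover have "- int M \<le> int (K.q k) * v (x k)" using xf k nz unfolding K.fil_iff_int by blast
        ultimately have "- int M < int (L.q k) * v' (\<iota> (x k))" using v_iota[OF K.W_closed[OF xW] nz] by simp
        then show ?thesis unfolding L.vgt_def using L.bnd_le_iff(2)[OF k] by simp
      qed simp
      ultimately show ?thesis unfolding y(2) using L.W_closed[OF ixW, of k] by (simp add: L.minus_eq)
    qed
  qed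
  then show ?thesis using t1 y(2) by (intro bexI[of _ t] bexI[of _ y]) auto
qed

lemma flat_filF_subset:
  assumes M: "M \<ge> 1" and "x \<in> flat_filF K v p n M"
  shows "\<iota> \<circ> x \<in> filF L v' p n (M - 1)"
  using assms(2) unfolding K.flat_filF_eq L.filF_eq
proof induction
  case zero
  show ?case unfolding iota_zero by (rule witt_span.zero)
next
  case (add a b)
  then obtain s j where s: "s \<in> flat_fil K v p n M" "a = (K.F ^^ j) s" by auto
  have sW: "s \<in> K.W" using s K.flat_W by auto
  have bW: "b \<in> K.W" using K.SF_W[OF K.flat_W add(2)] .
  obtain t y where ty: "t \<in> fil L v' p n (M - 1)" "y \<in> fil L v' p n (M - 1)" "\<iota> \<circ> s = witt_add L p n (L.F t) y"
    using flat_fil_subset[OF M s(1)] by blast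
  have tyW: "t \<in> L.W" "y \<in> L.W" using ty L.filD by auto
  have "\<iota> \<circ> a = witt_add L p n ((L.F ^^ Suc j) t) ((L.F ^^ j) y)"
    unfolding s(2) iota_F_iter[OF sW] ty(3) using L.F_iter_wadd[of "L.F t" y j] tyW by (simp add: funpow_swap1)
  then have "\<iota> \<circ> a \<in> L.SF (fil L v' p n (M - 1))"
    using L.SF_add[OF L.fil_W L.SF_elem[OF L.fil_W ty(1), of "Suc j"] L.SF_elem[OF L.fil_W ty(2), of j]] by simp
  moreover have "\<iota> \<circ> witt_add K p n a b = witt_add L p n (\<iota> \<circ> a) (\<iota> \<circ> b)"
    by (rule iota_wadd) (use s(2) sW bW in auto)
  ultimately show ?case using L.SF_add[OF L.fil_W _ add.IH] by (simp only:)
qed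

lemma sw_le:
  assumes "\<phi> \<in> K.W"
  shows "sw L v' p n (\<iota> \<circ> \<phi>) + 1 \<le> (LEAST m. m \<ge> 1 \<and> \<phi> \<in> flat_filF K v p n m)"
proof -
  define M where "M = (LEAST m. m \<ge> 1 \<and> \<phi> \<in> flat_filF K v p n m)"
  have "\<exists>m. m \<ge> 1 \<and> \<phi> \<in> flat_filF K v p n m" using K.flat_filF_exists[OF assms] by blast
  from LeastI_ex[OF this] have M: "M \<ge> 1" "\<phi> \<in> flat_filF K v p n M" by (auto simp: M_def)
  have "sw L v' p n (\<iota> \<circ> \<phi>) \<le> M - 1"
    unfolding sw_def by (rule Least_le) (rule flat_filF_subset[OF M])
  then show ?thesis using M(1) by (simp add: M_def)
qed

end

section \<open>Separating irreducible Witt vectors\<close>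

definition pth_approx :: "'a ring \<Rightarrow> ('a \<Rightarrow> int) \<Rightarrow> nat \<Rightarrow> 'a \<Rightarrow> 'a \<Rightarrow> bool" where
  "pth_approx K v p a c \<longleftrightarrow> c \<in> carrier K \<and> (c = \<zero>\<^bsub>K\<^esub> \<or> v c \<ge> 0) \<and>
     (a \<ominus>\<^bsub>K\<^esub> c [^]\<^bsub>K\<^esub> p = \<zero>\<^bsub>K\<^esub> \<or> v (a \<ominus>\<^bsub>K\<^esub> c [^]\<^bsub>K\<^esub> p) \<ge> 1)"

text \<open>To first order, the sum below is the last Witt component left after subtracting \<open>F\<close> of the
  vector of approximate roots \<open>b\<close>.\<close>

definition sep_ext :: "'a ring \<Rightarrow> ('a \<Rightarrow> int) \<Rightarrow> nat \<Rightarrow> nat \<Rightarrow> (nat \<Rightarrow> 'a) \<Rightarrow>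
    'b ring \<Rightarrow> ('b \<Rightarrow> int) \<Rightarrow> ('a \<Rightarrow> 'b) \<Rightarrow> (nat \<Rightarrow> 'b) \<Rightarrow> bool" where
  "sep_ext K v p i a L v' \<iota> b \<longleftrightarrow> E2 K v p L v' \<iota> \<and> (\<forall>j<i. pth_approx L v' p (\<iota> (a j)) (b j)) \<and>
     ((\<exists>j<i. \<nexists>c. pth_approx K v p (a j) c) \<longrightarrow>
       (\<Oplus>\<^bsub>L\<^esub>j\<in>{..<i}. b j [^]\<^bsub>L\<^esub> (p * (p ^ j - 1)) \<otimes>\<^bsub>L\<^esub> (\<iota> (a j) \<ominus>\<^bsub>L\<^esub> b j [^]\<^bsub>L\<^esub> p)) \<noteq> \<zero>\<^bsub>L\<^esub> \<and>
       v' (\<Oplus>\<^bsub>L\<^esub>j\<in>{..<i}. b j [^]\<^bsub>L\<^esub> (p * (p ^ j - 1)) \<otimes>\<^bsub>L\<^esub> (\<iota> (a j) \<ominus>\<^bsub>L\<^esub> b j [^]\<^bsub>L\<^esub> p)) < 2)"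

text \<open>In these components \<open>p\<close> divides \<open>q k\<close>, because
  \<open>p\<close> divides \<open>M\<close> while \<open>p * q k\<close> does not. So
  \<open>q k * v (x k)\<close> and \<open>M\<close> are both multiples of \<open>p\<close>, and
  strict inequality between them leaves room of at least \<open>p \<ge> 2\<close>.\<close>

lemma (in char_dvf) fil_high:
  assumes M: "M \<ge> 2" "p dvd M" and x: "x \<in> flat_fil R v p n M"
  shows "(\<lambda>k. if k < n \<and> \<not> p * q k dvd M then x k else \<zero>) \<in> fil R v p n (M - 2)"
  unfolding fil_iff_int
proof (intro conjI allI impI)
  have xf: "x \<in> fil R v p n M" using x flat_subset_fil by auto
  then have xW: "x \<in> W" using filD by auto
  show "(\<lambda>k. if k < n \<and> \<not> p * q k dvd M then x k else \<zero>) \<in> W"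
    using W_closed[OF xW] by (auto simp: witt_carrier_def)
  fix k assume k: "k < n"
  show "(if k < n \<and> \<not> p * q k dvd M then x k else \<zero>) = \<zero> \<or>
     - int (M - 2) \<le> int (q k) * v (if k < n \<and> \<not> p * q k dvd M then x k else \<zero>)"
  proof (cases "p * q k dvd M \<or> x k = \<zero>")
    case False
    have ge: "- int M \<le> int (q k) * v (x k)" using xf k False unfolding fil_iff_int by blast
    have M1: "1 \<le> M" using M by simp
    have ne: "int (q k) * v (x k) \<noteq> - int M" using x k False unfolding flat_iff[OF M1] by blast
    have "n - 1 - k \<noteq> 0" using False M(2) by auto
    then have "p dvd q k" by (simp add: dvd_power)
    then have d1: "int p dvd int (q k) * v (x k)" using int_dvd_int_iff dvd_mult2 by blast
    have "int p dvd int M" using M(2) by simp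
    with d1 have "int p dvd int (q k) * v (x k) + int M" by (rule dvd_add)
    moreover have "int (q k) * v (x k) + int M > 0" using ge ne by linarith
    ultimately have "int p \<le> int (q k) * v (x k) + int M" by (rule zdvd_imp_le)
    then have "- int (M - 2) \<le> int (q k) * v (x k)" using p_ge2 M(1) by linarith
    then show ?thesis using k False by simp
  qed auto
qed

lemma (in char_dvf) not_dvd_pred: assumes "M \<ge> 2" "p dvd M" shows "\<not> p dvd M - 1"
proof
  assume "p dvd M - 1"
  then have "p dvd M - (M - 1)" using assms(2) by (rule dvd_diff_nat[rotated])
  moreover have "M - (M - 1) = 1" using assms(1) by simp
  ultimately show False using p_ge2 by simp
qed

text \<open>For \<open>M\<close> prime to \<open>p\<close>, \<open>flat_fil\<close> at
  \<open>M\<close> is \<open>fil\<close> at \<open>M - 1\<close>. Modulo level \<open>M - 2\<close>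
  the image of \<open>x\<close> equals \<open>F w\<close>, so a component attaining
  \<open>M - 1\<close> has the value of a p-th power, which is the divisibility that flatness at
  \<open>M - 1\<close> demands. Every extension therefore separates in this case.\<close>

lemma (in e2_ext) not_dvd_case:
  assumes M: "M \<ge> 2" "\<not> p dvd M" and x: "x \<in> flat_fil K v p n M"
    and y: "y \<in> fil L v' p n (M - 2)" and w: "w \<in> L.W" and eq: "\<iota> \<circ> x = witt_add L p n y (L.F w)"
  shows "x \<in> flat_fil K v p n (M - 1)"
proof -
  have M1: "M - 1 \<ge> 1" "M \<ge> 1" using M by auto
  have M2: "M - 1 - 1 = M - 2" by simp
  have x1: "x \<in> fil K v p n (M - 1)" using x K.flat_eq_fil_pred[OF M1(2) M(2)] by simp
  have xW: "x \<in> K.W" using x1 K.filD by auto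
  have ix: "\<iota> \<circ> x \<in> fil L v' p n (M - 1)" using iota_fil[OF xW] x1 by simp
  have y1: "y \<in> fil L v' p n (M - 1)" by (rule subsetD[OF L.fil_mono y]) simp
  have yW: "y \<in> L.W" using y L.filD by auto
  have Fw: "L.F w \<in> fil L v' p n (M - 1)" by (rule L.fil_diff[OF ix y1 L.F_closed[OF w] eq[symmetric]])
  have eq': "witt_add L p n (L.F w) y = \<iota> \<circ> x" unfolding eq by (rule L.wadd_comm[OF L.F_closed[OF w] yW])
  show ?thesis unfolding K.flat_iff[OF M1(1)]
  proof (intro conjI x1 allI impI)
    fix k assume k: "k < n" "x k \<noteq> \<zero>\<^bsub>K\<^esub>" "int (K.q k) * v (x k) = - int (M - 1)"
    have xc: "x k \<in> carrier K" using K.W_closed[OF xW] .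
    have wc: "w k \<in> carrier L" using L.W_closed[OF w] .
    have vx: "v' (\<iota> (x k)) = v (x k)" using v_iota[OF xc k(2)] .
    have "L.vgt (witt_add L p n (L.F w) y k \<ominus>\<^bsub>L\<^esub> L.F w k) (- L.bnd (M - 1) * real (p ^ k))"
      by (rule L.wadd_strict[OF Fw _ M1(1) k(1)]) (use y M2 in simp)
    then have st: "L.vgt (\<iota> (x k) \<ominus>\<^bsub>L\<^esub> L.F w k) (- L.bnd (M - 1) * real (p ^ k))" unfolding eq' by simp
    have b: "- L.bnd (M - 1) * real (p ^ k) = real_of_int (v' (\<iota> (x k)))"
      using L.bnd_le_iff[OF k(1), of "M - 1" "v (x k)"] k(3) vx by simp
    have Fc: "L.F w k \<in> carrier L" using wc by (simp add: witt_F_def)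
    have "L.F w k \<ominus>\<^bsub>L\<^esub> \<iota> (x k) = \<ominus>\<^bsub>L\<^esub> (\<iota> (x k) \<ominus>\<^bsub>L\<^esub> L.F w k)"
      using Fc xc by (simp add: L.minus_eq L.minus_add L.a_comm)
    then have "L.vgt (L.F w k \<ominus>\<^bsub>L\<^esub> \<iota> (x k)) (real_of_int (v' (\<iota> (x k))))"
      using st Fc xc unfolding b by (simp add: L.vgt_neg)
    then have c: "L.F w k \<noteq> \<zero>\<^bsub>L\<^esub>" "v' (L.F w k) = v' (\<iota> (x k))"
      using L.w_close[of "L.F w k" "\<iota> (x k)"] Fc xc iota_zero_iff[OF xc] k(2) by auto
    have "w k \<noteq> \<zero>\<^bsub>L\<^esub>" using c(1) L.p_pos by (auto simp: witt_F_def L.nat_pow_zero)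
    then have "v' (L.F w k) = int p * v' (w k)" using L.v_pow[OF wc] by (simp add: witt_F_def)
    then have "int (K.q k) * (int p * v' (w k)) = - int (M - 1)" using k(3) c(2) vx by simp
    then have "int (p * K.q k) * (- v' (w k)) = int (M - 1)" by (simp add: algebra_simps)
    then have "int (p * K.q k) dvd int (M - 1)" by (metis dvd_triv_left)
    then show "p * K.q k dvd M - 1" using int_dvd_int_iff by blast
  qed
qed

context char_dvf begin

lemma dvd_iff_lt_min:
  assumes "M \<ge> 1" "k < n"
  shows "p * q k dvd M \<longleftrightarrow> n - 1 - k < min n (multiplicity p M)"
proof -
  have "p ^ Suc (n - 1 - k) dvd M \<longleftrightarrow> Suc (n - 1 - k) \<le> multiplicity p M"
    using assms(1) p_ge2 by (intro power_dvd_iff_le_multiplicity) auto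
  then show ?thesis using assms(2) by auto
qed

lemma top_coeff_vge:
  assumes u: "u \<in> fil R v p n M" and k: "k < n" "p * q k dvd M" and pi: "\<pi> \<in> carrier R" "\<pi> \<noteq> \<zero>" "v \<pi> = 1"
  shows "vge (u k \<otimes> \<pi> [^] (M div q k)) 0"
proof (cases "u k = \<zero>")
  case True then show ?thesis using pi_pow[OF pi] by simp
next
  case False
  have uc: "u k \<in> carrier R" using W_closed[OF filD[OF u]] .
  have "- int M \<le> int (q k) * v (u k)" using u k False unfolding fil_iff_int by auto
  moreover have "int M = int (q k) * int (M div q k)"
    using dvd_mult_right[OF k(2)] by (metis dvd_mult_div_cancel of_nat_mult)
  ultimately have "int (q k) * (v (u k) + int (M div q k)) \<ge> 0" by (simp add: algebra_simps)
  moreover have "int (q k) > 0" using p_pos by simp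
  ultimately have "v (u k) + int (M div q k) \<ge> 0" using zero_le_mult_iff by (metis not_less)
  then show ?thesis using w_mult[OF uc pi_pow(1)[OF pi] False pi_pow(2)[OF pi], of "M div q k"] pi_pow(3)[OF pi]
    by (simp add: vge_def)
qed

end

text \<open>If \<open>\<iota> \<circ> u\<close> were reducible modulo \<open>F\<close>, the
  remainder \<open>z\<close> of \<open>F t\<close> would have level \<open>M - 2\<close>, so its
  last component would have pole order at most \<open>M - 2\<close>. To second order that component
  is the sum of \<open>sep_ext\<close> divided by \<open>\<pi>' ^ M\<close>, and the sum would have
  value at least two.\<close>

lemma (in e2_ext) dvd_case_contradiction:
  assumes M: "M \<ge> 2" "p dvd M" and u: "u \<in> fil K v p n M" and u0: "\<forall>k<n. u k \<noteq> \<zero>\<^bsub>K\<^esub> \<longrightarrow> p * K.q k dvd M"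
    and pi: "\<pi> \<in> carrier K" "\<pi> \<noteq> \<zero>\<^bsub>K\<^esub>" "v \<pi> = 1"
    and i: "i = min n (multiplicity p M)"
    and a: "\<And>j. j < i \<Longrightarrow> a j = u (n - 1 - j) \<otimes>\<^bsub>K\<^esub> \<pi> [^]\<^bsub>K\<^esub> (M div p ^ j)"
    and sep: "sep_ext K v p i a L v' \<iota> b" and na: "\<exists>j<i. \<nexists>c. pth_approx K v p (a j) c"
    and y: "y \<in> fil L v' p n (M - 2)" and w: "w \<in> L.W" and eq: "\<iota> \<circ> u = witt_add L p n y (L.F w)"
  shows False
proof -
  have M1: "M \<ge> 1" using M by simp
  define N where "N = n - 1"
  have n: "n = Suc N" using na i by (auto simp: N_def)
  have uW: "u \<in> K.W" using K.filD[OF u] .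
  have iu: "\<iota> \<circ> u \<in> L.W" using iota_W[OF uW] .
  define \<pi>' where "\<pi>' = \<iota> \<pi>"
  have pi': "\<pi>' \<in> carrier L" "\<pi>' \<noteq> \<zero>\<^bsub>L\<^esub>" "v' \<pi>' = 1" using pi_L[OF pi] by (auto simp: \<pi>'_def)
  note pl = L.pi_pow[OF pi']
  define c where "c k = b (n - 1 - k)" for k
  have uc: "u k \<in> carrier K" for k using K.W_closed[OF uW] .
  have ij: "n - 1 - k < i" if "k < n" "p * K.q k dvd M" for k
    using that K.dvd_iff_lt_min[OF M1] i by simp
  have ia: "\<iota> (a (n - 1 - k)) = \<iota> (u k) \<otimes>\<^bsub>L\<^esub> \<pi>' [^]\<^bsub>L\<^esub> (M div K.q k)" if k: "k < n" "p * K.q k dvd M" for k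
  proof -
    have "n - 1 - (n - 1 - k) = k" using k by simp
    then have "a (n - 1 - k) = u k \<otimes>\<^bsub>K\<^esub> \<pi> [^]\<^bsub>K\<^esub> (M div K.q k)" using a[OF ij[OF k]] by simp
    then show ?thesis using uc K.pi_pow(1)[OF pi] iota_pow[OF pi(1)] by (simp add: \<pi>'_def)
  qed
  have c: "\<forall>k<n. p * K.q k dvd M \<longrightarrow> c k \<in> carrier L \<and> L.vge (c k) 0 \<and> L.vge ((\<iota> \<circ> u) k \<otimes>\<^bsub>L\<^esub> \<pi>' [^]\<^bsub>L\<^esub> (M div K.q k) \<ominus>\<^bsub>L\<^esub> c k [^]\<^bsub>L\<^esub> p) 1"
  proof (intro allI impI)
    fix k assume k: "k < n" "p * K.q k dvd M"
    have "pth_approx L v' p (\<iota> (a (n - 1 - k))) (b (n - 1 - k))" using sep ij[OF k] by (simp add: sep_ext_def)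
    then show "c k \<in> carrier L \<and> L.vge (c k) 0 \<and> L.vge ((\<iota> \<circ> u) k \<otimes>\<^bsub>L\<^esub> \<pi>' [^]\<^bsub>L\<^esub> (M div K.q k) \<ominus>\<^bsub>L\<^esub> c k [^]\<^bsub>L\<^esub> p) 1"
      unfolding ia[OF k] pth_approx_def c_def L.vge_def comp_def by auto
  qed
  have u0': "\<forall>k<n. (\<iota> \<circ> u) k \<noteq> \<zero>\<^bsub>L\<^esub> \<longrightarrow> p * K.q k dvd M" using u0 iota_zero_iff[OF uc] by auto
  define t where "t = (\<lambda>k. if k < n \<and> p * K.q k dvd M then c k \<otimes>\<^bsub>L\<^esub> inv\<^bsub>L\<^esub> (\<pi>' [^]\<^bsub>L\<^esub> (M div (p * K.q k))) else \<zero>\<^bsub>L\<^esub>)"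
  note ta = L.top_approx[OF iu u0' pi' c, folded t_def]
  have FtW: "L.F t \<in> L.W" using ta(1) by simp
  obtain z where z: "z \<in> L.W" "witt_add L p n (L.F t) z = \<iota> \<circ> u" using L.wdiff[OF iu FtW] by blast
  have zg: "L.vge (z k) (- L.bnd M * real (p ^ k) + 1)" if "k < n" for k
    by (rule L.wadd_gain_conv[OF FtW z(1) _ _ _ that]) (use ta(2,3) z(2) in auto)
  then have "z \<in> fil L v' p n (M - 1)"
    unfolding L.fil_pred_iff[OF M1] using z(1) L.vge_imp_vgt[OF zg] by simp
  then have "z \<in> fil L v' p n (M - 2)"
    by (rule L.fil_descend[OF M iu ta(1) w _ z(2) y eq])
  then have zN: "L.vge (z N) (- L.bnd (M - 2) * real (p ^ N))" by (rule L.fil_vge)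
  have "L.bnd m * real (p ^ N) = real m" for m unfolding L.bnd_def N_def using L.p_pos by simp
  then have bnd: "- L.bnd m * real (p ^ N) = - real m" for m by simp
  define T where "T l = L.F t l [^]\<^bsub>L\<^esub> (p ^ (N - l) - 1) \<otimes>\<^bsub>L\<^esub> (\<iota> (u l) \<ominus>\<^bsub>L\<^esub> L.F t l)" for l
  have Ftc: "L.F t l \<in> carrier L" for l using L.W_closed[OF FtW] .
  have Tc: "T l \<in> carrier L" for l using Ftc uc by (simp add: T_def)
  \<comment> \<open>\<open>z\<close> lies beyond the bound by one in every component, so the
    quadratic error has value at least \<open>- M + 2\<close>, the same bound as for
    \<open>z N\<close>.\<close>
  have "L.vge ((\<Oplus>\<^bsub>L\<^esub>l\<in>{..<n}. T l) \<ominus>\<^bsub>L\<^esub> z N) (- L.bnd M * real (p ^ N) + 2 * 1)"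
    using L.witt_Q_vge[OF FtW z(1) _ n ta(2) zg] unfolding z(2) T_def by simp
  then have "L.vge ((\<Oplus>\<^bsub>L\<^esub>l\<in>{..<n}. T l) \<ominus>\<^bsub>L\<^esub> z N) (- real (M - 2))"
    unfolding bnd using M(1) by (simp add: of_nat_diff)
  then have "L.vge (((\<Oplus>\<^bsub>L\<^esub>l\<in>{..<n}. T l) \<ominus>\<^bsub>L\<^esub> z N) \<oplus>\<^bsub>L\<^esub> z N) (- real (M - 2))"
    using zN Tc L.W_closed[OF z(1)] unfolding bnd by (intro L.vge_add) auto
  moreover have "((\<Oplus>\<^bsub>L\<^esub>l\<in>{..<n}. T l) \<ominus>\<^bsub>L\<^esub> z N) \<oplus>\<^bsub>L\<^esub> z N = (\<Oplus>\<^bsub>L\<^esub>l\<in>{..<n}. T l)"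
    using Tc L.W_closed[OF z(1)] by (simp add: L.minus_eq L.a_assoc L.l_neg)
  ultimately have "L.vge (\<Oplus>\<^bsub>L\<^esub>l\<in>{..<n}. T l) (- real (M - 2))" by simp
  then have "L.vge ((\<Oplus>\<^bsub>L\<^esub>l\<in>{..<n}. T l) \<otimes>\<^bsub>L\<^esub> \<pi>' [^]\<^bsub>L\<^esub> M) (- real (M - 2) + real M)"
    using Tc pl by (intro L.vge_mult) (auto simp: L.vge_def)
  then have v2: "L.vge ((\<Oplus>\<^bsub>L\<^esub>l\<in>{..<n}. T l) \<otimes>\<^bsub>L\<^esub> \<pi>' [^]\<^bsub>L\<^esub> M) 2" using M(1) by (simp add: of_nat_diff)
  define U where "U j = b j [^]\<^bsub>L\<^esub> (p * (p ^ j - 1)) \<otimes>\<^bsub>L\<^esub> (\<iota> (a j) \<ominus>\<^bsub>L\<^esub> b j [^]\<^bsub>L\<^esub> p)" for j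
  \<comment> \<open>Component \<open>N - j\<close> contributes \<open>F t\<close> to the power
    \<open>p ^ j - 1\<close> and one difference, each with denominator
    \<open>\<pi>' ^ (M div p ^ j)\<close>. Together these make \<open>\<pi>' ^ M\<close>,
    independently of \<open>j\<close>.\<close>
  have TU: "T (N - j) \<otimes>\<^bsub>L\<^esub> \<pi>' [^]\<^bsub>L\<^esub> M = (if j < i then U j else \<zero>\<^bsub>L\<^esub>)" if j: "j < n" for j
  proof -
    define k where "k = N - j"
    have k: "k < n" "n - 1 - k = j" "N - k = j" using j n by (auto simp: k_def)
    show ?thesis
    proof (cases "j < i")
      case False
      then have "\<not> p * K.q k dvd M" using K.dvd_iff_lt_min[OF M1 k(1)] k i by simp
      from ta(6)[OF k(1) this] have "\<iota> (u k) \<ominus>\<^bsub>L\<^esub> L.F t k = \<zero>\<^bsub>L\<^esub>" by (simp add: L.minus_eq)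
      then show ?thesis using False Ftc pl by (simp add: T_def k_def)
    next
      case True
      then have d: "p * K.q k dvd M" using K.dvd_iff_lt_min[OF M1 k(1)] k i by simp
      have q: "K.q k = p ^ j" using k by simp
      let ?P = "\<pi>' [^]\<^bsub>L\<^esub> (M div p ^ j)"
      have bc: "b j \<in> carrier L" using c k d by (auto simp: c_def)
      have cj: "c k = b j" using k by (simp add: c_def)
      have qM: "p ^ j * (M div p ^ j) = M" using dvd_mult_right[OF d] q by simp
      have e1: "L.F t k = b j [^]\<^bsub>L\<^esub> p \<otimes>\<^bsub>L\<^esub> inv\<^bsub>L\<^esub> ?P" using ta(4)[OF k(1) d] unfolding q cj .
      have e2: "\<iota> (u k) \<ominus>\<^bsub>L\<^esub> L.F t k = (\<iota> (a j) \<ominus>\<^bsub>L\<^esub> b j [^]\<^bsub>L\<^esub> p) \<otimes>\<^bsub>L\<^esub> inv\<^bsub>L\<^esub> ?P"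
        using ta(5)[OF k(1) d] ia[OF k(1) d] k(2) unfolding q cj by simp
      have ac: "\<iota> (a j) \<ominus>\<^bsub>L\<^esub> b j [^]\<^bsub>L\<^esub> p \<in> carrier L" using a[OF True] uc pi bc by simp
      define r where "r = p ^ j - 1"
      have r: "Suc r = p ^ j" using L.p_pos by (simp add: r_def)
      have PM: "\<pi>' [^]\<^bsub>L\<^esub> M = ?P [^]\<^bsub>L\<^esub> Suc r" using pi' by (simp add: L.nat_pow_pow r qM mult.commute del: L.nat_pow_Suc)
      have "T k \<otimes>\<^bsub>L\<^esub> \<pi>' [^]\<^bsub>L\<^esub> M = ((b j [^]\<^bsub>L\<^esub> p) [^]\<^bsub>L\<^esub> r \<otimes>\<^bsub>L\<^esub> (inv\<^bsub>L\<^esub> ?P) [^]\<^bsub>L\<^esub> r) \<otimes>\<^bsub>L\<^esub> ((\<iota> (a j) \<ominus>\<^bsub>L\<^esub> b j [^]\<^bsub>L\<^esub> p) \<otimes>\<^bsub>L\<^esub> inv\<^bsub>L\<^esub> ?P) \<otimes>\<^bsub>L\<^esub> ?P [^]\<^bsub>L\<^esub> Suc r"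
        unfolding T_def k(3) e2 PM r_def[symmetric] unfolding e1
        using L.nat_pow_distrib[of "b j [^]\<^bsub>L\<^esub> p" "inv\<^bsub>L\<^esub> ?P" r] bc pl by simp
      also have "\<dots> = ((b j [^]\<^bsub>L\<^esub> p) [^]\<^bsub>L\<^esub> r \<otimes>\<^bsub>L\<^esub> (\<iota> (a j) \<ominus>\<^bsub>L\<^esub> b j [^]\<^bsub>L\<^esub> p)) \<otimes>\<^bsub>L\<^esub> ((inv\<^bsub>L\<^esub> ?P) [^]\<^bsub>L\<^esub> Suc r \<otimes>\<^bsub>L\<^esub> ?P [^]\<^bsub>L\<^esub> Suc r)"
        using bc ac pl by (simp add: L.m_ac)
      also have "(inv\<^bsub>L\<^esub> ?P) [^]\<^bsub>L\<^esub> Suc r \<otimes>\<^bsub>L\<^esub> ?P [^]\<^bsub>L\<^esub> Suc r = (?P \<otimes>\<^bsub>L\<^esub> inv\<^bsub>L\<^esub> ?P) [^]\<^bsub>L\<^esub> Suc r"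
        unfolding L.nat_pow_distrib[OF pl(1)[of "M div p ^ j"] pl(4)[of "M div p ^ j"], of "Suc r"]
        by (rule L.m_comm) (use pl(1,4) in auto)
      also have "\<dots> = \<one>\<^bsub>L\<^esub>" unfolding pl(7) by simp
      finally have "T k \<otimes>\<^bsub>L\<^esub> \<pi>' [^]\<^bsub>L\<^esub> M = U j" using bc ac by (simp add: U_def L.nat_pow_pow r_def)
      then show ?thesis using True by (simp add: k_def)
    qed
  qed
  have bij: "(\<lambda>j. N - j) ` {..<n} = {..<n}"
  proof -
    have "l \<in> (\<lambda>j. N - j) ` {..<n}" if "l < n" for l using that n by (intro image_eqI[of _ _ "N - l"]) auto
    then show ?thesis using n by auto
  qed
  have inj: "inj_on (\<lambda>j. N - j) {..<n}" using n by (auto simp: inj_on_def)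
  have "(\<Oplus>\<^bsub>L\<^esub>l\<in>{..<n}. T l) \<otimes>\<^bsub>L\<^esub> \<pi>' [^]\<^bsub>L\<^esub> M = (\<Oplus>\<^bsub>L\<^esub>l\<in>{..<n}. T l \<otimes>\<^bsub>L\<^esub> \<pi>' [^]\<^bsub>L\<^esub> M)"
    using Tc pl by (intro L.finsum_ldistr) auto
  also have "\<dots> = (\<Oplus>\<^bsub>L\<^esub>l\<in>(\<lambda>j. N - j) ` {..<n}. T l \<otimes>\<^bsub>L\<^esub> \<pi>' [^]\<^bsub>L\<^esub> M)" by (simp only: bij)
  also have "\<dots> = (\<Oplus>\<^bsub>L\<^esub>j\<in>{..<n}. T (N - j) \<otimes>\<^bsub>L\<^esub> \<pi>' [^]\<^bsub>L\<^esub> M)"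
    by (rule L.finsum_reindex[OF _ inj]) (use Tc pl in auto)
  also have "\<dots> = (\<Oplus>\<^bsub>L\<^esub>j\<in>{..<i}. U j)"
    by (rule L.add.finprod_mono_neutral_cong_right) (use TU i Tc pl in auto)
  finally have "L.vge (\<Oplus>\<^bsub>L\<^esub>j\<in>{..<i}. U j) 2" using v2 by simp
  moreover have "(\<Oplus>\<^bsub>L\<^esub>j\<in>{..<i}. U j) \<noteq> \<zero>\<^bsub>L\<^esub>" "v' (\<Oplus>\<^bsub>L\<^esub>j\<in>{..<i}. U j) < 2"
    using sep na unfolding sep_ext_def U_def by auto
  ultimately show False by (simp add: L.vge_def)
qed

text \<open>For \<open>p\<close> dividing \<open>M\<close> two situations remain. If some leading
  residue is no p-th power over \<open>K\<close>, the extension from \<open>ext\<close> works. If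
  all are, the p-th roots exist over \<open>K\<close> itself; a reduction in any extension then
  lowers the level of the remainder over \<open>K\<close>, against irreducibility.\<close>

lemma irreducible_separated:
  fixes K :: "'a ring"
  assumes K: "char_dvf K v p"
    and ext: "\<And>i a. (\<forall>j<i. a j \<in> carrier K \<and> (a j = \<zero>\<^bsub>K\<^esub> \<or> v (a j) \<ge> 0)) \<Longrightarrow>
      \<exists>(L :: 'b ring) v' \<iota> b. sep_ext K v p i a L v' \<iota> b"
    and M: "M \<ge> 2" and x: "x \<in> flat_fil K v p n M"
    and irr: "\<not> (\<exists>x'\<in>witt_carrier K n. \<exists>x''\<in>flat_fil K v p n (M - 1). x = witt_add K p n x'' (witt_F K p x'))"
  shows "\<exists>(L :: 'b ring) v' \<iota>. E2 K v p L v' \<iota> \<and>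
    \<not> (\<exists>y\<in>fil L v' p n (M - 2). \<exists>w\<in>witt_carrier L n. \<iota> \<circ> x = witt_add L p n y (witt_F L p w))"
proof -
  interpret K: char_dvf K v p n by fact
  have M1: "M \<ge> 1" using M by simp
  have xf: "x \<in> fil K v p n M" using x K.flat_subset_fil by auto
  have xW: "x \<in> K.W" using K.filD[OF xf] .
  \<comment> \<open>With \<open>i = 0\<close> the conditions on residues are empty, and
    \<open>ext\<close> yields just some extension in \<open>E2\<close>.\<close>
  obtain L0 :: "'b ring" and v0 \<iota>0 b0 where "sep_ext K v p 0 (\<lambda>_. \<zero>\<^bsub>K\<^esub>) L0 v0 \<iota>0 b0"
    using ext[of 0] by blast
  then have E0: "E2 K v p L0 v0 \<iota>0" by (simp add: sep_ext_def)
  interpret E0: e2_ext K v p n L0 v0 \<iota>0 by unfold_locales (fact E0)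
  show ?thesis
  proof (cases "p dvd M")
    case False
    have "\<not> (\<exists>y\<in>fil L0 v0 p n (M - 2). \<exists>w\<in>witt_carrier L0 n. \<iota>0 \<circ> x = witt_add L0 p n y (witt_F L0 p w))"
    proof
      assume "\<exists>y\<in>fil L0 v0 p n (M - 2). \<exists>w\<in>witt_carrier L0 n. \<iota>0 \<circ> x = witt_add L0 p n y (witt_F L0 p w)"
      then have "x \<in> flat_fil K v p n (M - 1)" using E0.not_dvd_case[OF M False x] by blast
      moreover have "x = witt_add K p n x (witt_F K p (witt_zero K))" using xW by simp
      ultimately show False using irr K.wzero_closed by blast
    qed
    with E0 show ?thesis by blast
  next
    case True
    have flat_eq: "flat_fil K v p n (M - 1) = fil K v p n (M - 2)"
    proof -
      have "M - 1 \<ge> 1" using M by simp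
      from K.flat_eq_fil_pred[OF this K.not_dvd_pred[OF M True]] show ?thesis by (simp add: numeral_2_eq_2)
    qed
    \<comment> \<open>The split by divisibility has disjoint supports, so \<open>x\<close> is the
      Witt sum of the two parts without carry. The part \<open>hi\<close> already has level
      \<open>M - 2\<close> and can be ignored.\<close>
    define hi where "hi k = (if k < n \<and> \<not> p * K.q k dvd M then x k else \<zero>\<^bsub>K\<^esub>)" for k
    define u where "u k = (if k < n \<and> p * K.q k dvd M then x k else \<zero>\<^bsub>K\<^esub>)" for k
    have hi: "hi \<in> fil K v p n (M - 2)" using K.fil_high[OF M True x] by (simp add: hi_def[abs_def])
    have hiW: "hi \<in> K.W" using K.filD[OF hi] .
    have uW: "u \<in> K.W" using K.W_closed[OF xW] by (auto simp: witt_carrier_def u_def)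
    have uf: "u \<in> fil K v p n M" using xf uW unfolding K.fil_iff_int by (auto simp: u_def)
    have x_eq: "x = witt_add K p n hi u"
    proof (rule K.W_eqI[OF xW])
      show "witt_add K p n hi u \<in> K.W" using hiW uW by simp
      fix k assume k: "k < n"
      have "witt_add K p n hi u k = hi k \<oplus>\<^bsub>K\<^esub> u k"
        by (rule K.wadd_disjoint[OF hiW uW _ k]) (auto simp: hi_def u_def)
      then show "x k = witt_add K p n hi u k" using k K.W_closed[OF xW] by (simp add: hi_def u_def)
    qed
    have u0: "\<forall>k<n. u k \<noteq> \<zero>\<^bsub>K\<^esub> \<longrightarrow> p * K.q k dvd M" by (auto simp: u_def)
    obtain \<pi> where pi: "\<pi> \<in> carrier K" "\<pi> \<noteq> \<zero>\<^bsub>K\<^esub>" "v \<pi> = 1" using K.dvf by (auto simp: dvf_def)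
    define i where "i = min n (multiplicity p M)"
    define a where "a j = u (n - 1 - j) \<otimes>\<^bsub>K\<^esub> \<pi> [^]\<^bsub>K\<^esub> (M div p ^ j)" for j
    have jk: "n - 1 - j < n \<and> K.q (n - 1 - j) = p ^ j \<and> p * K.q (n - 1 - j) dvd M" if "j < i" for j
    proof -
      have j: "j < n" "n - 1 - (n - 1 - j) = j" "n - 1 - j < n" using that by (auto simp: i_def)
      then have "p * K.q (n - 1 - j) dvd M" using K.dvd_iff_lt_min[OF M1 j(3)] that by (simp add: i_def)
      with j show ?thesis by simp
    qed
    have ac: "\<forall>j<i. a j \<in> carrier K \<and> (a j = \<zero>\<^bsub>K\<^esub> \<or> v (a j) \<ge> 0)"
    proof (intro allI impI)
      fix j assume j: "j < i"
      have "K.vge (u (n - 1 - j) \<otimes>\<^bsub>K\<^esub> \<pi> [^]\<^bsub>K\<^esub> (M div K.q (n - 1 - j))) 0"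
        using jk[OF j] by (intro K.top_coeff_vge[OF uf _ _ pi]) auto
      then have "K.vge (a j) 0" using jk[OF j] by (simp add: a_def)
      then show "a j \<in> carrier K \<and> (a j = \<zero>\<^bsub>K\<^esub> \<or> v (a j) \<ge> 0)"
        using K.W_closed[OF uW] K.pi_pow(1)[OF pi] by (simp add: a_def K.vge_def)
    qed
    have shift: "\<exists>y'\<in>fil L v' p n (M - 2). \<iota> \<circ> u = witt_add L p n y' (witt_F L p w)"
      if E: "E2 K v p L v' \<iota>" and y: "y \<in> fil L v' p n (M - 2)" and w: "w \<in> witt_carrier L n"
        and e: "\<iota> \<circ> x = witt_add L p n y (witt_F L p w)" for L :: "'b ring" and v' \<iota> y w
    proof -
      interpret E: e2_ext K v p n L v' \<iota> by unfold_locales (fact E)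
      have hf: "\<iota> \<circ> hi \<in> fil L v' p n (M - 2)" using E.iota_fil[OF hiW] hi by simp
      have yW: "y \<in> E.L.W" and hW: "\<iota> \<circ> hi \<in> E.L.W" and FW: "witt_F L p w \<in> E.L.W" and iuW: "\<iota> \<circ> u \<in> E.L.W"
        using y hf w E.L.filD E.iota_W[OF uW] by auto
      obtain y' where y': "y' \<in> E.L.W" "witt_add L p n (\<iota> \<circ> hi) y' = y" using E.L.wdiff[OF yW hW] by blast
      have "witt_add L p n (\<iota> \<circ> hi) (\<iota> \<circ> u) = witt_add L p n (\<iota> \<circ> hi) (witt_add L p n y' (witt_F L p w))"
        using e E.iota_wadd[OF hiW uW] E.L.wadd_assoc[OF hW y'(1) FW] unfolding x_eq[symmetric] y'(2) by simp
      then have "\<iota> \<circ> u = witt_add L p n y' (witt_F L p w)"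
        by (rule E.L.wadd_cancel[OF hW iuW E.L.wadd_closed[OF y'(1) FW]])
      moreover have "y' \<in> fil L v' p n (M - 2)" by (rule E.L.fil_diff[OF y hf y'])
      ultimately show ?thesis by blast
    qed
    show ?thesis
    proof (cases "\<exists>j<i. \<nexists>c. pth_approx K v p (a j) c")
      case na: True
      obtain L :: "'b ring" and v' \<iota> b where sep: "sep_ext K v p i a L v' \<iota> b" using ext[OF ac] by blast
      then have E: "E2 K v p L v' \<iota>" by (simp add: sep_ext_def)
      interpret E: e2_ext K v p n L v' \<iota> by unfold_locales (fact E)
      have "\<not> (\<exists>y\<in>fil L v' p n (M - 2). \<exists>w\<in>witt_carrier L n. \<iota> \<circ> x = witt_add L p n y (witt_F L p w))"
      proof
        assume "\<exists>y\<in>fil L v' p n (M - 2). \<exists>w\<in>witt_carrier L n. \<iota> \<circ> x = witt_add L p n y (witt_F L p w)"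
        then obtain y w where "y \<in> fil L v' p n (M - 2)" and w: "w \<in> witt_carrier L n"
          and "\<iota> \<circ> x = witt_add L p n y (witt_F L p w)" by blast
        from shift[OF E this] obtain y' where y': "y' \<in> fil L v' p n (M - 2)" "\<iota> \<circ> u = witt_add L p n y' (witt_F L p w)" by blast
        show False
          by (rule E.dvd_case_contradiction[OF M True uf u0 pi i_def a_def sep na y'(1) w y'(2)])
      qed
      with E show ?thesis by blast
    next
      case False
      then obtain c where c: "\<And>j. j < i \<Longrightarrow> pth_approx K v p (a j) (c j)" by metis
      define b where "b k = c (n - 1 - k)" for k
      have b: "\<forall>k<n. p * K.q k dvd M \<longrightarrow> b k \<in> carrier K \<and> K.vge (b k) 0 \<and> K.vge (u k \<otimes>\<^bsub>K\<^esub> \<pi> [^]\<^bsub>K\<^esub> (M div K.q k) \<ominus>\<^bsub>K\<^esub> b k [^]\<^bsub>K\<^esub> p) 1"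
      proof (intro allI impI)
        fix k assume k: "k < n" "p * K.q k dvd M"
        have j: "n - 1 - k < i" using K.dvd_iff_lt_min[OF M1 k(1)] k(2) by (simp add: i_def)
        have "a (n - 1 - k) = u k \<otimes>\<^bsub>K\<^esub> \<pi> [^]\<^bsub>K\<^esub> (M div K.q k)" using k by (simp add: a_def)
        with c[OF j] show "b k \<in> carrier K \<and> K.vge (b k) 0 \<and> K.vge (u k \<otimes>\<^bsub>K\<^esub> \<pi> [^]\<^bsub>K\<^esub> (M div K.q k) \<ominus>\<^bsub>K\<^esub> b k [^]\<^bsub>K\<^esub> p) 1"
          unfolding pth_approx_def b_def K.vge_def by auto
      qed
      define t where "t = (\<lambda>k. if k < n \<and> p * K.q k dvd M then b k \<otimes>\<^bsub>K\<^esub> inv\<^bsub>K\<^esub> (\<pi> [^]\<^bsub>K\<^esub> (M div (p * K.q k))) else \<zero>\<^bsub>K\<^esub>)"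
      note ta = K.top_approx[OF uW u0 pi b, folded t_def]
      have FtW: "K.F t \<in> K.W" using ta(1) by simp
      obtain z where z: "z \<in> K.W" "witt_add K p n (K.F t) z = u" using K.wdiff[OF uW FtW] by blast
      have zg: "K.vge (z k) (- K.bnd M * real (p ^ k) + 1)" if "k < n" for k
        by (rule K.wadd_gain_conv[OF FtW z(1) _ _ _ that]) (use ta(2,3) z(2) in auto)
      then have z1: "z \<in> fil K v p n (M - 1)"
        unfolding K.fil_pred_iff[OF M1] using z(1) K.vge_imp_vgt[OF zg] by simp
      \<comment> \<open>\<open>z\<close> is defined over \<open>K\<close> but its drop to level
        \<open>M - 2\<close> is only derived over \<open>L0\<close>; \<open>iota_fil\<close> brings
        it back, since \<open>\<iota>0\<close> preserves values.\<close>
      have "\<not> (\<exists>y\<in>fil L0 v0 p n (M - 2). \<exists>w\<in>witt_carrier L0 n. \<iota>0 \<circ> x = witt_add L0 p n y (witt_F L0 p w))"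
      proof
        assume "\<exists>y\<in>fil L0 v0 p n (M - 2). \<exists>w\<in>witt_carrier L0 n. \<iota>0 \<circ> x = witt_add L0 p n y (witt_F L0 p w)"
        then obtain y w where "y \<in> fil L0 v0 p n (M - 2)" and w: "w \<in> witt_carrier L0 n"
          and "\<iota>0 \<circ> x = witt_add L0 p n y (witt_F L0 p w)" by blast
        from shift[OF E0 this] obtain y' where y': "y' \<in> fil L0 v0 p n (M - 2)" "\<iota>0 \<circ> u = witt_add L0 p n y' (witt_F L0 p w)" by blast
        have iz1: "\<iota>0 \<circ> z \<in> fil L0 v0 p n (M - 1)" using E0.iota_fil[OF z(1)] z1 by simp
        have ize: "witt_add L0 p n (witt_F L0 p (\<iota>0 \<circ> t)) (\<iota>0 \<circ> z) = \<iota>0 \<circ> u"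
          using E0.iota_wadd[OF FtW z(1)] E0.iota_F[OF ta(1)] z(2) by simp
        have "\<iota>0 \<circ> z \<in> fil L0 v0 p n (M - 2)"
          by (rule E0.L.fil_descend[OF M True E0.iota_W[OF uW] E0.iota_W[OF ta(1)] w iz1 ize y'])
        then have z2: "z \<in> fil K v p n (M - 2)" using E0.iota_fil[OF z(1)] by simp
        have "x = witt_add K p n (witt_add K p n hi z) (K.F t)"
          unfolding x_eq z(2)[symmetric]
          using K.wadd_comm[OF FtW z(1)] K.wadd_assoc[OF hiW z(1) FtW] by simp
        moreover have "witt_add K p n hi z \<in> flat_fil K v p n (M - 1)" unfolding flat_eq by (rule K.fil_add[OF hi z2])
        ultimately show False using irr ta(1) by blast
      qed
      with E0 show ?thesis by blast
    qed
  qed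
qed

text \<open>A Horner form for \<open>flat_filF\<close>: coefficients at flat level \<open>M\<close>,
  nested by \<open>F\<close>. The innermost term has level \<open>M - 1\<close>, so that splitting
  off \<open>F\<close> there leaves a vector of level \<open>(M - 1) div p \<le> M - 2\<close> and
  the reduction ends.\<close>

inductive_set F_poly :: "'a ring \<Rightarrow> ('a \<Rightarrow> int) \<Rightarrow> nat \<Rightarrow> nat \<Rightarrow> nat \<Rightarrow> (nat \<Rightarrow> 'a) set" for K v p n M where
  base: "x \<in> fil K v p n (M - 1) \<Longrightarrow> x \<in> F_poly K v p n M"
| step: "x \<in> flat_fil K v p n M \<Longrightarrow> \<psi> \<in> F_poly K v p n M \<Longrightarrow> witt_add K p n x (witt_F K p \<psi>) \<in> F_poly K v p n M"

lemma F_poly_W: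
  assumes "char_dvf K v p" "\<psi> \<in> F_poly K v p n M" shows "\<psi> \<in> witt_carrier K n"
proof -
  interpret K: char_dvf K v p n by fact
  show ?thesis using assms(2)
  proof induction
    case (base x) then show ?case by (rule K.filD)
  next
    case (step x \<psi>) then show ?case using K.flat_W[of M] by (intro K.wadd_closed K.F_closed) auto
  qed
qed

lemma F_poly_add:
  assumes "char_dvf K v p" "M \<ge> 1" "s \<in> flat_fil K v p n M" "\<psi> \<in> F_poly K v p n M"
  shows "witt_add K p n ((witt_F K p ^^ j) s) \<psi> \<in> F_poly K v p n M"
proof -
  interpret K: char_dvf K v p n by fact
  have sW: "s \<in> K.W" using assms(3) K.flat_W by auto
  have zero: "witt_zero K \<in> F_poly K v p n M" by (rule F_poly.base) simp
  show ?thesis using assms(4)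
  proof (induction j arbitrary: \<psi>)
    case 0
    then show ?case
    proof cases
      case base
      have "\<psi> \<in> flat_fil K v p n M" using base K.fil_pred_subset_flat[OF assms(2)] by auto
      then have "witt_add K p n s \<psi> \<in> flat_fil K v p n M" by (rule K.flat_add[OF assms(2,3)])
      from F_poly.step[OF this zero] show ?thesis using sW F_poly_W[OF assms(1) 0] by simp
    next
      case (step x \<psi>')
      have W: "x \<in> K.W" "K.F \<psi>' \<in> K.W" using step K.flat_W F_poly_W[OF assms(1) step(3)] by auto
      have "witt_add K p n s \<psi> = witt_add K p n (witt_add K p n s x) (K.F \<psi>')"
        unfolding step(1) K.wadd_assoc[OF sW W] ..
      with F_poly.step[OF K.flat_add[OF assms(2,3) step(2)] step(3)] show ?thesis by simp
    qed
  next
    case (Suc j)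
    have jW: "(K.F ^^ j) s \<in> K.W" using sW by simp
    obtain x \<psi>' where x: "x \<in> flat_fil K v p n M" "\<psi>' \<in> F_poly K v p n M" "\<psi> = witt_add K p n x (K.F \<psi>')"
      using Suc.prems
    proof cases
      case base
      have "\<psi> \<in> flat_fil K v p n M" using base K.fil_pred_subset_flat[OF assms(2)] by auto
      moreover have "\<psi> = witt_add K p n \<psi> (K.F (witt_zero K))" using F_poly_W[OF assms(1) Suc.prems] by simp
      ultimately show thesis using that zero by blast
    qed (use that in blast)
    have W: "x \<in> K.W" "\<psi>' \<in> K.W" using x K.flat_W F_poly_W[OF assms(1) x(2)] by auto
    have "witt_add K p n ((K.F ^^ Suc j) s) \<psi> = witt_add K p n x (K.F (witt_add K p n ((K.F ^^ j) s) \<psi>'))"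
      unfolding x(3) K.F_wadd[OF jW W(2)]
      using K.wadd_lcomm[OF K.F_closed[OF jW] W(1) K.F_closed[OF W(2)]] by simp
    with F_poly.step[OF x(1) Suc.IH[OF x(2)]] show ?case by simp
  qed
qed

lemma flat_filF_F_poly:
  assumes "char_dvf K v p" "M \<ge> 1" "\<phi> \<in> flat_filF K v p n M" shows "\<phi> \<in> F_poly K v p n M"
proof -
  interpret K: char_dvf K v p n by fact
  show ?thesis using assms(3) unfolding K.flat_filF_eq
  proof induction
    case zero
    show ?case by (rule F_poly.base) simp
  next
    case (add a b)
    then show ?case using F_poly_add[OF assms(1,2)] by auto
  qed
qed

text \<open>Reduce the coefficients from the outside in. If the current one is \<open>x''\<close>
  plus \<open>F x'\<close> with \<open>x''\<close> flat at \<open>M - 1\<close>, then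
  \<open>x'\<close> has level \<open>M div p \<le> M - 1\<close> and is carried into the next
  coefficient; \<open>z\<close> is this carried term. If a coefficient cannot be reduced, the
  extension that separates it also separates the whole vector.\<close>

lemma flat_filF_or_separated:
  fixes K :: "'a ring"
  assumes K: "char_dvf K v p"
    and ext: "\<And>i a. (\<forall>j<i. a j \<in> carrier K \<and> (a j = \<zero>\<^bsub>K\<^esub> \<or> v (a j) \<ge> 0)) \<Longrightarrow>
      \<exists>(L :: 'b ring) v' \<iota> b. sep_ext K v p i a L v' \<iota> b"
    and M: "M \<ge> 2" and \<phi>: "\<phi> \<in> F_poly K v p n M"
  shows "z \<in> fil K v p n (M - 1) \<Longrightarrow> witt_add K p n z \<phi> \<in> flat_filF K v p n (M - 1) \<or>
    (\<exists>(L :: 'b ring) v' \<iota>. E2 K v p L v' \<iota> \<and> \<iota> \<circ> witt_add K p n z \<phi> \<notin> filF L v' p n (M - 2))"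
  using \<phi>
proof (induction arbitrary: z)
  interpret K: char_dvf K v p n by fact
  have M1: "M \<ge> 1" "M - 1 \<ge> 1" using M by auto
  have M2: "M - 1 - 1 = M - 2" by simp
  have sub: "fil K v p n (M - 2) \<subseteq> flat_fil K v p n (M - 1)"
    using K.fil_pred_subset_flat[OF M1(2)] unfolding M2 .
  {
    case (base x)
    define y where "y = witt_add K p n z x"
    have y1: "y \<in> fil K v p n (M - 1)" unfolding y_def using base by (intro K.fil_add)
    have yf: "y \<in> flat_fil K v p n M" using y1 K.fil_pred_subset_flat[OF M1(1)] by auto
    have "y \<in> flat_filF K v p n (M - 1) \<or>
      (\<exists>(L :: 'b ring) v' \<iota>. E2 K v p L v' \<iota> \<and> \<iota> \<circ> y \<notin> filF L v' p n (M - 2))"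
    proof (cases "\<exists>x'\<in>witt_carrier K n. \<exists>x''\<in>flat_fil K v p n (M - 1). y = witt_add K p n x'' (witt_F K p x')")
      case True
      then obtain x' x'' where x: "x' \<in> K.W" "x'' \<in> flat_fil K v p n (M - 1)" "y = witt_add K p n x'' (K.F x')" by blast
      have x2: "x'' \<in> fil K v p n (M - 1)" using x(2) K.flat_subset_fil by auto
      have "K.F x' \<in> fil K v p n (M - 1)" by (rule K.fil_diff[OF y1 x2 K.F_closed[OF x(1)] x(3)[symmetric]])
      then have "x' \<in> fil K v p n ((M - 1) div p)" by (rule K.fil_F[OF x(1)])
      then have "x' \<in> flat_fil K v p n (M - 1)" using K.fil_mono[OF K.div_p_le2[OF M]] sub by auto
      then have "(K.F ^^ 1) x' \<in> K.SF (flat_fil K v p n (M - 1))" by (rule K.SF_elem[OF K.flat_W])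
      from K.SF_add_elem[OF x(2) this, of 0] show ?thesis unfolding x(3) K.flat_filF_eq by simp
    next
      case False
      from irreducible_separated[OF K ext M yf False]
      obtain L :: "'b ring" and v' \<iota> where E: "E2 K v p L v' \<iota>"
        and no: "\<not> (\<exists>y'\<in>fil L v' p n (M - 2). \<exists>w\<in>witt_carrier L n. \<iota> \<circ> y = witt_add L p n y' (witt_F L p w))" by blast
      interpret E: e2_ext K v p n L v' \<iota> by unfold_locales (fact E)
      have "\<iota> \<circ> y \<notin> filF L v' p n (M - 2)"
        using no E.L.filF_decomp[of "\<iota> \<circ> y" "M - 2"] E.L.SF_W[OF E.L.fil_W] unfolding E.L.filF_eq by blast
      with E show ?thesis by blast
    qed
    then show ?case unfolding y_def .
  next
    case (step x \<psi>)
    define y where "y = witt_add K p n z x"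
    have zf: "z \<in> flat_fil K v p n M" using step(4) K.fil_pred_subset_flat[OF M1(1)] by auto
    have yf: "y \<in> flat_fil K v p n M" unfolding y_def by (rule K.flat_add[OF M1(1) zf step(1)])
    have \<psi>W: "\<psi> \<in> K.W" using F_poly_W[OF K step(2)] .
    have zW: "z \<in> K.W" and xW: "x \<in> K.W" and yW: "y \<in> K.W" using zf step(1) yf K.flat_W by auto
    have yF: "y \<in> fil K v p n M" using yf K.flat_subset_fil by auto
    have eq: "witt_add K p n z (witt_add K p n x (K.F \<psi>)) = witt_add K p n y (K.F \<psi>)"
      unfolding y_def by (rule K.wadd_assoc[OF zW xW K.F_closed[OF \<psi>W], symmetric])
    show ?case unfolding eq
    proof (cases "\<exists>x'\<in>witt_carrier K n. \<exists>x''\<in>flat_fil K v p n (M - 1). y = witt_add K p n x'' (witt_F K p x')")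
      case True
      then obtain x' x'' where x: "x' \<in> K.W" "x'' \<in> flat_fil K v p n (M - 1)" "y = witt_add K p n x'' (K.F x')" by blast
      have x2: "x'' \<in> fil K v p n (M - 1)" using x(2) K.flat_subset_fil by auto
      have x2W: "x'' \<in> K.W" using K.filD[OF x2] .
      have "x'' \<in> fil K v p n M" by (rule subsetD[OF K.fil_mono x2]) simp
      then have "K.F x' \<in> fil K v p n M" by (rule K.fil_diff[OF yF _ K.F_closed[OF x(1)] x(3)[symmetric]])
      then have "x' \<in> fil K v p n (M div p)" by (rule K.fil_F[OF x(1)])
      then have x'1: "x' \<in> fil K v p n (M - 1)" using K.fil_mono[OF K.div_p_le[OF M1(1)]] by auto
      define \<chi> where "\<chi> = witt_add K p n x' \<psi>"
      have \<chi>W: "\<chi> \<in> K.W" using x(1) \<psi>W by (simp add: \<chi>_def)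
      have y_eq: "witt_add K p n y (K.F \<psi>) = witt_add K p n x'' (K.F \<chi>)"
        unfolding x(3) \<chi>_def K.F_wadd[OF x(1) \<psi>W] by (rule K.wadd_assoc[OF x2W K.F_closed[OF x(1)] K.F_closed[OF \<psi>W]])
      from step(3)[OF x'1] consider "\<chi> \<in> flat_filF K v p n (M - 1)"
        | (sep) L :: "'b ring" and v' \<iota> where "E2 K v p L v' \<iota>" "\<iota> \<circ> \<chi> \<notin> filF L v' p n (M - 2)"
        unfolding \<chi>_def by blast
      then show "witt_add K p n y (K.F \<psi>) \<in> flat_filF K v p n (M - 1) \<or>
        (\<exists>(L :: 'b ring) v' \<iota>. E2 K v p L v' \<iota> \<and> \<iota> \<circ> witt_add K p n y (K.F \<psi>) \<notin> filF L v' p n (M - 2))"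
        unfolding y_eq
      proof cases
        case 1
        then have "K.F \<chi> \<in> K.SF (flat_fil K v p n (M - 1))" unfolding K.flat_filF_eq by (rule K.SF_F[OF K.flat_W])
        from K.SF_add_elem[OF x(2) this, of 0]
        show "witt_add K p n x'' (K.F \<chi>) \<in> flat_filF K v p n (M - 1) \<or>
          (\<exists>(L :: 'b ring) v' \<iota>. E2 K v p L v' \<iota> \<and> \<iota> \<circ> witt_add K p n x'' (K.F \<chi>) \<notin> filF L v' p n (M - 2))"
          unfolding K.flat_filF_eq by simp
      next
        \<comment> \<open>Separation of \<open>\<chi>\<close> survives \<open>F\<close> and the
          addition of \<open>x''\<close>: otherwise \<open>\<chi>\<close> differs from an element of
          \<open>filF\<close> by some \<open>d\<close> with \<open>F d\<close> of level
          \<open>M - 1\<close>, so \<open>d\<close> has level at most \<open>M - 2\<close> and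
          \<open>\<chi>\<close> lies in \<open>filF\<close> itself.\<close>
        case sep
        interpret E: e2_ext K v p n L v' \<iota> by unfold_locales (fact sep(1))
        have i\<chi>: "\<iota> \<circ> \<chi> \<in> E.L.W" using E.iota_W[OF \<chi>W] .
        have "\<iota> \<circ> witt_add K p n x'' (K.F \<chi>) \<notin> filF L v' p n (M - 2)"
        proof
          assume "\<iota> \<circ> witt_add K p n x'' (K.F \<chi>) \<in> filF L v' p n (M - 2)"
          from E.L.filF_decomp[OF this] obtain y0 \<psi>' where y0: "y0 \<in> fil L v' p n (M - 2)" "\<psi>' \<in> filF L v' p n (M - 2)"
            "\<iota> \<circ> witt_add K p n x'' (K.F \<chi>) = witt_add L p n y0 (E.L.F \<psi>')" by blast
          have \<psi>'W: "\<psi>' \<in> E.L.W" using E.L.SF_W[OF E.L.fil_W] y0(2) unfolding E.L.filF_eq by blast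
          have y0W: "y0 \<in> E.L.W" using E.L.filD[OF y0(1)] .
          have ix2: "\<iota> \<circ> x'' \<in> fil L v' p n (M - 1)" using E.iota_fil[OF x2W] x2 by simp
          have ix2W: "\<iota> \<circ> x'' \<in> E.L.W" using E.L.filD[OF ix2] .
          obtain d where d: "d \<in> E.L.W" "witt_add L p n (\<iota> \<circ> \<chi>) d = \<psi>'" using E.L.wdiff[OF \<psi>'W i\<chi>] by blast
          have "witt_add L p n (E.L.F (\<iota> \<circ> \<chi>)) (\<iota> \<circ> x'') = witt_add L p n (\<iota> \<circ> x'') (E.L.F (\<iota> \<circ> \<chi>))"
            by (rule E.L.wadd_comm[OF E.L.F_closed[OF i\<chi>] ix2W])
          also have "\<dots> = witt_add L p n y0 (E.L.F \<psi>')"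
            using y0(3) E.iota_wadd[OF x2W K.F_closed[OF \<chi>W]] E.iota_F[OF \<chi>W] by simp
          also have "\<dots> = witt_add L p n (E.L.F (\<iota> \<circ> \<chi>)) (witt_add L p n y0 (E.L.F d))"
            unfolding d(2)[symmetric] E.L.F_wadd[OF i\<chi> d(1)]
            by (rule E.L.wadd_lcomm[OF y0W E.L.F_closed[OF i\<chi>] E.L.F_closed[OF d(1)]])
          finally have xd: "\<iota> \<circ> x'' = witt_add L p n y0 (E.L.F d)"
            by (rule E.L.wadd_cancel[OF E.L.F_closed[OF i\<chi>] ix2W E.L.wadd_closed[OF y0W E.L.F_closed[OF d(1)]]])
          have "y0 \<in> fil L v' p n (M - 1)" by (rule subsetD[OF E.L.fil_mono y0(1)]) simp
          then have "E.L.F d \<in> fil L v' p n (M - 1)" by (rule E.L.fil_diff[OF ix2 _ E.L.F_closed[OF d(1)] xd[symmetric]])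
          then have "d \<in> fil L v' p n ((M - 1) div p)" by (rule E.L.fil_F[OF d(1)])
          then have df: "d \<in> fil L v' p n (M - 2)" using E.L.fil_mono[OF K.div_p_le2[OF M]] by auto
          obtain d' where d': "d' \<in> E.L.W" "witt_add L p n d d' = witt_zero L" using E.L.wdiff[OF E.L.wzero_closed d(1)] by blast
          have d'f: "d' \<in> fil L v' p n (M - 2)" by (rule E.L.fil_diff[OF E.L.fil_zero df d'])
          have "witt_add L p n d' \<psi>' = \<iota> \<circ> \<chi>"
          proof -
            have "witt_add L p n d' \<psi>' = witt_add L p n (\<iota> \<circ> \<chi>) (witt_add L p n d' d)"
              unfolding d(2)[symmetric] by (rule E.L.wadd_lcomm[OF d'(1) i\<chi> d(1)])
            then show ?thesis using d' E.L.wadd_comm[OF d'(1) d(1)] i\<chi> by simp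
          qed
          moreover have "witt_add L p n d' \<psi>' \<in> filF L v' p n (M - 2)"
            using E.L.SF_add_elem[OF d'f, of \<psi>' 0] y0(2) unfolding E.L.filF_eq by simp
          ultimately show False using sep(2) by simp
        qed
        with sep(1) show "witt_add K p n x'' (K.F \<chi>) \<in> flat_filF K v p n (M - 1) \<or>
          (\<exists>(L :: 'b ring) v' \<iota>. E2 K v p L v' \<iota> \<and> \<iota> \<circ> witt_add K p n x'' (K.F \<chi>) \<notin> filF L v' p n (M - 2))" by blast
      qed
    next
      \<comment> \<open>The inner part \<open>F \<psi>\<close> is harmless: membership of the whole
        in \<open>filF\<close> would write \<open>\<iota> \<circ> y\<close> as level
        \<open>M - 2\<close> plus a Frobenius image, which \<open>L\<close> was chosen to
        exclude.\<close>
      case False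
      from irreducible_separated[OF K ext M yf False]
      obtain L :: "'b ring" and v' \<iota> where E: "E2 K v p L v' \<iota>"
        and no: "\<not> (\<exists>y'\<in>fil L v' p n (M - 2). \<exists>w\<in>witt_carrier L n. \<iota> \<circ> y = witt_add L p n y' (witt_F L p w))" by blast
      interpret E: e2_ext K v p n L v' \<iota> by unfold_locales (fact E)
      have iyW: "\<iota> \<circ> y \<in> E.L.W" and i\<psi>W: "\<iota> \<circ> \<psi> \<in> E.L.W" using E.iota_W yW \<psi>W by auto
      have "\<iota> \<circ> witt_add K p n y (K.F \<psi>) \<notin> filF L v' p n (M - 2)"
      proof
        assume "\<iota> \<circ> witt_add K p n y (K.F \<psi>) \<in> filF L v' p n (M - 2)"
        from E.L.filF_decomp[OF this] obtain y0 \<psi>' where y0: "y0 \<in> fil L v' p n (M - 2)" "\<psi>' \<in> filF L v' p n (M - 2)"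
          "\<iota> \<circ> witt_add K p n y (K.F \<psi>) = witt_add L p n y0 (E.L.F \<psi>')" by blast
        have \<psi>'W: "\<psi>' \<in> E.L.W" using E.L.SF_W[OF E.L.fil_W] y0(2) unfolding E.L.filF_eq by blast
        have y0W: "y0 \<in> E.L.W" using E.L.filD[OF y0(1)] .
        obtain d where d: "d \<in> E.L.W" "witt_add L p n (\<iota> \<circ> \<psi>) d = \<psi>'" using E.L.wdiff[OF \<psi>'W i\<psi>W] by blast
        have "witt_add L p n (E.L.F (\<iota> \<circ> \<psi>)) (\<iota> \<circ> y) = witt_add L p n (\<iota> \<circ> y) (E.L.F (\<iota> \<circ> \<psi>))"
          by (rule E.L.wadd_comm[OF E.L.F_closed[OF i\<psi>W] iyW])
        also have "\<dots> = witt_add L p n y0 (E.L.F \<psi>')"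
          using y0(3) E.iota_wadd[OF yW K.F_closed[OF \<psi>W]] E.iota_F[OF \<psi>W] by simp
        also have "\<dots> = witt_add L p n (E.L.F (\<iota> \<circ> \<psi>)) (witt_add L p n y0 (E.L.F d))"
          unfolding d(2)[symmetric] E.L.F_wadd[OF i\<psi>W d(1)]
          by (rule E.L.wadd_lcomm[OF y0W E.L.F_closed[OF i\<psi>W] E.L.F_closed[OF d(1)]])
        finally have "\<iota> \<circ> y = witt_add L p n y0 (E.L.F d)"
          by (rule E.L.wadd_cancel[OF E.L.F_closed[OF i\<psi>W] iyW E.L.wadd_closed[OF y0W E.L.F_closed[OF d(1)]]])
        with no y0(1) d(1) show False by blast
      qed
      with E show "witt_add K p n y (K.F \<psi>) \<in> flat_filF K v p n (M - 1) \<or>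
        (\<exists>(L :: 'b ring) v' \<iota>. E2 K v p L v' \<iota> \<and> \<iota> \<circ> witt_add K p n y (K.F \<psi>) \<notin> filF L v' p n (M - 2))" by blast
    qed
  }
qed

text \<open>Reduces everything to the hypothesis \<open>ext\<close>, the existence of extensions
  with prescribed separation. Minimality of \<open>M\<close> excludes the first alternative of
  \<open>flat_filF_or_separated\<close> for \<open>z = 0\<close>.\<close>

lemma sw_formula:
  fixes K :: "'a ring" and \<phi> :: "nat \<Rightarrow> 'a"
  assumes K: "char_dvf K v p" and \<phi>: "\<phi> \<in> witt_carrier K n"
    and ext: "\<And>i a. (\<forall>j<i. a j \<in> carrier K \<and> (a j = \<zero>\<^bsub>K\<^esub> \<or> v (a j) \<ge> 0)) \<Longrightarrow>
      \<exists>(L :: 'b ring) v' \<iota> b. sep_ext K v p i a L v' \<iota> b"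
  shows "(\<forall>(L :: 'b ring) v' \<iota>. E2 K v p L v' \<iota> \<longrightarrow>
            sw L v' p n (\<iota> \<circ> \<phi>) + 1 \<le> (LEAST m. m \<ge> 1 \<and> \<phi> \<in> flat_filF K v p n m))
       \<and> (\<exists>(L :: 'b ring) v' \<iota>. E2 K v p L v' \<iota> \<and>
            sw L v' p n (\<iota> \<circ> \<phi>) + 1 = (LEAST m. m \<ge> 1 \<and> \<phi> \<in> flat_filF K v p n m))"
proof -
  interpret K: char_dvf K v p n by fact
  define M where "M = (LEAST m. m \<ge> 1 \<and> \<phi> \<in> flat_filF K v p n m)"
  have "\<exists>m. m \<ge> 1 \<and> \<phi> \<in> flat_filF K v p n m" using K.flat_filF_exists[OF \<phi>] by blast
  from LeastI_ex[OF this] have M: "M \<ge> 1" "\<phi> \<in> flat_filF K v p n M" by (auto simp: M_def)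
  have le: "sw L v' p n (\<iota> \<circ> \<phi>) + 1 \<le> M" if E: "E2 K v p L v' \<iota>" for L :: "'b ring" and v' \<iota>
  proof -
    interpret E: e2_ext K v p n L v' \<iota> by unfold_locales (fact E)
    show ?thesis unfolding M_def by (rule E.sw_le[OF \<phi>])
  qed
  have "\<exists>(L :: 'b ring) v' \<iota>. E2 K v p L v' \<iota> \<and> M \<le> sw L v' p n (\<iota> \<circ> \<phi>) + 1"
  proof (cases "M \<ge> 2")
    \<comment> \<open>For \<open>M = 1\<close> the inequality is trivial and any extension will
      do.\<close>
    case False
    obtain L :: "'b ring" and v' \<iota> b where "sep_ext K v p 0 (\<lambda>_. \<zero>\<^bsub>K\<^esub>) L v' \<iota> b" using ext[of 0] by blast
    then have "E2 K v p L v' \<iota>" by (simp add: sep_ext_def)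
    with False show ?thesis by fastforce
  next
    case True
    have not: "\<phi> \<notin> flat_filF K v p n (M - 1)"
    proof
      assume "\<phi> \<in> flat_filF K v p n (M - 1)"
      then have "M \<le> M - 1" unfolding M_def using True M_def by (intro Least_le) auto
      with M(1) show False by simp
    qed
    from flat_filF_or_separated[OF K ext True flat_filF_F_poly[OF K M] K.fil_zero]
    obtain L :: "'b ring" and v' \<iota> where E: "E2 K v p L v' \<iota>" and n: "\<iota> \<circ> \<phi> \<notin> filF L v' p n (M - 2)"
      using not K.wadd_zero_left[OF \<phi>] by auto
    interpret E: e2_ext K v p n L v' \<iota> by unfold_locales (fact E)
    have "\<exists>m. \<iota> \<circ> \<phi> \<in> filF L v' p n m" using E.flat_filF_subset[OF M] by blast
    from LeastI_ex[OF this] have "\<iota> \<circ> \<phi> \<in> filF L v' p n (sw L v' p n (\<iota> \<circ> \<phi>))" by (simp add: sw_def)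
    with n have "\<not> sw L v' p n (\<iota> \<circ> \<phi>) \<le> M - 2" using E.L.filF_mono by blast
    with E show ?thesis by fastforce
  qed
  then show ?thesis using le unfolding M_def[symmetric] by (meson le_antisym)
qed

section \<open>Purely inseparable extensions with integral valuation\<close>

lemma (in cring) add_pow_mult_eq: "x \<in> carrier R \<Longrightarrow> add_pow R (k::nat) x = add_pow R k \<one> \<otimes> x"
  by (simp add: add_pow_ldistr)

text \<open>Gaussian elimination: \<open>m + 1\<close> rows of length \<open>m\<close> over
  \<open>E\<close> are dependent. The last row serves as pivot at a nonzero entry \<open>P\<close>
  in column \<open>s0\<close>; a relation among the reduced rows becomes one among all rows when the
  pivot row gets the coefficient \<open>- S s0\<close>.\<close>

lemma (in field) linear_dependence:
  fixes m :: nat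
  assumes E: "subfield E R" and A: "\<And>i s. A i s \<in> E"
  shows "\<exists>x. (\<forall>i. x i \<in> E) \<and> (\<exists>i\<le>m. x i \<noteq> \<zero>) \<and> (\<forall>s<m. (\<Oplus>i\<in>{..m}. x i \<otimes> A i s) = \<zero>)"
  using A
proof (induction m arbitrary: A)
  case 0
  show ?case using subringE(3)[OF subfieldE(1)[OF E]] by (intro exI[of _ "\<lambda>_. \<one>"]) auto
next
  case (Suc m)
  note sr = subringE[OF subfieldE(1)[OF E]]
  have Ac: "A i s \<in> carrier R" for i s using Suc.prems sr(1) by blast
  show ?case
  proof (cases "\<forall>s<Suc m. A (Suc m) s = \<zero>")
    case True
    have "(\<Oplus>i\<in>{..Suc m}. (if i = Suc m then \<one> else \<zero>) \<otimes> A i s) = \<zero>" if "s < Suc m" for s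
    proof -
      have "(\<Oplus>i\<in>{..Suc m}. (if i = Suc m then \<one> else \<zero>) \<otimes> A i s) = (\<Oplus>i\<in>{..Suc m}. \<zero>)"
        using True that Ac by (intro finsum_cong') auto
      then show ?thesis by (simp add: finsum_zero)
    qed
    then show ?thesis using sr by (intro exI[of _ "\<lambda>i. if i = Suc m then \<one> else \<zero>"]) auto
  next
    case False
    then obtain s0 where s0: "s0 < Suc m" "A (Suc m) s0 \<noteq> \<zero>" by blast
    define P where "P = A (Suc m) s0"
    \<comment> \<open>\<open>sk\<close> renumbers the columns with \<open>s0\<close> left
      out.\<close>
    define sk where "sk s = (if s < s0 then s else Suc s)" for s
    define B where "B i s = A i (sk s) \<otimes> P \<ominus> A i s0 \<otimes> A (Suc m) (sk s)" for i s
    have P: "P \<in> E" "P \<in> carrier R" using Suc.prems Ac by (auto simp: P_def)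
    have "B i s \<in> E" for i s unfolding B_def minus_eq using Suc.prems P sr by simp
    from Suc.IH[OF this] obtain x where "(\<forall>i. x i \<in> E) \<and> (\<exists>i\<le>m. x i \<noteq> \<zero>) \<and> (\<forall>s<m. (\<Oplus>i\<in>{..m}. x i \<otimes> B i s) = \<zero>)" ..
    then have x: "\<And>i. x i \<in> E" "\<exists>i\<le>m. x i \<noteq> \<zero>" "\<And>s. s < m \<Longrightarrow> (\<Oplus>i\<in>{..m}. x i \<otimes> B i s) = \<zero>" by auto
    have xc: "x i \<in> carrier R" for i using x(1) sr(1) by blast
    define S where "S s = (\<Oplus>i\<in>{..m}. x i \<otimes> A i s)" for s
    have Sc: "S s \<in> carrier R" for s unfolding S_def using xc Ac by (intro finsum_closed) auto
    have "S s \<in> E" for s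
    proof -
      have "(\<Oplus>i\<in>{..k}. x i \<otimes> A i s) \<in> E" for k
        using x(1) Suc.prems sr xc Ac by (induction k) (auto simp: atMost_Suc)
      then show ?thesis by (simp add: S_def)
    qed
    define y where "y i = (if i \<le> m then x i \<otimes> P else if i = Suc m then \<ominus> S s0 else \<zero>)" for i
    have yE: "y i \<in> E" for i using x(1) P \<open>\<And>s. S s \<in> E\<close> sr by (auto simp: y_def)
    have ysum: "(\<Oplus>i\<in>{..Suc m}. y i \<otimes> A i s) = S s \<otimes> P \<ominus> S s0 \<otimes> A (Suc m) s" for s
    proof -
      have "(\<Oplus>i\<in>{..Suc m}. y i \<otimes> A i s) = y (Suc m) \<otimes> A (Suc m) s \<oplus> (\<Oplus>i\<in>{..m}. y i \<otimes> A i s)"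
        using subsetD[OF sr(1) yE] Ac by (subst atMost_Suc, subst finsum_insert) auto
      also have "(\<Oplus>i\<in>{..m}. y i \<otimes> A i s) = (\<Oplus>i\<in>{..m}. (x i \<otimes> A i s) \<otimes> P)"
        using xc Ac P by (intro finsum_cong') (auto simp: y_def m_ac)
      also have "\<dots> = S s \<otimes> P" unfolding S_def using xc Ac P by (intro finsum_ldistr[symmetric]) auto
      finally show ?thesis using Sc P Ac by (simp add: y_def minus_eq l_minus a_comm)
    qed
    have "(\<Oplus>i\<in>{..Suc m}. y i \<otimes> A i s) = \<zero>" if s: "s < Suc m" for s
    proof (cases "s = s0")
      case True
      then show ?thesis unfolding ysum using Sc P by (simp add: P_def[symmetric] r_neg minus_eq)
    next
      case ne: False
      define t where "t = (if s < s0 then s else s - 1)"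
      have t: "t < m" "sk t = s" using s s0(1) ne by (auto simp: t_def sk_def)
      have "(\<Oplus>i\<in>{..k}. x i \<otimes> B i t) = (\<Oplus>i\<in>{..k}. x i \<otimes> A i s) \<otimes> P \<ominus> (\<Oplus>i\<in>{..k}. x i \<otimes> A i s0) \<otimes> A (Suc m) s" for k
      proof (induction k)
        case 0
        show ?case using xc Ac P t(2) by (simp add: B_def minus_eq r_distr r_minus m_ac)
      next
        case (Suc k)
        have Bc: "x i \<otimes> B i t \<in> carrier R" for i using xc Ac P by (simp add: B_def)
        define U V where "U = (\<Oplus>i\<in>{..k}. x i \<otimes> A i s)" and "V = (\<Oplus>i\<in>{..k}. x i \<otimes> A i s0)"
        have UV: "U \<in> carrier R" "V \<in> carrier R" using xc Ac by (auto simp: U_def V_def intro!: finsum_closed)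
        have "(\<Oplus>i\<in>{..Suc k}. x i \<otimes> B i t) = x (Suc k) \<otimes> B (Suc k) t \<oplus> (U \<otimes> P \<ominus> V \<otimes> A (Suc m) s)"
          using Bc Suc by (subst atMost_Suc, subst finsum_insert) (auto simp: U_def V_def)
        moreover have "(\<Oplus>i\<in>{..Suc k}. x i \<otimes> A i s') = x (Suc k) \<otimes> A (Suc k) s' \<oplus> (\<Oplus>i\<in>{..k}. x i \<otimes> A i s')" for s'
          using xc Ac by (subst atMost_Suc, subst finsum_insert) auto
        ultimately show ?case unfolding U_def[symmetric] V_def[symmetric] B_def t(2)
          using xc Ac P UV by (simp add: U_def[symmetric] V_def[symmetric] minus_eq r_distr l_distr r_minus l_minus minus_add m_ac a_ac)
      qed
      from this[of m] show ?thesis unfolding ysum using x(3)[OF t(1)] by (simp add: S_def)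
    qed
    moreover have "\<exists>i\<le>Suc m. y i \<noteq> \<zero>"
    proof -
      obtain i where "i \<le> m" "x i \<noteq> \<zero>" using x(2) by blast
      then have "y i \<noteq> \<zero>" using xc P s0 by (simp add: y_def integral_iff P_def)
      with \<open>i \<le> m\<close> show ?thesis by (meson le_SucI)
    qed
    ultimately show ?thesis using yE by blast
  qed
qed

section \<open>Adjoining a p-th root inside a perfect field\<close>

context ring begin

definition comb :: "(nat \<Rightarrow> 'a) \<Rightarrow> 'a \<Rightarrow> nat \<Rightarrow> 'a" where
  "comb x \<alpha> d = (\<Oplus>s\<in>{..<d}. x s \<otimes> \<alpha> [^] s)"

lemma comb_0 [simp]: "comb x \<alpha> 0 = \<zero>" by (simp add: comb_def)

lemma comb_Suc: "(\<And>s. x s \<in> carrier R) \<Longrightarrow> \<alpha> \<in> carrier R \<Longrightarrow> comb x \<alpha> (Suc d) = comb x \<alpha> d \<oplus> x d \<otimes> \<alpha> [^] d"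
  unfolding comb_def by (subst lessThan_Suc, subst finsum_insert) (auto simp: a_comm intro!: finsum_closed)

lemma comb_closed [simp, intro]: "(\<And>s. x s \<in> carrier R) \<Longrightarrow> \<alpha> \<in> carrier R \<Longrightarrow> comb x \<alpha> d \<in> carrier R"
  unfolding comb_def by (intro finsum_closed) auto

lemma comb_add: "(\<And>s. x s \<in> carrier R) \<Longrightarrow> (\<And>s. y s \<in> carrier R) \<Longrightarrow> \<alpha> \<in> carrier R \<Longrightarrow>
   comb (\<lambda>s. x s \<oplus> y s) \<alpha> d = comb x \<alpha> d \<oplus> comb y \<alpha> d"
  by (induction d) (auto simp: comb_Suc l_distr a_ac)

lemma comb_neg: "(\<And>s. x s \<in> carrier R) \<Longrightarrow> \<alpha> \<in> carrier R \<Longrightarrow> comb (\<lambda>s. \<ominus> x s) \<alpha> d = \<ominus> comb x \<alpha> d"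
  by (induction d) (auto simp: comb_Suc l_minus minus_add)

lemma comb_smult: "(\<And>s. x s \<in> carrier R) \<Longrightarrow> e \<in> carrier R \<Longrightarrow> \<alpha> \<in> carrier R \<Longrightarrow>
   comb (\<lambda>s. e \<otimes> x s) \<alpha> d = e \<otimes> comb x \<alpha> d"
  by (induction d) (auto simp: comb_Suc r_distr m_assoc)

lemma comb_trunc: "(\<And>s. x s \<in> carrier R) \<Longrightarrow> \<alpha> \<in> carrier R \<Longrightarrow> d \<le> d' \<Longrightarrow>
   comb (\<lambda>s. if s < d then x s else \<zero>) \<alpha> d' = comb x \<alpha> d"
  unfolding comb_def by (rule add.finprod_mono_neutral_cong_right) auto

lemma comb_unit: "\<alpha> \<in> carrier R \<Longrightarrow> t < d \<Longrightarrow> e \<in> carrier R \<Longrightarrow>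
   comb (\<lambda>s. if s = t then e else \<zero>) \<alpha> d = e \<otimes> \<alpha> [^] t"
proof -
  assume *: "\<alpha> \<in> carrier R" "t < d" "e \<in> carrier R"
  have "comb (\<lambda>s. if s = t then e else \<zero>) \<alpha> d = (\<Oplus>s\<in>{t}. e \<otimes> \<alpha> [^] s)"
    unfolding comb_def by (rule add.finprod_mono_neutral_cong_right) (use * in auto)
  then show ?thesis using * by simp
qed

lemma comb_in_subring:
  assumes "subring E R" "\<And>s. x s \<in> E" "\<alpha> \<in> E" shows "comb x \<alpha> d \<in> E"
proof -
  note sr = subringE[OF assms(1)]
  have c: "x s \<in> carrier R" "\<alpha> \<in> carrier R" for s using assms sr(1) by auto
  have pw: "\<alpha> [^] (s::nat) \<in> E" for s by (induction s) (auto simp: sr assms(3))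
  show ?thesis by (induction d) (auto simp: comb_Suc c sr pw assms)
qed

text \<open>For \<open>d = p\<close> and \<open>\<alpha> ^ p\<close> in \<open>E\<close> this span
  is the field \<open>E(\<alpha>)\<close>. Coefficient functions lie in \<open>E\<close> at every
  index, so sums and products need no care about the range.\<close>

definition adj :: "nat \<Rightarrow> 'a set \<Rightarrow> 'a \<Rightarrow> 'a set" where
  "adj d E \<alpha> = {comb x \<alpha> d | x. \<forall>s. x s \<in> E}"

lemma adjI: "(\<And>s. x s \<in> E) \<Longrightarrow> comb x \<alpha> d \<in> adj d E \<alpha>" by (auto simp: adj_def)

lemma adjE: assumes "y \<in> adj d E \<alpha>" obtains x where "\<And>s. x s \<in> E" "y = comb x \<alpha> d"
  using assms by (auto simp: adj_def)

end

text \<open>The ambient field from which all extensions are cut out: p-th roots exist in it, so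
  adjoining one means passing to a larger subfield with the restricted valuation.\<close>

locale perf_field = valued_field R w for R (structure) and w +
  fixes p :: nat and \<pi> :: 'a
  assumes prime_p: "Factorial_Ring.prime p" and add_pow_p: "add_pow R p \<one> = \<zero>"
    and root: "x \<in> carrier R \<Longrightarrow> \<exists>y\<in>carrier R. y [^] p = x"
    and pi: "\<pi> \<in> carrier R" "\<pi> \<noteq> \<zero>" "w \<pi> = 1"
begin

lemma p_pos: "p > 0" and p_ge2: "p \<ge> 2" and p_gt1: "p > 1"
  using prime_gt_0_nat[OF prime_p] prime_ge_2_nat[OF prime_p] by auto

lemma frob_add: "x \<in> carrier R \<Longrightarrow> y \<in> carrier R \<Longrightarrow> (x \<oplus> y) [^] p = x [^] p \<oplus> y [^] p"
  by (rule frobenius_add[OF prime_p add_pow_p])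

lemma frob_neg: assumes "x \<in> carrier R" shows "(\<ominus> x) [^] p = \<ominus> (x [^] p)"
proof -
  have "(\<ominus> x \<oplus> x) [^] p = (\<ominus> x) [^] p \<oplus> x [^] p" using assms by (intro frob_add) auto
  then have "(\<ominus> x) [^] p \<oplus> x [^] p = \<zero>" using assms p_pos by (simp add: l_neg nat_pow_zero)
  then show ?thesis using assms by (metis a_inv_closed minus_equality nat_pow_closed)
qed

lemma frob_diff: "x \<in> carrier R \<Longrightarrow> y \<in> carrier R \<Longrightarrow> (x \<ominus> y) [^] p = x [^] p \<ominus> y [^] p"
  by (simp add: minus_eq frob_add frob_neg)

lemma frob_comb: "(\<And>s. x s \<in> carrier R) \<Longrightarrow> \<alpha> \<in> carrier R \<Longrightarrow>
   comb x \<alpha> d [^] p = comb (\<lambda>s. x s [^] p) (\<alpha> [^] p) d"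
proof (induction d)
  case (Suc d)
  have "(\<alpha> [^] d) [^] p = (\<alpha> [^] p) [^] d" using Suc.prems by (simp add: nat_pow_pow mult.commute)
  then show ?case using Suc by (simp add: comb_Suc frob_add nat_pow_distrib)
qed (use p_pos in \<open>simp add: nat_pow_zero\<close>)

lemma pow_p_zero_iff: "x \<in> carrier R \<Longrightarrow> x [^] p = \<zero> \<longleftrightarrow> x = \<zero>"
  using pow_nonzero[of x p] p_pos by (auto simp: nat_pow_zero)

lemma vgt_pow_p: assumes "x \<in> carrier R" shows "vgt (x [^] p) 0 \<longleftrightarrow> vgt x 0"
  unfolding vgt_def using pow_p_zero_iff[OF assms] w_pow[OF assms] p_pos by (auto simp: zero_less_mult_iff)

lemma vge_pow_p: assumes "x \<in> carrier R" shows "vge (x [^] p) 0 \<longleftrightarrow> vge x 0"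
  unfolding vge_def using pow_p_zero_iff[OF assms] w_pow[OF assms] p_pos by (auto simp: zero_le_mult_iff)

text \<open>By Bezout \<open>k\<close> has an inverse \<open>j\<close> modulo \<open>p\<close>, so
  the images of \<open>k\<close> and \<open>j\<close> multiply to one. Both have value at least
  zero, hence both have value zero.\<close>

lemma w_nat_unit:
  assumes "0 < k" "k < p"
  shows "add_pow R k \<one> \<noteq> \<zero>" "w (add_pow R k \<one>) = 0"
proof -
  have "coprime k p" using assms prime_p by (metis coprime_commute prime_imp_coprime nat_dvd_not_less)
  then obtain j m where "k * j = p * m + 1" using coprime_bezout_strong[of k p] p_gt1 by auto
  then have "add_pow R k \<one> \<otimes> add_pow R j \<one> = add_pow R (p * m + 1) \<one>"
    by (metis add_pow_ldistr add.nat_pow_closed add.nat_pow_pow l_one mult.commute one_closed)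
  also have "\<dots> = add_pow R m (add_pow R p \<one>) \<oplus> \<one>"
    by (simp add: add.nat_pow_mult[symmetric] add.nat_pow_pow mult.commute)
  also have "\<dots> = \<one>" by (simp add: add_pow_p)
  finally have one: "add_pow R k \<one> \<otimes> add_pow R j \<one> = \<one>" .
  show nz: "add_pow R k \<one> \<noteq> \<zero>" using one by auto
  have nz': "add_pow R j \<one> \<noteq> \<zero>" using one by auto
  have "w (add_pow R k \<one>) + w (add_pow R j \<one>) = 0"
    using w_mult[of "add_pow R k \<one>" "add_pow R j \<one>"] nz nz' one w_one by simp
  moreover have "vge (add_pow R k \<one>) 0" "vge (add_pow R j \<one>) 0" by (auto intro!: vge_add_pow_nat vge_one)
  ultimately show "w (add_pow R k \<one>) = 0" using nz nz' by (auto simp: vge_def)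
qed

text \<open>Integral values together with an element of value one express ramification index one
  over the base field.\<close>

definition int_sub :: "'a set \<Rightarrow> bool" where
  "int_sub E \<longleftrightarrow> subfield E R \<and> \<pi> \<in> E \<and> (\<forall>x\<in>E. x \<noteq> \<zero> \<longrightarrow> w x \<in> \<int>)"

text \<open>For integral \<open>c\<close> this says that its class is a p-th power in the residue
  field of \<open>E\<close>.\<close>

definition app :: "'a set \<Rightarrow> 'a \<Rightarrow> bool" where
  "app E c \<longleftrightarrow> (\<exists>b\<in>E. vgt (c \<ominus> b [^] p) 0)"

lemma pow_in: assumes "subring E R" "x \<in> E" shows "x [^] (k::nat) \<in> E"
  by (induction k) (auto simp: subringE[OF assms(1)] assms(2))

context
  fixes E assumes E: "subfield E R"
begin

lemmas sr = subringE[OF subfieldE(1)[OF E]]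

lemma Ec: "x \<in> E \<Longrightarrow> x \<in> carrier R" using sr(1) by blast

lemma inv_in: "x \<in> E \<Longrightarrow> x \<noteq> \<zero> \<Longrightarrow> inv x \<in> E" using subfield_m_inv(1)[OF E, of x] by simp

lemma diff_in: "x \<in> E \<Longrightarrow> y \<in> E \<Longrightarrow> x \<ominus> y \<in> E" by (simp add: minus_eq sr)

lemma adj_base: "d > 0 \<Longrightarrow> \<alpha> \<in> carrier R \<Longrightarrow> E \<subseteq> adj d E \<alpha>"
proof
  fix e assume *: "d > 0" "\<alpha> \<in> carrier R" "e \<in> E"
  have "comb (\<lambda>s. if s = 0 then e else \<zero>) \<alpha> d = e" using comb_unit[of \<alpha> 0 d e] * Ec by simp
  then show "e \<in> adj d E \<alpha>" using adjI[of "\<lambda>s. if s = 0 then e else \<zero>" E \<alpha> d] * sr by simp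
qed

lemma adj_gen: "d > 1 \<Longrightarrow> \<alpha> \<in> carrier R \<Longrightarrow> \<alpha> \<in> adj d E \<alpha>"
proof -
  assume *: "d > 1" "\<alpha> \<in> carrier R"
  have "comb (\<lambda>s. if s = 1 then \<one> else \<zero>) \<alpha> d = \<alpha>" using comb_unit[of \<alpha> 1 d \<one>] * by simp
  then show "\<alpha> \<in> adj d E \<alpha>" using adjI[of "\<lambda>s. if s = 1 then \<one> else \<zero>" E \<alpha> d] sr by simp
qed

lemma adj_pow_p:
  assumes "\<alpha> \<in> carrier R" "\<alpha> [^] p \<in> E" "y \<in> adj d E \<alpha>" shows "y [^] p \<in> E"
proof -
  obtain x where x: "\<And>s. x s \<in> E" "y = comb x \<alpha> d" using adjE[OF assms(3)] by blast
  have "y [^] p = comb (\<lambda>s. x s [^] p) (\<alpha> [^] p) d" unfolding x(2) using x(1) Ec assms(1) by (intro frob_comb) auto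
  also have "\<dots> \<in> E" by (rule comb_in_subring[OF subfieldE(1)[OF E] _ assms(2)]) (use pow_in[OF subfieldE(1)[OF E]] x(1) in auto)
  finally show ?thesis .
qed

lemma adj_carrier: "\<alpha> \<in> carrier R \<Longrightarrow> y \<in> adj d E \<alpha> \<Longrightarrow> y \<in> carrier R"
  using Ec by (auto simp: adj_def)

lemma adj_add: assumes "\<alpha> \<in> carrier R" "y \<in> adj d E \<alpha>" "z \<in> adj d E \<alpha>" shows "y \<oplus> z \<in> adj d E \<alpha>"
proof -
  obtain a b where ab: "\<And>s. a s \<in> E" "y = comb a \<alpha> d" "\<And>s. b s \<in> E" "z = comb b \<alpha> d" using adjE[OF assms(2)] adjE[OF assms(3)] by metis
  have "y \<oplus> z = comb (\<lambda>s. a s \<oplus> b s) \<alpha> d" unfolding ab(2,4) using ab Ec assms(1) by (intro comb_add[symmetric]) auto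
  then show ?thesis using adjI[of "\<lambda>s. a s \<oplus> b s" E \<alpha> d] ab sr by simp
qed

lemma adj_smult: assumes "\<alpha> \<in> carrier R" "e \<in> E" "z \<in> adj d E \<alpha>" shows "e \<otimes> z \<in> adj d E \<alpha>"
proof -
  obtain b where ab: "\<And>s. b s \<in> E" "z = comb b \<alpha> d" using adjE[OF assms(3)] by metis
  have "e \<otimes> z = comb (\<lambda>s. e \<otimes> b s) \<alpha> d" unfolding ab(2) using ab Ec assms by (intro comb_smult[symmetric]) auto
  then show ?thesis using adjI[of "\<lambda>s. e \<otimes> b s" E \<alpha> d] ab assms sr by simp
qed

lemma adj_gen_mult: assumes "\<alpha> \<in> carrier R" "\<alpha> [^] p \<in> E" "z \<in> adj p E \<alpha>" shows "\<alpha> \<otimes> z \<in> adj p E \<alpha>"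
proof -
  obtain b where b: "\<And>s. b s \<in> E" "z = comb b \<alpha> p" using adjE[OF assms(3)] by metis
  have bc: "b s \<in> carrier R" for s using b Ec by blast
  define q where "q = p - 1"
  have q: "p = Suc q" using p_pos by (simp add: q_def)
  \<comment> \<open>Multiplication by \<open>\<alpha>\<close> shifts the coefficients by one place;
    the top one reenters at the bottom with the factor \<open>\<alpha> ^ p\<close>, which lies in
    \<open>E\<close>.\<close>
  define b' where "b' s = (if s = 0 then b q \<otimes> \<alpha> [^] p else b (s - 1))" for s
  have b': "b' s \<in> E" for s using b(1) assms(2) sr by (simp add: b'_def)
  have "\<alpha> \<otimes> comb b \<alpha> d = comb b' \<alpha> (Suc d) \<ominus> b' 0" for d
  proof (induction d)
    case 0
    show ?case using b' Ec assms(1) by (simp add: comb_Suc minus_eq r_neg)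
  next
    case (Suc d)
    have "\<alpha> \<otimes> comb b \<alpha> (Suc d) = \<alpha> \<otimes> comb b \<alpha> d \<oplus> b d \<otimes> \<alpha> [^] Suc d"
      using bc assms(1) by (simp add: comb_Suc r_distr m_ac)
    also have "\<dots> = (comb b' \<alpha> (Suc d) \<ominus> b' 0) \<oplus> b' (Suc d) \<otimes> \<alpha> [^] Suc d" unfolding Suc by (simp add: b'_def)
    also have "\<dots> = comb b' \<alpha> (Suc (Suc d)) \<ominus> b' 0"
      using Ec[OF b'] assms(1) by (simp add: comb_Suc[of _ _ "Suc d"] minus_eq a_ac del: nat_pow_Suc)
    finally show ?case .
  qed
  from this[of q] have "\<alpha> \<otimes> comb b \<alpha> q = comb b' \<alpha> p \<ominus> b' 0" by (simp add: q)
  moreover have "\<alpha> \<otimes> z = \<alpha> \<otimes> comb b \<alpha> q \<oplus> b' 0"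
    unfolding b(2) q using bc assms(1) by (simp add: comb_Suc r_distr b'_def q m_ac)
  ultimately have "\<alpha> \<otimes> z = comb b' \<alpha> p" using Ec[OF b'] assms(1) by (simp add: minus_eq a_assoc l_neg)
  then show ?thesis using adjI[of b' E \<alpha> p, OF b'] by simp
qed

lemma adj_mult: assumes "\<alpha> \<in> carrier R" "\<alpha> [^] p \<in> E" "y \<in> adj p E \<alpha>" "z \<in> adj p E \<alpha>" shows "y \<otimes> z \<in> adj p E \<alpha>"
proof -
  obtain x where x: "\<And>s. x s \<in> E" "y = comb x \<alpha> p" using adjE[OF assms(3)] by metis
  have xc: "x s \<in> carrier R" for s using x Ec by blast
  have zc: "z \<in> carrier R" using adj_carrier assms by blast
  have pw: "\<alpha> [^] (s::nat) \<otimes> z \<in> adj p E \<alpha>" for s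
  proof (induction s)
    case 0 then show ?case using assms zc by simp
  next
    case (Suc s)
    have "\<alpha> [^] Suc s \<otimes> z = \<alpha> \<otimes> (\<alpha> [^] s \<otimes> z)" using assms(1) zc by (simp add: m_ac)
    then show ?case using adj_gen_mult[OF assms(1,2) Suc] by simp
  qed
  have "comb x \<alpha> d \<otimes> z \<in> adj p E \<alpha>" for d
  proof (induction d)
    case 0 then show ?case using zc adj_base[OF p_pos assms(1)] sr by auto
  next
    case (Suc d)
    have "comb x \<alpha> (Suc d) \<otimes> z = comb x \<alpha> d \<otimes> z \<oplus> x d \<otimes> (\<alpha> [^] d \<otimes> z)"
      using xc assms(1) zc by (simp add: comb_Suc l_distr m_assoc)
    then show ?case using adj_add[OF assms(1) Suc adj_smult[OF assms(1) x(1) pw]] by simp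
  qed
  then show ?thesis by (simp add: x(2))
qed

lemma adj_subfield: assumes "\<alpha> \<in> carrier R" "\<alpha> [^] p \<in> E" shows "subfield (adj p E \<alpha>) R"
proof (rule subfieldI'[OF subringI])
  note b = adj_base[OF p_pos assms(1)]
  show "adj p E \<alpha> \<subseteq> carrier R" using adj_carrier assms(1) by blast
  show "\<one> \<in> adj p E \<alpha>" using b sr by auto
  show "\<ominus> h \<in> adj p E \<alpha>" if "h \<in> adj p E \<alpha>" for h
  proof -
    have "\<ominus> h = (\<ominus> \<one>) \<otimes> h" using adj_carrier[OF assms(1) that] by (simp add: l_minus)
    then show ?thesis using adj_smult[OF assms(1) _ that, of "\<ominus> \<one>"] sr by simp
  qed
  show "h1 \<oplus> h2 \<in> adj p E \<alpha>" if "h1 \<in> adj p E \<alpha>" "h2 \<in> adj p E \<alpha>" for h1 h2 using adj_add assms(1) that by blast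
  show mult: "h1 \<otimes> h2 \<in> adj p E \<alpha>" if "h1 \<in> adj p E \<alpha>" "h2 \<in> adj p E \<alpha>" for h1 h2 using adj_mult assms that by blast
  show "inv k \<in> adj p E \<alpha>" if "k \<in> adj p E \<alpha> - {\<zero>}" for k
  proof -
    have k: "k \<in> adj p E \<alpha>" "k \<noteq> \<zero>" "k \<in> carrier R" using that adj_carrier assms(1) by auto
    have kp: "k [^] p \<in> E" "k [^] p \<noteq> \<zero>" "k [^] p \<in> carrier R" using adj_pow_p[OF assms k(1)] k pow_p_zero_iff by auto
    have ip: "inv (k [^] p) \<in> carrier R" using inv_nonzero[OF kp(3,2)] by simp
    have pw: "k [^] (m::nat) \<in> adj p E \<alpha>" for m
      by (induction m) (use \<open>\<one> \<in> adj p E \<alpha>\<close> k mult in auto)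
    \<comment> \<open>Inverses need no linear algebra, since the p-th power of any element of the
      span lies in \<open>E\<close>.\<close>
    have "inv k = inv (k [^] p) \<otimes> k [^] (p - 1)"
    proof (rule comm_inv_char)
      have "k \<otimes> (inv (k [^] p) \<otimes> k [^] (p - 1)) = (k [^] (p - 1) \<otimes> k) \<otimes> inv (k [^] p)"
        using k ip by (simp add: m_ac)
      also have "k [^] (p - 1) \<otimes> k = k [^] p" using p_pos by (metis Suc_pred' nat_pow_Suc)
      finally show "k \<otimes> (inv (k [^] p) \<otimes> k [^] (p - 1)) = \<one>" using inv_nonzero[OF kp(3,2)] by simp
    qed (use k ip in auto)
    then show ?thesis using adj_smult[OF assms(1) inv_in[OF kp(1,2)] pw] by simp
  qed
qed

lemma finsum_comb:
  fixes m :: nat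
  assumes "\<And>i. x i \<in> carrier R" "\<And>i s. A i s \<in> carrier R" "\<alpha> \<in> carrier R"
  shows "(\<Oplus>i\<in>{..m}. x i \<otimes> comb (A i) \<alpha> d) = comb (\<lambda>s. \<Oplus>i\<in>{..m}. x i \<otimes> A i s) \<alpha> d"
proof (induction m)
  case 0
  show ?case using assms by (simp add: comb_smult)
next
  case (Suc m)
  have "(\<Oplus>i\<in>{..Suc m}. x i \<otimes> comb (A i) \<alpha> d) = x (Suc m) \<otimes> comb (A (Suc m)) \<alpha> d \<oplus> (\<Oplus>i\<in>{..m}. x i \<otimes> comb (A i) \<alpha> d)"
    using assms by (subst atMost_Suc, subst finsum_insert) auto
  moreover have "(\<lambda>s. \<Oplus>i\<in>{..Suc m}. x i \<otimes> A i s) = (\<lambda>s. x (Suc m) \<otimes> A (Suc m) s \<oplus> (\<Oplus>i\<in>{..m}. x i \<otimes> A i s))"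
    using assms by (intro ext, subst atMost_Suc, subst finsum_insert) auto
  ultimately show ?case unfolding Suc using assms by (simp add: comb_add comb_smult finsum_closed)
qed

text \<open>The \<open>p + 1\<close> elements
  \<open>1, \<beta>, ..., \<beta> ^ (p - 1), \<alpha>\<close> lie in a span of \<open>p\<close>
  elements, hence satisfy a relation. Independence of the powers of \<open>\<beta>\<close> makes the
  coefficient of \<open>\<alpha>\<close> nonzero, so the relation can be solved for
  \<open>\<alpha>\<close>.\<close>

lemma exchange:
  assumes \<alpha>: "\<alpha> \<in> carrier R" "\<alpha> [^] p \<in> E" and \<beta>: "\<beta> \<in> adj p E \<alpha>"
    and indep: "\<And>x. (\<And>s. x s \<in> E) \<Longrightarrow> comb x \<beta> p = \<zero> \<Longrightarrow> \<forall>s<p. x s = \<zero>"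
  shows "\<alpha> \<in> adj p E \<beta>"
proof -
  have \<beta>c: "\<beta> \<in> carrier R" using adj_carrier[OF \<alpha>(1) \<beta>] .
  define u where "u i = (if i < p then \<beta> [^] i else \<alpha>)" for i
  have uc: "u i \<in> carrier R" for i using \<beta>c \<alpha> by (simp add: u_def)
  have "\<beta> [^] (i::nat) \<in> adj p E \<alpha>" for i
    using pow_in[OF subfieldE(1)[OF adj_subfield[OF \<alpha>]] \<beta>] .
  then have "u i \<in> adj p E \<alpha>" for i using adj_gen[OF p_gt1 \<alpha>(1)] by (simp add: u_def)
  then have "\<forall>i. \<exists>A. (\<forall>s. A s \<in> E) \<and> u i = comb A \<alpha> p" by (metis adjE)
  then obtain A where A: "\<And>i s. A i s \<in> E" "\<And>i. u i = comb (A i) \<alpha> p" by metis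
  obtain x where x: "\<And>i. x i \<in> E" "\<exists>i\<le>p. x i \<noteq> \<zero>" "\<And>s. s < p \<Longrightarrow> (\<Oplus>i\<in>{..p}. x i \<otimes> A i s) = \<zero>"
    using linear_dependence[OF E, of A p] A(1) by blast
  have xc: "x i \<in> carrier R" and Ac: "A i s \<in> carrier R" for i s using x A Ec by auto
  have "(\<Oplus>i\<in>{..p}. x i \<otimes> u i) = comb (\<lambda>s. \<Oplus>i\<in>{..p}. x i \<otimes> A i s) \<alpha> p"
    unfolding A(2) by (rule finsum_comb[OF xc Ac \<alpha>(1)])
  also have "\<dots> = (\<Oplus>s\<in>{..<p}. \<zero>)" unfolding comb_def using x(3) \<alpha> by (intro finsum_cong') auto
  finally have z: "(\<Oplus>i\<in>{..p}. x i \<otimes> u i) = \<zero>" by (simp add: finsum_zero)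
  have "{..p} = insert p {..<p}" by auto
  then have "(\<Oplus>i\<in>{..p}. x i \<otimes> u i) = x p \<otimes> u p \<oplus> (\<Oplus>i\<in>{..<p}. x i \<otimes> u i)"
    using xc uc by (simp add: finsum_insert)
  also have "(\<Oplus>i\<in>{..<p}. x i \<otimes> u i) = comb x \<beta> p"
    unfolding comb_def using xc \<beta>c by (intro finsum_cong') (auto simp: u_def)
  finally have rel: "x p \<otimes> \<alpha> \<oplus> comb x \<beta> p = \<zero>" using z by (simp add: u_def)
  have cc: "comb x \<beta> p \<in> carrier R" using xc \<beta>c by simp
  have nz: "x p \<noteq> \<zero>"
  proof
    assume 0: "x p = \<zero>"
    then have "comb x \<beta> p = \<zero>" using rel \<alpha>(1) cc by simp
    from indep[OF x(1) this] 0 x(2) show False by (metis le_neq_implies_less)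
  qed
  have ix: "inv (x p) \<in> E" "inv (x p) \<in> carrier R" "x p \<otimes> inv (x p) = \<one>" using inv_in[OF x(1) nz] inv_nonzero[OF xc nz] by auto
  have "x p \<otimes> \<alpha> = \<ominus> comb x \<beta> p" using rel cc xc \<alpha>(1) by (metis m_closed minus_equality)
  then have "inv (x p) \<otimes> (x p \<otimes> \<alpha>) = inv (x p) \<otimes> (\<ominus> comb x \<beta> p)" by simp
  moreover have "inv (x p) \<otimes> (x p \<otimes> \<alpha>) = \<alpha>" using ix xc \<alpha>(1) by (simp add: m_assoc[symmetric] m_comm[of "inv (x p)"])
  ultimately have "\<alpha> = (\<ominus> (inv (x p))) \<otimes> comb x \<beta> p" using ix cc by (simp add: l_minus r_minus)
  moreover have "comb x \<beta> p \<in> adj p E \<beta>" using adjI[of x E \<beta> p] x(1) by simp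
  ultimately show ?thesis using adj_smult[OF \<beta>c, of "\<ominus> (inv (x p))" "comb x \<beta> p" p] ix sr by simp
qed

end

end

section \<open>Distinct values and Taylor expansion\<close>

context valued_field begin

text \<open>Nonzero terms of pairwise distinct values cannot cancel: the term of least value
  determines the value of the sum, so a bound for the sum bounds every term.\<close>

lemma vge_finsum_distinct:
  assumes fin: "finite I" and u: "\<And>i. i \<in> I \<Longrightarrow> u i \<in> carrier R"
    and dist: "\<And>i j. i \<in> I \<Longrightarrow> j \<in> I \<Longrightarrow> u i \<noteq> \<zero> \<Longrightarrow> u j \<noteq> \<zero> \<Longrightarrow> w (u i) = w (u j) \<Longrightarrow> i = j"
    and sum: "vge (finsum R u I) r" and i: "i \<in> I"
  shows "vge (u i) r"
proof (rule ccontr)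
  assume n: "\<not> vge (u i) r"
  define S where "S = {j \<in> I. u j \<noteq> \<zero>}"
  have "i \<in> S" "finite S" using n i fin by (auto simp: S_def vge_def)
  then obtain j where j: "j \<in> S" "\<And>k. k \<in> S \<Longrightarrow> w (u j) \<le> w (u k)"
    using arg_min_if_finite(1)[of S "w \<circ> u"] arg_min_least[of S _ "w \<circ> u"] by (metis comp_apply empty_iff)
  have jI: "j \<in> I" "u j \<noteq> \<zero>" using j by (auto simp: S_def)
  have "vgt (u k) (w (u j))" if "k \<in> I - {j}" for k
  proof (cases "u k = \<zero>")
    case False
    then have "w (u j) \<le> w (u k)" using j(2)[of k] that by (simp add: S_def)
    moreover have "w (u j) \<noteq> w (u k)" using dist[of j k] jI that False by auto
    ultimately show ?thesis by (simp add: vgt_def)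
  qed simp
  then have rest: "vgt (finsum R u (I - {j})) (w (u j))" using fin u by (intro vgt_finsum) auto
  have rc: "finsum R u (I - {j}) \<in> carrier R" using u by (intro finsum_closed) auto
  have split: "finsum R u I = u j \<oplus> finsum R u (I - {j})"
  proof -
    have "I = insert j (I - {j})" using jI by auto
    then have "finsum R u I = finsum R u (insert j (I - {j}))" by simp
    also have "\<dots> = u j \<oplus> finsum R u (I - {j})" using fin u jI by (intro finsum_insert) auto
    finally show ?thesis .
  qed
  have "finsum R u I \<ominus> u j = finsum R u (I - {j})"
    unfolding split using rc u[OF jI(1)] by (simp add: minus_eq a_comm[of "u j"] a_assoc r_neg)
  then have "finsum R u I \<noteq> \<zero> \<and> w (finsum R u I) = w (u j)"
    using rest u jI by (intro w_close) (auto intro!: finsum_closed)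
  with sum have "r \<le> w (u j)" by (simp add: vge_def)
  moreover have "w (u j) < r" using n j(2)[OF \<open>i \<in> S\<close>] by (auto simp: vge_def)
  ultimately show False by simp
qed

lemma vge_taylor:
  assumes x: "x \<in> carrier R" "vge x 0" and h: "h \<in> carrier R" "vge h r" and r: "r \<ge> 0"
  shows "vge ((x \<oplus> h) [^] (s::nat) \<ominus> x [^] s \<ominus> add_pow R s (x [^] (s - 1) \<otimes> h)) (2 * r)"
proof (induction s)
  case 0
  then show ?case by (simp add: minus_eq r_neg)
next
  case (Suc s)
  define A B C where "A = (x \<oplus> h) [^] s" and "B = x [^] s" and "C = add_pow R s (x [^] (s - 1) \<otimes> h)"
  have c: "A \<in> carrier R" "B \<in> carrier R" "C \<in> carrier R" using x h by (auto simp: A_def B_def C_def)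
  have "C \<otimes> x = add_pow R s (x [^] s \<otimes> h)"
  proof (cases s)
    case (Suc m)
    have "C \<otimes> x = add_pow R s (x [^] (s - 1) \<otimes> h \<otimes> x)" unfolding C_def using x h by (intro add_pow_ldistr) auto
    then show ?thesis using x h Suc by (simp add: m_ac)
  qed (use x in \<open>simp add: C_def\<close>)
  then have e: "add_pow R (Suc s) (x [^] (Suc s - 1) \<otimes> h) = C \<otimes> x \<oplus> B \<otimes> h"
    using x h by (simp add: add.nat_pow_Suc B_def)
  have "(x \<oplus> h) [^] Suc s \<ominus> x [^] Suc s \<ominus> add_pow R (Suc s) (x [^] (Suc s - 1) \<otimes> h)
     = A \<otimes> (x \<oplus> h) \<ominus> B \<otimes> x \<ominus> (C \<otimes> x \<oplus> B \<otimes> h)" unfolding e by (simp add: A_def B_def)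
  also have "\<dots> = (A \<ominus> B \<ominus> C) \<otimes> (x \<oplus> h) \<oplus> C \<otimes> h"
  proof -
    \<comment> \<open>An identity in five ring elements, checked over the integers.\<close>
    let ?\<rho> = "\<lambda>i. if i = 0 then A else if i = 1 then B else if i = 2 then C else if i = 3 then x else h"
    have "peval R ?\<rho> (PAdd (PAdd (PMul (Var 0) (PAdd (Var 3) (Var 4))) (PNeg (PMul (Var 1) (Var 3)))) (PNeg (PAdd (PMul (Var 2) (Var 3)) (PMul (Var 1) (Var 4)))))
      = peval R ?\<rho> (PAdd (PMul (PAdd (PAdd (Var 0) (PNeg (Var 1))) (PNeg (Var 2))) (PAdd (Var 3) (Var 4))) (PMul (Var 2) (Var 4)))"
      by (rule peval_cong_int) (use c x h in \<open>auto simp: algebra_simps\<close>)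
    then show ?thesis by (simp add: minus_eq)
  qed
  also have "vge \<dots> (2 * r)"
  proof (intro vge_add)
    have "vge (x \<oplus> h) 0" using x h r vge_mono[OF h(2), of 0] by (intro vge_add) auto
    moreover have "vge (A \<ominus> B \<ominus> C) (2 * r)" using Suc by (simp add: A_def B_def C_def)
    ultimately have "vge ((A \<ominus> B \<ominus> C) \<otimes> (x \<oplus> h)) (2 * r + 0)" using c x h by (intro vge_mult) auto
    then show "vge ((A \<ominus> B \<ominus> C) \<otimes> (x \<oplus> h)) (2 * r)" by simp
    have "vge (x [^] (s - 1) \<otimes> h) (0 + r)" using x h by (intro vge_mult vge_pow_nonneg) auto
    then have "vge C (0 + r)" unfolding C_def using x h by (intro vge_add_pow_nat) auto
    then have "vge (C \<otimes> h) ((0 + r) + r)" using c h by (intro vge_mult) auto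
    then show "vge (C \<otimes> h) (2 * r)" by simp
  qed (use c x h in auto)
  finally show ?case .
qed

lemma comb_vge: "(\<And>s. x s \<in> carrier R) \<Longrightarrow> \<alpha> \<in> carrier R \<Longrightarrow> vge \<alpha> 0 \<Longrightarrow> (\<And>s. s < d \<Longrightarrow> vge (x s) r) \<Longrightarrow> vge (comb x \<alpha> d) r"
proof (unfold comb_def, intro vge_finsum)
  fix s assume *: "\<And>s. x s \<in> carrier R" "\<alpha> \<in> carrier R" "vge \<alpha> 0" "\<And>s. s < d \<Longrightarrow> vge (x s) r" "s \<in> {..<d}"
  have "vge (x s \<otimes> \<alpha> [^] s) (r + 0)" using * by (intro vge_mult vge_pow_nonneg) auto
  then show "vge (x s \<otimes> \<alpha> [^] s) r" by simp
qed auto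

lemma comb_vgt: "(\<And>s. x s \<in> carrier R) \<Longrightarrow> \<alpha> \<in> carrier R \<Longrightarrow> vge \<alpha> 0 \<Longrightarrow> (\<And>s. s < d \<Longrightarrow> vgt (x s) r) \<Longrightarrow> vgt (comb x \<alpha> d) r"
proof (unfold comb_def, intro vgt_finsum)
  fix s assume *: "\<And>s. x s \<in> carrier R" "\<alpha> \<in> carrier R" "vge \<alpha> 0" "\<And>s. s < d \<Longrightarrow> vgt (x s) r" "s \<in> {..<d}"
  have "vgt (x s \<otimes> \<alpha> [^] s) (r + 0)" using * by (intro vgt_mult vge_pow_nonneg) auto
  then show "vgt (x s \<otimes> \<alpha> [^] s) r" by simp
qed auto

text \<open>The last \<open>comb\<close> is the formal derivative at \<open>\<alpha>\<close>; the
  omitted terms are at least quadratic in \<open>h\<close>.\<close>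

lemma comb_taylor:
  assumes x: "\<And>s. x s \<in> carrier R" "\<And>s. vge (x s) 0" and \<alpha>: "\<alpha> \<in> carrier R" "vge \<alpha> 0"
    and h: "h \<in> carrier R" "vge h r" and r: "r \<ge> 0"
  shows "vge (comb x (\<alpha> \<oplus> h) (Suc d) \<ominus> comb x \<alpha> (Suc d) \<ominus> h \<otimes> comb (\<lambda>s. add_pow R (Suc s) (x (Suc s))) \<alpha> d) (2 * r)"
proof (induction d)
  case 0
  show ?case using x \<alpha> h by (simp add: comb_Suc minus_eq r_neg)
next
  case (Suc d)
  let ?D = "\<lambda>s. add_pow R (Suc s) (x (Suc s))"
  define T where "T = (\<alpha> \<oplus> h) [^] Suc d \<ominus> \<alpha> [^] Suc d \<ominus> add_pow R (Suc d) (\<alpha> [^] d \<otimes> h)"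
  have T: "vge T (2 * r)" using vge_taylor[OF \<alpha> h r, of "Suc d"] by (simp add: T_def)
  define A B C U V where "A = comb x (\<alpha> \<oplus> h) (Suc d)" and "B = comb x \<alpha> (Suc d)" and "C = comb ?D \<alpha> d"
    and "U = (\<alpha> \<oplus> h) [^] Suc d" and "V = \<alpha> [^] Suc d"
  define Z where "Z = x (Suc d)"
  define N where "N = add_pow R (Suc d) (\<alpha> [^] d)"
  have c: "A \<in> carrier R" "B \<in> carrier R" "C \<in> carrier R" "U \<in> carrier R" "V \<in> carrier R" "Z \<in> carrier R" "N \<in> carrier R"
    using x \<alpha> h by (auto simp: A_def B_def C_def U_def V_def Z_def N_def simp del: nat_pow_Suc)
  have e1: "comb x (\<alpha> \<oplus> h) (Suc (Suc d)) = A \<oplus> Z \<otimes> U" "comb x \<alpha> (Suc (Suc d)) = B \<oplus> Z \<otimes> V"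
    using x \<alpha> h by (simp_all add: comb_Suc[of _ _ "Suc d"] A_def B_def U_def V_def Z_def del: nat_pow_Suc)
  have e2: "comb ?D \<alpha> (Suc d) = C \<oplus> Z \<otimes> N"
  proof -
    have "comb ?D \<alpha> (Suc d) = C \<oplus> ?D d \<otimes> \<alpha> [^] d" unfolding C_def by (rule comb_Suc) (use x \<alpha> in auto)
    moreover have "?D d \<otimes> \<alpha> [^] d = Z \<otimes> N" unfolding Z_def N_def
      using x \<alpha> by (simp only: add_pow_ldistr add_pow_rdistr nat_pow_closed)
    ultimately show ?thesis by simp
  qed
  have e3: "T = U \<ominus> V \<ominus> N \<otimes> h" unfolding T_def U_def V_def N_def
    using \<alpha> h by (simp only: add_pow_ldistr nat_pow_closed)
  have "(A \<oplus> Z \<otimes> U) \<ominus> (B \<oplus> Z \<otimes> V) \<ominus> h \<otimes> (C \<oplus> Z \<otimes> N) = (A \<ominus> B \<ominus> h \<otimes> C) \<oplus> Z \<otimes> (U \<ominus> V \<ominus> N \<otimes> h)"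
  proof -
    let ?\<rho> = "\<lambda>i. if i = 0 then A else if i = 1 then B else if i = 2 then C else if i = 3 then Z else if i = 4 then U else if i = 5 then V else if i = 6 then N else h"
    have "peval R ?\<rho> (PAdd (PAdd (PAdd (Var 0) (PMul (Var 3) (Var 4))) (PNeg (PAdd (Var 1) (PMul (Var 3) (Var 5))))) (PNeg (PMul (Var 7) (PAdd (Var 2) (PMul (Var 3) (Var 6))))))
      = peval R ?\<rho> (PAdd (PAdd (PAdd (Var 0) (PNeg (Var 1))) (PNeg (PMul (Var 7) (Var 2)))) (PMul (Var 3) (PAdd (PAdd (Var 4) (PNeg (Var 5))) (PNeg (PMul (Var 6) (Var 7))))))"
      by (rule peval_cong_int) (use c h in \<open>auto simp: algebra_simps\<close>)
    then show ?thesis by (simp add: minus_eq)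
  qed
  moreover have "vge ((A \<ominus> B \<ominus> h \<otimes> C) \<oplus> Z \<otimes> (U \<ominus> V \<ominus> N \<otimes> h)) (2 * r)"
  proof (intro vge_add)
    show "vge (A \<ominus> B \<ominus> h \<otimes> C) (2 * r)" using Suc by (simp add: A_def B_def C_def)
    have "vge (Z \<otimes> T) (0 + 2 * r)" using T c h x(2) unfolding e3 by (intro vge_mult) (auto simp: Z_def)
    then show "vge (Z \<otimes> (U \<ominus> V \<ominus> N \<otimes> h)) (2 * r)" unfolding e3 by simp
  qed (use c h in auto)
  ultimately show ?case unfolding e1 e2 by simp
qed

end

context perf_field begin

lemma int_subD: "int_sub E \<Longrightarrow> subfield E R" "int_sub E \<Longrightarrow> \<pi> \<in> E" "int_sub E \<Longrightarrow> x \<in> E \<Longrightarrow> x \<noteq> \<zero> \<Longrightarrow> w x \<in> \<int>"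
  by (auto simp: int_sub_def)

text \<open>Coefficients have integral value and \<open>y\<close> has value \<open>1 / p\<close>, so
  the nonzero terms with \<open>s < p\<close> have values in different classes modulo the
  integers.\<close>

lemma eisenstein_distinct:
  assumes E: "int_sub E" and y: "y \<in> carrier R" "y \<noteq> \<zero>" "w y = 1 / real p" and x: "\<And>s. x s \<in> E"
    and v: "vge (comb x y p) r" and s: "s < p"
  shows "vge (x s \<otimes> y [^] s) r"
proof (rule vge_finsum_distinct[OF finite_lessThan _ _ v[unfolded comb_def]])
  note sf = int_subD(1)[OF E]
  have xc: "x i \<in> carrier R" for i using Ec[OF sf x] .
  have val: "\<exists>m::int. w (x i \<otimes> y [^] i) = real_of_int m + real i / real p" if "x i \<otimes> y [^] i \<noteq> \<zero>" for i
  proof -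
    have "x i \<noteq> \<zero>" using that y by auto
    then have "w (x i) \<in> \<int>" using int_subD(3)[OF E x] by simp
    then obtain m where "w (x i) = real_of_int m" by (elim Ints_cases)
    moreover have "w (x i \<otimes> y [^] i) = w (x i) + real i * (1 / real p)"
      using w_mult[OF xc[of i], of "y [^] i"] \<open>x i \<noteq> \<zero>\<close> y pow_nonzero[OF y(1,2)] w_pow[OF y(1,2)] by simp
    ultimately show ?thesis by auto
  qed
  show "x i \<otimes> y [^] i \<in> carrier R" for i using xc y by simp
  fix i j assume ij: "i \<in> {..<p}" "j \<in> {..<p}" "x i \<otimes> y [^] i \<noteq> \<zero>" "x j \<otimes> y [^] j \<noteq> \<zero>"
    "w (x i \<otimes> y [^] i) = w (x j \<otimes> y [^] j)"
  obtain a b :: int where "w (x i \<otimes> y [^] i) = real_of_int a + real i / real p" "w (x j \<otimes> y [^] j) = real_of_int b + real j / real p"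
    using val[OF ij(3)] val[OF ij(4)] by blast
  with ij(5) have "real_of_int a + real i / real p = real_of_int b + real j / real p" by simp
  then have "real_of_int a * real p + real i = real_of_int b * real p + real j" using p_pos by (simp add: field_simps)
  then have "real_of_int (a * int p + int i) = real_of_int (b * int p + int j)" by simp
  then have e: "a * int p + int i = b * int p + int j" by linarith
  then have "(a * int p + int i) mod int p = (b * int p + int j) mod int p" by simp
  then have "int i mod int p = int j mod int p" by simp
  then show "i = j" using ij by simp
qed (use s in simp)

text \<open>An element of value \<open>1 / p\<close> makes \<open>E(\<alpha>)\<close> totally
  ramified of degree \<open>p\<close>, so no new residues appear. By \<open>exchange\<close> the
  element \<open>\<alpha>\<close> is a polynomial in \<open>y\<close>; all its terms are integral,
  those with \<open>s > 0\<close> have a fractional and hence positive value, and the residue of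
  \<open>\<alpha>\<close> is that of the constant term.\<close>

lemma eisenstein_approx:
  assumes E: "int_sub E" and \<alpha>: "\<alpha> \<in> carrier R" "\<alpha> [^] p \<in> E" "vge \<alpha> 0"
    and y: "y \<in> adj p E \<alpha>" "y \<noteq> \<zero>" "w y = 1 / real p"
  shows "\<exists>x0\<in>E. vgt (\<alpha> \<ominus> x0) 0"
proof -
  note sf = int_subD(1)[OF E]
  have yc: "y \<in> carrier R" using adj_carrier[OF sf \<alpha>(1) y(1)] .
  have "\<alpha> \<in> adj p E y"
  proof (rule exchange[OF sf \<alpha>(1,2) y(1)])
    fix x assume x: "\<And>s. x s \<in> E" "comb x y p = \<zero>"
    show "\<forall>s<p. x s = \<zero>"
    proof (intro allI impI)
      fix s assume s: "s < p"
      have "vge (x s \<otimes> y [^] s) (w (x s \<otimes> y [^] s) + 1)"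
        by (rule eisenstein_distinct[OF E yc y(2,3) x(1) _ s]) (simp add: x(2))
      then have "x s \<otimes> y [^] s = \<zero>" by (simp add: vge_def)
      then show "x s = \<zero>" using Ec[OF sf x(1)] pow_nonzero[OF yc y(2)] yc by (simp add: integral_iff)
    qed
  qed
  then obtain x where x: "\<And>s. x s \<in> E" "\<alpha> = comb x y p" using adjE by blast
  have xc: "x s \<in> carrier R" for s using Ec[OF sf x(1)] .
  have "vgt (x s \<otimes> y [^] s) 0" if s: "s < p" "s \<noteq> 0" for s
  proof (cases "x s = \<zero>")
    case True then show ?thesis using yc by simp
  next
    case False
    have ge: "vge (x s \<otimes> y [^] s) 0" by (rule eisenstein_distinct[OF E yc y(2,3) x(1) _ s(1)]) (use \<alpha>(3) x(2) in simp)
    obtain m where m: "w (x s) = real_of_int m" using int_subD(3)[OF E x(1) False] by (elim Ints_cases)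
    have wv: "w (x s \<otimes> y [^] s) = real_of_int m + real s / real p"
      using w_mult[OF xc[of s], of "y [^] s"] False yc y pow_nonzero[OF yc y(2)] w_pow[OF yc y(2)] m by simp
    have "real_of_int m + real s / real p \<noteq> 0"
    proof
      assume "real_of_int m + real s / real p = 0"
      then have "real_of_int (m * int p + int s) = 0" using p_pos by (simp add: field_simps)
      then have "m * int p + int s = 0" by linarith
      then have "int s = int p * (- m)" by (simp add: algebra_simps)
      then have "int p dvd int s" by (metis dvd_triv_left)
      then have "p dvd s" by simp
      with s show False by (auto dest: dvd_imp_le)
    qed
    with ge show ?thesis unfolding vge_def vgt_def wv by auto
  qed
  then have "vgt (\<Oplus>s\<in>{1..<p}. x s \<otimes> y [^] s) 0" using xc yc by (intro vgt_finsum) auto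
  moreover have "\<alpha> \<ominus> x 0 = (\<Oplus>s\<in>{1..<p}. x s \<otimes> y [^] s)"
  proof -
    have "{..<p} = insert 0 {1..<p}" using p_pos by auto
    then have "\<alpha> = x 0 \<otimes> y [^] (0::nat) \<oplus> (\<Oplus>s\<in>{1..<p}. x s \<otimes> y [^] s)"
      unfolding x(2) comb_def using xc yc by (simp add: finsum_insert)
    then show ?thesis using xc yc finsum_closed[of "\<lambda>s. x s \<otimes> y [^] s" "{1..<p}"]
      by (simp add: minus_eq a_comm[of "x 0"] a_assoc r_neg)
  qed
  ultimately show ?thesis using x(1) by metis
qed

text \<open>If \<open>c\<close> is no \<open>p\<close>-th power modulo the maximal ideal, the powers of \<open>\<alpha> = c ^ (1 / p)\<close> are
  independent in the residue field. A residual relation \<open>f(\<alpha>) = 0\<close> of minimal degree is simple, hence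
  \<open>f(\<alpha>)\<close> or \<open>f(\<alpha> + \<pi> ^ (1 / p))\<close> would generate a totally ramified extension of degree \<open>p\<close>
  inside \<open>E(\<alpha>)\<close> or \<open>E(\<alpha> + \<pi> ^ (1 / p))\<close>.\<close>

lemma residual_independence:
  assumes E: "int_sub E" and c: "c \<in> E" "vge c 0" "\<not> app E c" and \<alpha>: "\<alpha> \<in> carrier R" "\<alpha> [^] p = c"
  shows "d < p \<Longrightarrow> (\<And>s. e s \<in> E) \<Longrightarrow> (\<And>s. vge (e s) 0) \<Longrightarrow> \<not> vgt (e d) 0 \<Longrightarrow> \<not> vgt (comb e \<alpha> (Suc d)) 0"
proof (induction d arbitrary: e)
  case 0
  have "e 0 \<in> carrier R" using Ec[OF int_subD(1)[OF E] 0(2)] .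
  moreover have "comb e \<alpha> (Suc 0) = e 0" using Ec[OF int_subD(1)[OF E] 0(2)] \<alpha> by (simp add: comb_Suc)
  ultimately show ?case using 0(4) by simp
next
  case (Suc d)
  note sf = int_subD(1)[OF E]
  note S = sr[OF sf]
  have ec: "e s \<in> carrier R" for s using Ec[OF sf Suc.prems(2)] .
  have \<alpha>0: "vge \<alpha> 0" using vge_pow_p[OF \<alpha>(1)] \<alpha>(2) c(2) by simp
  define e' where "e' s = add_pow R (Suc s) (e (Suc s))" for s
  have natin: "add_pow R (k::nat) x \<in> E" if "x \<in> E" for k x
    by (induction k) (use that S in \<open>auto simp: add.nat_pow_Suc\<close>)
  have e'E: "e' s \<in> E" for s unfolding e'_def by (rule natin[OF Suc.prems(2)])
  have e'c: "e' s \<in> carrier R" for s using Ec[OF sf e'E] .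
  have e'0: "vge (e' s) 0" for s unfolding e'_def using ec Suc.prems(3) by (intro vge_add_pow_nat) auto
  \<comment> \<open>As \<open>d + 1 < p\<close>, the integer factor produced by differentiation is a
    unit. The derivative keeps a nonzero leading residue, and the induction hypothesis applies to
    it.\<close>
  have "\<not> vgt (e' d) 0"
  proof -
    have nz: "e (Suc d) \<noteq> \<zero>" "w (e (Suc d)) = 0" using Suc.prems(3)[of "Suc d"] Suc.prems(4) by (auto simp: vge_def vgt_def)
    have "e' d = add_pow R (Suc d) \<one> \<otimes> e (Suc d)" unfolding e'_def by (rule add_pow_mult_eq[OF ec])
    moreover note w_nat_unit[of "Suc d"]
    ultimately have "e' d \<noteq> \<zero> \<and> w (e' d) = 0"
      using nz Suc.prems(1) ec w_mult[of "add_pow R (Suc d) \<one>" "e (Suc d)"] by (auto simp: integral_iff)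
    then show ?thesis by (simp add: vgt_def)
  qed
  then have f'n: "\<not> vgt (comb e' \<alpha> (Suc d)) 0" using Suc.IH[of e'] Suc.prems(1) e'E e'0 by simp
  define f f' where "f = comb e \<alpha> (Suc (Suc d))" and "f' = comb e' \<alpha> (Suc d)"
  have fc: "f \<in> carrier R" "f' \<in> carrier R" using ec e'c \<alpha> by (auto simp: f_def f'_def)
  have "vge f' 0" unfolding f'_def using e'c e'0 \<alpha> \<alpha>0 by (intro comb_vge) auto
  then have f': "f' \<noteq> \<zero>" "w f' = 0" using f'n by (auto simp: f'_def vge_def vgt_def)
  have noapp: False if "x0 \<in> E" "vgt (\<alpha> \<ominus> x0) 0" for x0
  proof -
    have x0c: "x0 \<in> carrier R" using Ec[OF sf that(1)] .
    have "vgt ((\<alpha> \<ominus> x0) [^] p) 0" using vgt_pow_p[of "\<alpha> \<ominus> x0"] that \<alpha> x0c by simp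
    then have "vgt (c \<ominus> x0 [^] p) 0" using frob_diff[OF \<alpha>(1) x0c] \<alpha>(2) by simp
    with c(3) that(1) show False by (auto simp: app_def)
  qed
  have inadj: "comb e \<gamma> (Suc (Suc d)) \<in> adj p E \<gamma>" if "\<gamma> \<in> carrier R" for \<gamma>
  proof -
    have "comb (\<lambda>s. if s < Suc (Suc d) then e s else \<zero>) \<gamma> p = comb e \<gamma> (Suc (Suc d))"
      using ec that Suc.prems(1) by (intro comb_trunc) auto
    moreover have "comb (\<lambda>s. if s < Suc (Suc d) then e s else \<zero>) \<gamma> p \<in> adj p E \<gamma>"
      by (rule adjI) (use Suc.prems(2) S in auto)
    ultimately show ?thesis by simp
  qed
  show ?case
  proof
    assume "vgt (comb e \<alpha> (Suc (Suc d))) 0"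
    then have fg: "vgt f 0" by (simp add: f_def)
    \<comment> \<open>\<open>f ^ p\<close> lies in \<open>E\<close> and has integral value, so a
      positive value of \<open>f\<close> is at least \<open>1 / p\<close>.\<close>
    have fge: "vge f (1 / real p)"
    proof (cases "f = \<zero>")
      case False
      have fp: "f [^] p \<in> E" using adj_pow_p[OF sf \<alpha>(1) _ inadj[OF \<alpha>(1)]] \<alpha>(2) c(1) by (simp add: f_def)
      then obtain m where "w (f [^] p) = real_of_int m"
        using int_subD(3)[OF E fp] pow_nonzero[OF fc(1) False] by (auto elim: Ints_cases)
      then have m: "real p * w f = real_of_int m" using w_pow[OF fc(1) False] by simp
      have "w f > 0" using fg False by (simp add: vgt_def)
      then have "real_of_int m > 0" using m p_pos by (metis of_nat_0_less_iff mult_pos_pos)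
      then have "m \<ge> 1" by simp
      then have "1 \<le> real p * w f" unfolding m by simp
      then show ?thesis using p_pos by (simp add: vge_def field_simps)
    qed simp
    show False
    proof (cases "f \<noteq> \<zero> \<and> w f = 1 / real p")
      case True
      then obtain x0 where "x0 \<in> E" "vgt (\<alpha> \<ominus> x0) 0"
        using eisenstein_approx[OF E \<alpha>(1) _ \<alpha>0 inadj[OF \<alpha>(1)]] \<alpha>(2) c(1) by (auto simp: f_def)
      then show False by (rule noapp)
    next
      case False
      then have fgt: "vgt f (1 / real p)" using fge by (auto simp: vge_def vgt_def)
      \<comment> \<open>If \<open>f\<close> vanishes too strongly, shift \<open>\<alpha>\<close> by
        a p-th root \<open>h\<close> of \<open>\<pi>\<close>. The linear term \<open>h * f'\<close>
        has value exactly \<open>1 / p\<close> and beats both \<open>f\<close> and the quadratic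
        error, so the value of \<open>f1\<close> becomes \<open>1 / p\<close>. Since
        \<open>h\<close> has positive value, \<open>\<gamma>\<close> and \<open>\<alpha>\<close>
        have the same residue.\<close>
      obtain h where h: "h \<in> carrier R" "h [^] p = \<pi>" using root[OF pi(1)] by blast
      have hnz: "h \<noteq> \<zero>" using h pi p_pos by (auto simp: nat_pow_zero)
      have hw: "w h = 1 / real p" using w_pow[OF h(1) hnz, of p] h(2) pi(3) p_pos by (simp add: field_simps)
      have hge: "vge h (1 / real p)" by (simp add: vge_def hw)
      define \<gamma> where "\<gamma> = \<alpha> \<oplus> h"
      have \<gamma>: "\<gamma> \<in> carrier R" "\<gamma> [^] p \<in> E" using \<alpha> h c(1) int_subD(2)[OF E] S by (auto simp: \<gamma>_def frob_add)
      have hpos: "vge h 0" by (rule vge_mono[OF hge]) simp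
      have \<gamma>0: "vge \<gamma> 0" unfolding \<gamma>_def by (intro vge_add \<alpha> h(1) \<alpha>0 hpos)
      define f1 where "f1 = comb e \<gamma> (Suc (Suc d))"
      have f1c: "f1 \<in> carrier R" using ec \<gamma> by (simp add: f1_def)
      have "vge (f1 \<ominus> f \<ominus> h \<otimes> f') (2 * (1 / real p))"
        unfolding f1_def f_def f'_def \<gamma>_def e'_def
        by (rule comb_taylor[OF ec Suc.prems(3) \<alpha>(1) \<alpha>0 h(1) hge]) simp
      then have "vgt (f1 \<ominus> f \<ominus> h \<otimes> f') (1 / real p)" by (rule vge_imp_vgt) (use p_pos in \<open>simp add: field_simps\<close>)
      then have "vgt ((f1 \<ominus> f \<ominus> h \<otimes> f') \<oplus> f) (1 / real p)" using fc h f1c fgt by (intro vgt_add) auto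
      moreover have "(f1 \<ominus> f \<ominus> h \<otimes> f') \<oplus> f = f1 \<ominus> h \<otimes> f'"
        using fc h f1c by (simp add: minus_eq a_ac l_neg) (simp add: a_assoc[symmetric] r_neg)
      moreover have hf: "h \<otimes> f' \<noteq> \<zero>" "w (h \<otimes> f') = 1 / real p"
        using w_mult[OF h(1) fc(2) hnz f'(1)] hw f' hnz h fc by (auto simp: integral_iff)
      ultimately have "f1 \<noteq> \<zero> \<and> w f1 = 1 / real p" using w_close[of f1 "h \<otimes> f'"] f1c h fc by simp
      then obtain x0 where x0: "x0 \<in> E" "vgt (\<gamma> \<ominus> x0) 0"
        using eisenstein_approx[OF E \<gamma> \<gamma>0 inadj[OF \<gamma>(1)]] by (auto simp: f1_def)
      have x0c: "x0 \<in> carrier R" using Ec[OF sf x0(1)] .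
      have "vgt ((\<gamma> \<ominus> x0) \<ominus> h) 0" by (rule vgt_diff[OF _ h(1) x0(2) vge_imp_vgt[OF hge]]) (use \<gamma> x0c p_pos in auto)
      moreover have "(\<gamma> \<ominus> x0) \<ominus> h = \<alpha> \<ominus> x0"
        using \<alpha> h x0c by (simp add: \<gamma>_def minus_eq a_assoc a_comm[of "\<ominus> x0"]) (simp add: a_assoc[symmetric] r_neg)
      ultimately show False using noapp[OF x0(1)] by simp
    qed
  qed
qed

text \<open>Dividing by a coefficient of least value makes all coefficients integral and one of them
  equal to one; by \<open>residual_independence\<close> the resulting sum has value zero. So the
  value on \<open>E(\<alpha>)\<close> is the minimum over the coefficients.\<close>

lemma comb_min:
  assumes E: "int_sub E" and c: "c \<in> E" "vge c 0" "\<not> app E c" and \<alpha>: "\<alpha> \<in> carrier R" "\<alpha> [^] p = c"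
    and x: "\<And>s. x s \<in> E" and nz: "\<exists>s<p. x s \<noteq> \<zero>"
  shows "comb x \<alpha> p \<noteq> \<zero> \<and> (\<exists>s<p. x s \<noteq> \<zero> \<and> w (comb x \<alpha> p) = w (x s)) \<and> (\<forall>s<p. vge (x s) (w (comb x \<alpha> p)))"
proof -
  note sf = int_subD(1)[OF E]
  note S = sr[OF sf]
  have xc: "x s \<in> carrier R" for s using Ec[OF sf x] .
  have \<alpha>0: "vge \<alpha> 0" using vge_pow_p[OF \<alpha>(1)] \<alpha>(2) c(2) by simp
  define I where "I = {s. s < p \<and> x s \<noteq> \<zero>}"
  have "finite I" "I \<noteq> {}" using nz by (auto simp: I_def)
  then obtain t where t: "t \<in> I" "\<And>k. k \<in> I \<Longrightarrow> w (x t) \<le> w (x k)"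
    using arg_min_if_finite(1)[of I "w \<circ> x"] arg_min_least[of I _ "w \<circ> x"] by (metis comp_apply)
  have tp: "t < p" "x t \<noteq> \<zero>" using t by (auto simp: I_def)
  have it: "inv (x t) \<in> E" "inv (x t) \<in> carrier R" "inv (x t) \<noteq> \<zero>" "x t \<otimes> inv (x t) = \<one>"
    using inv_in[OF sf x tp(2)] inv_nonzero[OF xc tp(2)] by auto
  define e where "e s = (if s < p then inv (x t) \<otimes> x s else \<zero>)" for s
  have eE: "e s \<in> E" for s using x it S by (simp add: e_def)
  have ec: "e s \<in> carrier R" for s using Ec[OF sf eE] .
  have min: "vge (x s) (w (x t))" if "s < p" for s
    using t(2)[of s] that by (cases "x s = \<zero>") (auto simp: I_def vge_def)
  have e0: "vge (e s) 0" for s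
  proof (cases "s < p")
    case True
    have "vge (inv (x t) \<otimes> x s) (- w (x t) + w (x t))"
      using it xc min[OF True] w_inv[OF xc tp(2)] by (intro vge_mult) (auto simp: vge_def)
    then show ?thesis using True by (simp add: e_def)
  qed (simp add: e_def)
  have et: "e t = \<one>" using tp it xc by (simp add: e_def m_comm)
  \<comment> \<open>\<open>residual_independence\<close> needs a leading coefficient that is a unit.
    The coefficients above the largest index \<open>d\<close> in \<open>D\<close> vanish residually
    and are split off.\<close>
  define D where "D = {s. s < p \<and> \<not> vgt (e s) 0}"
  have "t \<in> D" using tp et w_one by (simp add: D_def vgt_def)
  then have Dne: "finite D" "D \<noteq> {}" by (auto simp: D_def)
  define d where "d = Max D"
  have d: "d < p" "\<not> vgt (e d) 0" using Max_in[OF Dne] by (auto simp: D_def d_def)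
  have above: "vgt (e s) 0" if "d < s" "s < p" for s
  proof (rule ccontr)
    assume "\<not> vgt (e s) 0"
    then have "s \<le> d" unfolding d_def using that by (intro Max_ge[OF Dne(1)]) (simp add: D_def)
    with that show False by simp
  qed
  have n: "\<not> vgt (comb e \<alpha> (Suc d)) 0" using residual_independence[OF E c \<alpha> d(1), of e] eE e0 d(2) by blast
  have split: "comb e \<alpha> p = comb e \<alpha> (Suc d) \<oplus> comb (\<lambda>s. if s < Suc d then \<zero> else e s) \<alpha> p"
  proof -
    have "comb e \<alpha> p = comb (\<lambda>s. (if s < Suc d then e s else \<zero>) \<oplus> (if s < Suc d then \<zero> else e s)) \<alpha> p"
      by (rule arg_cong[of _ _ "\<lambda>x. comb x \<alpha> p"]) (auto simp: fun_eq_iff ec)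
    also have "\<dots> = comb (\<lambda>s. if s < Suc d then e s else \<zero>) \<alpha> p \<oplus> comb (\<lambda>s. if s < Suc d then \<zero> else e s) \<alpha> p"
      using ec \<alpha> by (intro comb_add) auto
    also have "comb (\<lambda>s. if s < Suc d then e s else \<zero>) \<alpha> p = comb e \<alpha> (Suc d)"
      using ec \<alpha> d(1) by (intro comb_trunc) auto
    finally show ?thesis .
  qed
  have rest: "vgt (comb (\<lambda>s. if s < Suc d then \<zero> else e s) \<alpha> p) 0"
    using ec \<alpha> \<alpha>0 above by (intro comb_vgt) auto
  have cl: "comb e \<alpha> p \<in> carrier R" "comb e \<alpha> (Suc d) \<in> carrier R" "comb (\<lambda>s. if s < Suc d then \<zero> else e s) \<alpha> p \<in> carrier R"
    using ec \<alpha> by auto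
  have "\<not> vgt (comb e \<alpha> p) 0"
  proof
    assume "vgt (comb e \<alpha> p) 0"
    then have "vgt (comb e \<alpha> p \<ominus> comb (\<lambda>s. if s < Suc d then \<zero> else e s) \<alpha> p) 0" using rest cl by (intro vgt_diff)
    moreover have "comb e \<alpha> p \<ominus> comb (\<lambda>s. if s < Suc d then \<zero> else e s) \<alpha> p = comb e \<alpha> (Suc d)"
      unfolding split using cl(2,3) by (simp add: minus_eq a_assoc r_neg)
    ultimately show False using n by simp
  qed
  moreover have "vge (comb e \<alpha> p) 0" using ec e0 \<alpha> \<alpha>0 by (intro comb_vge) auto
  ultimately have ce: "comb e \<alpha> p \<noteq> \<zero>" "w (comb e \<alpha> p) = 0" by (auto simp: vge_def vgt_def)
  have "comb e \<alpha> p = comb (\<lambda>s. inv (x t) \<otimes> x s) \<alpha> p"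
    unfolding comb_def using xc it \<alpha> by (intro finsum_cong') (auto simp: e_def)
  also have "\<dots> = inv (x t) \<otimes> comb x \<alpha> p" using xc it \<alpha> by (intro comb_smult) auto
  finally have ceq: "comb e \<alpha> p = inv (x t) \<otimes> comb x \<alpha> p" .
  have xcc: "comb x \<alpha> p \<in> carrier R" using xc \<alpha> by simp
  have nz': "comb x \<alpha> p \<noteq> \<zero>" using ce(1) ceq it by auto
  have "0 = - w (x t) + w (comb x \<alpha> p)"
    using ce(2) ceq w_mult[OF it(2) xcc it(3) nz'] w_inv[OF xc tp(2)] by simp
  then have "w (comb x \<alpha> p) = w (x t)" by simp
  then show ?thesis using nz' tp min by auto
qed

text \<open>By \<open>comb_min\<close> each nonzero element of \<open>E(\<alpha>)\<close> has the
  value of a coefficient in \<open>E\<close>, hence an integral one.\<close>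

lemma adj_int_sub:
  assumes E: "int_sub E" and c: "c \<in> E" "vge c 0" "\<not> app E c" and \<alpha>: "\<alpha> \<in> carrier R" "\<alpha> [^] p = c"
  shows "int_sub (adj p E \<alpha>)" "E \<subseteq> adj p E \<alpha>" "\<alpha> \<in> adj p E \<alpha>" "\<alpha> \<notin> E"
proof -
  note sf = int_subD(1)[OF E]
  show "E \<subseteq> adj p E \<alpha>" by (rule adj_base[OF sf p_pos \<alpha>(1)])
  then have "\<pi> \<in> adj p E \<alpha>" using int_subD(2)[OF E] by blast
  moreover have "subfield (adj p E \<alpha>) R" by (rule adj_subfield[OF sf \<alpha>(1)]) (use \<alpha>(2) c(1) in simp)
  moreover have "w y \<in> \<int>" if y: "y \<in> adj p E \<alpha>" "y \<noteq> \<zero>" for y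
  proof -
    obtain x where x: "\<And>s. x s \<in> E" "y = comb x \<alpha> p" using adjE[OF y(1)] by blast
    have "\<exists>s<p. x s \<noteq> \<zero>"
    proof (rule ccontr)
      assume "\<not> (\<exists>s<p. x s \<noteq> \<zero>)"
      then have "comb x \<alpha> p = (\<Oplus>s\<in>{..<p}. \<zero>)" unfolding comb_def using \<alpha> by (intro finsum_cong') auto
      then show False using y(2) x(2) by (simp add: finsum_zero)
    qed
    from comb_min[OF E c \<alpha> x(1) this] obtain s where "x s \<noteq> \<zero>" "w y = w (x s)" unfolding x(2) by blast
    then show ?thesis using int_subD(3)[OF E x(1)] by simp
  qed
  ultimately show "int_sub (adj p E \<alpha>)" by (simp add: int_sub_def)
  show "\<alpha> \<in> adj p E \<alpha>" by (rule adj_gen[OF sf p_gt1 \<alpha>(1)])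
  show "\<alpha> \<notin> E"
  proof
    assume "\<alpha> \<in> E"
    moreover have "vgt (c \<ominus> \<alpha> [^] p) 0" using \<alpha>(2) Ec[OF sf c(1)] by (simp add: minus_eq r_neg)
    ultimately show False using c(3) by (auto simp: app_def)
  qed
qed

text \<open>Zorn's lemma for subfields avoiding a set. Avoidance passes to unions of chains, and
  both applications put their side conditions into \<open>B\<close>.\<close>

lemma maximal_subfield:
  assumes E0: "subfield E0 R" "E0 \<inter> B = {}"
  shows "\<exists>E. subfield E R \<and> E0 \<subseteq> E \<and> E \<inter> B = {} \<and> (\<forall>E'. subfield E' R \<longrightarrow> E \<subseteq> E' \<longrightarrow> E' \<inter> B = {} \<longrightarrow> E' = E)"
proof -
  define AA where "AA = {E. subfield E R \<and> E0 \<subseteq> E \<and> E \<inter> B = {}}"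
  have "\<exists>M\<in>AA. \<forall>U\<in>AA. M \<subseteq> U \<longrightarrow> U = M"
  proof (rule subset_Zorn_nonempty)
    show "AA \<noteq> {}" using E0 by (auto simp: AA_def)
    fix C assume C: "C \<noteq> {}" "subset.chain AA C"
    have CA: "E \<in> AA" if "E \<in> C" for E using C(2) that by (auto simp: subset.chain_def)
    have lin: "U \<subseteq> Y \<or> Y \<subseteq> U" if "U \<in> C" "Y \<in> C" for U Y using C(2) that by (auto simp: subset_chain_def)
    have sub: "subfield E R" if "E \<in> C" for E using CA[OF that] by (simp add: AA_def)
    have "subfield (\<Union>C) R"
    proof (rule subfieldI'[OF subringI])
      show "\<Union>C \<subseteq> carrier R" using Ec[OF sub] by blast
      show "\<one> \<in> \<Union>C" using C(1) sr(3)[OF sub] by blast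
      show "\<ominus> h \<in> \<Union>C" if "h \<in> \<Union>C" for h using that sr(5)[OF sub] by blast
      fix h1 h2 assume h: "h1 \<in> \<Union>C" "h2 \<in> \<Union>C"
      then obtain U Y where UY: "U \<in> C" "h1 \<in> U" "Y \<in> C" "h2 \<in> Y" by blast
      then obtain Z where Z: "Z \<in> C" "h1 \<in> Z" "h2 \<in> Z" using lin[OF UY(1,3)] by blast
      show "h1 \<otimes> h2 \<in> \<Union>C" using sr(6)[OF sub[OF Z(1)] Z(2,3)] Z(1) by blast
      show "h1 \<oplus> h2 \<in> \<Union>C" using sr(7)[OF sub[OF Z(1)] Z(2,3)] Z(1) by blast
    next
      fix k assume "k \<in> \<Union>C - {\<zero>}"
      then obtain U where "U \<in> C" "k \<in> U" "k \<noteq> \<zero>" by blast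
      then show "inv k \<in> \<Union>C" using inv_in[OF sub] by blast
    qed
    moreover have "E0 \<subseteq> \<Union>C" using C(1) CA by (auto simp: AA_def)
    moreover have "\<Union>C \<inter> B = {}" using CA by (auto simp: AA_def)
    ultimately show "\<Union>C \<in> AA" by (simp add: AA_def)
  qed
  then obtain M where M: "M \<in> AA" "\<And>U. U \<in> AA \<Longrightarrow> M \<subseteq> U \<Longrightarrow> U = M" by blast
  then show ?thesis unfolding AA_def by (intro exI[of _ M]) blast
qed

text \<open>In a maximal \<open>E\<close> with integral values, an integral \<open>c\<close> that is
  no residual p-th power would admit the larger field \<open>adj p E \<alpha>\<close>. So maximality
  yields a perfect residue field.\<close>

lemma ex_perfect:
  assumes E0: "int_sub E0"
  shows "\<exists>E. int_sub E \<and> E0 \<subseteq> E \<and> (\<forall>c\<in>E. vge c 0 \<longrightarrow> app E c)"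
proof -
  define B where "B = {x \<in> carrier R. x \<noteq> \<zero> \<and> w x \<notin> \<int>}"
  have iff: "int_sub E \<longleftrightarrow> subfield E R \<and> \<pi> \<in> E \<and> E \<inter> B = {}" for E
  proof
    assume "int_sub E" then show "subfield E R \<and> \<pi> \<in> E \<and> E \<inter> B = {}" by (auto simp: int_sub_def B_def)
  next
    assume *: "subfield E R \<and> \<pi> \<in> E \<and> E \<inter> B = {}"
    then show "int_sub E" using Ec[of E] unfolding int_sub_def B_def by blast
  qed
  obtain E where E: "subfield E R" "E0 \<subseteq> E" "E \<inter> B = {}" "\<And>E'. subfield E' R \<Longrightarrow> E \<subseteq> E' \<Longrightarrow> E' \<inter> B = {} \<Longrightarrow> E' = E"
    using maximal_subfield[of E0 B] E0 iff by blast
  have iE: "int_sub E" using E E0 iff by blast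
  have "app E c" if c: "c \<in> E" "vge c 0" for c
  proof (rule ccontr)
    assume n: "\<not> app E c"
    obtain \<alpha> where \<alpha>: "\<alpha> \<in> carrier R" "\<alpha> [^] p = c" using root Ec[OF E(1) c(1)] by blast
    note a = adj_int_sub[OF iE c n \<alpha>]
    have "adj p E \<alpha> = E" using E(4)[OF _ a(2)] a(1) iff by blast
    with a show False by blast
  qed
  with iE E(2) show ?thesis by blast
qed

text \<open>Take \<open>E\<close> maximal with \<open>a\<close> still no residual p-th power.
  Adjoining any other missing root \<open>\<alpha>\<close> then makes \<open>a\<close> residually
  the p-th power of some \<open>b\<close> in \<open>E(\<alpha>)\<close>. This \<open>b\<close>
  generates the same field, so \<open>\<alpha>\<close> is a polynomial in \<open>b\<close>, and its
  p-th power writes \<open>c\<close> as a polynomial in \<open>a\<close> with p-th powers as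
  coefficients.\<close>

lemma ex_p_basis:
  assumes E0: "int_sub E0" and a: "a \<in> E0" "vge a 0" "\<not> app E0 a"
  shows "\<exists>E. int_sub E \<and> E0 \<subseteq> E \<and> \<not> app E a \<and>
    (\<forall>c\<in>E. vge c 0 \<longrightarrow> (\<exists>x. (\<forall>s. x s \<in> E \<and> vge (x s) 0) \<and> vgt (c \<ominus> comb (\<lambda>s. x s [^] p) a p) 0))"
proof -
  define B where "B = {x \<in> carrier R. x \<noteq> \<zero> \<and> w x \<notin> \<int>} \<union> {b \<in> carrier R. vgt (a \<ominus> b [^] p) 0}"
  have iff: "int_sub E \<and> \<not> app E a \<longleftrightarrow> subfield E R \<and> \<pi> \<in> E \<and> E \<inter> B = {}" for E
  proof
    assume "int_sub E \<and> \<not> app E a" then show "subfield E R \<and> \<pi> \<in> E \<and> E \<inter> B = {}" by (auto simp: int_sub_def B_def app_def)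
  next
    assume *: "subfield E R \<and> \<pi> \<in> E \<and> E \<inter> B = {}"
    then show "int_sub E \<and> \<not> app E a" using Ec[of E] unfolding int_sub_def B_def app_def by blast
  qed
  obtain E where E: "subfield E R" "E0 \<subseteq> E" "E \<inter> B = {}" "\<And>E'. subfield E' R \<Longrightarrow> E \<subseteq> E' \<Longrightarrow> E' \<inter> B = {} \<Longrightarrow> E' = E"
    using maximal_subfield[of E0 B] E0 a(3) iff by blast
  have iE: "int_sub E" and na: "\<not> app E a" using E E0 a(3) iff[of E] iff[of E0] by auto
  have aE: "a \<in> E" and ac: "a \<in> carrier R" using a(1) E(2) Ec[OF E(1)] by auto
  note S = sr[OF E(1)]
  have "\<exists>x. (\<forall>s. x s \<in> E \<and> vge (x s) 0) \<and> vgt (c \<ominus> comb (\<lambda>s. x s [^] p) a p) 0" if c: "c \<in> E" "vge c 0" for c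
  proof (cases "app E c")
    case True
    then obtain b where b: "b \<in> E" "vgt (c \<ominus> b [^] p) 0" by (auto simp: app_def)
    have bc: "b \<in> carrier R" and cc: "c \<in> carrier R" using Ec[OF E(1)] b c by auto
    have "vge (c \<ominus> (c \<ominus> b [^] p)) 0" by (rule vge_diff[OF _ _ c(2) vgt_imp_vge[OF b(2)]]) (use bc cc in auto)
    moreover have "c \<ominus> (c \<ominus> b [^] p) = b [^] p" using bc cc by (simp add: minus_eq minus_add a_assoc[symmetric] r_neg)
    ultimately have b0: "vge b 0" using vge_pow_p[OF bc] by simp
    define x where "x s = (if s = 0 then b else \<zero>)" for s :: nat
    have "comb (\<lambda>s. x s [^] p) a p = comb (\<lambda>s. if s = 0 then b [^] p else \<zero>) a p"
      by (rule arg_cong[of _ _ "\<lambda>x. comb x a p"]) (use p_pos in \<open>auto simp: x_def fun_eq_iff nat_pow_zero\<close>)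
    also have "\<dots> = b [^] p" using comb_unit[of a 0 p "b [^] p"] bc ac p_pos by simp
    finally show ?thesis using b b0 S by (intro exI[of _ x]) (auto simp: x_def)
  next
    case False
    obtain \<alpha> where \<alpha>: "\<alpha> \<in> carrier R" "\<alpha> [^] p = c" using root Ec[OF E(1) c(1)] by blast
    note ad = adj_int_sub[OF iE c False \<alpha>]
    have "app (adj p E \<alpha>) a"
    proof (rule ccontr)
      assume "\<not> app (adj p E \<alpha>) a"
      then have "adj p E \<alpha> = E" using E(4)[OF _ ad(2)] ad(1) iff by blast
      with ad show False by blast
    qed
    then obtain b where b: "b \<in> adj p E \<alpha>" "vgt (a \<ominus> b [^] p) 0" by (auto simp: app_def)
    have bc: "b \<in> carrier R" using adj_carrier[OF E(1) \<alpha>(1) b(1)] .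
    have bE: "b [^] p \<in> E" by (rule adj_pow_p[OF E(1) \<alpha>(1) _ b(1)]) (use \<alpha>(2) c(1) in simp)
    have b0: "vge (b [^] p) 0"
    proof -
      have "vge (a \<ominus> (a \<ominus> b [^] p)) 0" by (rule vge_diff[OF _ _ a(2) vgt_imp_vge[OF b(2)]]) (use bc ac in auto)
      moreover have "a \<ominus> (a \<ominus> b [^] p) = b [^] p" using bc ac by (simp add: minus_eq minus_add a_assoc[symmetric] r_neg)
      ultimately show ?thesis by simp
    qed
    have nb: "\<not> app E (b [^] p)"
    proof
      assume "app E (b [^] p)"
      then obtain d where d: "d \<in> E" "vgt (b [^] p \<ominus> d [^] p) 0" by (auto simp: app_def)
      have dc: "d \<in> carrier R" using Ec[OF E(1) d(1)] .
      have "vgt ((a \<ominus> b [^] p) \<oplus> (b [^] p \<ominus> d [^] p)) 0" using b d bc dc ac by (intro vgt_add) auto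
      moreover have "(a \<ominus> b [^] p) \<oplus> (b [^] p \<ominus> d [^] p) = a \<ominus> d [^] p"
        using bc dc ac by (simp add: minus_eq a_assoc) (simp add: a_assoc[symmetric] l_neg)
      ultimately show False using na d(1) by (auto simp: app_def)
    qed
    \<comment> \<open>\<open>b ^ p\<close> is no residual p-th power, since it has the residue of
      \<open>a\<close>. Hence \<open>comb_min\<close> makes the powers of \<open>b\<close>
      independent.\<close>
    have "\<alpha> \<in> adj p E b"
    proof (rule exchange[OF E(1) \<alpha>(1) _ b(1)])
      show "\<alpha> [^] p \<in> E" using \<alpha>(2) c(1) by simp
      fix x assume x: "\<And>s. x s \<in> E" "comb x b p = \<zero>"
      then show "\<forall>s<p. x s = \<zero>" using comb_min[OF iE bE b0 nb bc refl, of x] by blast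
    qed
    then obtain y where y: "\<And>s. y s \<in> E" "\<alpha> = comb y b p" using adjE by blast
    define x where "x s = (if s < p then y s else \<zero>)" for s
    have xE: "x s \<in> E" for s using y S by (simp add: x_def)
    have xc: "x s \<in> carrier R" for s using Ec[OF E(1) xE] .
    have \<alpha>x: "\<alpha> = comb x b p" unfolding y(2) comb_def using Ec[OF E(1) y(1)] bc by (intro finsum_cong') (auto simp: x_def)
    have \<alpha>0: "vge \<alpha> 0" using vge_pow_p[OF \<alpha>(1)] \<alpha>(2) c(2) by simp
    \<comment> \<open>\<open>\<alpha>\<close> is integral and its value is the minimum over the
      coefficients.\<close>
    have x0: "vge (x s) 0" for s
    proof (cases "\<exists>s<p. x s \<noteq> \<zero>")
      case True
      from comb_min[OF iE bE b0 nb bc refl, of x] xE True have "comb x b p \<noteq> \<zero>" "\<forall>s<p. vge (x s) (w (comb x b p))" by auto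
      moreover have "w (comb x b p) \<ge> 0" using \<alpha>0 \<open>comb x b p \<noteq> \<zero>\<close> unfolding \<alpha>x by (simp add: vge_def)
      ultimately show ?thesis by (cases "s < p") (auto simp: x_def intro: vge_mono)
    next
      case False
      then have "x s = \<zero>" by (auto simp: x_def)
      then show ?thesis by simp
    qed
    have c_eq: "c = comb (\<lambda>s. x s [^] p) (b [^] p) p" unfolding \<alpha>(2)[symmetric] unfolding \<alpha>x by (rule frob_comb[OF xc bc])
    \<comment> \<open>\<open>b ^ p\<close> and \<open>a\<close> have the same residue, so one may
      replace the other in any polynomial with integral coefficients.\<close>
    have close: "vgt (comb z (b [^] p) d \<ominus> comb z a d) 0" if z: "\<And>s. z s \<in> carrier R" "\<And>s. vge (z s) 0" for z d
    proof -
      have pw: "vgt ((b [^] p) [^] (s::nat) \<ominus> a [^] s) 0" for s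
      proof (induction s)
        case 0 then show ?case by (simp add: minus_eq r_neg)
      next
        case (Suc s)
        let ?b = "b [^] p"
        have ba: "vgt (?b \<ominus> a) 0"
        proof -
          have "?b \<ominus> a = \<ominus> (a \<ominus> ?b)" using bc ac by (simp add: minus_eq minus_add a_comm)
          then show ?thesis using b(2) bc ac by (simp add: vgt_neg)
        qed
        have "?b [^] Suc s \<ominus> a [^] Suc s = (?b [^] s \<ominus> a [^] s) \<otimes> ?b \<oplus> (?b \<ominus> a) \<otimes> a [^] s"
          using bc ac by (simp add: minus_eq l_distr l_minus a_assoc m_comm[of a]) (simp add: a_assoc[symmetric] m_comm[of ?b] l_neg)
        moreover have "vgt ((?b [^] s \<ominus> a [^] s) \<otimes> ?b) (0 + 0)" using Suc b0 bc ac by (intro vgt_mult) auto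
        moreover have "vgt ((?b \<ominus> a) \<otimes> a [^] s) (0 + 0)" using ba a(2) bc ac by (intro vgt_mult vge_pow_nonneg) auto
        ultimately show ?case using bc ac by (simp add: vgt_add)
      qed
      show ?thesis
      proof (induction d)
        case 0 show ?case by (simp add: minus_eq)
      next
        case (Suc d)
        have "comb z (b [^] p) (Suc d) \<ominus> comb z a (Suc d) = (comb z (b [^] p) d \<ominus> comb z a d) \<oplus> ((b [^] p) [^] d \<ominus> a [^] d) \<otimes> z d"
          using z bc ac by (simp add: comb_Suc minus_eq minus_add r_distr r_minus m_comm[of _ "z d"] a_ac)
        moreover have "vgt (((b [^] p) [^] d \<ominus> a [^] d) \<otimes> z d) (0 + 0)" using pw z bc ac by (intro vgt_mult) auto
        ultimately show ?case using Suc z bc ac by (simp add: vgt_add)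
      qed
    qed
    have "vgt (c \<ominus> comb (\<lambda>s. x s [^] p) a p) 0"
      by (subst c_eq) (rule close, use xc x0 vge_pow_nonneg in auto)
    then show ?thesis using xE x0 by blast
  qed
  with iE E(2) na show ?thesis by blast
qed

end

section \<open>The Cartier operator on the residue field\<close>

lemma (in ring) finsum_diff:
  assumes "finite A" "\<And>i. i \<in> A \<Longrightarrow> f i \<in> carrier R" "\<And>i. i \<in> A \<Longrightarrow> g i \<in> carrier R"
  shows "finsum R f A \<ominus> finsum R g A = (\<Oplus>i\<in>A. f i \<ominus> g i)"
  using assms
proof (induction A rule: finite_induct)
  case (insert x A)
  have c: "finsum R f A \<in> carrier R" "finsum R g A \<in> carrier R" using insert.prems by (auto intro!: finsum_closed)
  have "finsum R f (insert x A) \<ominus> finsum R g (insert x A) = (f x \<oplus> finsum R f A) \<ominus> (g x \<oplus> finsum R g A)"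
    using insert by (subst (1 2) finsum_insert) auto
  also have "\<dots> = (f x \<ominus> g x) \<oplus> (finsum R f A \<ominus> finsum R g A)"
    using insert.prems c by (simp add: minus_eq minus_add a_ac)
  also have "\<dots> = (f x \<ominus> g x) \<oplus> (\<Oplus>i\<in>A. f i \<ominus> g i)" using insert by simp
  also have "\<dots> = (\<Oplus>i\<in>insert x A. f i \<ominus> g i)" using insert by (subst finsum_insert) auto
  finally show ?case .
qed (simp add: minus_eq)

text \<open>With \<open>g\<close> and \<open>g'\<close> for \<open>dx\<close> and \<open>dy\<close>,
  the left side is the differential of \<open>((x + y) ^ p - x ^ p - y ^ p) / p\<close>, expanded
  after the division. It shows that \<open>x ^ (p - 1) dx\<close> is additive in \<open>x\<close> up
  to an exact form.\<close>

lemma exact_difference_int: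
  fixes x y g g' :: int
  assumes p: "Factorial_Ring.prime p"
  shows "(\<Sum>i<p - 1. int ((p choose Suc i) div p) * (int (Suc i) * (x ^ i * g) * y ^ (p - Suc i) + x ^ Suc i * (int (p - Suc i) * (y ^ (p - Suc i - 1) * g'))))
    = g * ((x + y) ^ (p - 1) - x ^ (p - 1)) + g' * ((x + y) ^ (p - 1) - y ^ (p - 1))"
proof -
  define m where "m = p - 1"
  have pm: "p = Suc m" using prime_gt_0_nat[OF p] by (simp add: m_def)
  have dv: "p dvd (p choose Suc i)" if "i < m" for i using dvd_choose_prime[of "Suc i" p] p pm that by simp
  have c1: "((p choose Suc i) div p) * Suc i = m choose i" if "i < m" for i
  proof -
    have "p * (((p choose Suc i) div p) * Suc i) = (p choose Suc i) * Suc i" using dv[OF that] by (simp add: mult.assoc[symmetric] del: mult_Suc_right)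
    also have "\<dots> = p * (m choose i)" using Suc_times_binomial_eq[of m i] pm by (simp add: mult.commute)
    finally show ?thesis using pm by (simp del: mult_Suc_right mult_Suc)
  qed
  have c2: "((p choose Suc i) div p) * (p - Suc i) = m choose Suc i" if i: "i < m" for i
  proof -
    have "p * (((p choose Suc i) div p) * (p - Suc i)) = (p choose Suc i) * (p - Suc i)" using dv[OF i] by (simp add: mult.assoc[symmetric])
    also have "\<dots> = p * (m choose Suc i)"
      using binomial_absorb_comp[of p "Suc i"] pm by (simp add: mult.commute)
    finally show ?thesis using pm by (simp del: mult_Suc_right mult_Suc)
  qed
  have bin: "(x + y) ^ m = (\<Sum>i\<le>m. int (m choose i) * x ^ i * y ^ (m - i))" by (simp add: binomial_ring)
  have b1: "(x + y) ^ m - x ^ m = (\<Sum>i<m. int (m choose i) * x ^ i * y ^ (m - i))"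
    unfolding bin lessThan_Suc_atMost[symmetric] by simp
  have b2: "(x + y) ^ m - y ^ m = (\<Sum>i<m. int (m choose Suc i) * x ^ Suc i * y ^ (m - Suc i))"
    unfolding bin lessThan_Suc_atMost[symmetric] by (subst sum.lessThan_Suc_shift) simp
  have "(\<Sum>i<m. int ((p choose Suc i) div p) * (int (Suc i) * (x ^ i * g) * y ^ (p - Suc i) + x ^ Suc i * (int (p - Suc i) * (y ^ (p - Suc i - 1) * g'))))
    = (\<Sum>i<m. g * (int (m choose i) * x ^ i * y ^ (m - i)) + g' * (int (m choose Suc i) * x ^ Suc i * y ^ (m - Suc i)))"
  proof (intro sum.cong refl)
    fix i assume "i \<in> {..<m}"
    then have i: "i < m" by simp
    have e1: "int ((p choose Suc i) div p) * int (Suc i) = int (m choose i)" using c1[OF i] by (metis of_nat_mult)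
    have e2: "int ((p choose Suc i) div p) * int (p - Suc i) = int (m choose Suc i)" using c2[OF i] by (metis of_nat_mult)
    have p1: "p - Suc i = m - i" "p - Suc i - 1 = m - Suc i" using pm by auto
    have "int ((p choose Suc i) div p) * (int (Suc i) * (x ^ i * g) * y ^ (p - Suc i) + x ^ Suc i * (int (p - Suc i) * (y ^ (p - Suc i - 1) * g')))
      = (int ((p choose Suc i) div p) * int (Suc i)) * (x ^ i * g * y ^ (m - i)) + (int ((p choose Suc i) div p) * int (p - Suc i)) * (x ^ Suc i * (y ^ (m - Suc i) * g'))"
      unfolding p1 by (simp add: algebra_simps)
    then show "int ((p choose Suc i) div p) * (int (Suc i) * (x ^ i * g) * y ^ (p - Suc i) + x ^ Suc i * (int (p - Suc i) * (y ^ (p - Suc i - 1) * g')))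
      = g * (int (m choose i) * x ^ i * y ^ (m - i)) + g' * (int (m choose Suc i) * x ^ Suc i * y ^ (m - Suc i))"
      unfolding e1 e2 by (simp add: algebra_simps)
  qed
  then show ?thesis unfolding m_def[symmetric] b1 b2 by (simp add: sum.distrib sum_distrib_left)
qed

context perf_field begin

lemma vgt_diff_trans:
  assumes "x \<in> carrier R" "y \<in> carrier R" "z \<in> carrier R" "vgt (x \<ominus> y) 0" "vgt (y \<ominus> z) 0"
  shows "vgt (x \<ominus> z) 0"
proof -
  have "(x \<ominus> y) \<oplus> (y \<ominus> z) = x \<ominus> z" using assms(1-3) by (simp add: minus_eq a_assoc) (simp add: a_assoc[symmetric] l_neg)
  moreover have "vgt ((x \<ominus> y) \<oplus> (y \<ominus> z)) 0" using assms by (intro vgt_add) auto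
  ultimately show ?thesis by simp
qed

lemma vge_pow_close:
  assumes "x \<in> carrier R" "y \<in> carrier R" "vge x 0" "vge y 0" "vge (x \<ominus> y) r"
  shows "vge (x [^] (m::nat) \<ominus> y [^] m) r"
proof (induction m)
  case 0 then show ?case by (simp add: minus_eq r_neg)
next
  case (Suc m)
  have "x [^] Suc m \<ominus> y [^] Suc m = (x [^] m \<ominus> y [^] m) \<otimes> x \<oplus> (x \<ominus> y) \<otimes> y [^] m"
    using assms by (simp add: minus_eq l_distr l_minus a_assoc m_comm[of y]) (simp add: a_assoc[symmetric] m_comm[of x] l_neg)
  moreover have "vge ((x [^] m \<ominus> y [^] m) \<otimes> x) (r + 0)" using Suc assms by (intro vge_mult) auto
  moreover have "vge ((x \<ominus> y) \<otimes> y [^] m) (r + 0)" using assms by (intro vge_mult vge_pow_nonneg) auto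
  ultimately show ?case using assms by (simp add: vge_add)
qed

inductive DD :: "'a set \<Rightarrow> 'a \<Rightarrow> 'a \<Rightarrow> 'a \<Rightarrow> bool" for E a where
  monom: "c \<in> E \<Longrightarrow> vge c 0 \<Longrightarrow> DD E a (c [^] p \<otimes> a [^] (s::nat)) (add_pow R s (c [^] p \<otimes> a [^] (s - 1)))"
| add: "DD E a f g \<Longrightarrow> DD E a f' g' \<Longrightarrow> DD E a (f \<oplus> f') (g \<oplus> g')"

definition TT :: "'a set \<Rightarrow> 'a \<Rightarrow> 'a \<Rightarrow> 'a \<Rightarrow> bool" where
  "TT E a x y \<longleftrightarrow> x \<in> carrier R \<and> y \<in> carrier R \<and> (\<exists>e. (\<forall>s. e s \<in> E \<and> vge (e s) 0) \<and>
     vgt (x \<ominus> comb (\<lambda>s. e s [^] p) a p) 0 \<and> vgt (e (p - 1) \<ominus> y) 0)"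

text \<open>In the residue field \<open>l = l ^ p [a]\<close>, the relation \<open>DD\<close> is the derivation \<open>d / d a\<close> and \<open>TT\<close>
  sends an element to the \<open>p\<close>-th root of its \<open>a ^ (p - 1)\<close>-coefficient: the Cartier operator in disguise.\<close>

context
  fixes E a assumes E: "int_sub E" and a: "a \<in> E" "vge a 0" "\<not> app E a"
begin

lemma sf: "subfield E R" using int_subD(1)[OF E] .
lemma ac: "a \<in> carrier R" using Ec[OF sf a(1)] .

lemma natin: "x \<in> E \<Longrightarrow> add_pow R (k::nat) x \<in> E"
  by (induction k) (auto simp: add.nat_pow_Suc sr[OF sf])

lemma DD_in: "DD E a f g \<Longrightarrow> f \<in> E \<and> vge f 0 \<and> g \<in> E \<and> vge g 0"
proof (induction rule: DD.induct)
  case (monom c s)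
  have cc: "c \<in> carrier R" using Ec[OF sf monom(1)] .
  have m: "c [^] p \<otimes> a [^] (t::nat) \<in> E" "vge (c [^] p \<otimes> a [^] t) 0" for t
  proof -
    show "c [^] p \<otimes> a [^] t \<in> E" using sr(6)[OF sf] pow_in[OF subfieldE(1)[OF sf]] monom(1) a(1) by blast
    have "vge (c [^] p \<otimes> a [^] t) (0 + 0)" using cc ac monom(2) a(2) by (intro vge_mult vge_pow_nonneg) auto
    then show "vge (c [^] p \<otimes> a [^] t) 0" by simp
  qed
  then show ?case using natin vge_add_pow_nat[OF Ec[OF sf m(1)] m(2)] by blast
next
  case (add f g f' g')
  then show ?case using sr(7)[OF sf] Ec[OF sf] by (auto intro!: vge_add)
qed

lemma DDc: "DD E a f g \<Longrightarrow> f \<in> carrier R \<and> g \<in> carrier R" using DD_in Ec[OF sf] by blast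

lemma DD_zero: "DD E a \<zero> \<zero>"
  using DD.monom[of \<zero> E a 0] sr(2)[OF sf] p_pos by (simp add: nat_pow_zero)

lemma DD_nat: assumes "DD E a f g" shows "DD E a (add_pow R (k::nat) f) (add_pow R k g)"
  by (induction k) (use assms DD_zero in \<open>auto simp: add.nat_pow_Suc intro: DD.add\<close>)

lemma DD_mult_monom:
  assumes c: "c \<in> E" "vge c 0" and "DD E a f g"
  shows "DD E a (c [^] p \<otimes> a [^] (s::nat) \<otimes> f) (add_pow R s (c [^] p \<otimes> a [^] (s - 1)) \<otimes> f \<oplus> c [^] p \<otimes> a [^] s \<otimes> g)"
  using assms(3)
proof (induction rule: DD.induct)
  case (monom b t)
  have cc: "c \<in> carrier R" "b \<in> carrier R" using Ec[OF sf] c monom by auto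
  have "DD E a ((c \<otimes> b) [^] p \<otimes> a [^] (s + t)) (add_pow R (s + t) ((c \<otimes> b) [^] p \<otimes> a [^] (s + t - 1)))"
  proof (rule DD.monom)
    show "c \<otimes> b \<in> E" using sr(6)[OF sf] c monom by blast
    have "vge (c \<otimes> b) (0 + 0)" using c monom cc by (intro vge_mult) auto
    then show "vge (c \<otimes> b) 0" by simp
  qed
  moreover have "(c \<otimes> b) [^] p \<otimes> a [^] (s + t) = c [^] p \<otimes> a [^] s \<otimes> (b [^] p \<otimes> a [^] t)"
    using cc ac by (simp add: nat_pow_distrib nat_pow_mult[symmetric] m_ac)
  moreover have "add_pow R (s + t) ((c \<otimes> b) [^] p \<otimes> a [^] (s + t - 1))
    = add_pow R s (c [^] p \<otimes> a [^] (s - 1)) \<otimes> (b [^] p \<otimes> a [^] t) \<oplus> c [^] p \<otimes> a [^] s \<otimes> add_pow R t (b [^] p \<otimes> a [^] (t - 1))"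
  proof -
    have 1: "add_pow R s (c [^] p \<otimes> a [^] (s - 1)) \<otimes> (b [^] p \<otimes> a [^] t) = add_pow R s ((c \<otimes> b) [^] p \<otimes> a [^] (s + t - 1))"
    proof (cases s)
      case (Suc m)
      have "(c [^] p \<otimes> a [^] m) \<otimes> (b [^] p \<otimes> a [^] t) = (c \<otimes> b) [^] p \<otimes> a [^] (m + t)"
        using cc ac by (simp add: nat_pow_distrib nat_pow_mult[symmetric] m_ac)
      then show ?thesis using cc ac Suc by (simp only: add_pow_ldistr m_closed nat_pow_closed) simp
    qed (use cc ac in simp)
    have 2: "c [^] p \<otimes> a [^] s \<otimes> add_pow R t (b [^] p \<otimes> a [^] (t - 1)) = add_pow R t ((c \<otimes> b) [^] p \<otimes> a [^] (s + t - 1))"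
    proof (cases t)
      case (Suc m)
      have "(c [^] p \<otimes> a [^] s) \<otimes> (b [^] p \<otimes> a [^] m) = (c \<otimes> b) [^] p \<otimes> a [^] (s + m)"
        using cc ac by (simp add: nat_pow_distrib nat_pow_mult[symmetric] m_ac)
      then show ?thesis using cc ac Suc by (simp only: add_pow_rdistr m_closed nat_pow_closed) simp
    qed (use cc ac in simp)
    show ?thesis unfolding 1 2 using cc ac by (intro add.nat_pow_mult[symmetric]) auto
  qed
  ultimately show ?case by simp
next
  case (add f g f' g')
  define M N where "M = c [^] p \<otimes> a [^] s" and "N = add_pow R s (c [^] p \<otimes> a [^] (s - 1))"
  have MN: "M \<in> carrier R" "N \<in> carrier R" using Ec[OF sf c(1)] ac by (auto simp: M_def N_def)
  have fc: "f \<in> carrier R" "g \<in> carrier R" "f' \<in> carrier R" "g' \<in> carrier R" using DDc add by auto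
  have "DD E a (M \<otimes> f \<oplus> M \<otimes> f') ((N \<otimes> f \<oplus> M \<otimes> g) \<oplus> (N \<otimes> f' \<oplus> M \<otimes> g'))"
    unfolding M_def N_def by (rule DD.add[OF add.IH])
  moreover have "M \<otimes> f \<oplus> M \<otimes> f' = M \<otimes> (f \<oplus> f')" using MN fc by (simp add: r_distr)
  moreover have "(N \<otimes> f \<oplus> M \<otimes> g) \<oplus> (N \<otimes> f' \<oplus> M \<otimes> g') = N \<otimes> (f \<oplus> f') \<oplus> M \<otimes> (g \<oplus> g')"
    using MN fc by (simp add: r_distr a_ac)
  ultimately show ?case unfolding M_def N_def by simp
qed

lemma DD_mult:
  assumes "DD E a f g" "DD E a f' g'" shows "DD E a (f \<otimes> f') (g \<otimes> f' \<oplus> f \<otimes> g')"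
  using assms(1)
proof (induction rule: DD.induct)
  case (monom c s)
  show ?case by (rule DD_mult_monom[OF monom assms(2)])
next
  case (add h k h' k')
  have c: "h \<in> carrier R" "k \<in> carrier R" "h' \<in> carrier R" "k' \<in> carrier R" "f' \<in> carrier R" "g' \<in> carrier R"
    using DDc add assms(2) by auto
  have "DD E a (h \<otimes> f' \<oplus> h' \<otimes> f') ((k \<otimes> f' \<oplus> h \<otimes> g') \<oplus> (k' \<otimes> f' \<oplus> h' \<otimes> g'))" by (rule DD.add[OF add.IH])
  moreover have "(k \<otimes> f' \<oplus> h \<otimes> g') \<oplus> (k' \<otimes> f' \<oplus> h' \<otimes> g') = (k \<oplus> k') \<otimes> f' \<oplus> (h \<oplus> h') \<otimes> g'"
    using c by (simp add: l_distr a_ac)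
  ultimately show ?case using c by (simp add: l_distr)
qed

lemma DD_pow:
  assumes "DD E a f g" shows "DD E a (f [^] (m::nat)) (add_pow R m (f [^] (m - 1) \<otimes> g))"
proof (induction m)
  case 0
  have "DD E a (\<one> [^] p \<otimes> a [^] (0::nat)) (add_pow R (0::nat) (\<one> [^] p \<otimes> a [^] (0 - 1::nat)))"
    by (rule DD.monom) (use sr(3)[OF sf] vge_one in auto)
  then show ?case by simp
next
  case (Suc m)
  have c: "f \<in> carrier R" "g \<in> carrier R" using DDc assms by auto
  have "DD E a (f [^] m \<otimes> f) (add_pow R m (f [^] (m - 1) \<otimes> g) \<otimes> f \<oplus> f [^] m \<otimes> g)" by (rule DD_mult[OF Suc assms])
  moreover have "add_pow R m (f [^] (m - 1) \<otimes> g) \<otimes> f = add_pow R m (f [^] m \<otimes> g)"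
  proof (cases m)
    case (Suc k)
    have "f [^] k \<otimes> g \<otimes> f = f [^] Suc k \<otimes> g" using c by (simp add: m_ac)
    then show ?thesis using c Suc by (simp only: add_pow_ldistr m_closed nat_pow_closed) simp
  qed (use c in simp)
  ultimately show ?case using c by (simp add: add.nat_pow_Suc)
qed

lemma DD_finsum:
  assumes "\<And>i. DD E a (f i) (g i)" shows "DD E a (\<Oplus>i\<in>{..<m::nat}. f i) (\<Oplus>i\<in>{..<m}. g i)"
proof (induction m)
  case 0 then show ?case using DD_zero by simp
next
  case (Suc m)
  have c: "f i \<in> carrier R" "g i \<in> carrier R" for i using DDc assms by auto
  have "(\<Oplus>i\<in>{..<Suc m}. f i) = f m \<oplus> (\<Oplus>i\<in>{..<m}. f i)" "(\<Oplus>i\<in>{..<Suc m}. g i) = g m \<oplus> (\<Oplus>i\<in>{..<m}. g i)"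
    using c by (auto simp: lessThan_Suc finsum_insert)
  then show ?case using DD.add[OF assms Suc] by simp
qed

lemma DD_comb:
  assumes c: "\<And>s. c s \<in> E" "\<And>s. vge (c s) 0"
  shows "DD E a (comb (\<lambda>s. c s [^] p) a (Suc d)) (comb (\<lambda>s. add_pow R (Suc s) (c (Suc s) [^] p)) a d)"
proof (induction d)
  case 0
  have "DD E a (c 0 [^] p \<otimes> a [^] (0::nat)) (add_pow R (0::nat) (c 0 [^] p \<otimes> a [^] (0 - 1::nat)))" by (rule DD.monom[OF c])
  then show ?case using Ec[OF sf c(1)] ac by (simp add: comb_Suc)
next
  case (Suc d)
  have cc: "c s \<in> carrier R" for s using Ec[OF sf c(1)] .
  have "DD E a (comb (\<lambda>s. c s [^] p) a (Suc d) \<oplus> c (Suc d) [^] p \<otimes> a [^] Suc d)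
     (comb (\<lambda>s. add_pow R (Suc s) (c (Suc s) [^] p)) a d \<oplus> add_pow R (Suc d) (c (Suc d) [^] p \<otimes> a [^] (Suc d - 1)))"
    by (rule DD.add[OF Suc DD.monom[OF c]])
  moreover have "add_pow R (Suc d) (c (Suc d) [^] p \<otimes> a [^] (Suc d - 1)) = add_pow R (Suc d) (c (Suc d) [^] p) \<otimes> a [^] d"
    using cc ac by (simp only: add_pow_ldistr nat_pow_closed diff_Suc_1)
  moreover have "comb (\<lambda>s. add_pow R (Suc s) (c (Suc s) [^] p)) a (Suc d) = comb (\<lambda>s. add_pow R (Suc s) (c (Suc s) [^] p)) a d \<oplus> add_pow R (Suc d) (c (Suc d) [^] p) \<otimes> a [^] d"
    by (rule comb_Suc) (use cc ac in auto)
  moreover have "comb (\<lambda>s. c s [^] p) a (Suc (Suc d)) = comb (\<lambda>s. c s [^] p) a (Suc d) \<oplus> c (Suc d) [^] p \<otimes> a [^] Suc d"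
    by (rule comb_Suc) (use cc ac in auto)
  ultimately show ?case by simp
qed

section \<open>Rules for the Cartier relation\<close>

lemma TT_add: assumes "TT E a x y" "TT E a x' y'" shows "TT E a (x \<oplus> x') (y \<oplus> y')"
proof -
  obtain e e' where e: "\<And>s. e s \<in> E" "\<And>s. vge (e s) 0" "vgt (x \<ominus> comb (\<lambda>s. e s [^] p) a p) 0" "vgt (e (p - 1) \<ominus> y) 0"
    and e': "\<And>s. e' s \<in> E" "\<And>s. vge (e' s) 0" "vgt (x' \<ominus> comb (\<lambda>s. e' s [^] p) a p) 0" "vgt (e' (p - 1) \<ominus> y') 0"
    using assms unfolding TT_def by blast
  have c: "x \<in> carrier R" "y \<in> carrier R" "x' \<in> carrier R" "y' \<in> carrier R" "\<And>s. e s \<in> carrier R" "\<And>s. e' s \<in> carrier R"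
    using assms e e' Ec[OF sf] by (auto simp: TT_def)
  have "comb (\<lambda>s. (e s \<oplus> e' s) [^] p) a p = comb (\<lambda>s. e s [^] p \<oplus> e' s [^] p) a p"
    by (rule arg_cong[of _ _ "\<lambda>x. comb x a p"]) (auto simp: frob_add c)
  also have "\<dots> = comb (\<lambda>s. e s [^] p) a p \<oplus> comb (\<lambda>s. e' s [^] p) a p" using c ac by (intro comb_add) auto
  finally have q: "comb (\<lambda>s. (e s \<oplus> e' s) [^] p) a p = comb (\<lambda>s. e s [^] p) a p \<oplus> comb (\<lambda>s. e' s [^] p) a p" .
  have re: "(u \<oplus> u') \<ominus> (v \<oplus> v') = (u \<ominus> v) \<oplus> (u' \<ominus> v')" if "u \<in> carrier R" "u' \<in> carrier R" "v \<in> carrier R" "v' \<in> carrier R" for u u' v v'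
    using that by (simp add: minus_eq minus_add a_ac)
  have "vgt ((x \<oplus> x') \<ominus> comb (\<lambda>s. (e s \<oplus> e' s) [^] p) a p) 0"
    unfolding q using e(3) e'(3) c ac by (subst re) (auto intro!: vgt_add)
  moreover have "vgt ((e (p - 1) \<oplus> e' (p - 1)) \<ominus> (y \<oplus> y')) 0" using e(4) e'(4) c by (subst re) (auto intro!: vgt_add)
  ultimately show ?thesis unfolding TT_def using c e e' sr(7)[OF sf]
    by (intro conjI exI[of _ "\<lambda>s. e s \<oplus> e' s"] allI) (auto intro!: vge_add)
qed

lemma TT_zero: "TT E a \<zero> \<zero>"
proof -
  have "comb (\<lambda>s. \<zero> [^] p) a p = \<zero>" using p_pos ac by (simp add: comb_def nat_pow_zero finsum_zero)
  then show ?thesis unfolding TT_def using sr(2)[OF sf] by (intro conjI exI[of _ "\<lambda>_. \<zero>"]) (auto simp: minus_eq)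
qed

lemma TT_nat: assumes "TT E a x y" shows "TT E a (add_pow R (k::nat) x) (add_pow R k y)"
  by (induction k) (use assms TT_zero in \<open>auto simp: add.nat_pow_Suc intro: TT_add\<close>)

lemma TT_finsum:
  assumes "\<And>i. TT E a (f i) (g i)" shows "TT E a (\<Oplus>i\<in>{..m::nat}. f i) (\<Oplus>i\<in>{..m}. g i)"
proof (induction m)
  case 0
  have "f 0 \<in> carrier R" "g 0 \<in> carrier R" using assms by (auto simp: TT_def)
  then show ?case using assms[of 0] by simp
next
  case (Suc m)
  have c: "f i \<in> carrier R" "g i \<in> carrier R" for i using assms by (auto simp: TT_def)
  have "(\<Oplus>i\<in>{..Suc m}. f i) = f (Suc m) \<oplus> (\<Oplus>i\<in>{..m}. f i)" "(\<Oplus>i\<in>{..Suc m}. g i) = g (Suc m) \<oplus> (\<Oplus>i\<in>{..m}. g i)"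
    using c by (auto simp: atMost_Suc finsum_insert)
  then show ?case using TT_add[OF assms Suc] by simp
qed

lemma TT_smult: assumes "TT E a x y" "c \<in> E" "vge c 0" shows "TT E a (c [^] p \<otimes> x) (c \<otimes> y)"
proof -
  obtain e where e: "\<And>s. e s \<in> E" "\<And>s. vge (e s) 0" "vgt (x \<ominus> comb (\<lambda>s. e s [^] p) a p) 0" "vgt (e (p - 1) \<ominus> y) 0"
    using assms unfolding TT_def by blast
  have k: "x \<in> carrier R" "y \<in> carrier R" "\<And>s. e s \<in> carrier R" "c \<in> carrier R"
    using assms e Ec[OF sf] by (auto simp: TT_def)
  have "comb (\<lambda>s. (c \<otimes> e s) [^] p) a p = comb (\<lambda>s. c [^] p \<otimes> e s [^] p) a p"
    by (rule arg_cong[of _ _ "\<lambda>x. comb x a p"]) (auto simp: nat_pow_distrib k)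
  also have "\<dots> = c [^] p \<otimes> comb (\<lambda>s. e s [^] p) a p" using k ac by (intro comb_smult) auto
  finally have q: "comb (\<lambda>s. (c \<otimes> e s) [^] p) a p = c [^] p \<otimes> comb (\<lambda>s. e s [^] p) a p" .
  have re: "u \<otimes> v \<ominus> u \<otimes> v' = (v \<ominus> v') \<otimes> u" if "u \<in> carrier R" "v \<in> carrier R" "v' \<in> carrier R" for u v v'
    using that by (simp add: minus_eq l_distr l_minus m_comm[of u])
  have "vgt ((x \<ominus> comb (\<lambda>s. e s [^] p) a p) \<otimes> c [^] p) (0 + 0)" using e(3) k ac assms(3) by (intro vgt_mult vge_pow_nonneg) auto
  then have "vgt (c [^] p \<otimes> x \<ominus> comb (\<lambda>s. (c \<otimes> e s) [^] p) a p) 0" unfolding q using k ac by (simp add: re)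
  moreover have "vgt ((e (p - 1) \<ominus> y) \<otimes> c) (0 + 0)" using e(4) k assms(3) by (intro vgt_mult) auto
  then have "vgt (c \<otimes> e (p - 1) \<ominus> c \<otimes> y) 0" using k by (simp add: re)
  moreover have "vge (c \<otimes> e s) 0" for s
  proof -
    have "vge (c \<otimes> e s) (0 + 0)" using k e assms(3) by (intro vge_mult) auto
    then show ?thesis by simp
  qed
  ultimately show ?thesis unfolding TT_def using k e assms(2) sr(6)[OF sf]
    by (intro conjI exI[of _ "\<lambda>s. c \<otimes> e s"] allI) auto
qed

text \<open>Division of \<open>s\<close> by \<open>p\<close> with remainder moves
  \<open>a ^ (s div p)\<close> into the coefficient, as part of a p-th power; the relation sees the
  monomial only for remainder \<open>p - 1\<close>.\<close>

lemma TT_monom: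
  assumes c: "c \<in> E" "vge c 0"
  shows "TT E a (c [^] p \<otimes> a [^] (s::nat)) (if s mod p = p - 1 then c \<otimes> a [^] (s div p) else \<zero>)"
proof -
  define t where "t = s mod p"
  define b where "b = c \<otimes> a [^] (s div p)"
  have cc: "c \<in> carrier R" using Ec[OF sf c(1)] .
  have tp: "t < p" using p_pos by (simp add: t_def)
  have bE: "b \<in> E" using sr(6)[OF sf] pow_in[OF subfieldE(1)[OF sf]] c(1) a(1) by (auto simp: b_def)
  have bc: "b \<in> carrier R" using Ec[OF sf bE] .
  have b0: "vge b 0"
  proof -
    have "vge b (0 + 0)" unfolding b_def using cc ac c(2) a(2) by (intro vge_mult vge_pow_nonneg) auto
    then show ?thesis by simp
  qed
  have s: "s = (s div p) * p + t" by (simp add: t_def)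
  have "c [^] p \<otimes> a [^] s = b [^] p \<otimes> a [^] t"
  proof -
    have "a [^] s = (a [^] (s div p)) [^] p \<otimes> a [^] t" using ac s by (metis nat_pow_mult nat_pow_pow)
    then show ?thesis using cc ac by (simp add: b_def nat_pow_distrib m_assoc)
  qed
  moreover have "comb (\<lambda>r. (if r = t then b else \<zero>) [^] p) a p = b [^] p \<otimes> a [^] t"
  proof -
    have "(\<lambda>r. (if r = t then b else \<zero>) [^] p) = (\<lambda>r. if r = t then b [^] p else \<zero>)" using p_pos by (auto simp: nat_pow_zero)
    then show ?thesis using comb_unit[of a t p "b [^] p"] bc ac tp by simp
  qed
  ultimately have "vgt (c [^] p \<otimes> a [^] s \<ominus> comb (\<lambda>r. (if r = t then b else \<zero>) [^] p) a p) 0"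
    using bc ac by (simp add: minus_eq r_neg)
  moreover have "(if p - 1 = t then b else \<zero>) = (if s mod p = p - 1 then c \<otimes> a [^] (s div p) else \<zero>)"
    by (auto simp: t_def b_def)
  ultimately show ?thesis unfolding TT_def using bE b0 bc cc ac sr(2)[OF sf]
    by (intro conjI exI[of _ "\<lambda>r. if r = t then b else \<zero>"]) (auto simp: minus_eq r_neg t_def b_def)
qed

text \<open>Well-definedness on residues. With \<open>t\<close> a p-th root of \<open>a\<close>, the
  expansion is the p-th power of \<open>comb e t p\<close>, and by \<open>comb_min\<close> every
  coefficient has at least the value of that sum.\<close>

lemma TT_vanish: assumes "TT E a x y" "vgt x 0" shows "vgt y 0"
proof -
  obtain e where e: "\<And>s. e s \<in> E" "\<And>s. vge (e s) 0" "vgt (x \<ominus> comb (\<lambda>s. e s [^] p) a p) 0" "vgt (e (p - 1) \<ominus> y) 0"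
    using assms unfolding TT_def by blast
  have ec: "e s \<in> carrier R" for s using Ec[OF sf e(1)] .
  have xc: "x \<in> carrier R" "y \<in> carrier R" using assms(1) by (auto simp: TT_def)
  obtain t where t: "t \<in> carrier R" "t [^] p = a" using root[OF ac] by blast
  have tc: "comb e t p \<in> carrier R" using ec t by simp
  have "comb (\<lambda>s. e s [^] p) a p = comb e t p [^] p" using frob_comb[OF ec t(1)] t(2) by simp
  then have "vgt (x \<ominus> comb e t p [^] p) 0" using e(3) by simp
  from vgt_diff[OF _ _ assms(2) this] have "vgt (x \<ominus> (x \<ominus> comb e t p [^] p)) 0" using xc tc by simp
  moreover have "x \<ominus> (x \<ominus> comb e t p [^] p) = comb e t p [^] p" using xc tc by (simp add: minus_eq minus_add a_assoc[symmetric] r_neg)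
  ultimately have z: "vgt (comb e t p) 0" using vgt_pow_p[OF tc] by simp
  have "vgt (e (p - 1)) 0"
  proof (cases "\<exists>s<p. e s \<noteq> \<zero>")
    case True
    from comb_min[OF E a t, of e] e(1) True have "comb e t p \<noteq> \<zero>" "vge (e (p - 1)) (w (comb e t p))" using p_pos by auto
    with z show ?thesis by (auto simp: vgt_def vge_def)
  next
    case False then show ?thesis using p_pos by auto
  qed
  from vgt_diff[OF _ _ this e(4)] have "vgt (e (p - 1) \<ominus> (e (p - 1) \<ominus> y)) 0" using xc ec by simp
  moreover have "e (p - 1) \<ominus> (e (p - 1) \<ominus> y) = y" using xc ec by (simp add: minus_eq minus_add a_assoc[symmetric] r_neg)
  ultimately show ?thesis by simp
qed

lemma add_pow_dvd: assumes "p dvd k" "x \<in> carrier R" shows "add_pow R (k::nat) x = \<zero>"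
proof -
  obtain m where m: "k = p * m" using assms(1) by (elim dvdE)
  have "add_pow R k \<one> = add_pow R m (add_pow R p \<one>)" by (simp add: m add.nat_pow_pow mult.commute)
  then have "add_pow R k \<one> = \<zero>" by (simp add: add_pow_p)
  then show ?thesis using add_pow_mult_eq[OF assms(2), of k] assms(2) by simp
qed

text \<open>Exact forms are killed: the derivative of \<open>a ^ s\<close> has exponent
  \<open>p - 1\<close> modulo \<open>p\<close> only if \<open>p\<close> divides \<open>s\<close>,
  and then the factor \<open>s\<close> vanishes.\<close>

lemma TT_DD: assumes "DD E a f g" shows "TT E a g \<zero>"
  using assms
proof (induction rule: DD.induct)
  case (monom c s)
  have cc: "c \<in> carrier R" using Ec[OF sf monom(1)] .
  show ?case
  proof (cases "p dvd s")
    case True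
    then have "add_pow R s (c [^] p \<otimes> a [^] (s - 1)) = \<zero>" using cc ac by (intro add_pow_dvd) auto
    then show ?thesis using TT_zero by simp
  next
    case False
    then obtain m where s: "s = Suc m" by (cases s) auto
    have "m mod p \<noteq> p - 1"
    proof
      assume "m mod p = p - 1"
      then have "Suc m mod p = 0" using p_pos by (simp add: mod_Suc)
      with False s show False by (simp add: dvd_eq_mod_eq_0)
    qed
    then have "TT E a (c [^] p \<otimes> a [^] m) \<zero>" using TT_monom[OF monom, of m] by simp
    from TT_nat[OF this, of s] show ?thesis by (simp add: s)
  qed
next
  case (add f g f' g')
  from TT_add[OF add.IH] show ?case by simp
qed

text \<open>\<open>h\<close> is \<open>((f + f') ^ p - f ^ p - f' ^ p) / p\<close> evaluated through
  its integral coefficients, so that \<open>TT_DD\<close> removes the defect of additivity.\<close>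

lemma DD_exact:
  assumes f: "DD E a f g" and f': "DD E a f' g'"
  shows "\<exists>h. DD E a h ((f \<oplus> f') [^] (p - 1) \<otimes> (g \<oplus> g') \<ominus> (f [^] (p - 1) \<otimes> g \<oplus> f' [^] (p - 1) \<otimes> g'))"
proof -
  have c: "f \<in> carrier R" "g \<in> carrier R" "f' \<in> carrier R" "g' \<in> carrier R" using DDc f f' by auto
  define C where "C i = (p choose Suc i) div p" for i
  define G where "G i = add_pow R (C i) (add_pow R (Suc i) (f [^] i \<otimes> g) \<otimes> f' [^] (p - Suc i) \<oplus> f [^] Suc i \<otimes> add_pow R (p - Suc i) (f' [^] (p - Suc i - 1) \<otimes> g'))" for i
  have "DD E a (add_pow R (C i) (f [^] Suc i \<otimes> f' [^] (p - Suc i))) (G i)" for i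
  proof -
    have "DD E a (f [^] Suc i) (add_pow R (Suc i) (f [^] i \<otimes> g))" using DD_pow[OF f, of "Suc i"] by simp
    from DD_nat[OF DD_mult[OF this DD_pow[OF f', of "p - Suc i"]], of "C i"] show ?thesis unfolding G_def .
  qed
  from DD_finsum[where m = "p - 1" and g = G, OF this]
  have D: "DD E a (\<Oplus>i\<in>{..<p - 1}. add_pow R (C i) (f [^] Suc i \<otimes> f' [^] (p - Suc i))) (\<Oplus>i\<in>{..<p - 1}. G i)" .
  let ?\<rho> = "\<lambda>i. if i = (0::nat) then f else if i = 1 then g else if i = 2 then f' else g'"
  have \<rho>: "?\<rho> i \<in> carrier R" for i using c by simp
  define e where "e i = PMul (pnat (C i)) (PAdd (PMul (PMul (pnat (Suc i)) (PMul (ppow (Var 0) i) (Var 1))) (ppow (Var 2) (p - Suc i)))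
      (PMul (ppow (Var 0) (Suc i)) (PMul (pnat (p - Suc i)) (PMul (ppow (Var 2) (p - Suc i - 1)) (Var 3)))))" for i
  define e' where "e' = PAdd (PMul (Var 1) (PAdd (ppow (PAdd (Var 0) (Var 2)) (p - 1)) (PNeg (ppow (Var 0) (p - 1)))))
     (PMul (Var 3) (PAdd (ppow (PAdd (Var 0) (Var 2)) (p - 1)) (PNeg (ppow (Var 2) (p - 1)))))"
  have "peval R ?\<rho> (psum e (p - 1)) = peval R ?\<rho> e'"
  proof (rule peval_cong_int[OF \<rho>])
    fix \<sigma> show "eval_int \<sigma> (psum e (p - 1)) = eval_int \<sigma> e'"
      using exact_difference_int[OF prime_p, of "\<sigma> 0" "\<sigma> 1" "\<sigma> 2" "\<sigma> 3"]
      unfolding e_def e'_def C_def by (simp del: ppow.simps pnat.simps psum.simps)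
  qed
  moreover have "peval R ?\<rho> (psum e (p - 1)) = (\<Oplus>i\<in>{..<p - 1}. G i)"
  proof -
    have "peval R ?\<rho> (e i) = G i" for i
    proof -
      have "peval R ?\<rho> (e i) = add_pow R (C i) \<one> \<otimes> (add_pow R (Suc i) \<one> \<otimes> (f [^] i \<otimes> g) \<otimes> f' [^] (p - Suc i)
          \<oplus> f [^] Suc i \<otimes> (add_pow R (p - Suc i) \<one> \<otimes> (f' [^] (p - Suc i - 1) \<otimes> g')))"
        unfolding e_def using \<rho> by (simp del: ppow.simps pnat.simps nat_pow_Suc)
      also have "\<dots> = G i"
        unfolding G_def using c
        by (simp only: add_pow_mult_eq[of "f [^] i \<otimes> g", symmetric] add_pow_mult_eq[of "f' [^] (p - Suc i - 1) \<otimes> g'", symmetric]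
            add_pow_mult_eq[of "_ \<oplus> _", symmetric] m_closed nat_pow_closed a_closed add.nat_pow_closed)
      finally show ?thesis .
    qed
    then show ?thesis using \<rho> by (simp del: psum.simps)
  qed
  moreover have "peval R ?\<rho> e' = (f \<oplus> f') [^] (p - 1) \<otimes> (g \<oplus> g') \<ominus> (f [^] (p - 1) \<otimes> g \<oplus> f' [^] (p - 1) \<otimes> g')"
  proof -
    define A B D where "A = (f \<oplus> f') [^] (p - 1)" and "B = f [^] (p - 1)" and "D = f' [^] (p - 1)"
    have k: "A \<in> carrier R" "B \<in> carrier R" "D \<in> carrier R" using c by (auto simp: A_def B_def D_def)
    have "peval R ?\<rho> e' = g \<otimes> (A \<oplus> \<ominus> B) \<oplus> g' \<otimes> (A \<oplus> \<ominus> D)"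
      unfolding e'_def A_def B_def D_def using \<rho> c by (simp del: ppow.simps)
    also have "\<dots> = A \<otimes> (g \<oplus> g') \<ominus> (B \<otimes> g \<oplus> D \<otimes> g')"
      using k c by (simp add: minus_eq minus_add r_distr r_minus m_comm[of g] m_comm[of g'] a_ac)
    finally show ?thesis by (simp add: A_def B_def D_def)
  qed
  ultimately show ?thesis using D by auto
qed

text \<open>The Cartier operator sends \<open>f ^ (p - 1) df\<close> to \<open>df\<close>. For
  monomials this is a count of exponents, and \<open>DD_exact\<close> extends it to sums.\<close>

lemma TT_DD_pow: assumes "DD E a f g" shows "TT E a (f [^] (p - 1) \<otimes> g) g"
  using assms
proof (induction rule: DD.induct)
  case (monom c s)
  have cc: "c \<in> carrier R" using Ec[OF sf monom(1)] .
  show ?case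
  proof (cases s)
    case 0 then show ?thesis using TT_zero cc ac by simp
  next
    case (Suc m)
    define r where "r = p - 1"
    have r: "p = Suc r" using p_pos by (simp add: r_def)
    have cp: "c [^] p \<in> E" "vge (c [^] p) 0" using pow_in[OF subfieldE(1)[OF sf] monom(1)] vge_pow_nonneg[OF cc monom(2)] by auto
    \<comment> \<open>The exponent of \<open>a\<close> in \<open>f ^ (p - 1) df\<close> is
      \<open>s * (p - 1) + (s - 1)\<close>, with remainder \<open>p - 1\<close> and quotient
      \<open>s - 1\<close> modulo \<open>p\<close>.\<close>
    have ex: "s * r + m = m * p + r" unfolding Suc r by (simp add: algebra_simps)
    have "r < p" "p - 1 = r" using r by auto
    then have "(m * p + r) mod p = p - 1" "(m * p + r) div p = m" by (simp_all add: div_mult_self3 del: One_nat_def)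
    then have "TT E a ((c [^] p) [^] p \<otimes> a [^] (m * p + r)) (c [^] p \<otimes> a [^] m)" using TT_monom[OF cp, of "m * p + r"] by simp
    from TT_nat[OF this, of s] have T: "TT E a (add_pow R s ((c [^] p) [^] p \<otimes> a [^] (m * p + r))) (add_pow R s (c [^] p \<otimes> a [^] m))" .
    have "(c [^] p \<otimes> a [^] s) [^] r \<otimes> (c [^] p \<otimes> a [^] m) = (c [^] p) [^] p \<otimes> a [^] (m * p + r)"
    proof -
      have "(c [^] p \<otimes> a [^] s) [^] r = (c [^] p) [^] r \<otimes> a [^] (s * r)" using cc ac by (simp add: nat_pow_distrib nat_pow_pow)
      then have "(c [^] p \<otimes> a [^] s) [^] r \<otimes> (c [^] p \<otimes> a [^] m) = ((c [^] p) [^] r \<otimes> c [^] p) \<otimes> (a [^] (s * r) \<otimes> a [^] m)"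
        using cc ac by (simp add: m_ac)
      also have "(c [^] p) [^] r \<otimes> c [^] p = (c [^] p) [^] p" by (simp only: r nat_pow_Suc)
      also have "a [^] (s * r) \<otimes> a [^] m = a [^] (m * p + r)" using ac ex by (simp add: nat_pow_mult)
      finally show ?thesis .
    qed
    moreover have "(c [^] p \<otimes> a [^] s) [^] r \<otimes> add_pow R s (c [^] p \<otimes> a [^] m) = add_pow R s ((c [^] p \<otimes> a [^] s) [^] r \<otimes> (c [^] p \<otimes> a [^] m))"
      using cc ac by (intro add_pow_rdistr) auto
    ultimately have "TT E a ((c [^] p \<otimes> a [^] s) [^] r \<otimes> add_pow R s (c [^] p \<otimes> a [^] m)) (add_pow R s (c [^] p \<otimes> a [^] m))"
      using T by (simp only:)
    moreover have "s - 1 = m" using Suc by simp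
    ultimately show ?thesis unfolding r_def by (simp only:)
  qed
next
  case (add f g f' g')
  have c: "f \<in> carrier R" "g \<in> carrier R" "f' \<in> carrier R" "g' \<in> carrier R" using DDc add by auto
  define A B where "A = (f \<oplus> f') [^] (p - 1) \<otimes> (g \<oplus> g')" and "B = f [^] (p - 1) \<otimes> g \<oplus> f' [^] (p - 1) \<otimes> g'"
  have k: "A \<in> carrier R" "B \<in> carrier R" using c by (auto simp: A_def B_def)
  obtain h where "DD E a h (A \<ominus> B)" using DD_exact[OF add.hyps] unfolding A_def B_def by blast
  from TT_add[OF TT_add[OF add.IH] TT_DD[OF this]]
  have "TT E a (B \<oplus> (A \<ominus> B)) (g \<oplus> g')" using c by (simp add: B_def)
  moreover have "B \<oplus> (A \<ominus> B) = A" using k by (simp add: minus_eq a_lcomm[of B A] r_neg)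
  ultimately show ?case by (simp add: A_def)
qed

text \<open>One application of the operator kills the term for \<open>j = 0\<close> and, as
  \<open>p ^ (j + 1) - 1 = (p ^ j - 1) * p + (p - 1)\<close>, turns each later term into the one
  with exponent \<open>p ^ j - 1\<close>. After \<open>r\<close> applications only
  \<open>g r\<close> is left.\<close>

lemma cartier:
  "(\<And>j. DD E a (f j) (g j)) \<Longrightarrow> vgt (\<Oplus>j\<in>{..r}. f j [^] (p ^ j - 1) \<otimes> g j) 0 \<Longrightarrow> vgt (g r) 0"
proof (induction r arbitrary: f g)
  case 0
  have "f 0 \<in> carrier R" "g 0 \<in> carrier R" using DDc 0(1) by auto
  then show ?case using 0(2) by simp
next
  case (Suc r)
  have c: "f j \<in> carrier R" "g j \<in> carrier R" "f j \<in> E" "vge (f j) 0" for j using DDc[OF Suc.prems(1)] DD_in[OF Suc.prems(1)] by auto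
  define T where "T j = f j [^] (p ^ j - 1) \<otimes> g j" for j
  have Tc: "T j \<in> carrier R" for j using c by (simp add: T_def)
  have "TT E a (T (Suc j)) (f (Suc j) [^] (p ^ j - 1) \<otimes> g (Suc j))" for j
  proof -
    have "p ^ Suc j - 1 = (p ^ j - 1) * p + (p - 1)"
    proof -
      have "p ^ j \<ge> 1" using p_pos by simp
      then have "(p ^ j - 1) * p + (p - 1) = p ^ j * p - p + (p - 1)" by (simp add: diff_mult_distrib)
      moreover have "p \<le> p ^ j * p" using p_pos by simp
      ultimately show ?thesis using p_pos by (simp add: mult.commute)
    qed
    then have "T (Suc j) = (f (Suc j) [^] (p ^ j - 1)) [^] p \<otimes> (f (Suc j) [^] (p - 1) \<otimes> g (Suc j))"
      unfolding T_def using c by (simp add: nat_pow_mult[symmetric] nat_pow_pow m_assoc)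
    moreover have "TT E a ((f (Suc j) [^] (p ^ j - 1)) [^] p \<otimes> (f (Suc j) [^] (p - 1) \<otimes> g (Suc j))) (f (Suc j) [^] (p ^ j - 1) \<otimes> g (Suc j))"
      by (rule TT_smult[OF TT_DD_pow[OF Suc.prems(1)]]) (use pow_in[OF subfieldE(1)[OF sf]] c vge_pow_nonneg in auto)
    ultimately show ?thesis by simp
  qed
  from TT_finsum[where m = r and f = "\<lambda>j. T (Suc j)", OF this]
  have "TT E a (\<Oplus>j\<in>{..r}. T (Suc j)) (\<Oplus>j\<in>{..r}. f (Suc j) [^] (p ^ j - 1) \<otimes> g (Suc j))" .
  moreover have "TT E a (T 0) \<zero>" using TT_DD[OF Suc.prems(1), of 0] c by (simp add: T_def)
  ultimately have TT: "TT E a (T 0 \<oplus> (\<Oplus>j\<in>{..r}. T (Suc j))) (\<zero> \<oplus> (\<Oplus>j\<in>{..r}. f (Suc j) [^] (p ^ j - 1) \<otimes> g (Suc j)))"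
    by (intro TT_add)
  have "(\<Oplus>j\<in>{..Suc m}. T j) = T 0 \<oplus> (\<Oplus>j\<in>{..m}. T (Suc j))" for m
  proof (induction m)
    case 0
    have "{..Suc 0} = {0, Suc 0}" by auto
    then show ?case using Tc by (simp add: finsum_insert)
  next
    case (Suc m)
    have "(\<Oplus>j\<in>{..Suc (Suc m)}. T j) = T (Suc (Suc m)) \<oplus> (\<Oplus>j\<in>{..Suc m}. T j)"
      using Tc by (subst atMost_Suc, subst finsum_insert) auto
    moreover have "(\<Oplus>j\<in>{..Suc m}. T (Suc j)) = T (Suc (Suc m)) \<oplus> (\<Oplus>j\<in>{..m}. T (Suc j))"
      using Tc by (subst atMost_Suc, subst finsum_insert) auto
    ultimately show ?case unfolding Suc using Tc by (simp add: a_lcomm finsum_closed)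
  qed
  then have "vgt (T 0 \<oplus> (\<Oplus>j\<in>{..r}. T (Suc j))) 0" using Suc.prems(2) unfolding T_def[symmetric] by simp
  from TT_vanish[OF TT this] have "vgt (\<Oplus>j\<in>{..r}. f (Suc j) [^] (p ^ j - 1) \<otimes> g (Suc j)) 0"
    using c by (simp add: finsum_closed)
  from Suc.IH[of "\<lambda>j. f (Suc j)" "\<lambda>j. g (Suc j)", OF Suc.prems(1) this] show ?case .
qed

end

end

section \<open>Construction of the separating extension\<close>

context perf_field begin

text \<open>The p-basis is the last \<open>a r\<close> that is no residual p-th power. All
  \<open>a j\<close> are expanded in it, with \<open>F j\<close> the expansion and
  \<open>G j\<close> its derivative; \<open>a r\<close> is the variable itself, and later ones are
  p-th powers with derivative zero.\<close>

lemma ex_digits: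
  fixes a :: "nat \<Rightarrow> 'a" assumes E0: "int_sub E0" and a: "\<And>j. j < i \<Longrightarrow> a j \<in> E0" "\<And>j. j < i \<Longrightarrow> vge (a j) 0"
    and r: "r < i" "\<not> app E0 (a r)" and late: "\<And>j. r < j \<Longrightarrow> j < i \<Longrightarrow> app E0 (a j)"
  shows "\<exists>E c F G. int_sub E \<and> E0 \<subseteq> E \<and> \<not> app E (a r) \<and>
    (\<forall>j s. c j s \<in> E \<and> vge (c j s) 0) \<and>
    (\<forall>j. F j = comb (\<lambda>s. c j s [^] p) (a r) p) \<and>
    (\<forall>j. G j = comb (\<lambda>s. add_pow R (Suc s) (c j (Suc s) [^] p)) (a r) (p - 1)) \<and>
    (\<forall>j<i. vgt (a j \<ominus> F j) 0) \<and> G r = \<one> \<and> (\<forall>j>r. G j = \<zero>)"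
proof -
  obtain E where E: "int_sub E" "E0 \<subseteq> E" "\<not> app E (a r)"
    and rep: "\<And>c. c \<in> E \<Longrightarrow> vge c 0 \<Longrightarrow> \<exists>x. (\<forall>s. x s \<in> E \<and> vge (x s) 0) \<and> vgt (c \<ominus> comb (\<lambda>s. x s [^] p) (a r) p) 0"
    using ex_p_basis[OF E0 a(1)[OF r(1)] a(2)[OF r(1)] r(2)] by blast
  note sf = int_subD(1)[OF E(1)]
  have aE: "a j \<in> E" if "j < i" for j using a(1)[OF that] E(2) by blast
  have ac: "a j \<in> carrier R" if "j < i" for j using Ec[OF sf aE[OF that]] .
  note \<alpha> = ac[OF r(1)]
  let ?F = "\<lambda>c. comb (\<lambda>s. c s [^] p) (a r) p"
  let ?G = "\<lambda>c. comb (\<lambda>s. add_pow R (Suc s) (c (Suc s) [^] p)) (a r) (p - 1)"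
  have zp: "\<zero> [^] p = \<zero>" using p_pos by (simp add: nat_pow_zero)
  have const: "?F (\<lambda>s. if s = 0 then b else \<zero>) = b [^] p \<and> ?G (\<lambda>s. if s = 0 then b else \<zero>) = \<zero>" if b: "b \<in> carrier R" for b
  proof -
    have "(\<lambda>s. (if s = 0 then b else \<zero>) [^] p) = (\<lambda>s::nat. if s = 0 then b [^] p else \<zero>)" using zp by auto
    then have "?F (\<lambda>s. if s = 0 then b else \<zero>) = b [^] p"
      using comb_unit[of "a r" 0 p "b [^] p"] b \<alpha> p_pos by simp
    moreover have "?G (\<lambda>s. if s = 0 then b else \<zero>) = \<zero>" using \<alpha> by (simp add: comb_def zp finsum_zero)
    ultimately show ?thesis by blast
  qed
  let ?P = "\<lambda>j c. (\<forall>s. c s \<in> E \<and> vge (c s) 0) \<and> (j < i \<longrightarrow> vgt (a j \<ominus> ?F c) 0) \<and> (j = r \<longrightarrow> ?G c = \<one>) \<and> (j > r \<longrightarrow> ?G c = \<zero>)"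
  have "\<exists>c. ?P j c" for j
  proof (cases "j < i")
    case False
    then show ?thesis using const[of \<zero>] r(1) sr(2)[OF sf] by (intro exI[of _ "\<lambda>s. if s = 0 then \<zero> else \<zero>"]) auto
  next
    case ji: True
    consider "j < r" | "j = r" | "j > r" by linarith
    then show ?thesis
    proof cases
      case 1 with rep[OF aE[OF ji] a(2)[OF ji]] show ?thesis by auto
    next
      case 2
      define c where "c s = (if s = 1 then \<one> else \<zero>)" for s :: nat
      have "(\<lambda>s. c s [^] p) = (\<lambda>s. if s = 1 then \<one> else \<zero>)" using zp by (auto simp: c_def)
      then have "?F c = a r" using comb_unit[of "a r" 1 p \<one>] \<alpha> p_gt1 by simp
      moreover have "(\<lambda>s. add_pow R (Suc s) (c (Suc s) [^] p)) = (\<lambda>s. if s = 0 then \<one> else \<zero>)"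
        using zp by (auto simp: c_def add.nat_pow_Suc)
      then have "?G c = \<one>" using comb_unit[of "a r" 0 "p - 1" \<one>] \<alpha> p_gt1 by simp
      moreover have "c s \<in> E \<and> vge (c s) 0" for s using sr(2,3)[OF sf] vge_one by (simp add: c_def)
      ultimately show ?thesis using 2 \<alpha> by (intro exI[of _ c]) (auto simp: minus_eq r_neg)
    next
      case 3
      obtain b where b: "b \<in> E0" "vgt (a j \<ominus> b [^] p) 0" using late[OF 3 ji] by (auto simp: app_def)
      have bc: "b \<in> carrier R" using Ec[OF sf] b E(2) by blast
      have "vge (a j \<ominus> (a j \<ominus> b [^] p)) 0" by (rule vge_diff[OF _ _ a(2)[OF ji] vgt_imp_vge[OF b(2)]]) (use bc ac[OF ji] in auto)
      moreover have "a j \<ominus> (a j \<ominus> b [^] p) = b [^] p" using bc ac[OF ji] by (simp add: minus_eq minus_add a_assoc[symmetric] r_neg)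
      ultimately have "vge b 0" using vge_pow_p[OF bc] by simp
      then show ?thesis using const[OF bc] b E(2) 3 sr(2)[OF sf] by (intro exI[of _ "\<lambda>s. if s = 0 then b else \<zero>"]) auto
    qed
  qed
  then have "\<exists>c. \<forall>j. ?P j (c j)" by (intro choice allI)
  then obtain c where c: "\<forall>j. ?P j (c j)" by (elim exE)
  show ?thesis
    by (rule exI[of _ E], rule exI[of _ c], rule exI[of _ "\<lambda>j. ?F (c j)"], rule exI[of _ "\<lambda>j. ?G (c j)"])
      (intro conjI allI impI refl E; use c in simp)
qed

text \<open>If both choices of \<open>u\<close> failed, the difference of the two sums would vanish
  residually. It is the form to which \<open>cartier\<close> applies, with last nonzero derivative
  \<open>G r = 1\<close>.\<close>

lemma ex_shift:
  assumes E: "int_sub E" and \<alpha>: "\<alpha> \<in> E" "vge \<alpha> 0" "\<not> app E \<alpha>"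
    and DD: "\<And>j. DD E \<alpha> (F j) (G j)" and r: "r < i" "G r = \<one>" "\<And>j. j > r \<Longrightarrow> G j = \<zero>"
    and d: "\<And>j. j < i \<Longrightarrow> d j \<in> carrier R"
  shows "\<exists>u\<in>{\<zero>, \<one>}. \<not> vgt (\<Oplus>j\<in>{..<i}. F j [^] (p ^ j - 1) \<otimes> (d j \<ominus> u \<otimes> G j)) 0"
proof (rule ccontr)
  assume neg: "\<not> ?thesis"
  have c: "F j \<in> carrier R" "G j \<in> carrier R" for j using DDc[OF E \<alpha> DD] by auto
  let ?T = "\<lambda>u j. F j [^] (p ^ j - 1) \<otimes> (d j \<ominus> u \<otimes> G j)"
  have Tc: "?T u j \<in> carrier R" if "u \<in> carrier R" "j < i" for u j using c d that by simp
  have v: "vgt (\<Oplus>j\<in>{..<i}. ?T \<zero> j) 0" "vgt (\<Oplus>j\<in>{..<i}. ?T \<one> j) 0" using neg by auto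
  have "vgt ((\<Oplus>j\<in>{..<i}. ?T \<zero> j) \<ominus> (\<Oplus>j\<in>{..<i}. ?T \<one> j)) 0"
    by (rule vgt_diff[OF _ _ v]) (use Tc in \<open>auto intro!: finsum_closed\<close>)
  moreover have "(\<Oplus>j\<in>{..<i}. ?T \<zero> j) \<ominus> (\<Oplus>j\<in>{..<i}. ?T \<one> j) = (\<Oplus>j\<in>{..<i}. ?T \<zero> j \<ominus> ?T \<one> j)"
    by (rule finsum_diff) (use Tc in auto)
  moreover have "\<dots> = (\<Oplus>j\<in>{..<i}. F j [^] (p ^ j - 1) \<otimes> G j)"
  proof (rule finsum_cong')
    fix j assume "j \<in> {..<i}"
    then have dc: "d j \<in> carrier R" using d by simp
    have "d j \<oplus> (\<ominus> d j \<oplus> G j) = G j" using dc c by (simp add: a_assoc[symmetric] r_neg)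
    then have "x \<otimes> d j \<oplus> \<ominus> (x \<otimes> (d j \<oplus> \<ominus> G j)) = x \<otimes> G j" if "x \<in> carrier R" for x
      using that dc c by (simp add: r_minus[symmetric] r_distr[symmetric] minus_add)
    then show "?T \<zero> j \<ominus> ?T \<one> j = F j [^] (p ^ j - 1) \<otimes> G j" using c dc by (simp add: minus_eq)
  qed (use c in auto)
  moreover have "\<dots> = (\<Oplus>j\<in>{..r}. F j [^] (p ^ j - 1) \<otimes> G j)"
    by (rule add.finprod_mono_neutral_cong_right) (use c r in auto)
  ultimately have "vgt (G r) 0" using cartier[OF E \<alpha> DD] by simp
  then show False using r(2) w_one by (simp add: vgt_def)
qed

lemma ex_extension:
  assumes E0: "int_sub E0" and a: "\<And>j. j < i \<Longrightarrow> a j \<in> E0" "\<And>j. j < i \<Longrightarrow> vge (a j) 0"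
    and r: "r < i" "\<not> app E0 (a r)" and late: "\<And>j. r < j \<Longrightarrow> j < i \<Longrightarrow> app E0 (a j)"
  shows "\<exists>K' b. int_sub K' \<and> E0 \<subseteq> K' \<and> (\<forall>c\<in>K'. vge c 0 \<longrightarrow> app K' c) \<and>
    (\<forall>j<i. b j \<in> K' \<and> vge (b j) 0 \<and> vgt (a j \<ominus> b j [^] p) 0) \<and>
    \<not> vge (\<Oplus>j\<in>{..<i}. b j [^] (p * (p ^ j - 1)) \<otimes> (a j \<ominus> b j [^] p)) 2"
proof -
  define \<alpha> where "\<alpha> = a r"
  obtain E c F G where E: "int_sub E" "E0 \<subseteq> E" "\<not> app E \<alpha>"
    and c: "\<And>j s. c j s \<in> E" "\<And>j s. vge (c j s) 0"
    and F: "\<And>j. F j = comb (\<lambda>s. c j s [^] p) \<alpha> p"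
    and G: "\<And>j. G j = comb (\<lambda>s. add_pow R (Suc s) (c j (Suc s) [^] p)) \<alpha> (p - 1)"
    and close: "\<And>j. j < i \<Longrightarrow> vgt (a j \<ominus> F j) 0" and Gr: "G r = \<one>" "\<And>j. j > r \<Longrightarrow> G j = \<zero>"
    using ex_digits[where a = a and r = r and i = i, OF E0 a r late] unfolding \<alpha>_def by blast
  note sf = int_subD(1)[OF E(1)]
  have aE: "a j \<in> E" if "j < i" for j using a(1)[OF that] E(2) by blast
  have ac: "a j \<in> carrier R" if "j < i" for j using Ec[OF sf aE[OF that]] .
  have \<alpha>: "\<alpha> \<in> E" "vge \<alpha> 0" "\<not> app E \<alpha>" using aE a(2) r(1) E(3) by (auto simp: \<alpha>_def)
  have \<alpha>c: "\<alpha> \<in> carrier R" using Ec[OF sf \<alpha>(1)] .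
  have cc: "c j s \<in> carrier R" for j s using Ec[OF sf c(1)] .
  have pS: "p = Suc (p - 1)" using p_pos by simp
  have DD: "DD E \<alpha> (F j) (G j)" for j
    using DD_comb[OF E(1) \<alpha>, of "c j" "p - 1"] c pS unfolding F G by simp
  have FG: "F j \<in> E" "vge (F j) 0" "vge (G j) 0" "F j \<in> carrier R" "G j \<in> carrier R" for j
    using DD_in[OF E(1) \<alpha> DD] DDc[OF E(1) \<alpha> DD] by auto
  have ip: "inv \<pi> \<in> carrier R" "inv \<pi> \<noteq> \<zero>" "\<pi> \<otimes> inv \<pi> = \<one>" using inv_nonzero[OF pi(1,2)] by auto
  have vp: "vge \<pi> 1" using pi by (simp add: vge_def)
  \<comment> \<open>The first order defect of the expansion: \<open>a j = F j + \<pi> * d j\<close>,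
    with \<open>d j\<close> integral because values on \<open>E\<close> are integers.\<close>
  define d where "d j = (a j \<ominus> F j) \<otimes> inv \<pi>" for j
  have dc: "d j \<in> carrier R" if "j < i" for j using ac[OF that] FG ip by (simp add: d_def)
  have pd: "\<pi> \<otimes> d j = a j \<ominus> F j" if "j < i" for j
  proof -
    have "\<pi> \<otimes> d j = (\<pi> \<otimes> inv \<pi>) \<otimes> (a j \<ominus> F j)" unfolding d_def using ac[OF that] FG(4) ip(1) pi(1) by (simp add: m_assoc m_comm[of "a j \<ominus> F j"])
    then show ?thesis using ac[OF that] FG ip by simp
  qed
  have d0: "vge (d j) 0" if j: "j < i" for j
  proof (cases "a j \<ominus> F j = \<zero>")
    case True then show ?thesis using ip by (simp add: d_def)
  next
    case False
    then have "w (a j \<ominus> F j) \<in> \<int>" using int_subD(3)[OF E(1) diff_in[OF sf aE[OF j] FG(1)]] by simp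
    then obtain m where m: "w (a j \<ominus> F j) = real_of_int m" by (elim Ints_cases)
    have "0 < w (a j \<ominus> F j)" using close[OF j] False by (simp add: vgt_def)
    with m have "1 \<le> w (a j \<ominus> F j)" by simp
    moreover have "w (d j) = w (a j \<ominus> F j) - 1"
      unfolding d_def using w_mult[OF _ ip(1) False ip(2)] w_inv[OF pi(1,2)] pi(3) ac[OF j] FG by simp
    ultimately show ?thesis by (simp add: vge_def)
  qed
  obtain u where u: "u = \<zero> \<or> u = \<one>"
    and nv: "\<not> vgt (\<Oplus>j\<in>{..<i}. F j [^] (p ^ j - 1) \<otimes> (d j \<ominus> u \<otimes> G j)) 0"
    using ex_shift[where F = F and G = G and d = d, OF E(1) \<alpha> DD r(1) Gr dc] by blast
  have uc: "u \<in> carrier R" "vge u 0" "u \<in> E" using u vge_one sr(2,3)[OF sf] by auto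
  define h where "h = \<pi> \<otimes> u"
  have hc: "h \<in> carrier R" "h \<in> E" using uc pi int_subD(2)[OF E(1)] sr(6)[OF sf] by (auto simp: h_def)
  have "vge h (1 + 0)" unfolding h_def by (rule vge_mult[OF pi(1) uc(1) vp uc(2)])
  then have h1: "vge h 1" by simp
  have h0: "vge h 0" by (rule vge_mono[OF h1]) simp
  define \<gamma> where "\<gamma> = \<alpha> \<oplus> h"
  have \<gamma>: "\<gamma> \<in> E" "\<gamma> \<in> carrier R" using \<alpha>(1) \<alpha>c hc sr(7)[OF sf] by (auto simp: \<gamma>_def)
  have \<gamma>0: "vge \<gamma> 0" unfolding \<gamma>_def by (rule vge_add[OF \<alpha>c hc(1) \<alpha>(2) h0])
  have na: "\<not> app E \<gamma>"
  proof
    assume "app E \<gamma>"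
    then obtain b where b: "b \<in> E" "vgt (\<gamma> \<ominus> b [^] p) 0" by (auto simp: app_def)
    have "\<alpha> \<ominus> \<gamma> = \<ominus> h" using \<alpha>c hc by (simp add: \<gamma>_def minus_eq minus_add a_assoc[symmetric] r_neg)
    then have "vgt (\<alpha> \<ominus> \<gamma>) 0" using vge_imp_vgt[OF h1] hc by (simp add: vgt_neg)
    then have "vgt (\<alpha> \<ominus> b [^] p) 0" using vgt_diff_trans[OF \<alpha>c \<gamma>(2) _ _ b(2)] Ec[OF sf b(1)] by simp
    with b(1) \<alpha>(3) show False by (auto simp: app_def)
  qed
  obtain \<beta> where \<beta>: "\<beta> \<in> carrier R" "\<beta> [^] p = \<gamma>" using root[OF \<gamma>(2)] by blast
  have \<beta>0: "vge \<beta> 0" using vge_pow_p[OF \<beta>(1)] \<beta>(2) \<gamma>0 by simp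
  note adj = adj_int_sub[OF E(1) \<gamma>(1) \<gamma>0 na \<beta>]
  obtain K' where K': "int_sub K'" "adj p E \<beta> \<subseteq> K'" "\<forall>c\<in>K'. vge c 0 \<longrightarrow> app K' c"
    using ex_perfect[OF adj(1)] by blast
  \<comment> \<open>The digits of \<open>a j\<close> are reused with the p-th root
    \<open>\<beta>\<close> of \<open>\<alpha> + h\<close> as variable. Thus \<open>b j ^ p\<close>
    is the expansion \<open>F j\<close> with \<open>\<alpha>\<close> shifted by
    \<open>h\<close>.\<close>
  define b where "b j = comb (c j) \<beta> p" for j
  have bK: "b j \<in> K'" for j using adjI[of "c j" E \<beta> p] c(1) K'(2) by (auto simp: b_def)
  have bc: "b j \<in> carrier R" for j using cc \<beta> by (simp add: b_def)
  have b0: "vge (b j) 0" for j unfolding b_def by (rule comb_vge[OF cc \<beta>(1) \<beta>0 c(2)])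
  define B where "B j = b j [^] p" for j
  have Bc: "B j \<in> carrier R" for j using bc by (simp add: B_def)
  have B0: "vge (B j) 0" for j unfolding B_def by (rule vge_pow_nonneg[OF bc b0])
  have B: "B j = comb (\<lambda>s. c j s [^] p) (\<alpha> \<oplus> h) p" for j
    unfolding B_def b_def using frob_comb[OF cc \<beta>(1)] \<beta>(2) by (simp add: \<gamma>_def)
  \<comment> \<open>The Taylor remainder of the shifted expansion, quadratic in \<open>h\<close> and
    hence of value at least two.\<close>
  define \<epsilon> where "\<epsilon> j = B j \<ominus> F j \<ominus> h \<otimes> G j" for j
  have \<epsilon>c: "\<epsilon> j \<in> carrier R" for j using Bc FG hc by (simp add: \<epsilon>_def)
  have \<epsilon>2: "vge (\<epsilon> j) 2" for j
  proof -
    have "vge (comb (\<lambda>s. c j s [^] p) (\<alpha> \<oplus> h) (Suc (p - 1)) \<ominus> comb (\<lambda>s. c j s [^] p) \<alpha> (Suc (p - 1)) \<ominus> h \<otimes> G j) (2 * 1)"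
      unfolding G by (rule comb_taylor) (use cc c(2) \<alpha>c \<alpha>(2) hc h1 vge_pow_nonneg in auto)
    then show ?thesis unfolding \<epsilon>_def B F using pS by simp
  qed
  define D where "D j = d j \<ominus> u \<otimes> G j" for j
  have Dc: "D j \<in> carrier R" if "j < i" for j using dc[OF that] uc FG by (simp add: D_def)
  have D0: "vge (D j) 0" if "j < i" for j
  proof -
    have "vge (u \<otimes> G j) (0 + 0)" by (rule vge_mult[OF uc(1) FG(5) uc(2) FG(3)])
    then show ?thesis unfolding D_def using vge_diff[OF dc[OF that] _ d0[OF that]] uc FG by simp
  qed
  have pD: "vge (\<pi> \<otimes> D j) 1" if "j < i" for j
    using vge_mult[OF pi(1) Dc[OF that] vp D0[OF that]] by simp
  have aB: "a j \<ominus> B j = \<pi> \<otimes> D j \<ominus> \<epsilon> j" if j: "j < i" for j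
  proof -
    let ?\<rho> = "\<lambda>i. if i = 0 then a j else if i = 1 then B j else if i = 2 then F j else if i = 3 then G j else if i = 4 then u else if i = 5 then \<pi> else d j"
    have \<rho>: "?\<rho> i \<in> carrier R" for i using ac[OF j] Bc FG uc pi dc[OF j] by auto
    have "peval R ?\<rho> (PAdd (PMul (Var 5) (PAdd (Var 6) (PNeg (PMul (Var 4) (Var 3))))) (PNeg (PAdd (PAdd (Var 1) (PNeg (Var 2))) (PNeg (PMul (PMul (Var 5) (Var 4)) (Var 3))))))
      = peval R ?\<rho> (PAdd (PAdd (PMul (Var 5) (Var 6)) (Var 2)) (PNeg (Var 1)))"
      by (rule peval_cong_int[OF \<rho>]) (auto simp: algebra_simps)
    then have "\<pi> \<otimes> D j \<ominus> \<epsilon> j = (\<pi> \<otimes> d j \<oplus> F j) \<ominus> B j" by (simp add: minus_eq D_def \<epsilon>_def h_def)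
    also have "\<dots> = a j \<ominus> B j" unfolding pd[OF j] using ac[OF j] FG Bc by (simp add: minus_eq a_assoc l_neg)
    finally show ?thesis by simp
  qed
  have aB1: "vge (a j \<ominus> B j) 1" if j: "j < i" for j
    unfolding aB[OF j] by (rule vge_diff[OF _ \<epsilon>c pD[OF j] vge_mono[OF \<epsilon>2]]) (use pi Dc[OF j] in auto)
  have BF1: "vge (B j \<ominus> F j) 1" for j
  proof -
    have "vge (h \<otimes> G j) (1 + 0)" by (rule vge_mult[OF hc(1) FG(5) h1 FG(3)])
    then have "vge (\<epsilon> j \<oplus> h \<otimes> G j) 1" using \<epsilon>c hc FG vge_mono[OF \<epsilon>2, of 1] by (intro vge_add) auto
    moreover have "\<epsilon> j \<oplus> h \<otimes> G j = B j \<ominus> F j" unfolding \<epsilon>_def using Bc FG hc by (simp add: minus_eq a_assoc l_neg)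
    ultimately show ?thesis by simp
  qed
  define S where "S = (\<Oplus>j\<in>{..<i}. b j [^] (p * (p ^ j - 1)) \<otimes> (a j \<ominus> b j [^] p))"
  define T where "T = (\<Oplus>j\<in>{..<i}. F j [^] (p ^ j - 1) \<otimes> D j)"
  have Tc: "T \<in> carrier R" unfolding T_def using FG Dc by (intro finsum_closed) auto
  have Sc: "S \<in> carrier R" unfolding S_def using bc ac by (intro finsum_closed) auto
  \<comment> \<open>Modulo value two the sum \<open>S\<close> is \<open>\<pi> * T\<close>, and
    \<open>T\<close> has nonzero residue by the choice of \<open>u\<close>.\<close>
  have "vge (S \<ominus> \<pi> \<otimes> T) 2"
  proof -
    have "\<pi> \<otimes> T = (\<Oplus>j\<in>{..<i}. \<pi> \<otimes> (F j [^] (p ^ j - 1) \<otimes> D j))"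
      unfolding T_def using FG Dc pi by (intro finsum_rdistr) auto
    then have "S \<ominus> \<pi> \<otimes> T = (\<Oplus>j\<in>{..<i}. b j [^] (p * (p ^ j - 1)) \<otimes> (a j \<ominus> b j [^] p) \<ominus> \<pi> \<otimes> (F j [^] (p ^ j - 1) \<otimes> D j))"
      unfolding S_def by (simp only:, intro finsum_diff) (use bc ac FG(4) Dc pi(1) in auto)
    moreover have "vge (b j [^] (p * (p ^ j - 1)) \<otimes> (a j \<ominus> b j [^] p) \<ominus> \<pi> \<otimes> (F j [^] (p ^ j - 1) \<otimes> D j)) 2" if j: "j < i" for j
    proof -
      define U V where "U = B j [^] (p ^ j - 1)" and "V = F j [^] (p ^ j - 1)"
      have UV: "U \<in> carrier R" "V \<in> carrier R" using Bc FG by (auto simp: U_def V_def)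
      have c1: "vge (U \<ominus> V) 1" unfolding U_def V_def by (rule vge_pow_close[OF Bc FG(4) B0 FG(2) BF1])
      have U0: "vge U 0" unfolding U_def by (rule vge_pow_nonneg[OF Bc B0])
      have "b j [^] (p * (p ^ j - 1)) = U" unfolding U_def B_def using bc by (simp add: nat_pow_pow)
      then have "b j [^] (p * (p ^ j - 1)) \<otimes> (a j \<ominus> b j [^] p) \<ominus> \<pi> \<otimes> (F j [^] (p ^ j - 1) \<otimes> D j)
        = U \<otimes> (\<pi> \<otimes> D j \<ominus> \<epsilon> j) \<ominus> \<pi> \<otimes> (V \<otimes> D j)" using aB[OF j] by (simp add: B_def V_def)
      also have "\<dots> = (U \<ominus> V) \<otimes> (\<pi> \<otimes> D j) \<ominus> U \<otimes> \<epsilon> j"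
      proof -
        let ?\<rho> = "\<lambda>i. if i = 0 then U else if i = 1 then V else if i = 2 then \<pi> else if i = 3 then D j else \<epsilon> j"
        have \<rho>: "?\<rho> i \<in> carrier R" for i using UV pi Dc[OF j] \<epsilon>c by auto
        have "peval R ?\<rho> (PAdd (PMul (Var 0) (PAdd (PMul (Var 2) (Var 3)) (PNeg (Var 4)))) (PNeg (PMul (Var 2) (PMul (Var 1) (Var 3)))))
          = peval R ?\<rho> (PAdd (PMul (PAdd (Var 0) (PNeg (Var 1))) (PMul (Var 2) (Var 3))) (PNeg (PMul (Var 0) (Var 4))))"
          by (rule peval_cong_int[OF \<rho>]) (auto simp: algebra_simps)
        then show ?thesis by (simp add: minus_eq)
      qed
      finally have eq: "b j [^] (p * (p ^ j - 1)) \<otimes> (a j \<ominus> b j [^] p) \<ominus> \<pi> \<otimes> (F j [^] (p ^ j - 1) \<otimes> D j)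
        = (U \<ominus> V) \<otimes> (\<pi> \<otimes> D j) \<ominus> U \<otimes> \<epsilon> j" .
      have v1: "vge ((U \<ominus> V) \<otimes> (\<pi> \<otimes> D j)) (1 + 1)" by (rule vge_mult[OF _ _ c1 pD[OF j]]) (use UV pi Dc[OF j] in auto)
      have v2: "vge (U \<otimes> \<epsilon> j) (0 + 2)" by (rule vge_mult[OF UV(1) \<epsilon>c U0 \<epsilon>2])
      show ?thesis unfolding eq using vge_diff[of "(U \<ominus> V) \<otimes> (\<pi> \<otimes> D j)" "U \<otimes> \<epsilon> j" 2] v1 v2 UV pi Dc[OF j] \<epsilon>c by simp
    qed
    ultimately show ?thesis by (simp only:, intro vge_finsum) (use bc ac FG(4) Dc pi(1) in auto)
  qed
  moreover have False if "vge S 2" "vge (S \<ominus> \<pi> \<otimes> T) 2"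
  proof -
    have "vge (S \<ominus> (S \<ominus> \<pi> \<otimes> T)) 2" by (rule vge_diff[OF Sc _ that]) (use Sc Tc pi in simp)
    moreover have "S \<ominus> (S \<ominus> \<pi> \<otimes> T) = \<pi> \<otimes> T" using Sc Tc pi by (simp add: minus_eq minus_add a_assoc[symmetric] r_neg)
    ultimately have "vge (\<pi> \<otimes> T) 2" by simp
    then have "vgt T 0" using w_mult[OF pi(1) Tc pi(2)] pi Tc by (cases "T = \<zero>") (auto simp: vge_def vgt_def integral_iff)
    with nv show False by (simp add: T_def D_def)
  qed
  ultimately have "\<not> vge S 2" by blast
  moreover have "vgt (a j \<ominus> b j [^] p) 0" if "j < i" for j using vge_imp_vgt[OF aB1[OF that], of 0] by (simp add: B_def)
  moreover have "E0 \<subseteq> K'" using E(2) adj(2) K'(2) by blast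
  ultimately show ?thesis using K' bK b0 unfolding S_def by blast
qed

end

section \<open>The perfect closure\<close>

lemma (in algebraically_closed) ex_nth_root:
  assumes y: "y \<in> carrier L" and m: "m > 0"
  shows "\<exists>x\<in>carrier L. x [^] (m::nat) = y"
proof -
  \<comment> \<open>The coefficients of \<open>X ^ m - y\<close>, leading one first.\<close>
  define P where "P = \<one> # replicate (m - 1) \<zero> @ [\<ominus> y]"
  have P: "P \<in> carrier (poly_ring L)" using y by (auto simp: P_def univ_poly_def polynomial_def)
  have "splitted P" by (rule roots_over_carrier[OF P])
  then have "roots P \<noteq> {#}" unfolding splitted_def using m by (auto simp: P_def)
  then obtain x where "x \<in># roots P" by blast
  then have "is_root P x" using roots_mem_iff_is_root[OF P] by simp
  then have x: "x \<in> carrier L" "eval P x = \<zero>" by (auto simp: is_root_def)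
  have "eval (replicate k \<zero> @ [\<ominus> y]) x = \<ominus> y" for k using x y by (induction k) auto
  then have "x [^] m \<oplus> \<ominus> y = \<zero>" using x y m by (simp add: P_def)
  then have "x [^] m = y" using x y by (metis minus_equality minus_minus nat_pow_closed a_inv_closed)
  then show ?thesis using x by blast
qed

lemma (in field) ex_root_extension:
  "\<exists>(L :: (('a list \<times> nat) multiset \<Rightarrow> 'a) ring) \<sigma>. field L \<and> \<sigma> \<in> ring_hom R L \<and>
     (\<forall>y\<in>carrier L. \<forall>m>0. \<exists>x\<in>carrier L. x [^]\<^bsub>L\<^esub> (m::nat) = y)"
proof -
  interpret A: algebraic_closure alg_closure "indexed_const ` carrier R" by (rule alg_closureE(1))
  show ?thesis using alg_closureE(2) A.ex_nth_root A.field_axioms by blast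
qed

locale radical = K: char_dvf K v p "0::nat" + L: field L for K (structure) and v p and L (structure) +
  fixes \<sigma> and \<pi>
  assumes hom: "\<sigma> \<in> ring_hom K L" and roots: "y \<in> carrier L \<Longrightarrow> \<exists>x\<in>carrier L. x [^]\<^bsub>L\<^esub> p = y"
    and pi: "\<pi> \<in> carrier K" "\<pi> \<noteq> \<zero>\<^bsub>K\<^esub>" "v \<pi> = 1"
begin

sublocale h: ring_hom_cring K L \<sigma>
  by (intro ring_hom_cringI ring_hom_cring.intro ring_hom_cring_axioms.intro hom K.is_cring L.is_cring)

lemma p: "Factorial_Ring.prime p" "p > 0" using K.char_p prime_gt_0_nat by (auto simp: char_p_def)

lemma add_pow_L: "add_pow L p \<one>\<^bsub>L\<^esub> = \<zero>\<^bsub>L\<^esub>"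
proof -
  have "\<sigma> (add_pow K k \<one>\<^bsub>K\<^esub>) = add_pow L k \<one>\<^bsub>L\<^esub>" for k :: nat
    by (induction k) (auto simp: K.add.nat_pow_Suc L.add.nat_pow_Suc)
  from this[of p] show ?thesis using K.char_p by (simp add: char_p_def)
qed

lemma frob: "x \<in> carrier L \<Longrightarrow> y \<in> carrier L \<Longrightarrow> (x \<oplus>\<^bsub>L\<^esub> y) [^]\<^bsub>L\<^esub> (p ^ r) = x [^]\<^bsub>L\<^esub> (p ^ r) \<oplus>\<^bsub>L\<^esub> y [^]\<^bsub>L\<^esub> (p ^ r)"
proof (induction r)
  case (Suc r)
  have "z [^]\<^bsub>L\<^esub> (p ^ Suc r) = (z [^]\<^bsub>L\<^esub> (p ^ r)) [^]\<^bsub>L\<^esub> p" if "z \<in> carrier L" for z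
    using that by (simp add: L.nat_pow_pow mult.commute)
  then show ?case using Suc L.frobenius_add[OF p(1) add_pow_L] by simp
qed (simp add: L.nat_pow_eone)

lemma frob_neg: assumes "x \<in> carrier L" shows "(\<ominus>\<^bsub>L\<^esub> x) [^]\<^bsub>L\<^esub> (p ^ r) = \<ominus>\<^bsub>L\<^esub> (x [^]\<^bsub>L\<^esub> (p ^ r))"
proof -
  have "(\<ominus>\<^bsub>L\<^esub> x \<oplus>\<^bsub>L\<^esub> x) [^]\<^bsub>L\<^esub> (p ^ r) = (\<ominus>\<^bsub>L\<^esub> x) [^]\<^bsub>L\<^esub> (p ^ r) \<oplus>\<^bsub>L\<^esub> x [^]\<^bsub>L\<^esub> (p ^ r)" using assms by (intro frob) auto
  then have "(\<ominus>\<^bsub>L\<^esub> x) [^]\<^bsub>L\<^esub> (p ^ r) \<oplus>\<^bsub>L\<^esub> x [^]\<^bsub>L\<^esub> (p ^ r) = \<zero>\<^bsub>L\<^esub>" using assms p(2) by (simp add: L.l_neg L.nat_pow_zero)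
  then show ?thesis using assms by (metis L.a_inv_closed L.minus_equality L.nat_pow_closed)
qed

lemma pow_zero_iff: "x \<in> carrier L \<Longrightarrow> x [^]\<^bsub>L\<^esub> (m::nat) = \<zero>\<^bsub>L\<^esub> \<Longrightarrow> x = \<zero>\<^bsub>L\<^esub>"
  by (induction m) (auto simp: L.integral_iff)

lemma frob_inj: assumes "x \<in> carrier L" "y \<in> carrier L" "x [^]\<^bsub>L\<^esub> (p ^ r) = y [^]\<^bsub>L\<^esub> (p ^ r)" shows "x = y"
proof -
  have "(x \<oplus>\<^bsub>L\<^esub> \<ominus>\<^bsub>L\<^esub> y) [^]\<^bsub>L\<^esub> (p ^ r) = \<zero>\<^bsub>L\<^esub>" using assms by (simp add: frob frob_neg L.r_neg)
  then have "x \<oplus>\<^bsub>L\<^esub> \<ominus>\<^bsub>L\<^esub> y = \<zero>\<^bsub>L\<^esub>" using pow_zero_iff assms by simp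
  then show ?thesis using assms by (metis L.minus_equality L.minus_minus L.a_inv_closed)
qed

lemma hzero: assumes "x \<in> carrier K" "\<sigma> x = \<zero>\<^bsub>L\<^esub>" shows "x = \<zero>\<^bsub>K\<^esub>"
proof (rule ccontr)
  assume "x \<noteq> \<zero>\<^bsub>K\<^esub>"
  then have "\<sigma> (x \<otimes>\<^bsub>K\<^esub> inv\<^bsub>K\<^esub> x) = \<one>\<^bsub>L\<^esub>" "inv\<^bsub>K\<^esub> x \<in> carrier K" using K.inv_nonzero[OF assms(1)] by auto
  then show False using assms by simp
qed

lemma hinj: assumes "x \<in> carrier K" "y \<in> carrier K" "\<sigma> x = \<sigma> y" shows "x = y"
proof -
  have "\<sigma> (x \<oplus>\<^bsub>K\<^esub> \<ominus>\<^bsub>K\<^esub> y) = \<zero>\<^bsub>L\<^esub>" using assms by (simp add: L.r_neg)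
  then have "x \<oplus>\<^bsub>K\<^esub> \<ominus>\<^bsub>K\<^esub> y = \<zero>\<^bsub>K\<^esub>" using hzero assms by simp
  then show ?thesis using assms by (metis K.minus_equality K.minus_minus K.a_inv_closed)
qed

definition rep :: "'c \<Rightarrow> nat \<Rightarrow> 'a \<Rightarrow> bool" where
  "rep x r k \<longleftrightarrow> x \<in> carrier L \<and> k \<in> carrier K \<and> x [^]\<^bsub>L\<^esub> (p ^ r) = \<sigma> k"

text \<open>The purely inseparable closure of the image of \<open>K\<close> in \<open>L\<close>.
  Since \<open>L\<close> has all p-th roots, it is the perfect closure.\<close>

definition Om :: "'c set" where "Om = {x. \<exists>r k. rep x r k}"

definition w :: "'c \<Rightarrow> real" where
  "w x = (let (r, k) = (SOME (r, k). rep x r k) in real_of_int (v k) / real (p ^ r))"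

lemma rep_lift: "rep x r k \<Longrightarrow> rep x (r + s) (k [^]\<^bsub>K\<^esub> (p ^ s))"
  unfolding rep_def by (auto simp: power_add L.nat_pow_pow[symmetric])

lemma rep2: assumes "x \<in> Om" "y \<in> Om" obtains r k l where "rep x r k" "rep y r l"
proof -
  obtain r k s l where "rep x r k" "rep y s l" using assms by (auto simp: Om_def)
  from rep_lift[OF this(1), of s] rep_lift[OF this(2), of r] show thesis by (intro that) (auto simp: add.commute)
qed

lemma rep_nz: "rep x r k \<Longrightarrow> x \<noteq> \<zero>\<^bsub>L\<^esub> \<Longrightarrow> k \<noteq> \<zero>\<^bsub>K\<^esub>"
  using pow_zero_iff[of x "p ^ r"] by (auto simp: rep_def)

text \<open>Two representations of \<open>x\<close> are lifted to the common exponent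
  \<open>s + r\<close>, where injectivity of \<open>\<sigma>\<close> compares them; so the choice in
  \<open>w\<close> does not matter.\<close>

lemma w_rep: assumes "rep x r k" "x \<noteq> \<zero>\<^bsub>L\<^esub>" shows "w x = real_of_int (v k) / real (p ^ r)"
proof -
  obtain s l where sl: "(SOME (r, k). rep x r k) = (s, l)" by (cases "SOME (r, k). rep x r k")
  have "case (SOME (r, k). rep x r k) of (r, k) \<Rightarrow> rep x r k" by (rule someI[of _ "(r, k)"]) (use assms in simp)
  then have l: "rep x s l" by (simp add: sl)
  have c: "k \<in> carrier K" "l \<in> carrier K" using assms l by (auto simp: rep_def)
  have "rep x (s + r) (l [^]\<^bsub>K\<^esub> (p ^ r))" "rep x (s + r) (k [^]\<^bsub>K\<^esub> (p ^ s))"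
    using rep_lift[OF l, of r] rep_lift[OF assms(1), of s] by (auto simp: add.commute)
  then have "\<sigma> (l [^]\<^bsub>K\<^esub> (p ^ r)) = \<sigma> (k [^]\<^bsub>K\<^esub> (p ^ s))" by (simp add: rep_def)
  then have "l [^]\<^bsub>K\<^esub> (p ^ r) = k [^]\<^bsub>K\<^esub> (p ^ s)" using hinj c by simp
  then have "real (p ^ r) * real_of_int (v l) = real (p ^ s) * real_of_int (v k)"
    using K.w_pow[OF c(1) rep_nz[OF assms], of "p ^ s"] K.w_pow[OF c(2) rep_nz[OF l assms(2)], of "p ^ r"] by simp
  then show ?thesis unfolding w_def sl using p(2) by (simp add: field_simps)
qed

lemma rep_mult: "rep x r k \<Longrightarrow> rep y r l \<Longrightarrow> rep (x \<otimes>\<^bsub>L\<^esub> y) r (k \<otimes>\<^bsub>K\<^esub> l)"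
  unfolding rep_def by (auto simp: L.nat_pow_distrib)

lemma rep_add: "rep x r k \<Longrightarrow> rep y r l \<Longrightarrow> rep (x \<oplus>\<^bsub>L\<^esub> y) r (k \<oplus>\<^bsub>K\<^esub> l)"
  unfolding rep_def by (auto simp: frob)

lemma rep_neg: "rep x r k \<Longrightarrow> rep (\<ominus>\<^bsub>L\<^esub> x) r (\<ominus>\<^bsub>K\<^esub> k)"
  unfolding rep_def by (auto simp: frob_neg)

lemma rep_inv: assumes "rep x r k" "x \<noteq> \<zero>\<^bsub>L\<^esub>" shows "rep (inv\<^bsub>L\<^esub> x) r (inv\<^bsub>K\<^esub> k)"
proof -
  have c: "x \<in> carrier L" "k \<in> carrier K" "x [^]\<^bsub>L\<^esub> (p ^ r) = \<sigma> k" using assms by (auto simp: rep_def)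
  have "x \<in> Units L" using c(1) assms(2) L.field_Units by simp
  then have i: "inv\<^bsub>L\<^esub> x \<in> carrier L" "x \<otimes>\<^bsub>L\<^esub> inv\<^bsub>L\<^esub> x = \<one>\<^bsub>L\<^esub>" by auto
  have j: "inv\<^bsub>K\<^esub> k \<in> carrier K" "k \<otimes>\<^bsub>K\<^esub> inv\<^bsub>K\<^esub> k = \<one>\<^bsub>K\<^esub>" using K.inv_nonzero[OF c(2) rep_nz[OF assms]] by auto
  have "\<sigma> k \<otimes>\<^bsub>L\<^esub> (inv\<^bsub>L\<^esub> x) [^]\<^bsub>L\<^esub> (p ^ r) = \<one>\<^bsub>L\<^esub>" using c i by (metis L.nat_pow_distrib L.nat_pow_one)
  moreover have "\<sigma> k \<otimes>\<^bsub>L\<^esub> \<sigma> (inv\<^bsub>K\<^esub> k) = \<one>\<^bsub>L\<^esub>" using c j by (metis h.hom_mult h.hom_one)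
  moreover have "\<sigma> k \<noteq> \<zero>\<^bsub>L\<^esub>" using hzero[OF c(2)] rep_nz[OF assms] by blast
  ultimately have "(inv\<^bsub>L\<^esub> x) [^]\<^bsub>L\<^esub> (p ^ r) = \<sigma> (inv\<^bsub>K\<^esub> k)" using c i j by (metis L.m_lcancel L.nat_pow_closed h.hom_closed)
  then show ?thesis using i j by (simp add: rep_def)
qed

lemma rep_hom: "k \<in> carrier K \<Longrightarrow> rep (\<sigma> k) 0 k" by (simp add: rep_def L.nat_pow_eone)

lemma Om_subfield: "subfield Om L"
proof (rule L.subfieldI'[OF L.subringI])
  show "Om \<subseteq> carrier L" by (auto simp: Om_def rep_def)
  show "\<one>\<^bsub>L\<^esub> \<in> Om" using rep_hom[of "\<one>\<^bsub>K\<^esub>"] by (auto simp: Om_def)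
  show "\<ominus>\<^bsub>L\<^esub> x \<in> Om" if "x \<in> Om" for x using that rep_neg unfolding Om_def by blast
  show "x \<otimes>\<^bsub>L\<^esub> y \<in> Om" if "x \<in> Om" "y \<in> Om" for x y by (rule rep2[OF that]) (unfold Om_def, blast intro: rep_mult)
  show "x \<oplus>\<^bsub>L\<^esub> y \<in> Om" if "x \<in> Om" "y \<in> Om" for x y by (rule rep2[OF that]) (unfold Om_def, blast intro: rep_add)
  show "inv\<^bsub>L\<^esub> x \<in> Om" if "x \<in> Om - {\<zero>\<^bsub>L\<^esub>}" for x using that rep_inv unfolding Om_def by blast
qed

definition PC where "PC = L\<lparr>carrier := Om\<rparr>"

lemma PC_simps: "carrier PC = Om" "monoid.mult PC = monoid.mult L" "\<one>\<^bsub>PC\<^esub> = \<one>\<^bsub>L\<^esub>" "\<zero>\<^bsub>PC\<^esub> = \<zero>\<^bsub>L\<^esub>" "ring.add PC = ring.add L"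
  by (simp_all add: PC_def)

lemma PC_pow: "x [^]\<^bsub>PC\<^esub> (m::nat) = x [^]\<^bsub>L\<^esub> m"
  by (induction m) (simp_all add: nat_pow_def PC_simps)

lemma w_hom: "k \<in> carrier K \<Longrightarrow> k \<noteq> \<zero>\<^bsub>K\<^esub> \<Longrightarrow> w (\<sigma> k) = real_of_int (v k)"
  using w_rep[OF rep_hom] hzero by fastforce

lemma perf_field_PC: "perf_field PC w p (\<sigma> \<pi>)"
proof -
  interpret P: field PC unfolding PC_def by (rule L.subfield_iff(2)[OF Om_subfield])
  have Oc: "x \<in> Om \<Longrightarrow> x \<in> carrier L" for x by (auto simp: Om_def rep_def)
  show ?thesis
  proof unfold_locales
    fix x y assume "x \<in> carrier PC" "y \<in> carrier PC" and nz: "x \<noteq> \<zero>\<^bsub>PC\<^esub>" "y \<noteq> \<zero>\<^bsub>PC\<^esub>"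
    then have xy: "x \<in> Om" "y \<in> Om" "x \<noteq> \<zero>\<^bsub>L\<^esub>" "y \<noteq> \<zero>\<^bsub>L\<^esub>" by (auto simp: PC_simps)
    obtain r k l where kl: "rep x r k" "rep y r l" using rep2[OF xy(1,2)] .
    have c: "k \<in> carrier K" "l \<in> carrier K" "k \<noteq> \<zero>\<^bsub>K\<^esub>" "l \<noteq> \<zero>\<^bsub>K\<^esub>" using kl xy rep_nz by (auto simp: rep_def)
    have "x \<otimes>\<^bsub>L\<^esub> y \<noteq> \<zero>\<^bsub>L\<^esub>" using xy Oc by (simp add: L.integral_iff)
    then show "w (x \<otimes>\<^bsub>PC\<^esub> y) = w x + w y"
      using w_rep[OF rep_mult[OF kl]] w_rep[OF kl(1) xy(3)] w_rep[OF kl(2) xy(4)] K.w_mult[OF c]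
      by (simp add: PC_simps add_divide_distrib)
    assume "x \<oplus>\<^bsub>PC\<^esub> y \<noteq> \<zero>\<^bsub>PC\<^esub>"
    then have nz: "x \<oplus>\<^bsub>L\<^esub> y \<noteq> \<zero>\<^bsub>L\<^esub>" by (simp add: PC_simps)
    have "k \<oplus>\<^bsub>K\<^esub> l \<noteq> \<zero>\<^bsub>K\<^esub>" by (rule rep_nz[OF rep_add[OF kl] nz])
    then have m: "min (real_of_int (v k)) (real_of_int (v l)) \<le> real_of_int (v (k \<oplus>\<^bsub>K\<^esub> l))" using K.w_add[OF c] by simp
    have "min (w x) (w y) = min (real_of_int (v k)) (real_of_int (v l)) / real (p ^ r)"
      using w_rep[OF kl(1) xy(3)] w_rep[OF kl(2) xy(4)] p(2) by (simp add: min_def divide_le_cancel)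
    also have "\<dots> \<le> real_of_int (v (k \<oplus>\<^bsub>K\<^esub> l)) / real (p ^ r)" by (rule divide_right_mono[OF m]) simp
    also have "\<dots> = w (x \<oplus>\<^bsub>PC\<^esub> y)" using w_rep[OF rep_add[OF kl] nz] by (simp add: PC_simps)
    finally show "min (w x) (w y) \<le> w (x \<oplus>\<^bsub>PC\<^esub> y)" .
  next
    show "Factorial_Ring.prime p" by (rule p(1))
    have "add_pow PC k \<one>\<^bsub>PC\<^esub> = add_pow L k \<one>\<^bsub>L\<^esub>" for k :: nat
      by (induction k) (auto simp: P.add.nat_pow_Suc L.add.nat_pow_Suc PC_simps)
    then show "add_pow PC p \<one>\<^bsub>PC\<^esub> = \<zero>\<^bsub>PC\<^esub>" using add_pow_L by (simp add: PC_simps)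
  next
    fix x assume "x \<in> carrier PC"
    then obtain r k where k: "rep x r k" by (auto simp: PC_simps Om_def)
    then obtain y where y: "y \<in> carrier L" "y [^]\<^bsub>L\<^esub> p = x" using roots by (auto simp: rep_def)
    have "y [^]\<^bsub>L\<^esub> (p ^ Suc r) = (y [^]\<^bsub>L\<^esub> p) [^]\<^bsub>L\<^esub> (p ^ r)" using y(1) by (simp add: L.nat_pow_pow)
    then have "rep y (Suc r) k" using k y by (simp add: rep_def)
    then show "\<exists>y\<in>carrier PC. y [^]\<^bsub>PC\<^esub> p = x" using y by (auto simp: PC_simps PC_pow Om_def)
  next
    show "\<sigma> \<pi> \<in> carrier PC" using rep_hom[OF pi(1)] by (auto simp: PC_simps Om_def)
    show "\<sigma> \<pi> \<noteq> \<zero>\<^bsub>PC\<^esub>" using hzero[OF pi(1)] pi(2) by (auto simp: PC_simps)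
    show "w (\<sigma> \<pi>) = 1" using w_hom[OF pi(1,2)] pi(3) by simp
  qed
qed

lemma hom_PC: "\<sigma> \<in> ring_hom K PC"
  using rep_hom by (auto simp: ring_hom_def PC_simps Om_def)

text \<open>Iterated Frobenius is injective, so a representing pair determines the element. This
  bounds the size of the perfect closure, though it is built inside a much larger type.\<close>

lemma inj_PC: "\<exists>g :: 'c \<Rightarrow> nat \<times> 'a. inj_on g (carrier PC)"
proof -
  define g where "g x = (SOME (r, k). rep x r k)" for x
  have g: "rep x (fst (g x)) (snd (g x))" if "x \<in> Om" for x
  proof -
    obtain r k where "rep x r k" using \<open>x \<in> Om\<close> by (auto simp: Om_def)
    then have "case (SOME (r, k). rep x r k) of (r, k) \<Rightarrow> rep x r k" by - (rule someI[of _ "(r, k)"], simp)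
    then show ?thesis by (simp add: g_def case_prod_unfold)
  qed
  have "x = y" if "x \<in> Om" "y \<in> Om" "g x = g y" for x y
    using g[OF that(1)] g[OF that(2)] that(3) frob_inj[of x y "fst (g x)"] by (auto simp: rep_def)
  then show ?thesis by (auto simp: PC_simps intro: inj_onI)
qed

end

lemma ex_perfect_closure:
  fixes K :: "'a ring" and f :: "'a \<Rightarrow> 'b"
  assumes K: "char_dvf K v p" and pi: "\<pi> \<in> carrier K" "\<pi> \<noteq> \<zero>\<^bsub>K\<^esub>" "v \<pi> = 1" and f: "inj f"
  shows "\<exists>(R :: (('a list \<times> nat) multiset \<Rightarrow> 'a) ring) w \<sigma> (g :: _ \<Rightarrow> 'b). perf_field R w p (\<sigma> \<pi>) \<and> \<sigma> \<in> ring_hom K R \<and>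
    (\<forall>k\<in>carrier K. k \<noteq> \<zero>\<^bsub>K\<^esub> \<longrightarrow> w (\<sigma> k) = real_of_int (v k)) \<and> inj_on g (carrier R)"
proof -
  interpret K: char_dvf K v p 0 by fact
  have p: "p > 0" using K.char_p prime_gt_0_nat by (auto simp: char_p_def)
  obtain L :: "(('a list \<times> nat) multiset \<Rightarrow> 'a) ring" and \<sigma>
    where L: "field L" "\<sigma> \<in> ring_hom K L" "\<forall>y\<in>carrier L. \<forall>m>0. \<exists>x\<in>carrier L. x [^]\<^bsub>L\<^esub> (m::nat) = y"
    using K.ex_root_extension by blast
  interpret L: field L by fact
  interpret radical K v p L \<sigma> \<pi> by unfold_locales (use L p pi in auto)
  obtain g :: "(('a list \<times> nat) multiset \<Rightarrow> 'a) \<Rightarrow> nat \<times> 'a" where g: "inj_on g (carrier PC)" using inj_PC by blast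
  \<comment> \<open>The powers of \<open>\<pi>\<close> have distinct values, so \<open>'a\<close> is
    infinite and \<open>nat \<times> 'a\<close> embeds into it.\<close>
  have "real_of_int (v (\<pi> [^]\<^bsub>K\<^esub> m)) = real m" for m :: nat using K.w_pow[OF pi(1,2), of m] pi(3) by simp
  then have "inj (\<lambda>m::nat. \<pi> [^]\<^bsub>K\<^esub> m)" by (metis injI of_nat_eq_iff)
  then have inf: "infinite (UNIV :: 'a set)" using finite_subset[OF subset_UNIV, of "range (\<lambda>m::nat. \<pi> [^]\<^bsub>K\<^esub> m)"] finite_imageD[of "\<lambda>m::nat. \<pi> [^]\<^bsub>K\<^esub> m" UNIV] by auto
  then have "(card_of (UNIV :: nat set), card_of (UNIV :: 'a set)) \<in> ordLeq" using infinite_iff_card_of_nat by blast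
  then have "(card_of ((UNIV :: nat set) \<times> (UNIV :: 'a set)), card_of (UNIV :: 'a set)) \<in> ordIso"
    using card_of_Times_infinite_simps(3)[OF inf UNIV_not_empty] by blast
  then have "(card_of ((UNIV :: nat set) \<times> (UNIV :: 'a set)), card_of (UNIV :: 'a set)) \<in> ordLeq"
    by (simp add: ordIso_iff_ordLeq)
  then obtain c :: "nat \<times> 'a \<Rightarrow> 'a" where c: "inj c"
    using card_of_ordLeq[of "(UNIV :: nat set) \<times> (UNIV :: 'a set)" "UNIV :: 'a set"] by auto
  have "inj_on (\<lambda>x. f (c (g x))) (carrier PC)"
    by (rule inj_onI) (use inj_onD[OF g] injD[OF c] injD[OF f] in blast)
  then show ?thesis using perf_field_PC hom_PC w_hom by blast
qed

text \<open>Transport of structure to the prescribed type. The equations list what is needed to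
  carry over the residual conditions and the finite sum of \<open>sep_ext\<close>.\<close>

lemma (in perf_field) ex_copy:
  fixes g :: "'a \<Rightarrow> 'z"
  assumes E: "int_sub E" and g: "inj_on g E"
  shows "\<exists>(M :: 'z ring) v'. field M \<and> carrier M = g ` E \<and> g \<zero> = \<zero>\<^bsub>M\<^esub> \<and> g \<one> = \<one>\<^bsub>M\<^esub> \<and>
    (\<forall>x\<in>E. \<forall>y\<in>E. g (x \<oplus> y) = g x \<oplus>\<^bsub>M\<^esub> g y \<and> g (x \<otimes> y) = g x \<otimes>\<^bsub>M\<^esub> g y \<and> g (x \<ominus> y) = g x \<ominus>\<^bsub>M\<^esub> g y) \<and>
    (\<forall>x\<in>E. \<forall>m::nat. g (x [^] m) = g x [^]\<^bsub>M\<^esub> m) \<and>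
    (\<forall>f (A :: nat set). finite A \<longrightarrow> f \<in> A \<rightarrow> E \<longrightarrow> finsum R f A \<in> E \<and> g (finsum R f A) = (\<Oplus>\<^bsub>M\<^esub>i\<in>A. g (f i))) \<and>
    (\<forall>x\<in>E. x \<noteq> \<zero> \<longrightarrow> real_of_int (v' (g x)) = w x)"
proof -
  note sf = int_subD(1)[OF E]
  define N where "N = R\<lparr>carrier := E\<rparr>"
  define M where "M = image_ring g N"
  have N: "carrier N = E" "monoid.mult N = monoid.mult R" "\<one>\<^bsub>N\<^esub> = \<one>" "\<zero>\<^bsub>N\<^esub> = \<zero>" "ring.add N = ring.add R" by (simp_all add: N_def)
  interpret N: field N unfolding N_def by (rule subfield_iff(2)[OF sf])
  have gN: "inj_on g (carrier N)" using g by (simp add: N)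
  interpret M: field M unfolding M_def by (rule N.inj_imp_image_ring_is_field[OF gN])
  have "g \<in> ring_hom N M" using inj_imp_image_ring_iso[OF gN] by (simp add: M_def ring_iso_def)
  then have hom: "g x \<in> carrier M" "g (x \<oplus> y) = g x \<oplus>\<^bsub>M\<^esub> g y" "g (x \<otimes> y) = g x \<otimes>\<^bsub>M\<^esub> g y" "g \<one> = \<one>\<^bsub>M\<^esub>"
    if "x \<in> E" "y \<in> E" for x y using that by (auto simp: ring_hom_def N)
  have z: "g \<zero> = \<zero>\<^bsub>M\<^esub>" using image_ring_zero[of g N] by (simp add: M_def N)
  have ec: "x \<in> E \<Longrightarrow> x \<in> carrier R" for x using Ec[OF sf] .
  have mi: "g (x \<ominus> y) = g x \<ominus>\<^bsub>M\<^esub> g y" if xy: "x \<in> E" "y \<in> E" for x y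
  proof -
    have ny: "\<ominus> y \<in> E" using sr(5)[OF sf] xy by blast
    have "g (\<ominus> y) \<oplus>\<^bsub>M\<^esub> g y = \<zero>\<^bsub>M\<^esub>" using hom(2)[OF ny xy(2)] z ec[OF xy(2)] by (simp add: l_neg)
    then have "g (\<ominus> y) = \<ominus>\<^bsub>M\<^esub> g y" using hom(1)[OF ny ny] hom(1)[OF xy(2,2)] by (metis M.minus_equality)
    then show ?thesis using hom(2)[OF xy(1) ny] by (simp add: minus_eq M.minus_eq)
  qed
  have pw: "g (x [^] (m::nat)) = g x [^]\<^bsub>M\<^esub> m" if x: "x \<in> E" for x m
    by (induction m) (use x hom pow_in[OF subfieldE(1)[OF sf]] in auto)
  have fs: "finsum R f A \<in> E \<and> g (finsum R f A) = (\<Oplus>\<^bsub>M\<^esub>i\<in>A. g (f i))" if "finite A" "f \<in> A \<rightarrow> E" for f and A :: "nat set"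
    using that
  proof (induction A rule: finite_induct)
    case empty then show ?case using z sr(2)[OF sf] by simp
  next
    case (insert a A)
    have fc: "f a \<in> E" "f \<in> A \<rightarrow> E" "f \<in> A \<rightarrow> carrier R" "f a \<in> carrier R" using insert.prems ec by auto
    have gc: "(\<lambda>i. g (f i)) \<in> A \<rightarrow> carrier M" "g (f a) \<in> carrier M" using fc hom(1) by auto
    have S: "finsum R f (insert a A) = f a \<oplus> finsum R f A" using insert fc by (simp add: finsum_insert)
    have IH: "finsum R f A \<in> E" "g (finsum R f A) = (\<Oplus>\<^bsub>M\<^esub>i\<in>A. g (f i))" using insert.IH fc by auto
    show ?case unfolding S using sr(7)[OF sf fc(1) IH(1)] hom(2)[OF fc(1) IH(1)] IH(2) insert gc by (simp add: M.finsum_insert)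
  qed
  \<comment> \<open>Values on \<open>E\<close> are integers, so the floor only changes their
    type.\<close>
  define v' where "v' y = \<lfloor>w (inv_into E g y)\<rfloor>" for y
  have "real_of_int (v' (g x)) = w x" if "x \<in> E" "x \<noteq> \<zero>" for x
  proof -
    have "w x \<in> \<int>" by (rule int_subD(3)[OF E that])
    then obtain m where "w x = real_of_int m" by (elim Ints_cases)
    then show ?thesis by (simp add: v'_def inv_into_f_f[OF g that(1)])
  qed
  moreover have "carrier M = g ` E" using image_ring_carrier[of g N] by (simp add: M_def N)
  moreover have "g \<one> = \<one>\<^bsub>M\<^esub>" using hom(4) sr(3)[OF sf] by blast
  ultimately show ?thesis
    by (intro exI[of _ M] exI[of _ v'] conjI ballI allI impI) (simp_all add: M.field_axioms z hom(2,3) mi pw fs)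
qed

lemma ex_sep_ext:
  fixes K :: "'a ring" and f :: "'a \<Rightarrow> 'b"
  assumes K: "char_dvf K v p" and f: "inj f"
    and a: "\<forall>j<i. a j \<in> carrier K \<and> (a j = \<zero>\<^bsub>K\<^esub> \<or> v (a j) \<ge> 0)"
  shows "\<exists>(L :: 'b ring) v' \<iota> b. sep_ext K v p i a L v' \<iota> b"
proof -
  interpret K: char_dvf K v p 0 by fact
  obtain \<pi> where pi: "\<pi> \<in> carrier K" "\<pi> \<noteq> \<zero>\<^bsub>K\<^esub>" "v \<pi> = 1" using K.dvf by (auto simp: dvf_def)
  obtain R :: "(('a list \<times> nat) multiset \<Rightarrow> 'a) ring" and w \<sigma> and g :: "_ \<Rightarrow> 'b"
    where R: "perf_field R w p (\<sigma> \<pi>)" and hom: "\<sigma> \<in> ring_hom K R"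
      and w\<sigma>: "\<And>k. k \<in> carrier K \<Longrightarrow> k \<noteq> \<zero>\<^bsub>K\<^esub> \<Longrightarrow> w (\<sigma> k) = real_of_int (v k)" and g: "inj_on g (carrier R)"
    using ex_perfect_closure[OF K pi f] by blast
  interpret R: perf_field R w p "\<sigma> \<pi>" by fact
  interpret h: ring_hom_cring K R \<sigma>
    by (intro ring_hom_cringI ring_hom_cring.intro ring_hom_cring_axioms.intro hom K.is_cring R.is_cring)
  have hz: "x = \<zero>\<^bsub>K\<^esub>" if "x \<in> carrier K" "\<sigma> x = \<zero>\<^bsub>R\<^esub>" for x
  proof (rule ccontr)
    assume "x \<noteq> \<zero>\<^bsub>K\<^esub>"
    then have "\<sigma> (x \<otimes>\<^bsub>K\<^esub> inv\<^bsub>K\<^esub> x) = \<one>\<^bsub>R\<^esub>" "inv\<^bsub>K\<^esub> x \<in> carrier K" using K.inv_nonzero[OF that(1)] by auto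
    then show False using that by simp
  qed
  have hziff: "\<sigma> x = \<zero>\<^bsub>R\<^esub> \<longleftrightarrow> x = \<zero>\<^bsub>K\<^esub>" if "x \<in> carrier K" for x using hz[OF that] h.hom_zero by blast
  have hpow: "\<sigma> (x [^]\<^bsub>K\<^esub> (k::nat)) = \<sigma> x [^]\<^bsub>R\<^esub> k" if "x \<in> carrier K" for x k using that by (induction k) auto
  define K0 where "K0 = \<sigma> ` carrier K"
  have K0: "R.int_sub K0"
  proof -
    have "subfield K0 R"
    proof (rule R.subfieldI'[OF R.subringI])
      show "K0 \<subseteq> carrier R" by (auto simp: K0_def)
      show "\<one>\<^bsub>R\<^esub> \<in> K0" unfolding K0_def by (rule image_eqI[of _ _ "\<one>\<^bsub>K\<^esub>"]) auto
      show "\<ominus>\<^bsub>R\<^esub> x \<in> K0" if "x \<in> K0" for x using that unfolding K0_def by (auto simp: h.hom_a_inv[symmetric] simp del: h.hom_a_inv)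
      show "x \<otimes>\<^bsub>R\<^esub> y \<in> K0" if "x \<in> K0" "y \<in> K0" for x y using that unfolding K0_def by (auto simp: h.hom_mult[symmetric] simp del: h.hom_mult)
      show "x \<oplus>\<^bsub>R\<^esub> y \<in> K0" if "x \<in> K0" "y \<in> K0" for x y using that unfolding K0_def by (auto simp: h.hom_add[symmetric] simp del: h.hom_add)
    next
      fix x assume "x \<in> K0 - {\<zero>\<^bsub>R\<^esub>}"
      then obtain k where k: "k \<in> carrier K" "x = \<sigma> k" "k \<noteq> \<zero>\<^bsub>K\<^esub>" unfolding K0_def using h.hom_zero by blast
      have ik: "inv\<^bsub>K\<^esub> k \<in> carrier K" "k \<otimes>\<^bsub>K\<^esub> inv\<^bsub>K\<^esub> k = \<one>\<^bsub>K\<^esub>" using K.inv_nonzero[OF k(1,3)] by auto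
      then have "x \<otimes>\<^bsub>R\<^esub> \<sigma> (inv\<^bsub>K\<^esub> k) = \<one>\<^bsub>R\<^esub>" using k by (metis h.hom_mult h.hom_one)
      then have "inv\<^bsub>R\<^esub> x = \<sigma> (inv\<^bsub>K\<^esub> k)" using k ik by (intro R.comm_inv_char) auto
      then show "inv\<^bsub>R\<^esub> x \<in> K0" using ik by (simp add: K0_def)
    qed
    moreover have "w x \<in> \<int>" if "x \<in> K0" "x \<noteq> \<zero>\<^bsub>R\<^esub>" for x
    proof -
      obtain k where k: "k \<in> carrier K" "x = \<sigma> k" using \<open>x \<in> K0\<close> by (auto simp: K0_def)
      then have "w x = real_of_int (v k)" using w\<sigma>[OF k(1)] that(2) h.hom_zero by metis
      then show ?thesis by simp
    qed
    ultimately show ?thesis using pi(1) by (auto simp: R.int_sub_def K0_def)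
  qed
  have vge\<sigma>: "R.vge (\<sigma> k) 0 \<longleftrightarrow> k = \<zero>\<^bsub>K\<^esub> \<or> v k \<ge> 0" if "k \<in> carrier K" for k
    using w\<sigma>[OF that] hziff[OF that] by (cases "k = \<zero>\<^bsub>K\<^esub>") (auto simp: R.vge_def)
  have vgt\<sigma>: "R.vgt (\<sigma> k) 0 \<longleftrightarrow> k = \<zero>\<^bsub>K\<^esub> \<or> v k \<ge> 1" if "k \<in> carrier K" for k
    using w\<sigma>[OF that] hziff[OF that] by (cases "k = \<zero>\<^bsub>K\<^esub>") (auto simp: R.vgt_def)
  have app_vge: "R.vge b 0" if b: "b \<in> carrier R" "c \<in> carrier R" "R.vge c 0" "R.vgt (c \<ominus>\<^bsub>R\<^esub> b [^]\<^bsub>R\<^esub> p) 0" for b c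
  proof -
    have "R.vge (c \<ominus>\<^bsub>R\<^esub> (c \<ominus>\<^bsub>R\<^esub> b [^]\<^bsub>R\<^esub> p)) 0" by (rule R.vge_diff[OF _ _ b(3) R.vgt_imp_vge[OF b(4)]]) (use b in auto)
    moreover have "c \<ominus>\<^bsub>R\<^esub> (c \<ominus>\<^bsub>R\<^esub> b [^]\<^bsub>R\<^esub> p) = b [^]\<^bsub>R\<^esub> p" using b(1,2) by (simp add: R.minus_eq R.minus_add R.a_assoc[symmetric] R.r_neg)
    ultimately show ?thesis using R.vge_pow_p[OF b(1)] by simp
  qed
  have aK: "\<sigma> (a j) \<in> K0" "R.vge (\<sigma> (a j)) 0" "a j \<in> carrier K" if "j < i" for j using a that vge\<sigma> by (auto simp: K0_def)
  \<comment> \<open>A residual p-th root in the copy \<open>K0\<close> of \<open>K\<close> comes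
    from one in \<open>K\<close>; hence a failure over \<open>K\<close> is a failure over
    \<open>K0\<close>.\<close>
  have pth: "\<exists>c. pth_approx K v p (a j) c" if j: "j < i" and ap: "R.app K0 (\<sigma> (a j))" for j
  proof -
    obtain c where c: "c \<in> carrier K" "R.vgt (\<sigma> (a j) \<ominus>\<^bsub>R\<^esub> \<sigma> c [^]\<^bsub>R\<^esub> p) 0" using ap by (auto simp: R.app_def K0_def)
    have "\<sigma> (a j) \<ominus>\<^bsub>R\<^esub> \<sigma> c [^]\<^bsub>R\<^esub> p = \<sigma> (a j \<ominus>\<^bsub>K\<^esub> c [^]\<^bsub>K\<^esub> p)" using c(1) aK(3)[OF j] by (simp add: R.minus_eq K.minus_eq hpow)
    then have "a j \<ominus>\<^bsub>K\<^esub> c [^]\<^bsub>K\<^esub> p = \<zero>\<^bsub>K\<^esub> \<or> v (a j \<ominus>\<^bsub>K\<^esub> c [^]\<^bsub>K\<^esub> p) \<ge> 1" using c(2) vgt\<sigma>[of "a j \<ominus>\<^bsub>K\<^esub> c [^]\<^bsub>K\<^esub> p"] K.minus_closed[OF aK(3)[OF j] K.nat_pow_closed[OF c(1)]] by metis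
    moreover have "c = \<zero>\<^bsub>K\<^esub> \<or> v c \<ge> 0" using app_vge[OF _ _ aK(2)[OF j] c(2)] vge\<sigma> c(1) aK(3)[OF j] by simp
    ultimately show ?thesis using c(1) unfolding pth_approx_def by blast
  qed
  let ?S = "\<lambda>b. \<Oplus>\<^bsub>R\<^esub>j\<in>{..<i}. b j [^]\<^bsub>R\<^esub> (p * (p ^ j - 1)) \<otimes>\<^bsub>R\<^esub> (\<sigma> (a j) \<ominus>\<^bsub>R\<^esub> b j [^]\<^bsub>R\<^esub> p)"
  obtain E b where E: "R.int_sub E" "K0 \<subseteq> E" "\<And>c. c \<in> E \<Longrightarrow> R.vge c 0 \<Longrightarrow> R.app E c"
    and b: "\<And>j. j < i \<Longrightarrow> b j \<in> E" "\<And>j. j < i \<Longrightarrow> R.vge (b j) 0" "\<And>j. j < i \<Longrightarrow> R.vgt (\<sigma> (a j) \<ominus>\<^bsub>R\<^esub> b j [^]\<^bsub>R\<^esub> p) 0"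
    and S: "(\<exists>j<i. \<not> R.app K0 (\<sigma> (a j))) \<Longrightarrow> \<not> R.vge (?S b) 2"
  proof (cases "\<exists>j<i. \<not> R.app K0 (\<sigma> (a j))")
    case True
    define J where "J = {j. j < i \<and> \<not> R.app K0 (\<sigma> (a j))}"
    have J: "finite J" "J \<noteq> {}" using True by (auto simp: J_def)
    \<comment> \<open>The last index is taken because \<open>cartier\<close> extracts the last
      derivative of the sum.\<close>
    define r where "r = Max J"
    have r: "r < i" "\<not> R.app K0 (\<sigma> (a r))" using Max_in[OF J] by (auto simp: r_def J_def)
    have late: "R.app K0 (\<sigma> (a j))" if "r < j" "j < i" for j
    proof (rule ccontr)
      assume "\<not> ?thesis"
      then have "j \<in> J" using that by (simp add: J_def)
      from Max_ge[OF J(1) this] that(1) show False by (simp add: r_def)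
    qed
    show thesis
      using R.ex_extension[where a = "\<lambda>j. \<sigma> (a j)" and r = r and i = i, OF K0 aK(1) aK(2) r late] that by blast
  next
    case False
    obtain E where E: "R.int_sub E" "K0 \<subseteq> E" "\<forall>c\<in>E. R.vge c 0 \<longrightarrow> R.app E c" using R.ex_perfect[OF K0] by blast
    have "\<exists>b. b \<in> E \<and> R.vge b 0 \<and> R.vgt (\<sigma> (a j) \<ominus>\<^bsub>R\<^esub> b [^]\<^bsub>R\<^esub> p) 0" if j: "j < i" for j
    proof -
      have "R.app E (\<sigma> (a j))" using E aK[OF j] by blast
      then obtain b where b: "b \<in> E" "R.vgt (\<sigma> (a j) \<ominus>\<^bsub>R\<^esub> b [^]\<^bsub>R\<^esub> p) 0" by (auto simp: R.app_def)
      have "R.vge b 0" by (rule app_vge[OF _ _ aK(2)[OF j] b(2)]) (use R.Ec[OF R.int_subD(1)[OF E(1)] b(1)] aK(3)[OF j] in auto)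
      then show ?thesis using b by blast
    qed
    then obtain b where b: "\<And>j. j < i \<Longrightarrow> b j \<in> E \<and> R.vge (b j) 0 \<and> R.vgt (\<sigma> (a j) \<ominus>\<^bsub>R\<^esub> b j [^]\<^bsub>R\<^esub> p) 0" by metis
    show thesis by (rule that[of E b]) (use E b False in auto)
  qed
  note sf = R.int_subD(1)[OF E(1)]
  have ec: "x \<in> E \<Longrightarrow> x \<in> carrier R" for x using R.Ec[OF sf] .
  have gE: "inj_on g E" using g ec by (auto intro: inj_on_subset)
  obtain M :: "'b ring" and v' where M: "field M" "carrier M = g ` E" and g0: "g \<zero>\<^bsub>R\<^esub> = \<zero>\<^bsub>M\<^esub>" and g1: "g \<one>\<^bsub>R\<^esub> = \<one>\<^bsub>M\<^esub>"
    and g2: "\<forall>x\<in>E. \<forall>y\<in>E. g (x \<oplus>\<^bsub>R\<^esub> y) = g x \<oplus>\<^bsub>M\<^esub> g y \<and> g (x \<otimes>\<^bsub>R\<^esub> y) = g x \<otimes>\<^bsub>M\<^esub> g y \<and> g (x \<ominus>\<^bsub>R\<^esub> y) = g x \<ominus>\<^bsub>M\<^esub> g y"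
    and gp: "\<forall>x\<in>E. \<forall>m::nat. g (x [^]\<^bsub>R\<^esub> m) = g x [^]\<^bsub>M\<^esub> m"
    and gs: "\<forall>f (A :: nat set). finite A \<longrightarrow> f \<in> A \<rightarrow> E \<longrightarrow> finsum R f A \<in> E \<and> g (finsum R f A) = (\<Oplus>\<^bsub>M\<^esub>i\<in>A. g (f i))"
    and gv: "\<forall>x\<in>E. x \<noteq> \<zero>\<^bsub>R\<^esub> \<longrightarrow> real_of_int (v' (g x)) = w x"
    using R.ex_copy[OF E(1) gE] by auto
  have gz: "g x = \<zero>\<^bsub>M\<^esub> \<longleftrightarrow> x = \<zero>\<^bsub>R\<^esub>" if "x \<in> E" for x
    using inj_on_eq_iff[OF gE that, of "\<zero>\<^bsub>R\<^esub>"] R.sr(2)[OF sf] g0 by simp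
  have cl: "x \<oplus>\<^bsub>R\<^esub> y \<in> E" "x \<otimes>\<^bsub>R\<^esub> y \<in> E" "x \<ominus>\<^bsub>R\<^esub> y \<in> E" "x [^]\<^bsub>R\<^esub> (m::nat) \<in> E" if "x \<in> E" "y \<in> E" for x y m
    using that R.sr(6,7)[OF sf] R.diff_in[OF sf] R.pow_in[OF subfieldE(1)[OF sf]] by auto
  have vge_iff: "R.vge x (real_of_int m) \<longleftrightarrow> g x = \<zero>\<^bsub>M\<^esub> \<or> v' (g x) \<ge> m" if "x \<in> E" for x m
    using gz[OF that] gv[rule_format, OF that] unfolding R.vge_def by (metis of_int_le_iff)
  have vgt_iff: "R.vgt x 0 \<longleftrightarrow> g x = \<zero>\<^bsub>M\<^esub> \<or> v' (g x) > 0" if "x \<in> E" for x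
    using gz[OF that] gv[rule_format, OF that] unfolding R.vgt_def by (metis of_int_0_less_iff)
  define \<iota> where "\<iota> = (\<lambda>x. g (\<sigma> x))"
  have sE: "\<sigma> x \<in> E" if "x \<in> carrier K" for x using that E(2) by (auto simp: K0_def)
  have v\<iota>: "v' (\<iota> x) = v x" if "x \<in> carrier K" "x \<noteq> \<zero>\<^bsub>K\<^esub>" for x
  proof -
    have "real_of_int (v' (\<iota> x)) = real_of_int (v x)" using gv sE[OF that(1)] hziff[OF that(1)] w\<sigma>[OF that] that(2) by (auto simp: \<iota>_def)
    then show ?thesis by simp
  qed
  have dvfM: "dvf M v'"
  proof -
    have "v' (y \<otimes>\<^bsub>M\<^esub> z) = v' y + v' z \<and> (y \<oplus>\<^bsub>M\<^esub> z \<noteq> \<zero>\<^bsub>M\<^esub> \<longrightarrow> v' (y \<oplus>\<^bsub>M\<^esub> z) \<ge> min (v' y) (v' z))"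
      if yz: "y \<in> carrier M - {\<zero>\<^bsub>M\<^esub>}" "z \<in> carrier M - {\<zero>\<^bsub>M\<^esub>}" for y z
    proof -
      obtain x x' where x: "x \<in> E" "y = g x" "x' \<in> E" "z = g x'" "x \<noteq> \<zero>\<^bsub>R\<^esub>" "x' \<noteq> \<zero>\<^bsub>R\<^esub>" using yz g0 by (auto simp: M(2))
      have m: "g x \<otimes>\<^bsub>M\<^esub> g x' = g (x \<otimes>\<^bsub>R\<^esub> x')" "g x \<oplus>\<^bsub>M\<^esub> g x' = g (x \<oplus>\<^bsub>R\<^esub> x')" using g2 x by auto
      have "x \<otimes>\<^bsub>R\<^esub> x' \<noteq> \<zero>\<^bsub>R\<^esub>" using x ec by (simp add: R.integral_iff)
      then have "real_of_int (v' (y \<otimes>\<^bsub>M\<^esub> z)) = real_of_int (v' y) + real_of_int (v' z)"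
        using gv x cl R.w_mult[OF ec[OF x(1)] ec[OF x(3)] x(5,6)] by (simp add: m)
      moreover have "min (v' y) (v' z) \<le> v' (y \<oplus>\<^bsub>M\<^esub> z)" if "y \<oplus>\<^bsub>M\<^esub> z \<noteq> \<zero>\<^bsub>M\<^esub>"
      proof -
        have "x \<oplus>\<^bsub>R\<^esub> x' \<noteq> \<zero>\<^bsub>R\<^esub>" using that gz[OF cl(1)[OF x(1,3)]] x m by simp
        then have "min (real_of_int (v' y)) (real_of_int (v' z)) \<le> real_of_int (v' (y \<oplus>\<^bsub>M\<^esub> z))"
          using gv x cl R.w_add[OF ec[OF x(1)] ec[OF x(3)] x(5,6)] by (simp add: m)
        then show ?thesis by linarith
      qed
      ultimately show ?thesis by (simp add: of_int_add[symmetric] del: of_int_add)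
    qed
    moreover have "\<iota> \<pi> \<in> carrier M - {\<zero>\<^bsub>M\<^esub>}" using sE[OF pi(1)] gz[OF sE[OF pi(1)]] hziff[OF pi(1)] pi(2) by (auto simp: M(2) \<iota>_def)
    moreover have "v' (\<iota> \<pi>) = 1" using v\<iota>[OF pi(1,2)] pi(3) by simp
    ultimately show ?thesis unfolding dvf_def by (intro conjI ballI M(1) bexI[of _ "\<iota> \<pi>"]) simp_all
  qed
  have E2: "E2 K v p M v' \<iota>"
    unfolding E2_def
  proof (intro conjI ballI impI)
    show "dvf M v'" by (rule dvfM)
    show "\<iota> \<in> ring_hom K M"
      unfolding ring_hom_def \<iota>_def using sE g2 g1 by (auto simp: M(2))
    fix c assume c: "c \<in> carrier M" "c = \<zero>\<^bsub>M\<^esub> \<or> 0 \<le> v' c"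
    then obtain x where x: "x \<in> E" "c = g x" by (auto simp: M(2))
    have x0: "R.vge x 0" using vge_iff[OF x(1), of 0] c x by simp
    then obtain y where y: "y \<in> E" "R.vgt (x \<ominus>\<^bsub>R\<^esub> y [^]\<^bsub>R\<^esub> p) 0" using E(3)[OF x(1)] by (auto simp: R.app_def)
    have "R.vge y 0" by (rule app_vge[OF ec[OF y(1)] ec[OF x(1)] x0 y(2)])
    then have "g y = \<zero>\<^bsub>M\<^esub> \<or> v' (g y) \<ge> 0" using vge_iff[OF y(1), of 0] by simp
    moreover have "g (x \<ominus>\<^bsub>R\<^esub> y [^]\<^bsub>R\<^esub> p) = c \<ominus>\<^bsub>M\<^esub> g y [^]\<^bsub>M\<^esub> p" using g2 gp x y cl by simp
    ultimately show "\<exists>b\<in>carrier M. (b = \<zero>\<^bsub>M\<^esub> \<or> 0 \<le> v' b) \<and> (c \<ominus>\<^bsub>M\<^esub> b [^]\<^bsub>M\<^esub> p = \<zero>\<^bsub>M\<^esub> \<or> 0 < v' (c \<ominus>\<^bsub>M\<^esub> b [^]\<^bsub>M\<^esub> p))"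
      using vgt_iff[of "x \<ominus>\<^bsub>R\<^esub> y [^]\<^bsub>R\<^esub> p"] y x cl by (intro bexI[of _ "g y"]) (auto simp: M(2))
  qed (use v\<iota> in auto)
  have diff: "g (\<sigma> (a j) \<ominus>\<^bsub>R\<^esub> b j [^]\<^bsub>R\<^esub> p) = \<iota> (a j) \<ominus>\<^bsub>M\<^esub> g (b j) [^]\<^bsub>M\<^esub> p" "\<sigma> (a j) \<ominus>\<^bsub>R\<^esub> b j [^]\<^bsub>R\<^esub> p \<in> E" if j: "j < i" for j
    using g2 gp b(1)[OF j] cl sE[OF aK(3)[OF j]] by (auto simp: \<iota>_def)
  have "pth_approx M v' p (\<iota> (a j)) (g (b j))" if j: "j < i" for j
    unfolding pth_approx_def using vge_iff[OF b(1)[OF j], of 0] b[OF j] vgt_iff[OF diff(2)[OF j]] diff(1)[OF j] by (auto simp: M(2))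
  moreover have "(\<Oplus>\<^bsub>M\<^esub>j\<in>{..<i}. g (b j) [^]\<^bsub>M\<^esub> (p * (p ^ j - 1)) \<otimes>\<^bsub>M\<^esub> (\<iota> (a j) \<ominus>\<^bsub>M\<^esub> g (b j) [^]\<^bsub>M\<^esub> p)) \<noteq> \<zero>\<^bsub>M\<^esub> \<and>
       v' (\<Oplus>\<^bsub>M\<^esub>j\<in>{..<i}. g (b j) [^]\<^bsub>M\<^esub> (p * (p ^ j - 1)) \<otimes>\<^bsub>M\<^esub> (\<iota> (a j) \<ominus>\<^bsub>M\<^esub> g (b j) [^]\<^bsub>M\<^esub> p)) < 2"
    if na: "\<exists>j<i. \<nexists>c. pth_approx K v p (a j) c"
  proof -
    have nS: "\<not> R.vge (?S b) 2" using S na pth by blast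
    let ?T = "\<lambda>j. b j [^]\<^bsub>R\<^esub> (p * (p ^ j - 1)) \<otimes>\<^bsub>R\<^esub> (\<sigma> (a j) \<ominus>\<^bsub>R\<^esub> b j [^]\<^bsub>R\<^esub> p)"
    have T: "?T \<in> {..<i} \<rightarrow> E"
    proof
      fix j assume "j \<in> {..<i}"
      then have j: "j < i" by simp
      show "?T j \<in> E" by (rule cl(2)[OF cl(4)[OF b(1)[OF j] b(1)[OF j]] diff(2)[OF j]])
    qed
    have gT: "g (?T j) = g (b j) [^]\<^bsub>M\<^esub> (p * (p ^ j - 1)) \<otimes>\<^bsub>M\<^esub> (\<iota> (a j) \<ominus>\<^bsub>M\<^esub> g (b j) [^]\<^bsub>M\<^esub> p)" if j: "j < i" for j
      using g2 gp diff[OF j] b(1)[OF j] cl(4)[OF b(1)[OF j] b(1)[OF j]] by auto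
    interpret M: field M by fact
    have "(\<Oplus>\<^bsub>M\<^esub>j\<in>{..<i}. g (?T j)) = (\<Oplus>\<^bsub>M\<^esub>j\<in>{..<i}. g (b j) [^]\<^bsub>M\<^esub> (p * (p ^ j - 1)) \<otimes>\<^bsub>M\<^esub> (\<iota> (a j) \<ominus>\<^bsub>M\<^esub> g (b j) [^]\<^bsub>M\<^esub> p))"
    proof (rule M.finsum_cong')
      show "(\<lambda>j. g (b j) [^]\<^bsub>M\<^esub> (p * (p ^ j - 1)) \<otimes>\<^bsub>M\<^esub> (\<iota> (a j) \<ominus>\<^bsub>M\<^esub> g (b j) [^]\<^bsub>M\<^esub> p)) \<in> {..<i} \<rightarrow> carrier M"
      proof
        fix j assume "j \<in> {..<i}"
        then have "j < i" "?T j \<in> E" using T by auto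
        then show "g (b j) [^]\<^bsub>M\<^esub> (p * (p ^ j - 1)) \<otimes>\<^bsub>M\<^esub> (\<iota> (a j) \<ominus>\<^bsub>M\<^esub> g (b j) [^]\<^bsub>M\<^esub> p) \<in> carrier M"
          unfolding gT[OF \<open>j < i\<close>, symmetric] by (simp add: M(2))
      qed
    qed (use gT in auto)
    then have eq: "g (?S b) = (\<Oplus>\<^bsub>M\<^esub>j\<in>{..<i}. g (b j) [^]\<^bsub>M\<^esub> (p * (p ^ j - 1)) \<otimes>\<^bsub>M\<^esub> (\<iota> (a j) \<ominus>\<^bsub>M\<^esub> g (b j) [^]\<^bsub>M\<^esub> p))"
      and SE: "?S b \<in> E" using gs[rule_format, OF _ T] by auto
    show ?thesis unfolding eq[symmetric] using vge_iff[OF SE, of 2] nS by simp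
  qed
  ultimately have "sep_ext K v p i a M v' \<iota> (\<lambda>j. g (b j))" using E2 unfolding sep_ext_def by blast
  then show ?thesis by blast
qed

text \<open>The maximum over the class is expressed as a bound for all extensions on
  \<open>'b\<close> together with one that attains it; the injection into \<open>'b\<close> provides
  the room for the latter.\<close>

theorem theorem8p7:
  fixes K :: "'a ring" and v :: "'a \<Rightarrow> int" and p n :: nat and \<phi> :: "nat \<Rightarrow> 'a"
  assumes "dvf K v" and "char_p K p"
    and "\<phi> \<in> witt_carrier K n"
    and "\<exists>f :: 'a \<Rightarrow> 'b. inj f"
  shows "(\<forall>(K' :: 'b ring) v' \<iota>. E2 K v p K' v' \<iota> \<longrightarrow>
            sw K' v' p n (\<iota> \<circ> \<phi>) + 1 \<le> (LEAST m. m \<ge> 1 \<and> \<phi> \<in> flat_filF K v p n m))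
       \<and> (\<exists>(K' :: 'b ring) v' \<iota>. E2 K v p K' v' \<iota> \<and>
            sw K' v' p n (\<iota> \<circ> \<phi>) + 1 = (LEAST m. m \<ge> 1 \<and> \<phi> \<in> flat_filF K v p n m))"
proof -
  obtain f :: "'a \<Rightarrow> 'b" where f: "inj f" using assms(4) by blast
  interpret field K using assms(1) by (simp add: dvf_def)
  have K: "char_dvf K v p" by unfold_locales (fact assms(1,2))+
  show ?thesis by (rule sw_formula[OF K assms(3)]) (rule ex_sep_ext[OF K f])
qed

end
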